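(* In the setting and under the assumptions of the context, let $\{(x^k,y^k,z^k,s^k)\}$ be the sequence of outer iterates generated by iG-BSPM (the algorithm described in the context). Assume that $\tau_k\to0$ as $k\to\infty$ and that the inexactness parameters satisfy $\sum_{\ell}(\zeta^\theta_{k,\ell})^2<\infty$ for all $k$ and $\lim_{k\to\infty}\sum_{\ell}(\zeta^\theta_{k,\ell})^2=0$. Then, for every accumulation point $(\bar x,\bar y,\bar z,\bar s)$ of $\{(x^k,y^k,z^k,s^k)\}$, the pair $(\bar x,\bar y)$ satisfies the approximate KKT condition for $(\mathrm{GP})_{\mathcal C}$. Moreover, assume that MFCQ holds at $\bar y$ for the system $\{y\mid g(\bar x,y)\le0\}$ and that MFCQ holds at $(\bar x,\bar y)$ for the system $\{(x,y)\mid G(x,y)\le0\}$, and let $\bar w:=(\bar x,\bar y,\bar z)$. Then: - If $\{\sigma_k\}$ is bounded, then $\bar w$ is S-stationary for the MPCC. - If $\sigma_k\to+\infty$ (i.e. $\sigma_{k,1}\to+\infty$ and $\sigma_{k,2}\to+\infty$) and MPCC-MFCQ holds at $\bar w$ for the MPCC, then $\bar w$ is M-stationary for the MPCC.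
   Context: Setting. $F,f:\mathbb R^n\times\mathbb R^m\to\mathbb R$, $G=(G_1,\dots,G_p):\mathbb R^n\times\mathbb R^m\to\mathbb R^p$, $g=(g_1,\dots,g_q):\mathbb R^n\times\mathbb R^m\to\mathbb R^q$; $\Omega:=\{(x,y)\mid G(x,y)\le0\}$, $X:=\{x\mid\exists y:(x,y)\in\Omega\}$; $S(x)$ is the solution set of $\min_y f(x,y)$ s.t. $g(x,y)\le0$; $\mathcal M(x,y):=\{\lambda\in\mathbb R^q_+\mid\nabla_yf(x,y)+\nabla_yg(x,y)^\top\lambda=0,\ \lambda^\top g(x,y)=0\}$. $\mathcal C:=\{(z,s)\in\mathbb R^q_+\times\mathbb R^q_+\mid z_is_i=0\ \forall i\}$. $[\cdot]_+$ is the componentwise positive part. Assumptions. (i) $F$ is continuously differentiable on an open set containing $\Omega$ and $\nabla F$ is $L_F$-Lipschitz on $\Omega$ for some $L_F>0$; each $G_i$ is continuously differentiable and convex on an open set containing $\Omega$. (ii) For every $x\in X$, $f(x,\cdot)$ and all $g_i(x,\cdot)$ are convex on $\mathbb R^m$; $f$ and all $g_i$ are twice continuously differentiable on an open set containing $X\times\mathbb R^m$. (iii) $\Omega$ is nonempty, closed, convex and bounded. (iv) For every $x\in X$ there exist $y_x\in S(x)$ with $(x,y_x)\in\Omega$ and $z_x\in\mathcal M(x,y_x)$. Functions. $\mathcal L(x,y,z):=f(x,y)+z^\top g(x,y)$; $\gamma_1,\gamma_2>0$ fixed. For $(x,y,z)\in\Omega\times\mathbb R^q_+$, $$\mathcal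 G_\gamma(x,y,z):=\max_{\theta\in\mathbb R^m,\lambda\in\mathbb R^q_+}\Big\{\mathcal L(x,y,\lambda)-\tfrac1{2\gamma_2}\|\lambda-z\|^2-\mathcal L(x,\theta,z)-\tfrac1{2\gamma_1}\|\theta-y\|^2\Big\}.$$ With $\theta^*:=\operatorname{argmin}_\theta\{\mathcal L(x,\theta,z)+\tfrac1{2\gamma_1}\|\theta-y\|^2\}$, $\lambda^*:=[z+\gamma_2g(x,y)]_+$, $\mathcal G_\gamma$ is continuously differentiable on $\Omega\times\mathbb R^q_+$ with $x$-, $y$-, $z$-gradients $\nabla_xf(x,y)+\nabla_xg(x,y)^\top\lambda^*-\nabla_xf(x,\theta^* )-\nabla_xg(x,\theta^* )^\top z$, $\ \nabla_yf(x,y)+\nabla_yg(x,y)^\top\lambda^*-(y-\theta^* )/\gamma_1$, $\ -(z-\lambda^* )/\gamma_2-g(x,\theta^* )$. Further, $$\mathcal P_{\gamma_2}(x,y,z):=\tfrac1{2\gamma_2}\big(\|[z+\gamma_2g(x,y)]_+\|^2-\|z\|^2\big),$$ $$\hat{\mathcal G}_\gamma(x,y,z;\theta):=f(x,y)+\mathcal P_{\gamma_2}(x,y,z)-f(x,\theta)-z^\top g(x,\theta)-\tfrac1{2\gamma_1}\|\theta-y\|^2,$$ $$\hat\psi_\sigma(x,y,z,s;\theta):=\tfrac1{\sigma_1}F(x,y)+\hat{\mathcal G}_\gamma(x,y,z;\theta)+\tfrac{\sigma_2}2\|g(x,y)+s\|^2,\qquad\sigma=(\sigma_1,\sigma_2),$$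 $$R(\theta;x,y,z):=\|\nabla_y\mathcal L(x,\theta,z)+\tfrac1{\gamma_1}(\theta-y)\|.$$ Truncated set and projection. For $M_{z,k}>0$, $\mathcal C_k:=\{(z,s)\in\mathcal C\mid z_i\le M_{z,k},\ s_i\le M_{z,k}\ \forall i\}$. $\operatorname{Proj}_{\mathcal C_k}(z,s)$ is the Euclidean projection selected componentwise: with $[t]_{[0,M]}:=\min\{M,[t]_+\}$, $M=M_{z,k}$, the $i$-th pair is $([z_i]_{[0,M]},0)$ if $(z_i-[z_i]_{[0,M]})^2+s_i^2\le z_i^2+(s_i-[s_i]_{[0,M]})^2$, and $(0,[s_i]_{[0,M]})$ otherwise. Algorithm iG-BSPM. Inputs: $(x^0,\tilde y^0)\in\Omega$, $(\tilde z^0,\tilde s^0)\in\mathcal C_0$, $\tilde\theta^0\in\mathbb R^m$ with $R(\tilde\theta^0;x^0,\tilde y^0,\tilde z^0)\le\zeta^\theta_{0,0}$; $\sigma_0=(\sigma_{0,1},\sigma_{0,2})\in(0,\infty)^2$; constants $\varrho_\rho,c_\rho,\tilde c,M_{z,0},\Delta_z,c_\alpha,c_\beta,\widehat L>0$, $\kappa_L>1$; initial line-search estimates $0<\widehat L^{xy,0}_{k,\ell},\widehat L^{zs,0}_{k,\ell}\le\widehat L$; tolerances $\tau_k>0$; inexactness parameters $\zeta^\theta_{0,0}\ge0$ and $\zeta^\theta_{k,\ell}\ge0$ ($k\ge0,\ell\ge1$). For $k=0,1,2,\dots$: (1) Inner loop. Set $(x^{k,0},y^{k,0},z^{k,0},s^{k,0},\theta^{k,0}):=(x^k,\tilde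 y^k,\tilde z^k,\tilde s^k,\tilde\theta^k)$. For $\ell=0,1,\dots$ (inner quantities written without $k$): (a) With $\lambda^\ell:=[z^\ell+\gamma_2g(x^\ell,y^\ell)]_+$, let $$d_{xy}^\ell:=\tfrac1{\sigma_{k,1}}\nabla F(x^\ell,y^\ell)+\sigma_{k,2}\nabla g(x^\ell,y^\ell)^\top(g(x^\ell,y^\ell)+s^\ell)+\begin{pmatrix}\nabla_x\mathcal L(x^\ell,y^\ell,\lambda^\ell)-\nabla_x\mathcal L(x^\ell,\theta^\ell,z^\ell)\\ \nabla_y\mathcal L(x^\ell,y^\ell,\lambda^\ell)-(y^\ell-\theta^\ell)/\gamma_1\end{pmatrix}.$$ For $j=0,1,\dots$ set $\alpha_\ell^j:=1/(\widehat L^{xy,0}_{k,\ell}\kappa_L^j+c_\alpha)$, $(x^{\ell+1,j},y^{\ell+1,j}):=\operatorname{Proj}_\Omega((x^\ell,y^\ell)-\alpha_\ell^jd_{xy}^\ell)$, and accept the first $j$ with $$\hat\psi_{\sigma_k}(x^{\ell+1,j},y^{\ell+1,j},z^\ell,s^\ell;\theta^\ell)+\tfrac{\gamma_1}2R(\theta^\ell;x^{\ell+1,j},y^{\ell+1,j},z^\ell)^2\le\hat\psi_{\sigma_k}(x^\ell,y^\ell,z^\ell,s^\ell;\theta^\ell)-c_\alpha\|(x^{\ell+1,j},y^{\ell+1,j})-(x^\ell,y^\ell)\|^2+\gamma_1(\zeta^\theta_{k,\ell})^2;$$ the accepted point is $(x^{\ell+1},y^{\ell+1})$. (b) Choose $\theta^{\ell+1/2}$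 with $R(\theta^{\ell+1/2};x^{\ell+1},y^{\ell+1},z^\ell)\le\zeta^\theta_{k,\ell}$ and set $$d_{zs}^\ell:=\big(\nabla_z\mathcal P_{\gamma_2}(x^{\ell+1},y^{\ell+1},z^\ell)-g(x^{\ell+1},\theta^{\ell+1/2}),\ \sigma_{k,2}(g(x^{\ell+1},y^{\ell+1})+s^\ell)\big).$$ For $j=0,1,\dots$ set $\beta_\ell^j:=1/(\widehat L^{zs,0}_{k,\ell}\kappa_L^j+c_\beta)$, $(z^{\ell+1,j},s^{\ell+1,j}):=\operatorname{Proj}_{\mathcal C_k}((z^\ell,s^\ell)-\beta_\ell^jd_{zs}^\ell)$, and accept the first $j$ with $$\hat\psi_{\sigma_k}(x^{\ell+1},y^{\ell+1},z^{\ell+1,j},s^{\ell+1,j};\theta^{\ell+1/2})+\tfrac{\gamma_1}2R(\theta^{\ell+1/2};x^{\ell+1},y^{\ell+1},z^{\ell+1,j})^2\le\hat\psi_{\sigma_k}(x^{\ell+1},y^{\ell+1},z^\ell,s^\ell;\theta^{\ell+1/2})-c_\beta\|(z^{\ell+1,j},s^{\ell+1,j})-(z^\ell,s^\ell)\|^2+\gamma_1(\zeta^\theta_{k,\ell})^2;$$ the accepted point is $(z^{\ell+1},s^{\ell+1})$. (c) Choose $\theta^{\ell+1}$ with $R(\theta^{\ell+1};x^{\ell+1},y^{\ell+1},z^{\ell+1})\le\zeta^\theta_{k,\ell+1}$. (d) Terminate the inner loop if $\|(x^{\ell+1},y^{\ell+1},z^{\ell+1},s^{\ell+1})-(x^\ell,y^\ell,z^\ell,s^\ell)\|\le\tau_k/(\sigma_{k,1}\sigma_{k,2}M_{z,k})$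 and $\sigma_{k,1}M_{z,k}\max\{\zeta^\theta_{k,\ell},\zeta^\theta_{k,\ell+1}\}\le\tau_k$. Upon termination set $(x^{k+1},y^{k+1},z^{k+1},s^{k+1},\theta^{k+1}):=(x^{\ell+1},y^{\ell+1},z^{\ell+1},s^{\ell+1},\theta^{\ell+1})$ and $\zeta^\theta_{k+1,0}:=\zeta^\theta_{k,\ell+1}$. (2) Let $t^{k+1}:=\hat{\mathcal G}_\gamma(x^{k+1},y^{k+1},z^{k+1};\theta^{k+1})+\tfrac{\sigma_{k,2}}2\|g(x^{k+1},y^{k+1})+s^{k+1}\|^2$. Case 1: if $t^{k+1}\le c_\rho\tau_k$, set $\sigma_{k+1}:=\sigma_k$ and $(\tilde y^{k+1},\tilde z^{k+1},\tilde s^{k+1},\tilde\theta^{k+1}):=(y^{k+1},z^{k+1},s^{k+1},\theta^{k+1})$. Case 2: if $t^{k+1}>c_\rho\tau_k$ but $t^{k+1}\le\tilde c/\sigma_{k,1}$, set $\sigma_{k+1}:=(\sigma_{k,1}+\varrho_\rho,\sigma_{k,2}+\varrho_\rho)$ and the tilde variables as in Case 1. Case 3: otherwise set $\sigma_{k+1}:=(\sigma_{k,1}+\varrho_\rho,\sigma_{k,2}+\varrho_\rho)$ and compute $(\tilde y^{k+1},\tilde z^{k+1},\tilde\theta^{k+1})$ with $(x^{k+1},\tilde y^{k+1},\tilde z^{k+1})\in\Omega\times\mathbb R^q_+$, $R(\tilde\theta^{k+1};x^{k+1},\tilde y^{k+1},\tilde z^{k+1})\le\zeta^\theta_{k+1,0}$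 and $$\hat{\mathcal G}_\gamma(x^{k+1},\tilde y^{k+1},\tilde z^{k+1};\tilde\theta^{k+1})+\tfrac{\gamma_1}2R(\tilde\theta^{k+1};x^{k+1},\tilde y^{k+1},\tilde z^{k+1})^2+\tfrac{\sigma_{k,2}}2\big(\|g_{I_+}(x^{k+1},\tilde y^{k+1})\|^2+\|[g_{I_0}(x^{k+1},\tilde y^{k+1})]_+\|^2\big)\le\tfrac{\tilde c}{\sigma_{k,1}},$$ where $I_+=\{i\mid\tilde z_i^{k+1}>0\}$, $I_0=\{i\mid\tilde z_i^{k+1}=0\}$; set $\tilde s_i^{k+1}:=0$ if $\tilde z_i^{k+1}>0$ and $\tilde s_i^{k+1}:=[-g_i(x^{k+1},\tilde y^{k+1})]_+$ otherwise. (3) $M_{z,k+1}:=\max\{M_{z,k}+\Delta_z,\|\tilde z^{k+1}\|,\|\tilde s^{k+1}\|\}$. (Assumption (iv) makes Case 3 well defined.) Approximate KKT condition for $(\mathrm{GP})_{\mathcal C}$. $(\bar x,\bar y)$ satisfies it if there exist sequences $\{(\mathsf x^j,\mathsf y^j,\mathsf z^j,\mathsf s^j)\}\subset\mathbb R^{n+m+q+q}$, $\{\varepsilon^j\}\subset\mathbb R^{n+m+q+q}$, $\{(\rho_1^j,\rho_2^j)\}\subset(0,\infty)^2$ with $(\mathsf x^j,\mathsf y^j)\to(\bar x,\bar y)$, $\varepsilon^j\to0$, $(\mathsf x^j,\mathsf y^j)\in\Omega$, $(\mathsf z^j,\mathsf s^j)\in\mathcal C$, $\mathcal G_\gamma(\mathsf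 x^j,\mathsf y^j,\mathsf z^j)\to0$, $g(\mathsf x^j,\mathsf y^j)+\mathsf s^j\to0$, and $$\varepsilon^j\in\nabla F(\mathsf x^j,\mathsf y^j)+\rho_1^j\nabla\mathcal G_\gamma(\mathsf x^j,\mathsf y^j,\mathsf z^j)+\rho_2^j\nabla(\|g(\mathsf x^j,\mathsf y^j)+\mathsf s^j\|^2)+\mathcal N_\Omega(\mathsf x^j,\mathsf y^j)\times\mathcal N_{\mathcal C}(\mathsf z^j,\mathsf s^j),$$ gradients being embedded in the $(x,y,z,s)$-space with zeros for absent variables. $\mathcal N_D$ is the limiting (Mordukhovich) normal cone. MFCQ. For a system $\{w\mid h(w)=0,\ c(w)\le0\}$ with continuously differentiable $h,c$, MFCQ holds at a feasible $\bar w$ if $\sum_j\mu^h_j\nabla h_j(\bar w)+\sum_{i:c_i(\bar w)=0}\mu^c_i\nabla c_i(\bar w)=0$ with $\mu^h_j\in\mathbb R$, $\mu^c_i\ge0$ implies that all these multipliers vanish. The MPCC is $\min_{x,y,z}F(x,y)$ s.t. $G(x,y)\le0$, $\nabla_y\mathcal L(x,y,z)=0$, $0\le z\perp-g(x,y)\ge0$. For a feasible $\bar w=(\bar x,\bar y,\bar z)$ let $\mathcal I_{+0}=\{i\mid\bar z_i>0,g_i(\bar x,\bar y)=0\}$, $\mathcal I_{0+}=\{i\mid\bar z_i=0,g_i(\bar x,\bar y)<0\}$, $\mathcal I_{00}=\{i\mid\bar z_i=0,g_i(\bar x,\bar y)=0\}$. MPCC-MFCQ holds at $\bar w$ if MFCQ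 holds at $\bar w$ for the system: $G(x,y)\le0$; $\nabla_y\mathcal L(x,y,z)=0$; $-g_i(x,y)=0$ ($i\in\mathcal I_{+0}\cup\mathcal I_{00}$); $z_i=0$ ($i\in\mathcal I_{0+}\cup\mathcal I_{00}$); $-g_i(x,y)\ge0$ ($i\in\mathcal I_{0+}$); $z_i\ge0$ ($i\in\mathcal I_{+0}$). Stationarity. A feasible $\bar w$ of the MPCC is S-stationary (resp. M-stationary) if there exist $\mu\in\mathbb R^p_+$, $\omega\in\mathbb R^m$, $\eta\in\mathbb R^q$ with $0=\nabla F(\bar x,\bar y)+\nabla G(\bar x,\bar y)^\top\mu+\nabla_y\nabla_{x,y}\mathcal L(\bar x,\bar y,\bar z)\omega+\nabla g(\bar x,\bar y)^\top\eta$ (where $\nabla_y\nabla_{x,y}\mathcal L$ is the $(n+m)\times m$ Jacobian in $y$ of the $(x,y)$-gradient of $\mathcal L$), $\mu_jG_j(\bar x,\bar y)=0$ for all $j$, $\eta_i=0$ for $i\in\mathcal I_{0+}$, $\nabla_yg_i(\bar x,\bar y)^\top\omega=0$ for $i\in\mathcal I_{+0}$, and, for every $i\in\mathcal I_{00}$: $\eta_i\ge0$ and $\nabla_yg_i(\bar x,\bar y)^\top\omega\ge0$ (S-stationary); resp. either ($\eta_i>0$ and $\nabla_yg_i(\bar x,\bar y)^\top\omega>0$) or $\eta_i\nabla_yg_i(\bar x,\bar y)^\top\omega=0$ (M-stationary). *)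

theory Defs
  imports "HOL-Analysis.Analysis"
begin

section \<open>Gradients, smoothness, normal cones\<close>

definition grad :: "('a::real_inner \<Rightarrow> real) \<Rightarrow> 'a \<Rightarrow> 'a" where
  "grad h w = (THE D. GDERIV h w :> D)"

text \<open>The product \<open>\<nabla>h(w)\<^sup>T v\<close> of the transposed Jacobian of a vector-valued map with a vector.\<close>

definition jac_transp :: "('a::real_inner \<Rightarrow> real^'k) \<Rightarrow> 'a \<Rightarrow> real^'k \<Rightarrow> 'a" where
  "jac_transp h w v = (\<Sum>i\<in>UNIV. (v $ i) *\<^sub>R grad (\<lambda>w'. h w' $ i) w)"

definition cont_diff_on :: "'a::euclidean_space set \<Rightarrow> ('a \<Rightarrow> real) \<Rightarrow> bool" where
  "cont_diff_on U h \<longleftrightarrow> (\<forall>w\<in>U. GDERIV h w :> grad h w) \<and> continuous_on U (grad h)"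

definition twice_cont_diff_on :: "'a::euclidean_space set \<Rightarrow> ('a \<Rightarrow> real) \<Rightarrow> bool" where
  "twice_cont_diff_on U h \<longleftrightarrow> cont_diff_on U h \<and>
     (\<exists>H :: 'a \<Rightarrow> 'a \<Rightarrow>\<^sub>L 'a. (\<forall>w\<in>U. (grad h has_derivative blinfun_apply (H w)) (at w)) \<and>
        continuous_on U H)"

definition regular_normal_cone :: "'a::euclidean_space set \<Rightarrow> 'a \<Rightarrow> 'a set" where
  "regular_normal_cone D w = {v. w \<in> D \<and>
     (\<forall>e>0. \<forall>\<^sub>F w' in at w within D. v \<bullet> (w' - w) \<le> e * norm (w' - w))}"

definition limiting_normal_cone :: "'a::euclidean_space set \<Rightarrow> 'a \<Rightarrow> 'a set" where
  "limiting_normal_cone D w = {v. \<exists>ws vs. (\<forall>j. vs j \<in> regular_normal_cone D (ws j)) \<and>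
     ws \<longlonglongrightarrow> w \<and> vs \<longlonglongrightarrow> v}"

text \<open>
  The Mangasarian-Fromovitz condition at \<open>w\<close> for the system \<open>h e w = 0\<close> (\<open>e \<in> E\<close>),
  \<open>c i w \<le> 0\<close> (\<open>i \<in> I\<close>), with \<open>E\<close> and \<open>I\<close> finite. Feasibility of \<open>w\<close> is not part of
  the predicate.
\<close>

definition MFCQ :: "'e set \<Rightarrow> ('e \<Rightarrow> 'a::real_inner \<Rightarrow> real) \<Rightarrow> 'i set \<Rightarrow> ('i \<Rightarrow> 'a \<Rightarrow> real) \<Rightarrow> 'a \<Rightarrow> bool"
  where
  "MFCQ E h I c w \<longleftrightarrow>
     (\<forall>\<mu>h \<mu>c. (\<forall>i\<in>I. 0 \<le> \<mu>c i) \<longrightarrow>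
        (\<Sum>e\<in>E. \<mu>h e *\<^sub>R grad (h e) w) + (\<Sum>i\<in>{i\<in>I. c i w = 0}. \<mu>c i *\<^sub>R grad (c i) w) = 0 \<longrightarrow>
        (\<forall>e\<in>E. \<mu>h e = 0) \<and> (\<forall>i\<in>{i\<in>I. c i w = 0}. \<mu>c i = 0))"

abbreviation MFCQ_ineq :: "('i::finite \<Rightarrow> 'a::real_inner \<Rightarrow> real) \<Rightarrow> 'a \<Rightarrow> bool" where
  "MFCQ_ineq c w \<equiv> MFCQ ({} :: unit set) (\<lambda>_ _. 0) UNIV c w"


section \<open>The bilevel problem\<close>

text \<open>Inequalities between vectors are componentwise (the library order on \<open>real^'k\<close>).\<close>

definition Omega :: "((real^'n) \<times> (real^'m) \<Rightarrow> real^'p) \<Rightarrow> ((real^'n) \<times> (real^'m)) set" where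
  "Omega G = {(x, y). G (x, y) \<le> 0}"

definition Xset :: "((real^'n) \<times> (real^'m) \<Rightarrow> real^'p) \<Rightarrow> (real^'n) set" where
  "Xset G = {x. \<exists>y. (x, y) \<in> Omega G}"

definition lower_solutions ::
  "((real^'n) \<times> (real^'m) \<Rightarrow> real) \<Rightarrow> ((real^'n) \<times> (real^'m) \<Rightarrow> real^'q) \<Rightarrow> real^'n \<Rightarrow> (real^'m) set" where
  "lower_solutions f g x = {y. g (x, y) \<le> 0 \<and> (\<forall>y'. g (x, y') \<le> 0 \<longrightarrow> f (x, y) \<le> f (x, y'))}"

definition lower_multipliers ::
  "((real^'n) \<times> (real^'m) \<Rightarrow> real) \<Rightarrow> ((real^'n) \<times> (real^'m) \<Rightarrow> real^'q) \<Rightarrow>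
   real^'n \<Rightarrow> real^'m \<Rightarrow> (real^'q) set" where
  "lower_multipliers f g x y = {lam. 0 \<le> lam \<and>
     grad (\<lambda>y'. f (x, y')) y + jac_transp (\<lambda>y'. g (x, y')) y lam = 0 \<and> lam \<bullet> g (x, y) = 0}"

definition Lag ::
  "((real^'n) \<times> (real^'m) \<Rightarrow> real) \<Rightarrow> ((real^'n) \<times> (real^'m) \<Rightarrow> real^'q) \<Rightarrow>
   real^'n \<Rightarrow> real^'m \<Rightarrow> real^'q \<Rightarrow> real" where
  "Lag f g x y z = f (x, y) + z \<bullet> g (x, y)"

abbreviation grad_x_Lag where
  "grad_x_Lag f g x y z \<equiv> grad (\<lambda>x'. Lag f g x' y z) x"

abbreviation grad_y_Lag where
  "grad_y_Lag f g x y z \<equiv> grad (\<lambda>y'. Lag f g x y' z) y"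

definition pos_part :: "real^'q \<Rightarrow> real^'q" where
  "pos_part v = (\<chi> i. max 0 (v $ i))"

definition compl_set :: "((real^'q) \<times> (real^'q)) set" where
  "compl_set = {(z, s). 0 \<le> z \<and> 0 \<le> s \<and> (\<forall>i. z $ i * s $ i = 0)}"


section \<open>The regularized gap function\<close>

text \<open>On \<open>\<Omega> \<times> \<real>\<^sub>+\<^sup>q\<close> the supremum is attained, so it is the maximum.\<close>

definition gap ::
  "((real^'n) \<times> (real^'m) \<Rightarrow> real) \<Rightarrow> ((real^'n) \<times> (real^'m) \<Rightarrow> real^'q) \<Rightarrow> real \<Rightarrow> real \<Rightarrow>
   real^'n \<Rightarrow> real^'m \<Rightarrow> real^'q \<Rightarrow> real" where
  "gap f g \<gamma>1 \<gamma>2 x y z = (SUP (\<theta>, lam) \<in> UNIV \<times> {lam. 0 \<le> lam}.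
     Lag f g x y lam - (norm (lam - z))\<^sup>2 / (2 * \<gamma>2) - Lag f g x \<theta> z - (norm (\<theta> - y))\<^sup>2 / (2 * \<gamma>1))"

definition theta_star ::
  "((real^'n) \<times> (real^'m) \<Rightarrow> real) \<Rightarrow> ((real^'n) \<times> (real^'m) \<Rightarrow> real^'q) \<Rightarrow> real \<Rightarrow>
   real^'n \<Rightarrow> real^'m \<Rightarrow> real^'q \<Rightarrow> real^'m" where
  "theta_star f g \<gamma>1 x y z =
     arg_min (\<lambda>\<theta>. Lag f g x \<theta> z + (norm (\<theta> - y))\<^sup>2 / (2 * \<gamma>1)) (\<lambda>_. True)"

definition lambda_star ::
  "((real^'n) \<times> (real^'m) \<Rightarrow> real^'q) \<Rightarrow> real \<Rightarrow> real^'n \<Rightarrow> real^'m \<Rightarrow> real^'q \<Rightarrow> real^'q" where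
  "lambda_star g \<gamma>2 x y z = pos_part (z + \<gamma>2 *\<^sub>R g (x, y))"

text \<open>
  The gradient of \<open>gap\<close> on \<open>\<Omega> \<times> \<real>\<^sub>+\<^sup>q\<close> is given by its explicit formula rather than as
  \<open>grad\<close> of \<open>gap\<close>: convexity of the lower level is only available for \<open>x \<in> X\<close> and \<open>z \<ge> 0\<close>, so
  \<open>gap\<close> need not be finite on a neighbourhood of a boundary point of this set.
\<close>

definition gap_grad_x ::
  "((real^'n) \<times> (real^'m) \<Rightarrow> real) \<Rightarrow> ((real^'n) \<times> (real^'m) \<Rightarrow> real^'q) \<Rightarrow> real \<Rightarrow> real \<Rightarrow>
   real^'n \<Rightarrow> real^'m \<Rightarrow> real^'q \<Rightarrow> real^'n" where
  "gap_grad_x f g \<gamma>1 \<gamma>2 x y z = (let \<theta> = theta_star f g \<gamma>1 x y z; lam = lambda_star g \<gamma>2 x y z in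
     grad (\<lambda>x'. f (x', y)) x + jac_transp (\<lambda>x'. g (x', y)) x lam
     - grad (\<lambda>x'. f (x', \<theta>)) x - jac_transp (\<lambda>x'. g (x', \<theta>)) x z)"

definition gap_grad_y ::
  "((real^'n) \<times> (real^'m) \<Rightarrow> real) \<Rightarrow> ((real^'n) \<times> (real^'m) \<Rightarrow> real^'q) \<Rightarrow> real \<Rightarrow> real \<Rightarrow>
   real^'n \<Rightarrow> real^'m \<Rightarrow> real^'q \<Rightarrow> real^'m" where
  "gap_grad_y f g \<gamma>1 \<gamma>2 x y z = (let \<theta> = theta_star f g \<gamma>1 x y z; lam = lambda_star g \<gamma>2 x y z in
     grad (\<lambda>y'. f (x, y')) y + jac_transp (\<lambda>y'. g (x, y')) y lam - (1 / \<gamma>1) *\<^sub>R (y - \<theta>))"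

definition gap_grad_z ::
  "((real^'n) \<times> (real^'m) \<Rightarrow> real) \<Rightarrow> ((real^'n) \<times> (real^'m) \<Rightarrow> real^'q) \<Rightarrow> real \<Rightarrow> real \<Rightarrow>
   real^'n \<Rightarrow> real^'m \<Rightarrow> real^'q \<Rightarrow> real^'q" where
  "gap_grad_z f g \<gamma>1 \<gamma>2 x y z = (let \<theta> = theta_star f g \<gamma>1 x y z; lam = lambda_star g \<gamma>2 x y z in
     - ((1 / \<gamma>2) *\<^sub>R (z - lam)) - g (x, \<theta>))"

definition penP ::
  "((real^'n) \<times> (real^'m) \<Rightarrow> real^'q) \<Rightarrow> real \<Rightarrow> real^'n \<Rightarrow> real^'m \<Rightarrow> real^'q \<Rightarrow> real" where
  "penP g \<gamma>2 x y z = ((norm (pos_part (z + \<gamma>2 *\<^sub>R g (x, y))))\<^sup>2 - (norm z)\<^sup>2) / (2 * \<gamma>2)"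

definition gap_hat ::
  "((real^'n) \<times> (real^'m) \<Rightarrow> real) \<Rightarrow> ((real^'n) \<times> (real^'m) \<Rightarrow> real^'q) \<Rightarrow> real \<Rightarrow> real \<Rightarrow>
   real^'n \<Rightarrow> real^'m \<Rightarrow> real^'q \<Rightarrow> real^'m \<Rightarrow> real" where
  "gap_hat f g \<gamma>1 \<gamma>2 x y z \<theta> =
     f (x, y) + penP g \<gamma>2 x y z - f (x, \<theta>) - z \<bullet> g (x, \<theta>) - (norm (\<theta> - y))\<^sup>2 / (2 * \<gamma>1)"

definition psi_hat ::
  "((real^'n) \<times> (real^'m) \<Rightarrow> real) \<Rightarrow> ((real^'n) \<times> (real^'m) \<Rightarrow> real) \<Rightarrow>
   ((real^'n) \<times> (real^'m) \<Rightarrow> real^'q) \<Rightarrow> real \<Rightarrow> real \<Rightarrow> real \<times> real \<Rightarrow>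
   real^'n \<Rightarrow> real^'m \<Rightarrow> real^'q \<Rightarrow> real^'q \<Rightarrow> real^'m \<Rightarrow> real" where
  "psi_hat F f g \<gamma>1 \<gamma>2 \<sigma> x y z s \<theta> =
     (1 / fst \<sigma>) * F (x, y) + gap_hat f g \<gamma>1 \<gamma>2 x y z \<theta> + (snd \<sigma> / 2) * (norm (g (x, y) + s))\<^sup>2"

definition resid ::
  "((real^'n) \<times> (real^'m) \<Rightarrow> real) \<Rightarrow> ((real^'n) \<times> (real^'m) \<Rightarrow> real^'q) \<Rightarrow> real \<Rightarrow>
   real^'m \<Rightarrow> real^'n \<Rightarrow> real^'m \<Rightarrow> real^'q \<Rightarrow> real" where
  "resid f g \<gamma>1 \<theta> x y z = norm (grad_y_Lag f g x \<theta> z + (1 / \<gamma>1) *\<^sub>R (\<theta> - y))"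


section \<open>Truncated complementarity set and its projection\<close>

definition compl_trunc :: "real \<Rightarrow> ((real^'q) \<times> (real^'q)) set" where
  "compl_trunc M = {(z, s) \<in> compl_set. \<forall>i. z $ i \<le> M \<and> s $ i \<le> M}"

definition clip :: "real \<Rightarrow> real \<Rightarrow> real" where
  "clip M t = min M (max 0 t)"

definition proj_compl :: "real \<Rightarrow> (real^'q) \<times> (real^'q) \<Rightarrow> (real^'q) \<times> (real^'q)" where
  "proj_compl M = (\<lambda>(z, s).
     let keep_z = (\<lambda>i. (z $ i - clip M (z $ i))\<^sup>2 + (s $ i)\<^sup>2 \<le> (z $ i)\<^sup>2 + (s $ i - clip M (s $ i))\<^sup>2)
     in (\<chi> i. if keep_z i then clip M (z $ i) else 0, \<chi> i. if keep_z i then 0 else clip M (s $ i)))"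


section \<open>The algorithm iG-BSPM\<close>

text \<open>
  Inputs of the algorithm. The entries \<open>zeta (k + 1) 0\<close> are not free inputs; the relation
  \<open>iG_BSPM\<close> below ties them to the last inexactness parameter used in outer iteration \<open>k\<close>.
\<close>

record ig_params =
  sigma_init :: "real \<times> real"
  varrho_rho :: real
  c_rho :: real
  c_tilde :: real
  M_init :: real
  Delta_z :: real
  c_alpha :: real
  c_beta :: real
  L_hat :: real
  kappa_L :: real
  L0_xy :: "nat \<Rightarrow> nat \<Rightarrow> real"
  L0_zs :: "nat \<Rightarrow> nat \<Rightarrow> real"
  tau :: "nat \<Rightarrow> real"
  zeta :: "nat \<Rightarrow> nat \<Rightarrow> real"

definition valid_params :: "ig_params \<Rightarrow> bool" where
  "valid_params P \<longleftrightarrow>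
     0 < fst (sigma_init P) \<and> 0 < snd (sigma_init P) \<and>
     0 < varrho_rho P \<and> 0 < c_rho P \<and> 0 < c_tilde P \<and> 0 < M_init P \<and> 0 < Delta_z P \<and>
     0 < c_alpha P \<and> 0 < c_beta P \<and> 0 < L_hat P \<and> 1 < kappa_L P \<and>
     (\<forall>k l. 0 < L0_xy P k l \<and> L0_xy P k l \<le> L_hat P \<and> 0 < L0_zs P k l \<and> L0_zs P k l \<le> L_hat P) \<and>
     (\<forall>k. 0 < tau P k) \<and> (\<forall>k l. 0 \<le> zeta P k l)"

text \<open>
  A run. \<open>*_out k\<close> are the outer iterates with index \<open>k\<close>, \<open>*_start k\<close> the tilde variables,
  \<open>*_in k l\<close> the inner iterates, \<open>th_half k l\<close> is \<open>\<theta>\<close> at inner index \<open>l + 1/2\<close>, and \<open>stop k\<close> is the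
  value of \<open>l\<close> at which the inner loop of outer iteration \<open>k\<close> terminates. Inner iterates with
  index beyond \<open>stop k + 1\<close> are irrelevant, as are \<open>y_out\<close>, \<open>z_out\<close>, \<open>s_out\<close>, \<open>th_out\<close> at \<open>0\<close>
  (the algorithm only produces \<open>x\<^sup>0\<close>).
\<close>

record ('n::finite, 'm::finite, 'q::finite) ig_run =
  x_out :: "nat \<Rightarrow> real^'n"
  y_out :: "nat \<Rightarrow> real^'m"
  z_out :: "nat \<Rightarrow> real^'q"
  s_out :: "nat \<Rightarrow> real^'q"
  th_out :: "nat \<Rightarrow> real^'m"
  y_start :: "nat \<Rightarrow> real^'m"
  z_start :: "nat \<Rightarrow> real^'q"
  s_start :: "nat \<Rightarrow> real^'q"
  th_start :: "nat \<Rightarrow> real^'m"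
  x_in :: "nat \<Rightarrow> nat \<Rightarrow> real^'n"
  y_in :: "nat \<Rightarrow> nat \<Rightarrow> real^'m"
  z_in :: "nat \<Rightarrow> nat \<Rightarrow> real^'q"
  s_in :: "nat \<Rightarrow> nat \<Rightarrow> real^'q"
  th_in :: "nat \<Rightarrow> nat \<Rightarrow> real^'m"
  th_half :: "nat \<Rightarrow> nat \<Rightarrow> real^'m"
  stop :: "nat \<Rightarrow> nat"
  sigma_out :: "nat \<Rightarrow> real \<times> real"
  Mz :: "nat \<Rightarrow> real"

definition first_accepted :: "(nat \<Rightarrow> bool) \<Rightarrow> nat \<Rightarrow> bool" where
  "first_accepted A j \<longleftrightarrow> A j \<and> (\<forall>i<j. \<not> A i)"

definition d_xy ::
  "((real^'n) \<times> (real^'m) \<Rightarrow> real) \<Rightarrow> ((real^'n) \<times> (real^'m) \<Rightarrow> real) \<Rightarrow>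
   ((real^'n) \<times> (real^'m) \<Rightarrow> real^'q) \<Rightarrow> real \<Rightarrow> real \<Rightarrow> real \<times> real \<Rightarrow>
   real^'n \<Rightarrow> real^'m \<Rightarrow> real^'q \<Rightarrow> real^'q \<Rightarrow> real^'m \<Rightarrow> (real^'n) \<times> (real^'m)" where
  "d_xy F f g \<gamma>1 \<gamma>2 \<sigma> x y z s \<theta> = (let lam = pos_part (z + \<gamma>2 *\<^sub>R g (x, y)) in
     (1 / fst \<sigma>) *\<^sub>R grad F (x, y) + snd \<sigma> *\<^sub>R jac_transp g (x, y) (g (x, y) + s)
     + (grad_x_Lag f g x y lam - grad_x_Lag f g x \<theta> z,
        grad_y_Lag f g x y lam - (1 / \<gamma>1) *\<^sub>R (y - \<theta>)))"

definition d_zs ::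
  "((real^'n) \<times> (real^'m) \<Rightarrow> real^'q) \<Rightarrow> real \<Rightarrow> real \<times> real \<Rightarrow>
   real^'n \<Rightarrow> real^'m \<Rightarrow> real^'q \<Rightarrow> real^'q \<Rightarrow> real^'m \<Rightarrow> (real^'q) \<times> (real^'q)" where
  "d_zs g \<gamma>2 \<sigma> x y z s \<theta> =
     (grad (\<lambda>z'. penP g \<gamma>2 x y z') z - g (x, \<theta>), snd \<sigma> *\<^sub>R (g (x, y) + s))"

definition step_xy ::
  "((real^'n) \<times> (real^'m) \<Rightarrow> real) \<Rightarrow> ((real^'n) \<times> (real^'m) \<Rightarrow> real) \<Rightarrow>
   ((real^'n) \<times> (real^'m) \<Rightarrow> real^'p) \<Rightarrow> ((real^'n) \<times> (real^'m) \<Rightarrow> real^'q) \<Rightarrow> real \<Rightarrow> real \<Rightarrow>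
   ig_params \<Rightarrow> ('n, 'm, 'q) ig_run \<Rightarrow> nat \<Rightarrow> nat \<Rightarrow> bool" where
  "step_xy F f G g \<gamma>1 \<gamma>2 P r k l \<longleftrightarrow>
     (let \<sigma> = sigma_out r k; x = x_in r k l; y = y_in r k l; z = z_in r k l; s = s_in r k l;
          \<theta> = th_in r k l; \<zeta> = zeta P k l;
          \<alpha> = (\<lambda>j. 1 / (L0_xy P k l * kappa_L P ^ j + c_alpha P));
          trial = (\<lambda>j. closest_point (Omega G) ((x, y) - \<alpha> j *\<^sub>R d_xy F f g \<gamma>1 \<gamma>2 \<sigma> x y z s \<theta>));
          accept = (\<lambda>j. let (x', y') = trial j in
            psi_hat F f g \<gamma>1 \<gamma>2 \<sigma> x' y' z s \<theta> + (\<gamma>1 / 2) * (resid f g \<gamma>1 \<theta> x' y' z)\<^sup>2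
              \<le> psi_hat F f g \<gamma>1 \<gamma>2 \<sigma> x y z s \<theta>
                - c_alpha P * (norm ((x', y') - (x, y)))\<^sup>2 + \<gamma>1 * \<zeta>\<^sup>2)
      in \<exists>j. first_accepted accept j \<and> (x_in r k (Suc l), y_in r k (Suc l)) = trial j)"

definition step_zs ::
  "((real^'n) \<times> (real^'m) \<Rightarrow> real) \<Rightarrow> ((real^'n) \<times> (real^'m) \<Rightarrow> real) \<Rightarrow>
   ((real^'n) \<times> (real^'m) \<Rightarrow> real^'q) \<Rightarrow> real \<Rightarrow> real \<Rightarrow>
   ig_params \<Rightarrow> ('n, 'm, 'q) ig_run \<Rightarrow> nat \<Rightarrow> nat \<Rightarrow> bool" where
  "step_zs F f g \<gamma>1 \<gamma>2 P r k l \<longleftrightarrow>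
     (let \<sigma> = sigma_out r k; x = x_in r k (Suc l); y = y_in r k (Suc l);
          z = z_in r k l; s = s_in r k l; \<theta> = th_half r k l; \<zeta> = zeta P k l;
          \<beta> = (\<lambda>j. 1 / (L0_zs P k l * kappa_L P ^ j + c_beta P));
          trial = (\<lambda>j. proj_compl (Mz r k) ((z, s) - \<beta> j *\<^sub>R d_zs g \<gamma>2 \<sigma> x y z s \<theta>));
          accept = (\<lambda>j. let (z', s') = trial j in
            psi_hat F f g \<gamma>1 \<gamma>2 \<sigma> x y z' s' \<theta> + (\<gamma>1 / 2) * (resid f g \<gamma>1 \<theta> x y z')\<^sup>2
              \<le> psi_hat F f g \<gamma>1 \<gamma>2 \<sigma> x y z s \<theta>
                - c_beta P * (norm ((z', s') - (z, s)))\<^sup>2 + \<gamma>1 * \<zeta>\<^sup>2)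
      in \<exists>j. first_accepted accept j \<and> (z_in r k (Suc l), s_in r k (Suc l)) = trial j)"

definition inner_step ::
  "((real^'n) \<times> (real^'m) \<Rightarrow> real) \<Rightarrow> ((real^'n) \<times> (real^'m) \<Rightarrow> real) \<Rightarrow>
   ((real^'n) \<times> (real^'m) \<Rightarrow> real^'p) \<Rightarrow> ((real^'n) \<times> (real^'m) \<Rightarrow> real^'q) \<Rightarrow> real \<Rightarrow> real \<Rightarrow>
   ig_params \<Rightarrow> ('n, 'm, 'q) ig_run \<Rightarrow> nat \<Rightarrow> nat \<Rightarrow> bool" where
  "inner_step F f G g \<gamma>1 \<gamma>2 P r k l \<longleftrightarrow>
     step_xy F f G g \<gamma>1 \<gamma>2 P r k l \<and>
     resid f g \<gamma>1 (th_half r k l) (x_in r k (Suc l)) (y_in r k (Suc l)) (z_in r k l) \<le> zeta P k l \<and>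
     step_zs F f g \<gamma>1 \<gamma>2 P r k l \<and>
     resid f g \<gamma>1 (th_in r k (Suc l)) (x_in r k (Suc l)) (y_in r k (Suc l)) (z_in r k (Suc l))
       \<le> zeta P k (Suc l)"

definition inner_stop ::
  "ig_params \<Rightarrow> ('n::finite, 'm::finite, 'q::finite) ig_run \<Rightarrow> nat \<Rightarrow> nat \<Rightarrow> bool" where
  "inner_stop P r k l \<longleftrightarrow>
     norm (((x_in r k (Suc l), y_in r k (Suc l)), (z_in r k (Suc l), s_in r k (Suc l)))
           - ((x_in r k l, y_in r k l), (z_in r k l, s_in r k l)))
       \<le> tau P k / (fst (sigma_out r k) * snd (sigma_out r k) * Mz r k) \<and>
     fst (sigma_out r k) * Mz r k * max (zeta P k l) (zeta P k (Suc l)) \<le> tau P k"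

definition inner_loop ::
  "((real^'n) \<times> (real^'m) \<Rightarrow> real) \<Rightarrow> ((real^'n) \<times> (real^'m) \<Rightarrow> real) \<Rightarrow>
   ((real^'n) \<times> (real^'m) \<Rightarrow> real^'p) \<Rightarrow> ((real^'n) \<times> (real^'m) \<Rightarrow> real^'q) \<Rightarrow> real \<Rightarrow> real \<Rightarrow>
   ig_params \<Rightarrow> ('n, 'm, 'q) ig_run \<Rightarrow> nat \<Rightarrow> bool" where
  "inner_loop F f G g \<gamma>1 \<gamma>2 P r k \<longleftrightarrow>
     x_in r k 0 = x_out r k \<and> y_in r k 0 = y_start r k \<and> z_in r k 0 = z_start r k \<and>
     s_in r k 0 = s_start r k \<and> th_in r k 0 = th_start r k \<and>
     (\<forall>l\<le>stop r k. inner_step F f G g \<gamma>1 \<gamma>2 P r k l) \<and>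
     (\<forall>l<stop r k. \<not> inner_stop P r k l) \<and> inner_stop P r k (stop r k) \<and>
     x_out r (Suc k) = x_in r k (Suc (stop r k)) \<and>
     y_out r (Suc k) = y_in r k (Suc (stop r k)) \<and>
     z_out r (Suc k) = z_in r k (Suc (stop r k)) \<and>
     s_out r (Suc k) = s_in r k (Suc (stop r k)) \<and>
     th_out r (Suc k) = th_in r k (Suc (stop r k)) \<and>
     zeta P (Suc k) 0 = zeta P k (Suc (stop r k))"

definition keep_iterates :: "('n::finite, 'm::finite, 'q::finite) ig_run \<Rightarrow> nat \<Rightarrow> bool" where
  "keep_iterates r k \<longleftrightarrow>
     y_start r (Suc k) = y_out r (Suc k) \<and> z_start r (Suc k) = z_out r (Suc k) \<and>
     s_start r (Suc k) = s_out r (Suc k) \<and> th_start r (Suc k) = th_out r (Suc k)"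

definition increase_sigma :: "ig_params \<Rightarrow> ('n::finite, 'm::finite, 'q::finite) ig_run \<Rightarrow> nat \<Rightarrow> bool" where
  "increase_sigma P r k \<longleftrightarrow>
     sigma_out r (Suc k) = (fst (sigma_out r k) + varrho_rho P, snd (sigma_out r k) + varrho_rho P)"

definition restart_iterates ::
  "((real^'n) \<times> (real^'m) \<Rightarrow> real) \<Rightarrow> ((real^'n) \<times> (real^'m) \<Rightarrow> real^'p) \<Rightarrow>
   ((real^'n) \<times> (real^'m) \<Rightarrow> real^'q) \<Rightarrow> real \<Rightarrow> real \<Rightarrow>
   ig_params \<Rightarrow> ('n, 'm, 'q) ig_run \<Rightarrow> nat \<Rightarrow> bool" where
  "restart_iterates f G g \<gamma>1 \<gamma>2 P r k \<longleftrightarrow>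
     (let x = x_out r (Suc k); y = y_start r (Suc k); z = z_start r (Suc k);
          \<theta> = th_start r (Suc k)
      in (x, y) \<in> Omega G \<and> 0 \<le> z \<and> resid f g \<gamma>1 \<theta> x y z \<le> zeta P (Suc k) 0 \<and>
         gap_hat f g \<gamma>1 \<gamma>2 x y z \<theta> + (\<gamma>1 / 2) * (resid f g \<gamma>1 \<theta> x y z)\<^sup>2
           + (snd (sigma_out r k) / 2) *
               ((\<Sum>i\<in>{i. z $ i > 0}. (g (x, y) $ i)\<^sup>2) + (\<Sum>i\<in>{i. z $ i = 0}. (max 0 (g (x, y) $ i))\<^sup>2))
           \<le> c_tilde P / fst (sigma_out r k) \<and>
         s_start r (Suc k) = (\<chi> i. if z $ i > 0 then 0 else max 0 (- (g (x, y) $ i))))"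

definition outer_update ::
  "((real^'n) \<times> (real^'m) \<Rightarrow> real) \<Rightarrow> ((real^'n) \<times> (real^'m) \<Rightarrow> real^'p) \<Rightarrow>
   ((real^'n) \<times> (real^'m) \<Rightarrow> real^'q) \<Rightarrow> real \<Rightarrow> real \<Rightarrow>
   ig_params \<Rightarrow> ('n, 'm, 'q) ig_run \<Rightarrow> nat \<Rightarrow> bool" where
  "outer_update f G g \<gamma>1 \<gamma>2 P r k \<longleftrightarrow>
     (let x = x_out r (Suc k); y = y_out r (Suc k); z = z_out r (Suc k); s = s_out r (Suc k);
          t = gap_hat f g \<gamma>1 \<gamma>2 x y z (th_out r (Suc k)) + (snd (sigma_out r k) / 2) * (norm (g (x, y) + s))\<^sup>2
      in if t \<le> c_rho P * tau P k then sigma_out r (Suc k) = sigma_out r k \<and> keep_iterates r k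
         else if t \<le> c_tilde P / fst (sigma_out r k) then increase_sigma P r k \<and> keep_iterates r k
         else increase_sigma P r k \<and> restart_iterates f G g \<gamma>1 \<gamma>2 P r k) \<and>
     Mz r (Suc k) = max (Mz r k + Delta_z P) (max (norm (z_start r (Suc k))) (norm (s_start r (Suc k))))"

definition iG_BSPM ::
  "((real^'n) \<times> (real^'m) \<Rightarrow> real) \<Rightarrow> ((real^'n) \<times> (real^'m) \<Rightarrow> real) \<Rightarrow>
   ((real^'n) \<times> (real^'m) \<Rightarrow> real^'p) \<Rightarrow> ((real^'n) \<times> (real^'m) \<Rightarrow> real^'q) \<Rightarrow> real \<Rightarrow> real \<Rightarrow>
   ig_params \<Rightarrow> ('n, 'm, 'q) ig_run \<Rightarrow> bool" where
  "iG_BSPM F f G g \<gamma>1 \<gamma>2 P r \<longleftrightarrow>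
     valid_params P \<and>
     sigma_out r 0 = sigma_init P \<and> Mz r 0 = M_init P \<and>
     (x_out r 0, y_start r 0) \<in> Omega G \<and> (z_start r 0, s_start r 0) \<in> compl_trunc (Mz r 0) \<and>
     resid f g \<gamma>1 (th_start r 0) (x_out r 0) (y_start r 0) (z_start r 0) \<le> zeta P 0 0 \<and>
     (\<forall>k. inner_loop F f G g \<gamma>1 \<gamma>2 P r k \<and> outer_update f G g \<gamma>1 \<gamma>2 P r k)"


section \<open>Approximate KKT condition\<close>

text \<open>Points of the \<open>(x, y, z, s)\<close>-space are represented as \<open>((x, y), (z, s))\<close>.\<close>

definition approx_KKT ::
  "((real^'n) \<times> (real^'m) \<Rightarrow> real) \<Rightarrow> ((real^'n) \<times> (real^'m) \<Rightarrow> real) \<Rightarrow>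
   ((real^'n) \<times> (real^'m) \<Rightarrow> real^'p) \<Rightarrow> ((real^'n) \<times> (real^'m) \<Rightarrow> real^'q) \<Rightarrow> real \<Rightarrow> real \<Rightarrow>
   real^'n \<Rightarrow> real^'m \<Rightarrow> bool" where
  "approx_KKT F f G g \<gamma>1 \<gamma>2 xb yb \<longleftrightarrow>
     (\<exists>(x :: nat \<Rightarrow> real^'n) (y :: nat \<Rightarrow> real^'m) (z :: nat \<Rightarrow> real^'q) (s :: nat \<Rightarrow> real^'q)
        (\<epsilon> :: nat \<Rightarrow> ((real^'n) \<times> (real^'m)) \<times> ((real^'q) \<times> (real^'q)))
        (\<rho>1 :: nat \<Rightarrow> real) (\<rho>2 :: nat \<Rightarrow> real).
        (\<forall>j. 0 < \<rho>1 j \<and> 0 < \<rho>2 j) \<and>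
        (\<lambda>j. (x j, y j)) \<longlonglongrightarrow> (xb, yb) \<and> \<epsilon> \<longlonglongrightarrow> 0 \<and>
        (\<forall>j. (x j, y j) \<in> Omega G) \<and> (\<forall>j. (z j, s j) \<in> compl_set) \<and>
        (\<lambda>j. gap f g \<gamma>1 \<gamma>2 (x j) (y j) (z j)) \<longlonglongrightarrow> 0 \<and>
        (\<lambda>j. g (x j, y j) + s j) \<longlonglongrightarrow> 0 \<and>
        (\<forall>j. \<exists>\<nu> \<in> limiting_normal_cone (Omega G) (x j, y j) \<times> limiting_normal_cone compl_set (z j, s j).
           \<epsilon> j = (grad F (x j, y j), (0, 0))
             + \<rho>1 j *\<^sub>R ((gap_grad_x f g \<gamma>1 \<gamma>2 (x j) (y j) (z j), gap_grad_y f g \<gamma>1 \<gamma>2 (x j) (y j) (z j)),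
                        (gap_grad_z f g \<gamma>1 \<gamma>2 (x j) (y j) (z j), 0))
             + \<rho>2 j *\<^sub>R grad (\<lambda>((x', y'), (z' :: real^'q, s')). (norm (g (x', y') + s'))\<^sup>2)
                         ((x j, y j), (z j, s j))
             + \<nu>))"


section \<open>The MPCC: constraint qualification and stationarity\<close>

definition MPCC_feasible ::
  "((real^'n) \<times> (real^'m) \<Rightarrow> real) \<Rightarrow>
   ((real^'n) \<times> (real^'m) \<Rightarrow> real^'p) \<Rightarrow> ((real^'n) \<times> (real^'m) \<Rightarrow> real^'q) \<Rightarrow>
   (real^'n) \<times> (real^'m) \<times> (real^'q) \<Rightarrow> bool" where
  "MPCC_feasible f G g = (\<lambda>(x, y, z).
     G (x, y) \<le> 0 \<and> grad_y_Lag f g x y z = 0 \<and> 0 \<le> z \<and> 0 \<le> - g (x, y) \<and> z \<bullet> (- g (x, y)) = 0)"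

definition I_p0 ::
  "((real^'n) \<times> (real^'m) \<Rightarrow> real^'q) \<Rightarrow> (real^'n) \<times> (real^'m) \<times> (real^'q) \<Rightarrow> 'q set" where
  "I_p0 g = (\<lambda>(x, y, z). {i. z $ i > 0 \<and> g (x, y) $ i = 0})"

definition I_0p ::
  "((real^'n) \<times> (real^'m) \<Rightarrow> real^'q) \<Rightarrow> (real^'n) \<times> (real^'m) \<times> (real^'q) \<Rightarrow> 'q set" where
  "I_0p g = (\<lambda>(x, y, z). {i. z $ i = 0 \<and> g (x, y) $ i < 0})"

definition I_00 ::
  "((real^'n) \<times> (real^'m) \<Rightarrow> real^'q) \<Rightarrow> (real^'n) \<times> (real^'m) \<times> (real^'q) \<Rightarrow> 'q set" where
  "I_00 g = (\<lambda>(x, y, z). {i. z $ i = 0 \<and> g (x, y) $ i = 0})"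

text \<open>
  The index sets are taken at the fixed point \<open>wb\<close>; constraints of the form \<open>\<dots> \<ge> 0\<close> are
  rewritten as \<open>\<dots> \<le> 0\<close>.
\<close>

definition MPCC_MFCQ ::
  "((real^'n) \<times> (real^'m) \<Rightarrow> real) \<Rightarrow>
   ((real^'n) \<times> (real^'m) \<Rightarrow> real^'p) \<Rightarrow> ((real^'n) \<times> (real^'m) \<Rightarrow> real^'q) \<Rightarrow>
   (real^'n) \<times> (real^'m) \<times> (real^'q) \<Rightarrow> bool" where
  "MPCC_MFCQ f G g wb \<longleftrightarrow>
     MFCQ
       ((UNIV :: 'm set) <+> ((I_p0 g wb \<union> I_00 g wb) <+> (I_0p g wb \<union> I_00 g wb)))
       (case_sum (\<lambda>j (x, y, z). grad_y_Lag f g x y z $ j)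
         (case_sum (\<lambda>i (x, y, z). - (g (x, y) $ i)) (\<lambda>i (x, y, z). z $ i)))
       ((UNIV :: 'p set) <+> (I_0p g wb <+> I_p0 g wb))
       (case_sum (\<lambda>j (x, y, z). G (x, y) $ j)
         (case_sum (\<lambda>i (x, y, z). g (x, y) $ i) (\<lambda>i (x, y, z). - (z $ i))))
       wb"

text \<open>
  The stationarity conditions common to the S- and M-variants. The product of the Jacobian in
  \<open>y\<close> of the \<open>(x, y)\<close>-gradient of the Lagrangian with \<open>\<omega>\<close> is the derivative of this gradient,
  as a function of \<open>y\<close>, in direction \<open>\<omega>\<close>.
\<close>

definition MPCC_multipliers ::
  "((real^'n) \<times> (real^'m) \<Rightarrow> real) \<Rightarrow> ((real^'n) \<times> (real^'m) \<Rightarrow> real) \<Rightarrow>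
   ((real^'n) \<times> (real^'m) \<Rightarrow> real^'p) \<Rightarrow> ((real^'n) \<times> (real^'m) \<Rightarrow> real^'q) \<Rightarrow>
   (real^'n) \<times> (real^'m) \<times> (real^'q) \<Rightarrow> real^'p \<Rightarrow> real^'m \<Rightarrow> real^'q \<Rightarrow> bool" where
  "MPCC_multipliers F f G g = (\<lambda>(x, y, z) \<mu> \<omega> \<eta>.
     0 \<le> \<mu> \<and>
     0 = grad F (x, y) + jac_transp G (x, y) \<mu>
         + frechet_derivative (\<lambda>y'. grad (\<lambda>(a, b). Lag f g a b z) (x, y')) (at y) \<omega>
         + jac_transp g (x, y) \<eta> \<and>
     (\<forall>j. \<mu> $ j * G (x, y) $ j = 0) \<and>
     (\<forall>i\<in>I_0p g (x, y, z). \<eta> $ i = 0) \<and>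
     (\<forall>i\<in>I_p0 g (x, y, z). grad (\<lambda>y'. g (x, y') $ i) y \<bullet> \<omega> = 0))"

definition S_stationary ::
  "((real^'n) \<times> (real^'m) \<Rightarrow> real) \<Rightarrow> ((real^'n) \<times> (real^'m) \<Rightarrow> real) \<Rightarrow>
   ((real^'n) \<times> (real^'m) \<Rightarrow> real^'p) \<Rightarrow> ((real^'n) \<times> (real^'m) \<Rightarrow> real^'q) \<Rightarrow>
   (real^'n) \<times> (real^'m) \<times> (real^'q) \<Rightarrow> bool" where
  "S_stationary F f G g = (\<lambda>(x, y, z).
     MPCC_feasible f G g (x, y, z) \<and>
     (\<exists>\<mu> \<omega> \<eta>. MPCC_multipliers F f G g (x, y, z) \<mu> \<omega> \<eta> \<and>
        (\<forall>i\<in>I_00 g (x, y, z). 0 \<le> \<eta> $ i \<and> 0 \<le> grad (\<lambda>y'. g (x, y') $ i) y \<bullet> \<omega>)))"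

definition M_stationary ::
  "((real^'n) \<times> (real^'m) \<Rightarrow> real) \<Rightarrow> ((real^'n) \<times> (real^'m) \<Rightarrow> real) \<Rightarrow>
   ((real^'n) \<times> (real^'m) \<Rightarrow> real^'p) \<Rightarrow> ((real^'n) \<times> (real^'m) \<Rightarrow> real^'q) \<Rightarrow>
   (real^'n) \<times> (real^'m) \<times> (real^'q) \<Rightarrow> bool" where
  "M_stationary F f G g = (\<lambda>(x, y, z).
     MPCC_feasible f G g (x, y, z) \<and>
     (\<exists>\<mu> \<omega> \<eta>. MPCC_multipliers F f G g (x, y, z) \<mu> \<omega> \<eta> \<and>
        (\<forall>i\<in>I_00 g (x, y, z).
           (0 < \<eta> $ i \<and> 0 < grad (\<lambda>y'. g (x, y') $ i) y \<bullet> \<omega>) \<or>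
           \<eta> $ i * (grad (\<lambda>y'. g (x, y') $ i) y \<bullet> \<omega>) = 0)))"

end

theory Submission
  imports Defs
begin

text \<open>
  Strong convexity of the proximal subproblem makes \<open>gap_hat\<close> at an approximate solution and the gap
  agree up to the squared residual. Hence the line searches, which test the residual as well, decrease the penalized
  objective up to summable errors, and the gap and the infeasibility tend to zero at the outer iterates,
  whether the penalty parameters stay bounded or not.

  Along a convergent subsequence the multipliers are bounded, so the curvature seen by the line searches, and with it
  the accepted inverse step sizes, are at most proportional to \<open>\<sigma>\<^sub>2\<close>. The stopping test compensates exactly
  this factor and \<open>\<sigma>\<^sub>1\<close>, and the optimality conditions of the last two projections become the approximate KKT
  system; the truncation of the complementarity set is inactive because its bound tends to infinity.

  If the penalty parameters are bounded, the penalty gradients vanish in the limit and all multipliers except \<open>\<mu>\<close> can be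
  taken to be zero. If they tend to infinity, put \<open>\<omega> = \<sigma>\<^sub>1 (y - \<theta>\<^sup>*)\<close> and
  \<open>\<eta> = \<sigma>\<^sub>1 (\<lambda>\<^sup>* - z) + \<sigma>\<^sub>1 \<sigma>\<^sub>2 (g + s)\<close>. Linearizing at the limit turns the approximate KKT system into the MPCC
  system for these multipliers, \<open>MPCC_MFCQ\<close> bounds them, and the sign conditions on biactive indices come from the
  regular normal cone of the complementarity set and \<open>\<sigma>\<^sub>2 \<rightarrow> \<infinity>\<close>.
\<close>

section \<open>Gradients and second derivatives\<close>

text \<open>Convexity of the lower level holds only for \<open>x\<close> in \<open>X\<close> and
  \<open>z \<ge> 0\<close>, so the gap itself is never differentiated. The analysis uses the
  surrogate with \<open>\<theta>\<close> frozen, whose derivatives are explicit, and increments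
  between points of \<open>\<Omega>\<close>. When the penalty parameters diverge, the gap vanishes
  because the starting points are controlled: Case 3 replaces a start whose penalty value is not of
  order \<open>1 / \<sigma>\<^sub>1\<close>, and the bounded objective \<open>F\<close> is itself
  divided by \<open>\<sigma>\<^sub>1\<close>. Two obstacles shape the passage to the limit. The
  proximal point and \<open>y\<close> both move while \<open>\<sigma>\<^sub>1\<close> magnifies
  their difference, so the gradients have to be strictly differentiable at the limit. And the
  regular normal cone of the complementarity set, unlike that of the convex \<open>\<Omega>\<close>,
  is not stable under limits, since the iterates may change branch. Its sign information is
  therefore extracted at each iterate and put into one inequality between continuous functions,
  which survives the limit.\<close>

lemma GDERIV_unique:
  assumes "GDERIV h w :> D" "GDERIV h w :> E"
  shows "D = E"
proof -
  have "(\<lambda>k. k \<bullet> D) = (\<lambda>k. k \<bullet> E)"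
    using assms has_derivative_unique unfolding gderiv_def by blast
  then have "(D - E) \<bullet> D = (D - E) \<bullet> E" by metis
  then have "(D - E) \<bullet> (D - E) = 0" by (simp add: inner_diff_right)
  then show ?thesis by simp
qed

lemma grad_eqI: "GDERIV h w :> D \<Longrightarrow> grad h w = D"
  unfolding grad_def using GDERIV_unique by blast

lemma GDERIV_partial_fst:
  fixes h :: "'a::real_inner \<times> 'b::real_inner \<Rightarrow> real"
  assumes "GDERIV h (x, y) :> D"
  shows "GDERIV (\<lambda>x'. h (x', y)) x :> fst D"
proof -
  have "((\<lambda>x'. h (x', y)) has_derivative (\<lambda>k. (k, 0) \<bullet> D)) (at x)"
    by (rule has_derivative_compose[where g=h and f="\<lambda>x'. (x', y)"])
       (use assms in \<open>auto simp: gderiv_def intro!: derivative_eq_intros\<close>)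
  then show ?thesis by (simp add: gderiv_def inner_prod_def)
qed

lemma GDERIV_partial_snd:
  fixes h :: "'a::real_inner \<times> 'b::real_inner \<Rightarrow> real"
  assumes "GDERIV h (x, y) :> D"
  shows "GDERIV (\<lambda>y'. h (x, y')) y :> snd D"
proof -
  have "((\<lambda>y'. h (x, y')) has_derivative (\<lambda>k. (0, k) \<bullet> D)) (at y)"
    by (rule has_derivative_compose[where g=h and f="\<lambda>y'. (x, y')"])
       (use assms in \<open>auto simp: gderiv_def intro!: derivative_eq_intros\<close>)
  then show ?thesis by (simp add: gderiv_def inner_prod_def)
qed

lemma GDERIV_sum:
  "(\<And>i. i \<in> I \<Longrightarrow> GDERIV (h i) w :> D i) \<Longrightarrow> GDERIV (\<lambda>w. \<Sum>i\<in>I. h i w) w :> (\<Sum>i\<in>I. D i)"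
  unfolding gderiv_def inner_sum_right by (rule has_derivative_sum)

lemma GDERIV_cmult:
  "GDERIV h w :> D \<Longrightarrow> GDERIV (\<lambda>w. c * h w) w :> c *\<^sub>R D"
  unfolding gderiv_def inner_scaleR_right by (rule has_derivative_mult_right)

text \<open>Restricted to the line through \<open>w\<close> and \<open>w'\<close>, the claim is the
  tangent inequality for convex functions of one real variable.\<close>

lemma convex_on_gradient_ineq:
  fixes h :: "'a::real_inner \<Rightarrow> real"
  assumes "convex_on UNIV h" "GDERIV h w :> D"
  shows "h w + D \<bullet> (w' - w) \<le> h w'"
proof -
  let ?q = "\<lambda>t::real. h (w + t *\<^sub>R (w' - w))"
  have "convex_on UNIV ?q"
  proof (rule convex_onI)
    fix t a b :: real assume "0 < t" "t < 1"
    have "w + ((1 - t) *\<^sub>R a + t *\<^sub>R b) *\<^sub>R (w' - w)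
        = (1 - t) *\<^sub>R (w + a *\<^sub>R (w' - w)) + t *\<^sub>R (w + b *\<^sub>R (w' - w))"
      by (simp add: algebra_simps)
    then show "?q ((1 - t) *\<^sub>R a + t *\<^sub>R b) \<le> (1 - t) * ?q a + t * ?q b"
      using convex_onD[OF assms(1), of t] \<open>0 < t\<close> \<open>t < 1\<close> by simp
  qed simp
  moreover have "(?q has_real_derivative (w' - w) \<bullet> D) (at 0)"
  proof -
    have "(?q has_derivative (\<lambda>k. (k *\<^sub>R (w' - w)) \<bullet> D)) (at 0)"
      by (rule has_derivative_compose[where g=h and f="\<lambda>t. w + t *\<^sub>R (w' - w)"])
         (use assms in \<open>auto simp: gderiv_def intro!: derivative_eq_intros\<close>)
    then show ?thesis by (simp add: has_field_derivative_def mult.commute[of _ "(w' - w) \<bullet> D"])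
  qed
  ultimately have "?q 1 - ?q 0 \<ge> ((w' - w) \<bullet> D) * (1 - 0)"
    by (intro convex_on_imp_above_tangent[where A=UNIV]) auto
  then show ?thesis by (simp add: inner_commute)
qed

section \<open>Symmetry of second derivatives\<close>

text \<open>The mean value theorem in \<open>s\<close> for
  \<open>h (w + t u + s v) - h (w + s v)\<close> turns the second difference into \<open>t\<close>
  times an increment of gradients. The points compared are \<open>t u + \<xi> v\<close> and
  \<open>\<xi> v\<close>; their norms, at most \<open>t (norm u + norm v)\<close> and
  \<open>t norm v\<close>, produce the factor \<open>norm u + 2 norm v\<close>.\<close>

lemma second_difference_estimate:
  fixes h :: "'a::real_inner \<Rightarrow> real"
  assumes "d > 0" and diff: "\<And>k. norm k < d \<Longrightarrow> GDERIV h (w + k) :> G k"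
    and est: "\<And>k. norm k < d \<Longrightarrow> norm (G k - G 0 - A k) \<le> e * norm k"
    and lin: "bounded_linear A" and "0 \<le> e"
    and t: "0 < t" "t * (norm u + norm v) < d"
  shows "\<bar>(h (w + t *\<^sub>R u + t *\<^sub>R v) - h (w + t *\<^sub>R u) - h (w + t *\<^sub>R v) + h w) - t^2 * (A u \<bullet> v)\<bar>
           \<le> t^2 * (e * (norm u + 2 * norm v) * norm v)"
proof -
  let ?q = "\<lambda>s. h (w + (t *\<^sub>R u + s *\<^sub>R v)) - h (w + s *\<^sub>R v)"
  have small: "norm (t *\<^sub>R u + s *\<^sub>R v) < d \<and> norm (s *\<^sub>R v) < d
      \<and> norm (t *\<^sub>R u + s *\<^sub>R v) \<le> t * (norm u + norm v) \<and> norm (s *\<^sub>R v) \<le> t * norm v" if "0 \<le> s" "s \<le> t" for s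
  proof -
    have "norm (t *\<^sub>R u + s *\<^sub>R v) \<le> t * norm u + s * norm v"
      using norm_triangle_ineq[of "t *\<^sub>R u" "s *\<^sub>R v"] t that by simp
    moreover have "s * norm v \<le> t * norm v" using that by (simp add: mult_right_mono)
    moreover have "0 \<le> t * norm u" using t by simp
    moreover have "norm (s *\<^sub>R v) = s * norm v" using that by simp
    ultimately show ?thesis using t unfolding distrib_left by linarith
  qed
  have "\<exists>\<xi>. 0 < \<xi> \<and> \<xi> < t \<and> ?q t - ?q 0 = (t - 0) * (v \<bullet> (G (t *\<^sub>R u + \<xi> *\<^sub>R v) - G (\<xi> *\<^sub>R v)))"
  proof (rule MVT2[OF t(1)])
    fix s :: real assume s: "0 \<le> s" "s \<le> t"
    have 1: "((\<lambda>s. h (w + (t *\<^sub>R u + s *\<^sub>R v))) has_derivative (\<lambda>k. (k *\<^sub>R v) \<bullet> G (t *\<^sub>R u + s *\<^sub>R v))) (at s)"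
      by (rule has_derivative_compose[where g=h and f="\<lambda>s. w + (t *\<^sub>R u + s *\<^sub>R v)"])
         (use diff small[OF s] in \<open>auto simp: gderiv_def intro!: derivative_eq_intros\<close>)
    have 2: "((\<lambda>s. h (w + s *\<^sub>R v)) has_derivative (\<lambda>k. (k *\<^sub>R v) \<bullet> G (s *\<^sub>R v))) (at s)"
      by (rule has_derivative_compose[where g=h and f="\<lambda>s. w + s *\<^sub>R v"])
         (use diff small[OF s] in \<open>auto simp: gderiv_def intro!: derivative_eq_intros\<close>)
    show "(?q has_real_derivative v \<bullet> (G (t *\<^sub>R u + s *\<^sub>R v) - G (s *\<^sub>R v))) (at s)"
      unfolding has_field_derivative_def
      by (rule has_derivative_eq_rhs[OF has_derivative_diff[OF 1 2]])
         (auto simp: fun_eq_iff inner_diff_right algebra_simps)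
  qed
  then obtain \<xi> where \<xi>: "0 < \<xi>" "\<xi> < t"
    and eq: "?q t - ?q 0 = t * (v \<bullet> (G (t *\<^sub>R u + \<xi> *\<^sub>R v) - G (\<xi> *\<^sub>R v)))" by auto
  let ?a = "t *\<^sub>R u + \<xi> *\<^sub>R v" and ?b = "\<xi> *\<^sub>R v"
  have sm: "norm ?a < d" "norm ?b < d" "norm ?a \<le> t * (norm u + norm v)" "norm ?b \<le> t * norm v"
    using small[of \<xi>] \<xi> by auto
  have Aab: "A ?a - A ?b = t *\<^sub>R A u"
    by (simp add: linear_diff[symmetric] linear_scale[symmetric] bounded_linear.linear[OF lin])
  let ?D = "(G ?a - G 0 - A ?a) - (G ?b - G 0 - A ?b)"
  have "norm ?D \<le> e * (t * (norm u + norm v)) + e * (t * norm v)"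
    using norm_triangle_ineq4[of "G ?a - G 0 - A ?a" "G ?b - G 0 - A ?b"] est[OF sm(1)] est[OF sm(2)]
      mult_left_mono[OF sm(3) \<open>0 \<le> e\<close>] mult_left_mono[OF sm(4) \<open>0 \<le> e\<close>] by linarith
  then have D: "norm ?D \<le> t * (e * (norm u + 2 * norm v))" by (simp add: algebra_simps)
  have "G ?a - G ?b = ?D + (A ?a - A ?b)" by simp
  then have "G ?a - G ?b = ?D + t *\<^sub>R A u" using Aab by simp
  then have "v \<bullet> (G ?a - G ?b) = v \<bullet> ?D + t * (A u \<bullet> v)"
    by (metis inner_add_right inner_commute inner_scaleR_right)
  then have "(?q t - ?q 0) - t^2 * (A u \<bullet> v) = t * (v \<bullet> ?D)"
    unfolding eq by (simp add: power2_eq_square distrib_left)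
  moreover have "\<bar>v \<bullet> ?D\<bar> \<le> norm v * (t * (e * (norm u + 2 * norm v)))"
    using Cauchy_Schwarz_ineq2[of v ?D] mult_left_mono[OF D norm_ge_zero[of v]] by linarith
  ultimately have "\<bar>(?q t - ?q 0) - t^2 * (A u \<bullet> v)\<bar> \<le> t * (norm v * (t * (e * (norm u + 2 * norm v))))"
    using t(1) by (simp add: abs_mult)
  then show ?thesis by (simp add: power2_eq_square algebra_simps)
qed

text \<open>The second difference of \<open>h\<close> in directions \<open>u\<close>, \<open>v\<close> is symmetric in them.\<close>

lemma hessian_symmetric:
  fixes h :: "'a::real_inner \<Rightarrow> real"
  assumes U: "open U" "w \<in> U" and G: "\<And>w. w \<in> U \<Longrightarrow> GDERIV h w :> G w"
    and A: "(G has_derivative A) (at w)"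
  shows "A u \<bullet> v = A v \<bullet> u"
proof -
  have lin: "bounded_linear A" using A by (rule has_derivative_bounded_linear)
  have bound: "\<bar>A u \<bullet> v - A v \<bullet> u\<bar> \<le> e * ((norm u + 2 * norm v) * norm v + (norm v + 2 * norm u) * norm u)"
    if "e > 0" for e :: real
  proof -
    obtain d1 where d1: "d1 > 0" "ball w d1 \<subseteq> U" using U open_contains_ball by blast
    obtain d2 where d2: "d2 > 0"
      "\<And>w'. norm (w' - w) < d2 \<Longrightarrow> norm (G w' - G w - A (w' - w)) \<le> e * norm (w' - w)"
      using A \<open>e > 0\<close> unfolding has_derivative_at_alt by blast
    define d where "d = min d1 d2"
    have d: "d > 0" using d1 d2 by (simp add: d_def)
    have in_U: "w + k \<in> U" if "norm k < d" for k
      using d1(2) that by (auto simp: d_def dist_norm subset_iff)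
    have diff: "GDERIV h (w + k) :> G (w + k)" if "norm k < d" for k using G in_U that by blast
    have est: "norm (G (w + k) - G (w + 0) - A k) \<le> e * norm k" if "norm k < d" for k
      using d2(2)[of "w + k"] that by (simp add: d_def)
    \<comment> \<open>Any \<open>t\<close> with \<open>t * (norm u + norm v) < d\<close> would do;
      the summand \<open>1\<close> covers \<open>u = v = 0\<close>.\<close>
    define t where "t = d / (2 * (norm u + norm v + 1))"
    have n: "0 < norm u + norm v + 1" using norm_ge_zero[of u] norm_ge_zero[of v] by linarith
    have t: "0 < t" using d n by (simp add: t_def)
    have "t * (norm u + norm v + 1) = d / 2" using n by (simp add: t_def field_simps)
    then have tuv: "t * (norm u + norm v) < d" using d t by (simp add: distrib_left)
    have tvu: "t * (norm v + norm u) < d" using tuv by (simp add: add.commute)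
    let ?S = "h (w + t *\<^sub>R u + t *\<^sub>R v) - h (w + t *\<^sub>R u) - h (w + t *\<^sub>R v) + h w"
    have "\<bar>?S - t^2 * (A u \<bullet> v)\<bar> \<le> t^2 * (e * (norm u + 2 * norm v) * norm v)"
      using second_difference_estimate[where G="\<lambda>k. G (w + k)", OF d diff est lin _ t tuv] \<open>e > 0\<close> by simp
    moreover have "\<bar>?S - t^2 * (A v \<bullet> u)\<bar> \<le> t^2 * (e * (norm v + 2 * norm u) * norm u)"
      using second_difference_estimate[where G="\<lambda>k. G (w + k)", OF d diff est lin _ t tvu] \<open>e > 0\<close>
      by (simp add: algebra_simps)
    ultimately have "\<bar>t^2 * (A u \<bullet> v) - t^2 * (A v \<bullet> u)\<bar>
        \<le> t^2 * (e * (norm u + 2 * norm v) * norm v) + t^2 * (e * (norm v + 2 * norm u) * norm u)"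
      by linarith
    then have "t^2 * \<bar>A u \<bullet> v - A v \<bullet> u\<bar>
        \<le> t^2 * (e * ((norm u + 2 * norm v) * norm v + (norm v + 2 * norm u) * norm u))"
      unfolding right_diff_distrib[symmetric] abs_mult by (simp add: algebra_simps)
    then show ?thesis using t by simp
  qed
  \<comment> \<open>The factor \<open>t^2\<close> has cancelled, so the bound is \<open>e\<close>
    times a fixed constant for every \<open>e > 0\<close>.\<close>
  have "\<bar>A u \<bullet> v - A v \<bullet> u\<bar> \<le> 0"
  proof (rule field_le_epsilon)
    fix e :: real assume "e > 0"
    define c where "c = (norm u + 2 * norm v) * norm v + (norm v + 2 * norm u) * norm u"
    have "c \<ge> 0" by (simp add: c_def)
    have "e / (c + 1) * c \<le> e / (c + 1) * (c + 1)"
      using \<open>e > 0\<close> \<open>c \<ge> 0\<close> by (intro mult_left_mono) auto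
    also have "\<dots> = e" using \<open>c \<ge> 0\<close> by (simp add: add_nonneg_eq_0_iff)
    finally have "e / (c + 1) * c \<le> e" .
    moreover have "0 < e / (c + 1)" using \<open>e > 0\<close> \<open>c \<ge> 0\<close> by (intro divide_pos_pos) auto
    ultimately show "\<bar>A u \<bullet> v - A v \<bullet> u\<bar> \<le> 0 + e"
      using bound[of "e / (c + 1)"] unfolding c_def by linarith
  qed
  then show ?thesis by simp
qed

section \<open>Uniform bounds for smooth functions on convex sets\<close>

text \<open>One constant for values, gradients and remainders, so that later estimates carry a
  single number. Only pairs within \<open>K\<close> are compared, and the quadratic remainder has
  \<open>C\<close> instead of the sharp \<open>C / 2\<close>.\<close>

definition smooth_bound :: "'a::euclidean_space set \<Rightarrow> ('a \<Rightarrow> real) \<Rightarrow> real \<Rightarrow> bool" where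
  "smooth_bound K h C \<longleftrightarrow> (\<forall>w\<in>K. \<bar>h w\<bar> \<le> C \<and> norm (grad h w) \<le> C \<and>
     (\<forall>w'\<in>K. \<bar>h w' - h w\<bar> \<le> C * norm (w' - w) \<and>
        norm (grad h w' - grad h w) \<le> C * norm (w' - w) \<and>
        \<bar>h w' - h w - grad h w \<bullet> (w' - w)\<bar> \<le> C * (norm (w' - w))\<^sup>2))"

lemma smooth_bound_mono:
  assumes "smooth_bound K h C" "C \<le> C'"
  shows "smooth_bound K h C'"
proof -
  have *: "a \<le> C' * b" if "a \<le> C * b" "0 \<le> b" for a b :: real
    using that assms(2) by (meson mult_right_mono order_trans)
  show ?thesis
    unfolding smooth_bound_def
  proof (intro ballI conjI)
    fix w assume w: "w \<in> K"
    show "\<bar>h w\<bar> \<le> C'" "norm (grad h w) \<le> C'"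
      using assms w unfolding smooth_bound_def by force+
    fix w' assume w': "w' \<in> K"
    show "\<bar>h w' - h w\<bar> \<le> C' * norm (w' - w)" "norm (grad h w' - grad h w) \<le> C' * norm (w' - w)"
      "\<bar>h w' - h w - grad h w \<bullet> (w' - w)\<bar> \<le> C' * (norm (w' - w))\<^sup>2"
      by (rule *; use assms(1) w w' in \<open>simp add: smooth_bound_def\<close>)+
  qed
qed

text \<open>Convexity keeps segments inside \<open>K\<close>. The mean value inequality with
  \<open>norm (grad h) \<le> C\<close> gives the Lipschitz bound for \<open>h\<close>; applied to
  \<open>h\<close> minus its linearization at \<open>w\<close> it gives the quadratic one.\<close>

lemma smooth_bound_of_lipschitz_grad:
  fixes h :: "'a::euclidean_space \<Rightarrow> real"
  assumes K: "convex K" and GD: "\<And>w. w \<in> K \<Longrightarrow> GDERIV h w :> grad h w"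
    and b: "\<And>w. w \<in> K \<Longrightarrow> \<bar>h w\<bar> \<le> C" "\<And>w. w \<in> K \<Longrightarrow> norm (grad h w) \<le> C"
    and lip: "\<And>w w'. w \<in> K \<Longrightarrow> w' \<in> K \<Longrightarrow> norm (grad h w' - grad h w) \<le> C * norm (w' - w)"
  shows "smooth_bound K h C"
proof -
  have on: "onorm (\<lambda>k. k \<bullet> D) \<le> c" if "norm D \<le> c" for D :: 'a and c
  proof (rule onorm_le)
    fix k :: 'a
    have "norm (k \<bullet> D) \<le> norm k * norm D" using Cauchy_Schwarz_ineq2 by simp
    also have "\<dots> \<le> norm k * c" using that by (simp add: mult_left_mono)
    finally show "norm (k \<bullet> D) \<le> c * norm k" by (simp add: mult.commute)
  qed
  have L: "\<bar>h w' - h w\<bar> \<le> C * norm (w' - w)" if "w \<in> K" "w' \<in> K" for w w'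
    using differentiable_bound[OF K, where f=h and f'="\<lambda>w k. k \<bullet> grad h w" and B=C and x=w' and y=w] that on b(2) GD
    by (auto simp: gderiv_def has_derivative_at_withinI)
  have Q: "\<bar>h w' - h w - grad h w \<bullet> (w' - w)\<bar> \<le> C * (norm (w' - w))\<^sup>2" if w: "w \<in> K" "w' \<in> K" for w w'
  proof -
    have C0: "0 \<le> C" using b(2)[OF w(1)] norm_ge_zero order_trans by blast
    have seg: "closed_segment w w' \<subseteq> K" using K w by (simp add: closed_segment_subset)
    have "norm (h w' - h w - (w' - w) \<bullet> grad h w) \<le> norm (w' - w) * (C * norm (w' - w))"
    proof (rule differentiable_bound_linearization[where S="closed_segment w w'" and f'="\<lambda>w k. k \<bullet> grad h w" and ?x0.0=w])
      show "w + t *\<^sub>R (w' - w) \<in> closed_segment w w'" if "t \<in> {0..1}" for t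
        using that unfolding closed_segment_def by (auto intro!: exI[of _ t] simp: algebra_simps)
      show "(h has_derivative (\<lambda>k. k \<bullet> grad h x)) (at x within closed_segment w w')" if "x \<in> closed_segment w w'" for x
        using GD[of x] seg that by (auto simp: gderiv_def intro: has_derivative_at_withinI)
      show "onorm ((\<lambda>k. k \<bullet> grad h x) - (\<lambda>k. k \<bullet> grad h w)) \<le> C * norm (w' - w)" if "x \<in> closed_segment w w'" for x
      proof -
        have "norm (grad h x - grad h w) \<le> C * norm (x - w)" using lip w seg that by auto
        also have "\<dots> \<le> C * norm (w' - w)"
          using segment_bound(1)[OF that] C0 by (simp add: mult_left_mono norm_minus_commute)
        finally have "onorm (\<lambda>k. k \<bullet> (grad h x - grad h w)) \<le> C * norm (w' - w)" by (rule on)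
        then show ?thesis by (simp add: fun_diff_def inner_diff_right)
      qed
    qed simp
    then show ?thesis by (simp add: inner_commute power2_eq_square algebra_simps)
  qed
  show ?thesis unfolding smooth_bound_def using b lip L Q by blast
qed

text \<open>By compactness \<open>h\<close>, its gradient and its Hessian are bounded on
  \<open>K\<close>, and a Hessian bound is a Lipschitz constant for the gradient because
  \<open>K\<close> is convex.\<close>

lemma smooth_bound_exists:
  fixes h :: "'a::euclidean_space \<Rightarrow> real"
  assumes U: "twice_cont_diff_on U h" "K \<subseteq> U" and K: "compact K" "convex K"
  shows "\<exists>C>0. smooth_bound K h C"
proof -
  obtain H where H: "\<And>w. w \<in> U \<Longrightarrow> (grad h has_derivative blinfun_apply (H w)) (at w)"
      "continuous_on U H"
    using U(1) unfolding twice_cont_diff_on_def by auto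
  have GD: "\<And>w. w \<in> U \<Longrightarrow> GDERIV h w :> grad h w" and cg: "continuous_on U (grad h)"
    using U(1) unfolding twice_cont_diff_on_def cont_diff_on_def by auto
  have ch: "continuous_on U h"
  proof (rule has_derivative_continuous_on)
    show "(h has_derivative (\<lambda>k. k \<bullet> grad h w)) (at w within U)" if "w \<in> U" for w
      using GD[OF that] unfolding gderiv_def by (rule has_derivative_at_withinI)
  qed
  have bd: "\<exists>c. \<forall>w\<in>K. norm (q w) \<le> c" if "continuous_on U q" for q :: "'a \<Rightarrow> 'c::real_normed_vector"
  proof -
    have "compact (q ` K)" using that U(2) K(1) compact_continuous_image continuous_on_subset by blast
    then show ?thesis using compact_imp_bounded bounded_iff by (metis (no_types, lifting) imageI)
  qed
  obtain c1 c2 c3 where c: "\<And>w. w \<in> K \<Longrightarrow> norm (h w) \<le> c1" "\<And>w. w \<in> K \<Longrightarrow> norm (grad h w) \<le> c2"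
      "\<And>w. w \<in> K \<Longrightarrow> norm (H w) \<le> c3"
    using bd[OF ch] bd[OF cg] bd[OF H(2)] by blast
  define C where "C = max 1 (max c1 (max c2 c3))"
  have "norm (grad h w' - grad h w) \<le> C * norm (w' - w)" if "w \<in> K" "w' \<in> K" for w w'
  proof (rule differentiable_bound[OF K(2), where f'="\<lambda>w. blinfun_apply (H w)"])
    show "onorm (blinfun_apply (H x)) \<le> C" if "x \<in> K" for x
      using c(3)[OF that] by (simp add: C_def norm_blinfun.rep_eq)
  qed (use H that U(2) in \<open>auto intro: has_derivative_at_withinI\<close>)
  moreover have "\<bar>h w\<bar> \<le> C" "norm (grad h w) \<le> C" if "w \<in> K" for w
    using c(1,2)[OF that] by (auto simp: C_def)
  moreover have "0 < C" by (simp add: C_def)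
  ultimately show ?thesis
    using smooth_bound_of_lipschitz_grad[OF K(2), of h C] GD U(2) by blast
qed

text \<open>Near \<open>w\<close> the map \<open>grad h - H w\<close> has a derivative of norm at
  most \<open>e\<close>, hence Lipschitz constant \<open>e\<close> on a ball. Neither
  \<open>a\<close> nor \<open>b\<close> has to be \<open>w\<close>: in the application both are
  moving iterates.\<close>

lemma grad_strict_differentiable:
  fixes h :: "'a::euclidean_space \<Rightarrow> real"
  assumes U: "open U" "w \<in> U" and H: "\<And>w. w \<in> U \<Longrightarrow> (grad h has_derivative blinfun_apply (H w)) (at w)"
    and cH: "continuous_on U H" and "e > 0"
  shows "\<exists>d>0. \<forall>a\<in>ball w d. \<forall>b\<in>ball w d. norm (grad h b - grad h a - H w (b - a)) \<le> e * norm (b - a)"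
proof -
  have "continuous (at w) H" using cH U continuous_on_eq_continuous_at by blast
  then obtain d1 where d1: "d1 > 0" "\<And>v. dist v w < d1 \<Longrightarrow> dist (H v) (H w) < e"
    using \<open>e > 0\<close> unfolding continuous_at_eps_delta by blast
  obtain d2 where d2: "d2 > 0" "ball w d2 \<subseteq> U" using U open_contains_ball by blast
  define d where "d = min d1 d2"
  have d: "d > 0" using d1 d2 by (simp add: d_def)
  have "norm (grad h b - grad h a - H w (b - a)) \<le> norm (b - a) * e" if "a \<in> ball w d" "b \<in> ball w d" for a b
  proof (rule differentiable_bound_linearization[where S="ball w d" and f'="\<lambda>v. blinfun_apply (H v)"])
    show "a + t *\<^sub>R (b - a) \<in> ball w d" if "t \<in> {0..1}" for t
    proof -
      have "a + t *\<^sub>R (b - a) = (1 - t) *\<^sub>R a + t *\<^sub>R b" by (simp add: algebra_simps)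
      then show ?thesis using convexD[OF convex_ball, of a w d b "1 - t" t] \<open>a \<in> _\<close> \<open>b \<in> _\<close> that by simp
    qed
    show "(grad h has_derivative H x) (at x within ball w d)" if "x \<in> ball w d" for x
      using H[of x] d2 that by (auto simp: d_def subset_iff intro: has_derivative_at_withinI)
    show "onorm (blinfun_apply (H x) - blinfun_apply (H w)) \<le> e" if "x \<in> ball w d" for x
    proof -
      have "norm (H x - H w) \<le> e" using d1(2)[of x] that by (simp add: d_def dist_norm norm_minus_commute)
      moreover have "blinfun_apply (H x) - blinfun_apply (H w) = blinfun_apply (H x - H w)"
        by (auto simp: blinfun.diff_left)
      ultimately show ?thesis by (simp add: norm_blinfun.rep_eq)
    qed
    show "w \<in> ball w d" using d by simp
  qed
  then show ?thesis using d by (auto simp: mult.commute)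
qed

section \<open>Normal cones, multipliers and projections\<close>

text \<open>A positive inner product with a feasible direction violates the normal inequality on
  short steps, with half the slope along \<open>d\<close> as tolerance.\<close>

lemma regular_normal_direction:
  fixes D :: "'a::euclidean_space set"
  assumes v: "v \<in> regular_normal_cone D w" and "\<delta> > 0"
    and dir: "\<And>t. 0 < t \<Longrightarrow> t < \<delta> \<Longrightarrow> w + t *\<^sub>R d \<in> D"
  shows "v \<bullet> d \<le> 0"
proof (rule ccontr)
  assume "\<not> v \<bullet> d \<le> 0"
  then have vd: "v \<bullet> d > 0" by simp
  then have "d \<noteq> 0" by auto
  define e where "e = v \<bullet> d / (2 * norm d)"
  have "e > 0" using vd \<open>d \<noteq> 0\<close> by (simp add: e_def)
  then obtain r where r: "r > 0"
    "\<And>u. u \<in> D \<Longrightarrow> u \<noteq> w \<Longrightarrow> dist u w < r \<Longrightarrow> v \<bullet> (u - w) \<le> e * norm (u - w)"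
    using v unfolding regular_normal_cone_def eventually_at by blast
  define t where "t = min \<delta> (r / norm d) / 2"
  have t: "0 < t" "t < \<delta>" "t * norm d < r"
    using \<open>\<delta> > 0\<close> r(1) \<open>d \<noteq> 0\<close> by (auto simp: t_def min_def field_simps)
  have "v \<bullet> (t *\<^sub>R d) \<le> e * norm (t *\<^sub>R d)"
    using r(2)[of "w + t *\<^sub>R d"] dir[OF t(1,2)] t \<open>d \<noteq> 0\<close> by (simp add: dist_norm)
  then have "v \<bullet> d \<le> e * norm d" using t(1) by simp
  then show False using vd \<open>d \<noteq> 0\<close> by (simp add: e_def)
qed

text \<open>Every point of a convex set is reached along a feasible direction, so the local
  inequality becomes global and the cone is that of convex analysis.\<close>

lemma regular_normal_cone_convex_iff:
  fixes D :: "'a::euclidean_space set"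
  assumes "convex D" "w \<in> D"
  shows "v \<in> regular_normal_cone D w \<longleftrightarrow> (\<forall>u\<in>D. v \<bullet> (u - w) \<le> 0)"
proof
  assume v: "v \<in> regular_normal_cone D w"
  show "\<forall>u\<in>D. v \<bullet> (u - w) \<le> 0"
  proof
    fix u assume "u \<in> D"
    have "w + t *\<^sub>R (u - w) \<in> D" if "0 < t" "t < 1" for t
      using convexD[OF assms(1) assms(2) \<open>u \<in> D\<close>, of "1 - t" t] that by (simp add: algebra_simps)
    then show "v \<bullet> (u - w) \<le> 0" using regular_normal_direction[OF v, of 1] by simp
  qed
next
  assume *: "\<forall>u\<in>D. v \<bullet> (u - w) \<le> 0"
  have "v \<bullet> (u - w) \<le> e * norm (u - w)" if "e > 0" "u \<in> D" for e u
    using * that by (meson mult_nonneg_nonneg norm_ge_zero order_less_imp_le order_trans)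
  then show "v \<in> regular_normal_cone D w"
    using assms(2) unfolding regular_normal_cone_def
    by (auto simp: eventually_at_filter intro!: always_eventually)
qed

lemma regular_normal_cone_scale:
  assumes "v \<in> regular_normal_cone D w" "0 < c"
  shows "c *\<^sub>R v \<in> regular_normal_cone D w"
  unfolding regular_normal_cone_def
proof (intro CollectI conjI allI impI)
  show "w \<in> D" using assms(1) by (simp add: regular_normal_cone_def)
  fix e :: real assume "e > 0"
  then have "e / c > 0" using \<open>0 < c\<close> by simp
  then have "\<forall>\<^sub>F w' in at w within D. v \<bullet> (w' - w) \<le> e / c * norm (w' - w)"
    using assms(1) unfolding regular_normal_cone_def by blast
  then show "\<forall>\<^sub>F w' in at w within D. c *\<^sub>R v \<bullet> (w' - w) \<le> e * norm (w' - w)"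
    by (rule eventually_mono) (use \<open>0 < c\<close> in \<open>simp add: field_simps\<close>)
qed

text \<open>Expanding the squared distances gives
  \<open>2 (p - w) \<bullet> (u - w) \<le> (norm (u - w))\<^sup>2\<close>, which is of smaller order
  than \<open>norm (u - w)\<close>. The argument covers projections onto the nonconvex truncated
  complementarity set as well as onto \<open>\<Omega>\<close>.\<close>

lemma nearest_point_regular_normal:
  fixes D :: "'a::euclidean_space set"
  assumes "w \<in> D" and near: "\<And>u. u \<in> D \<Longrightarrow> norm (p - w) \<le> norm (p - u)"
  shows "p - w \<in> regular_normal_cone D w"
  unfolding regular_normal_cone_def
proof (intro CollectI conjI allI impI)
  fix e :: real assume "e > 0"
  show "\<forall>\<^sub>F u in at w within D. (p - w) \<bullet> (u - w) \<le> e * norm (u - w)"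
    unfolding eventually_at
  proof (intro exI conjI ballI impI)
    show "0 < 2 * e" using \<open>e > 0\<close> by simp
    fix u assume u: "u \<in> D" "u \<noteq> w \<and> dist u w < 2 * e"
    have "(norm (p - u))\<^sup>2 = (norm (p - w))\<^sup>2 - 2 * ((p - w) \<bullet> (u - w)) + (norm (u - w))\<^sup>2"
      unfolding power2_norm_eq_inner by (simp add: algebra_simps inner_commute)
    moreover have "(norm (p - w))\<^sup>2 \<le> (norm (p - u))\<^sup>2" using near[OF u(1)] by simp
    ultimately have "2 * ((p - w) \<bullet> (u - w)) \<le> norm (u - w) * norm (u - w)"
      by (simp add: power2_eq_square)
    also have "\<dots> \<le> 2 * e * norm (u - w)"
      using u(2) by (intro mult_right_mono) (auto simp: dist_norm)
    finally show "(p - w) \<bullet> (u - w) \<le> e * norm (u - w)" by simp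
  qed
qed (fact assms(1))

lemma regular_normal_cone_local:
  assumes "open V" "w \<in> V" "D \<inter> V = E \<inter> V"
  shows "regular_normal_cone D w = regular_normal_cone E w"
proof -
  have "at w within D = at w within E"
    by (rule at_within_nhd[OF assms(2,1)]) (use assms(3) in blast)
  moreover have "w \<in> D \<longleftrightarrow> w \<in> E" using assms by blast
  ultimately show ?thesis by (simp add: regular_normal_cone_def)
qed

lemma regular_subset_limiting: "regular_normal_cone D w \<subseteq> limiting_normal_cone D w"
proof
  fix v assume "v \<in> regular_normal_cone D w"
  then show "v \<in> limiting_normal_cone D w"
    unfolding limiting_normal_cone_def
    by (intro CollectI exI[of _ "\<lambda>_. w"] exI[of _ "\<lambda>_. v"]) simp
qed

section \<open>Multipliers under the Mangasarian-Fromovitz condition\<close>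

lemma in_convex_hull_image:
  assumes "finite I" "x \<in> convex hull (a ` I)"
  shows "\<exists>u. (\<forall>i\<in>I. 0 \<le> u i) \<and> sum u I = 1 \<and> (\<Sum>i\<in>I. u i *\<^sub>R a i) = x"
proof -
  obtain u where u: "\<And>y. y \<in> a ` I \<Longrightarrow> 0 \<le> u y" "sum u (a ` I) = 1" "(\<Sum>y\<in>a ` I. u y *\<^sub>R y) = x"
    using assms(2) unfolding convex_hull_finite[OF finite_imageI[OF assms(1), of a]] by blast
  \<comment> \<open>\<open>a\<close> need not be injective on \<open>I\<close>, so the weight of
    each image point is put on one chosen index and all other indices get weight
    \<open>0\<close>.\<close>
  define R where "R = inv_into I a ` (a ` I)"
  have R: "R \<subseteq> I" "inj_on a R" "a ` R = a ` I"
    unfolding R_def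
    by (auto intro!: inv_into_into f_inv_into_f inj_on_inverseI[where g="inv_into I a"]
             simp: f_inv_into_f image_image cong: image_cong)
  have sumR: "(\<Sum>i\<in>I. if i \<in> R then q i else 0) = sum q R" for q :: "_ \<Rightarrow> 'c::comm_monoid_add"
    using assms(1) R(1) by (simp add: sum.inter_restrict[symmetric] Int_absorb1)
  define \<mu> where "\<mu> i = (if i \<in> R then u (a i) else 0)" for i
  have "sum \<mu> I = sum u (a ` R)" unfolding \<mu>_def sumR using R(2) by (simp add: sum.reindex)
  moreover have "(\<Sum>i\<in>I. \<mu> i *\<^sub>R a i) = (\<Sum>i\<in>I. if i \<in> R then u (a i) *\<^sub>R a i else 0)"
    by (intro sum.cong) (auto simp: \<mu>_def)
  then have "(\<Sum>i\<in>I. \<mu> i *\<^sub>R a i) = (\<Sum>y\<in>a ` R. u y *\<^sub>R y)"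
    unfolding sumR using R(2) by (simp add: sum.reindex)
  moreover have "\<forall>i\<in>I. 0 \<le> \<mu> i" using u(1) by (simp add: \<mu>_def)
  ultimately show ?thesis using u R(3) by (intro exI[of _ \<mu>]) simp
qed

text \<open>
  If \<open>0\<close> is in the convex hull of the active gradients and \<open>-v\<close>, then \<open>MFCQ\<close> makes the weight of
  \<open>-v\<close> positive, which yields the multipliers. Otherwise a separating direction is strictly feasible
  and has positive inner product with \<open>v\<close>, so \<open>v\<close> is not normal.
\<close>

lemma normal_cone_multipliers:
  fixes c :: "'i::finite \<Rightarrow> 'a::euclidean_space \<Rightarrow> real"
  assumes feas: "\<And>i. c i w \<le> 0" and GD: "\<And>i. GDERIV (c i) w :> grad (c i) w"
    and mfcq: "MFCQ_ineq c w"
    and v: "v \<in> regular_normal_cone {w. \<forall>i. c i w \<le> 0} w"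
  shows "\<exists>\<mu>. (\<forall>i. 0 \<le> \<mu> i) \<and> (\<forall>i. \<mu> i * c i w = 0) \<and> v = (\<Sum>i\<in>UNIV. \<mu> i *\<^sub>R grad (c i) w)"
proof -
  define I where "I = {i. c i w = 0}"
  \<comment> \<open>The index \<open>None\<close> stands for \<open>-v\<close> and
    \<open>Some i\<close> for an active gradient, so that a convex combination records the weight of
    \<open>-v\<close> separately.\<close>
  define b where "b = case_option (- v) (\<lambda>i. grad (c i) w)"
  define J where "J = insert None (Some ` I)"
  have J: "finite J" by (simp add: J_def)
  have sumJ: "sum q J = q None + (\<Sum>i\<in>I. q (Some i))" for q :: "_ \<Rightarrow> 'c::comm_monoid_add"
    unfolding J_def by (subst sum.insert) (auto simp: sum.reindex)
  have mfcq': "\<forall>i\<in>I. \<mu> i = 0" if "\<And>i. 0 \<le> \<mu> i" "(\<Sum>i\<in>I. \<mu> i *\<^sub>R grad (c i) w) = 0" for \<mu>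
    using mfcq[unfolded MFCQ_def, THEN spec, THEN spec, of \<mu> "\<lambda>_. 0"] that by (simp add: I_def)
  \<comment> \<open>\<open>MFCQ\<close> asks for nonnegativity at every index; extension by zero
    admits multipliers that are nonnegative only on the active set.\<close>
  have mf: "\<mu> i = 0" if "\<And>i. i \<in> I \<Longrightarrow> 0 \<le> \<mu> i" "(\<Sum>i\<in>I. \<mu> i *\<^sub>R grad (c i) w) = 0" "i \<in> I" for \<mu> i
  proof -
    have "(\<Sum>i\<in>I. (if i \<in> I then \<mu> i else 0) *\<^sub>R grad (c i) w) = (\<Sum>i\<in>I. \<mu> i *\<^sub>R grad (c i) w)"
      by (rule sum.cong) auto
    also note that(2)
    finally have "\<forall>i\<in>I. (if i \<in> I then \<mu> i else 0) = 0"
      by (intro mfcq') (use that(1) in auto)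
    then show ?thesis using that(3) by simp
  qed
  have "0 \<in> convex hull (b ` J)"
  proof (rule ccontr)
    assume not: "0 \<notin> convex hull (b ` J)"
    have "closed (convex hull (b ` J))"
      using J by (simp add: compact_imp_closed finite_imp_compact_convex_hull)
    then obtain a \<beta> where a: "0 < \<beta>" "\<And>x. x \<in> convex hull (b ` J) \<Longrightarrow> \<beta> < a \<bullet> x"
      using separating_hyperplane_closed_0[OF convex_convex_hull _ not] by blast
    have aj: "a \<bullet> b j > 0" if "j \<in> J" for j
      using a(1) a(2)[of "b j"] that by (meson hull_inc imageI less_trans)
    define d where "d = - a"
    have vd: "v \<bullet> d > 0" using aj[of None] by (simp add: J_def b_def d_def inner_commute)
    have ad: "grad (c i) w \<bullet> d < 0" if "i \<in> I" for i
      using aj[of "Some i"] that by (simp add: J_def b_def d_def inner_commute)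
    \<comment> \<open>Along \<open>d\<close> the active constraints decrease strictly to first order
      and the inactive ones stay negative by continuity; with finitely many constraints the
      admissible step length is uniform.\<close>
    have "\<forall>i\<in>UNIV. \<forall>\<^sub>F t in at_right 0. c i (w + t *\<^sub>R d) \<le> 0"
    proof
      fix i
      have der: "((\<lambda>t. c i (w + t *\<^sub>R d)) has_real_derivative grad (c i) w \<bullet> d) (at 0)"
      proof -
        have "((\<lambda>t. c i (w + t *\<^sub>R d)) has_derivative (\<lambda>k. (k *\<^sub>R d) \<bullet> grad (c i) w)) (at 0)"
          by (rule has_derivative_compose[where g="c i" and f="\<lambda>t. w + t *\<^sub>R d"])
             (use GD[of i] in \<open>auto simp: gderiv_def intro!: derivative_eq_intros\<close>)
        then show ?thesis
          unfolding has_field_derivative_def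
          by (rule has_derivative_eq_rhs) (auto simp: fun_eq_iff inner_commute)
      qed
      show "\<forall>\<^sub>F t in at_right 0. c i (w + t *\<^sub>R d) \<le> 0"
      proof (cases "i \<in> I")
        case True
        then obtain r where "r > 0" "\<And>t. 0 < t \<Longrightarrow> t < r \<Longrightarrow> c i (w + 0 *\<^sub>R d) > c i (w + (0 + t) *\<^sub>R d)"
          using DERIV_neg_dec_right[OF der ad] by auto
        then show ?thesis
          using True unfolding eventually_at_right_field I_def by (intro exI[of _ r]) force
      next
        case False
        have "((\<lambda>t. c i (w + t *\<^sub>R d)) \<longlongrightarrow> c i (w + 0 *\<^sub>R d)) (at_right 0)"
          using DERIV_isCont[OF der] unfolding isCont_def by (rule filterlim_mono) (simp_all add: at_le)
        moreover have "c i (w + 0 *\<^sub>R d) < 0" using False feas[of i] by (simp add: I_def)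
        ultimately have "\<forall>\<^sub>F t in at_right 0. c i (w + t *\<^sub>R d) < 0" by (rule order_tendstoD)
        then show ?thesis by (rule eventually_mono) simp
      qed
    qed
    then have "\<forall>\<^sub>F t in at_right 0. \<forall>i\<in>UNIV. c i (w + t *\<^sub>R d) \<le> 0"
      by (intro eventually_ball_finite) auto
    then obtain r where "r > 0" "\<And>t. 0 < t \<Longrightarrow> t < r \<Longrightarrow> w + t *\<^sub>R d \<in> {w. \<forall>i. c i w \<le> 0}"
      unfolding eventually_at_right_field by auto
    then show False using regular_normal_direction[OF v] vd by fastforce
  qed
  then obtain u where u: "\<And>j. j \<in> J \<Longrightarrow> 0 \<le> u j" "sum u J = 1" "(\<Sum>j\<in>J. u j *\<^sub>R b j) = 0"
    using in_convex_hull_image[OF J, of 0 b] by auto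
  have u0: "u None \<ge> 0" "\<And>i. i \<in> I \<Longrightarrow> 0 \<le> u (Some i)" using u(1) by (auto simp: J_def)
  have eq: "(\<Sum>i\<in>I. u (Some i) *\<^sub>R grad (c i) w) = u None *\<^sub>R v"
    using u(3) unfolding sumJ by (simp add: b_def)
  have "u None \<noteq> 0"
  proof
    assume "u None = 0"
    then have "u (Some i) = 0" if "i \<in> I" for i
      using mf[of "\<lambda>i. u (Some i)"] u0 eq that by simp
    then show False using u(2) \<open>u None = 0\<close> unfolding sumJ by simp
  qed
  then have pos: "u None > 0" using u0 by simp
  define \<mu> where "\<mu> i = (if i \<in> I then u (Some i) / u None else 0)" for i
  have "(\<Sum>i\<in>UNIV. \<mu> i *\<^sub>R grad (c i) w) = (\<Sum>i\<in>I. (u (Some i) / u None) *\<^sub>R grad (c i) w)"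
    by (rule sum.mono_neutral_cong_right) (auto simp: \<mu>_def)
  also have "\<dots> = (1 / u None) *\<^sub>R (\<Sum>i\<in>I. u (Some i) *\<^sub>R grad (c i) w)"
    by (simp add: scaleR_sum_right)
  finally have "v = (\<Sum>i\<in>UNIV. \<mu> i *\<^sub>R grad (c i) w)" using eq pos by simp
  moreover have "\<forall>i. 0 \<le> \<mu> i" using u0 pos by (simp add: \<mu>_def)
  moreover have "\<forall>i. \<mu> i * c i w = 0" by (simp add: \<mu>_def I_def)
  ultimately show ?thesis by blast
qed

section \<open>Projection and normal vectors of the complementarity set\<close>

lemma clip_nearest:
  assumes "0 \<le> a" "a \<le> M"
  shows "(t - clip M t)\<^sup>2 \<le> (t - a)\<^sup>2"
proof -
  have "\<bar>t - clip M t\<bar> \<le> \<bar>t - a\<bar>" using assms by (auto simp: clip_def)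
  then show ?thesis using abs_le_square_iff by blast
qed

lemma clip_bounds: "0 \<le> M \<Longrightarrow> 0 \<le> clip M t \<and> clip M t \<le> M"
  by (auto simp: clip_def)

lemma norm_vec_sq: "(norm (x :: real^'k))\<^sup>2 = (\<Sum>i\<in>UNIV. (x $ i)\<^sup>2)"
  unfolding power2_norm_eq_inner inner_vec_def by (simp add: power2_eq_square)

lemma norm_pair_sq: "(norm p)\<^sup>2 = (norm (fst p))\<^sup>2 + (norm (snd p))\<^sup>2"
  by (simp add: norm_prod_def)

lemma proj_compl_in: "0 \<le> M \<Longrightarrow> proj_compl M v \<in> compl_trunc M"
  using clip_bounds[of M]
  by (auto simp: proj_compl_def compl_trunc_def compl_set_def Let_def less_eq_vec_def split: prod.split)

text \<open>Squared distance and constraints split over the indices. In each index the admissible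
  pairs form two segments on the axes, clipping is nearest on each, and the definition keeps the
  better of the two.\<close>

lemma proj_compl_nearest:
  assumes "u \<in> compl_trunc M"
  shows "norm (v - proj_compl M v) \<le> norm (v - u)"
proof -
  obtain z s a b where v: "v = (z, s)" and u: "u = (a, b)" by (meson surj_pair)
  have ab: "0 \<le> a $ i" "a $ i \<le> M" "0 \<le> b $ i" "b $ i \<le> M" "a $ i * b $ i = 0" for i
    using assms unfolding u by (simp_all add: compl_trunc_def compl_set_def less_eq_vec_def)
  let ?p = "proj_compl M (z, s)"
  have comp: "(z $ i - fst ?p $ i)\<^sup>2 + (s $ i - snd ?p $ i)\<^sup>2 \<le> (z $ i - a $ i)\<^sup>2 + (s $ i - b $ i)\<^sup>2" for i
  proof -
    have "(z $ i - clip M (z $ i))\<^sup>2 \<le> (z $ i - a $ i)\<^sup>2" "(s $ i - clip M (s $ i))\<^sup>2 \<le> (s $ i - b $ i)\<^sup>2"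
      using clip_nearest ab by blast+
    moreover have "a $ i = 0 \<or> b $ i = 0" using ab(5)[of i] by simp
    ultimately show ?thesis by (auto simp: proj_compl_def Let_def)
  qed
  have sq: "(norm (v - q))\<^sup>2 = (\<Sum>i\<in>UNIV. (z $ i - fst q $ i)\<^sup>2 + (s $ i - snd q $ i)\<^sup>2)" for q
    by (simp add: v norm_pair_sq norm_vec_sq sum.distrib)
  have "(norm (v - proj_compl M v))\<^sup>2 \<le> (norm (v - u))\<^sup>2"
    unfolding sq unfolding v u by (rule sum_mono) (use comp in simp)
  then show ?thesis by simp
qed

text \<open>Where no entry attains the bound \<open>M\<close>, both sets coincide in a
  neighbourhood, so the truncation leaves no trace in the normal cone.\<close>

lemma compl_trunc_normal:
  assumes w: "(z, s) \<in> compl_trunc M" and lt: "\<And>i. z $ i < M" "\<And>i. s $ i < M"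
  shows "regular_normal_cone (compl_trunc M) (z, s) = regular_normal_cone compl_set (z, s)"
proof (rule regular_normal_cone_local)
  let ?V = "(\<Inter>i. {p :: (real^'a) \<times> (real^'a). fst p $ i < M}) \<inter> (\<Inter>i. {p. snd p $ i < M})"
  show "open ?V"
    by (intro open_Int open_INT ballI finite open_Collect_less continuous_intros)
  show "(z, s) \<in> ?V" using lt by simp
  show "compl_trunc M \<inter> ?V = compl_set \<inter> ?V"
    by (auto simp: compl_trunc_def less_imp_le)
qed

text \<open>Each claim tests the normal vector on a coordinate direction that stays feasible: an
  entry whose partner vanishes may always increase, and it may decrease if it is positive.\<close>

lemma compl_set_normal:
  assumes n: "(a, b) \<in> regular_normal_cone compl_set (z, s)"
  shows "z $ i > 0 \<Longrightarrow> a $ i = 0" "s $ i > 0 \<Longrightarrow> b $ i = 0"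
    "s $ i = 0 \<Longrightarrow> a $ i \<le> 0" "z $ i = 0 \<Longrightarrow> b $ i \<le> 0"
proof -
  have zs: "(z, s) \<in> compl_set" using n by (simp add: regular_normal_cone_def)
  then have c: "0 \<le> z $ j" "0 \<le> s $ j" "z $ j * s $ j = 0" for j
    by (auto simp: compl_set_def less_eq_vec_def)
  have in_z: "(z, s) + t *\<^sub>R (axis i c, 0) \<in> compl_set" if "s $ i = 0" "0 \<le> z $ i + t * c" for t c
    using c that by (auto simp: compl_set_def less_eq_vec_def axis_def)
  have in_s: "(z, s) + t *\<^sub>R (0, axis i c) \<in> compl_set" if "z $ i = 0" "0 \<le> s $ i + t * c" for t c
    using c that by (auto simp: compl_set_def less_eq_vec_def axis_def)
  show a: "a $ i \<le> 0" if "s $ i = 0"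
    using regular_normal_direction[OF n, of 1 "(axis i 1, 0)"] in_z[OF that] c(1)[of i]
    by (simp add: inner_axis)
  show b: "b $ i \<le> 0" if "z $ i = 0"
    using regular_normal_direction[OF n, of 1 "(0, axis i 1)"] in_s[OF that] c(2)[of i]
    by (simp add: inner_axis)
  show "a $ i = 0" if "z $ i > 0"
  proof -
    have "s $ i = 0" using c(3)[of i] that by simp
    \<comment> \<open>In the direction that decreases the entry, the feasible length is
      \<open>z $ i\<close> itself.\<close>
    moreover have "- a $ i \<le> 0"
      using regular_normal_direction[OF n that, of "(axis i (-1), 0)"] in_z[OF \<open>s $ i = 0\<close>, of _ "-1"]
      by (simp add: inner_axis)
    ultimately show ?thesis using a by simp
  qed
  show "b $ i = 0" if "s $ i > 0"
  proof -
    have "z $ i = 0" using c(3)[of i] that by simp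
    moreover have "- b $ i \<le> 0"
      using regular_normal_direction[OF n that, of "(0, axis i (-1))"] in_s[OF \<open>z $ i = 0\<close>, of _ "-1"]
      by (simp add: inner_axis)
    ultimately show ?thesis using b by simp
  qed
qed

section \<open>The proximal subproblem and the gap\<close>

lemma twice_cont_diff_on_subset:
  assumes "twice_cont_diff_on V h" "U \<subseteq> V"
  shows "twice_cont_diff_on U h"
proof -
  obtain H where H: "\<forall>w\<in>V. (grad h has_derivative blinfun_apply (H w)) (at w)" "continuous_on V H"
    using assms(1) unfolding twice_cont_diff_on_def by auto
  then have "\<forall>w\<in>U. (grad h has_derivative blinfun_apply (H w)) (at w)" "continuous_on U H"
    using assms(2) continuous_on_subset by auto
  moreover have "cont_diff_on U h"
    using assms continuous_on_subset unfolding twice_cont_diff_on_def cont_diff_on_def by (metis subsetD)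
  ultimately show ?thesis unfolding twice_cont_diff_on_def by auto
qed

lemma convex_on_finite_sum:
  assumes "convex S" "finite I" "\<And>i. i \<in> I \<Longrightarrow> convex_on S (h i)"
  shows "convex_on S (\<lambda>w. \<Sum>i\<in>I. h i w)"
  using assms(2,3)
proof (induction I)
  case empty
  then show ?case using assms(1) by (simp add: convex_on_def)
next
  case (insert i I)
  then show ?case using convex_on_add[of S "h i" "\<lambda>w. \<Sum>i\<in>I. h i w"] by simp
qed

section \<open>Standing assumptions and bounds for the data\<close>

locale bilevel =
  fixes F f :: "(real^'n) \<times> (real^'m) \<Rightarrow> real"
    and G :: "(real^'n) \<times> (real^'m) \<Rightarrow> real^'p"
    and g :: "(real^'n) \<times> (real^'m) \<Rightarrow> real^'q"
    and LF \<gamma>1 \<gamma>2 :: real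
  assumes F_smooth: "\<exists>U. open U \<and> Omega G \<subseteq> U \<and> cont_diff_on U F"
    and F_lipschitz: "0 < LF" "LF-lipschitz_on (Omega G) (grad F)"
    and G_smooth_convex: "\<And>i. \<exists>U. open U \<and> Omega G \<subseteq> U \<and>
          cont_diff_on U (\<lambda>w. G w $ i) \<and> convex_on U (\<lambda>w. G w $ i)"
    and lower_convex: "\<And>x. x \<in> Xset G \<Longrightarrow> convex_on UNIV (\<lambda>y. f (x, y))"
          "\<And>x i. x \<in> Xset G \<Longrightarrow> convex_on UNIV (\<lambda>y. g (x, y) $ i)"
    and f_smooth: "\<exists>U. open U \<and> Xset G \<times> UNIV \<subseteq> U \<and> twice_cont_diff_on U f"
    and g_smooth: "\<And>i. \<exists>U. open U \<and> Xset G \<times> UNIV \<subseteq> U \<and> twice_cont_diff_on U (\<lambda>w. g w $ i)"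
    and Omega_set: "Omega G \<noteq> {}" "closed (Omega G)" "convex (Omega G)" "bounded (Omega G)"
    and gamma_pos: "0 < \<gamma>1" "0 < \<gamma>2"
begin

abbreviation Gg :: "'q \<Rightarrow> (real^'n) \<times> (real^'m) \<Rightarrow> (real^'n) \<times> (real^'m)" where
  "Gg i \<equiv> grad (\<lambda>w. g w $ i)"

text \<open>The gradient of the Lagrangian in \<open>(x, y)\<close>, spelled out so that it is
  affine in \<open>z\<close> by definition and increments in \<open>z\<close> and in the point can
  be treated separately.\<close>

definition Lg :: "(real^'n) \<times> (real^'m) \<Rightarrow> real^'q \<Rightarrow> (real^'n) \<times> (real^'m)" where
  "Lg w z = grad f w + (\<Sum>i\<in>UNIV. z $ i *\<^sub>R Gg i w)"

lemma Omega_X: "(x, y) \<in> Omega G \<Longrightarrow> x \<in> Xset G"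
  by (auto simp: Xset_def)

lemma X_image: "Xset G = fst ` Omega G"
  by (force simp: Xset_def)

lemma convex_X: "convex (Xset G)"
  unfolding X_image by (rule convex_linear_image[OF linear_fst Omega_set(3)])

lemma compact_Omega: "compact (Omega G)"
  using Omega_set by (simp add: compact_eq_bounded_closed)

lemma compact_X: "compact (Xset G)"
  unfolding X_image by (intro compact_continuous_image compact_Omega continuous_on_fst continuous_on_id)

lemma common_domain:
  "\<exists>U. open U \<and> Xset G \<times> UNIV \<subseteq> U \<and> twice_cont_diff_on U f \<and> (\<forall>i. twice_cont_diff_on U (\<lambda>w. g w $ i))"
proof -
  obtain Uf where Uf: "open Uf" "Xset G \<times> UNIV \<subseteq> Uf" "twice_cont_diff_on Uf f" using f_smooth by auto
  obtain Ug where Ug: "\<And>i. open (Ug i)" "\<And>i. Xset G \<times> UNIV \<subseteq> Ug i" "\<And>i. twice_cont_diff_on (Ug i) (\<lambda>w. g w $ i)"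
    using g_smooth by metis
  define U where "U = Uf \<inter> (\<Inter>i. Ug i)"
  show ?thesis
  proof (intro exI[of _ U] conjI allI)
    show "open U" unfolding U_def by (intro open_Int open_INT ballI finite Uf Ug)
    show "Xset G \<times> UNIV \<subseteq> U" using Uf Ug unfolding U_def by blast
    show "twice_cont_diff_on U f" by (rule twice_cont_diff_on_subset[OF Uf(3)]) (auto simp: U_def)
    show "twice_cont_diff_on U (\<lambda>w. g w $ i)" for i by (rule twice_cont_diff_on_subset[OF Ug(3)]) (auto simp: U_def)
  qed
qed

lemma GDERIV_f: "x \<in> Xset G \<Longrightarrow> GDERIV f (x, y) :> grad f (x, y)"
  and GDERIV_g: "x \<in> Xset G \<Longrightarrow> GDERIV (\<lambda>w. g w $ i) (x, y) :> Gg i (x, y)"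
proof -
  obtain U where U: "open U" "Xset G \<times> UNIV \<subseteq> U" "twice_cont_diff_on U f"
    "\<And>i. twice_cont_diff_on U (\<lambda>w. g w $ i)" using common_domain by auto
  assume "x \<in> Xset G"
  then have "(x, y) \<in> U" using U(2) by blast
  then show "GDERIV f (x, y) :> grad f (x, y)" "GDERIV (\<lambda>w. g w $ i) (x, y) :> Gg i (x, y)"
    using U(3) U(4)[of i] unfolding twice_cont_diff_on_def cont_diff_on_def by auto
qed

lemma GDERIV_F: "w \<in> Omega G \<Longrightarrow> GDERIV F w :> grad F w"
  using F_smooth unfolding cont_diff_on_def by auto

lemma GDERIV_G: "w \<in> Omega G \<Longrightarrow> GDERIV (\<lambda>w. G w $ i) w :> grad (\<lambda>w. G w $ i) w"
  using G_smooth_convex[of i] unfolding cont_diff_on_def by auto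

text \<open>\<open>F\<close> is assumed only once continuously differentiable, so the Lipschitz
  constant of its gradient takes the place of a Hessian bound; compactness of
  \<open>\<Omega>\<close> bounds the rest.\<close>

lemma smooth_bound_F: "\<exists>C>0. smooth_bound (Omega G) F C"
proof -
  obtain U where U: "open U" "Omega G \<subseteq> U" "cont_diff_on U F" using F_smooth by auto
  have cg: "continuous_on (Omega G) (grad F)"
    using U continuous_on_subset unfolding cont_diff_on_def by auto
  have cF: "continuous_on (Omega G) F"
  proof (rule has_derivative_continuous_on)
    show "(F has_derivative (\<lambda>k. k \<bullet> grad F w)) (at w within Omega G)" if "w \<in> Omega G" for w
      using GDERIV_F[OF that] unfolding gderiv_def by (rule has_derivative_at_withinI)
  qed
  obtain c1 where c1: "\<And>w. w \<in> Omega G \<Longrightarrow> norm (F w) \<le> c1"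
    using compact_imp_bounded[OF compact_continuous_image[OF cF compact_Omega]] unfolding bounded_iff by auto
  obtain c2 where c2: "\<And>w. w \<in> Omega G \<Longrightarrow> norm (grad F w) \<le> c2"
    using compact_imp_bounded[OF compact_continuous_image[OF cg compact_Omega]] unfolding bounded_iff by auto
  define C where "C = max LF (max c1 c2)"
  have "smooth_bound (Omega G) F C"
  proof (rule smooth_bound_of_lipschitz_grad[OF Omega_set(3) GDERIV_F])
    fix w w' assume w: "w \<in> Omega G" "w' \<in> Omega G"
    have "norm (grad F w' - grad F w) \<le> LF * norm (w' - w)"
      using lipschitz_onD[OF F_lipschitz(2), of w' w] w by (simp add: dist_norm)
    also have "\<dots> \<le> C * norm (w' - w)" by (intro mult_right_mono) (auto simp: C_def)
    finally show "norm (grad F w' - grad F w) \<le> C * norm (w' - w)" .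
  next
    fix w assume "w \<in> Omega G"
    then show "\<bar>F w\<bar> \<le> C" "norm (grad F w) \<le> C" using c1[of w] c2[of w] by (auto simp: C_def)
  qed
  moreover have "C > 0" using F_lipschitz(1) by (simp add: C_def less_max_iff_disj)
  ultimately show ?thesis by blast
qed

text \<open>The points \<open>(x, \<theta>)\<close> may leave \<open>\<Omega>\<close>, hence the
  estimates for \<open>f\<close> and \<open>g\<close> live on the compact convex set
  \<open>X \<times> cball 0 B\<close> with a radius chosen later. For \<open>F\<close>, evaluated
  only at iterates, \<open>\<Omega>\<close> suffices.\<close>

lemma data_bound:
  obtains C where "C \<ge> 1" "smooth_bound (Omega G) F C" "smooth_bound (Xset G \<times> cball 0 B) f C"
    "\<And>i. smooth_bound (Xset G \<times> cball 0 B) (\<lambda>w. g w $ i) C"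
proof -
  obtain U where U: "open U" "Xset G \<times> UNIV \<subseteq> U" "twice_cont_diff_on U f"
    "\<And>i. twice_cont_diff_on U (\<lambda>w. g w $ i)" using common_domain by auto
  have K: "compact (Xset G \<times> cball (0::real^'m) B)" "convex (Xset G \<times> cball (0::real^'m) B)"
     "Xset G \<times> cball (0::real^'m) B \<subseteq> U"
    using compact_X convex_X U(2) by (auto intro: compact_Times convex_Times)
  obtain CF where CF: "smooth_bound (Omega G) F CF" using smooth_bound_F by blast
  obtain Cf where Cf: "smooth_bound (Xset G \<times> cball 0 B) f Cf"
    using smooth_bound_exists[OF U(3) K(3,1,2)] by blast
  have "\<forall>i. \<exists>C>0. smooth_bound (Xset G \<times> cball 0 B) (\<lambda>w. g w $ i) C"
    using smooth_bound_exists[OF U(4) K(3,1,2)] by blast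
  then obtain Cg where Cg: "\<And>i. Cg i > 0" "\<And>i. smooth_bound (Xset G \<times> cball 0 B) (\<lambda>w. g w $ i) (Cg i)"
    by metis
  define C where "C = max 1 (max CF (max Cf (\<Sum>i\<in>UNIV. Cg i)))"
  have "Cg i \<le> C" for i
    using member_le_sum[of i UNIV Cg] Cg(1) by (auto simp: C_def less_imp_le intro: order_trans)
  then show ?thesis
    using CF Cf Cg by (intro that[of C]) (auto simp: C_def elim!: smooth_bound_mono intro: smooth_bound_mono)
qed

lemma Omega_bounded_y: "\<exists>B. \<forall>x y. (x, y) \<in> Omega G \<longrightarrow> norm y \<le> B"
proof -
  obtain B where B: "\<And>w. w \<in> Omega G \<Longrightarrow> norm w \<le> B" using Omega_set(4) unfolding bounded_iff by blast
  have "norm y \<le> B" if "(x, y) \<in> Omega G" for x y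
    using B[OF that] norm_snd_le[of y x] by simp
  then show ?thesis by blast
qed

lemma GDERIV_Lag:
  assumes "GDERIV f w :> grad f w" "\<And>i. GDERIV (\<lambda>w. g w $ i) w :> Gg i w"
  shows "GDERIV (\<lambda>w. f w + z \<bullet> g w) w :> Lg w z"
  unfolding Lg_def inner_vec_def inner_real_def
  by (intro GDERIV_add GDERIV_sum GDERIV_cmult assms)

lemma GDERIV_Lag_X: "x \<in> Xset G \<Longrightarrow> GDERIV (\<lambda>w. f w + z \<bullet> g w) (x, y) :> Lg (x, y) z"
  by (intro GDERIV_Lag GDERIV_f GDERIV_g)

lemma GDERIV_Lag_y:
  "x \<in> Xset G \<Longrightarrow> GDERIV (\<lambda>y. Lag f g x y z) \<theta> :> snd (Lg (x, \<theta>) z)"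
  using GDERIV_partial_snd[OF GDERIV_Lag_X] by (simp add: Lag_def)

lemma grad_Lag:
  assumes "x \<in> Xset G"
  shows "grad_x_Lag f g x y z = fst (Lg (x, y) z)" "grad_y_Lag f g x y z = snd (Lg (x, y) z)"
  using GDERIV_partial_fst[OF GDERIV_Lag_X[OF assms]] GDERIV_partial_snd[OF GDERIV_Lag_X[OF assms]]
  by (simp_all add: Lag_def grad_eqI)

lemma grad_partials:
  assumes "x \<in> Xset G"
  shows "grad (\<lambda>x'. f (x', y)) x + jac_transp (\<lambda>x'. g (x', y)) x z = fst (Lg (x, y) z)"
    "grad (\<lambda>y'. f (x, y')) y + jac_transp (\<lambda>y'. g (x, y')) y z = snd (Lg (x, y) z)"
    "grad (\<lambda>y'. g (x, y') $ i) y = snd (Gg i (x, y))"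
proof -
  have 1: "grad (\<lambda>x'. g (x', y) $ i) x = fst (Gg i (x, y))" "grad (\<lambda>y'. g (x, y') $ i) y = snd (Gg i (x, y))" for i
    using GDERIV_partial_fst[OF GDERIV_g[OF assms]] GDERIV_partial_snd[OF GDERIV_g[OF assms]] grad_eqI by blast+
  have 2: "grad (\<lambda>x'. f (x', y)) x = fst (grad f (x, y))" "grad (\<lambda>y'. f (x, y')) y = snd (grad f (x, y))"
    using GDERIV_partial_fst[OF GDERIV_f[OF assms]] GDERIV_partial_snd[OF GDERIV_f[OF assms]] grad_eqI by blast+
  show "grad (\<lambda>y'. g (x, y') $ i) y = snd (Gg i (x, y))" by (fact 1(2))
  show "grad (\<lambda>x'. f (x', y)) x + jac_transp (\<lambda>x'. g (x', y)) x z = fst (Lg (x, y) z)"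
    "grad (\<lambda>y'. f (x, y')) y + jac_transp (\<lambda>y'. g (x, y')) y z = snd (Lg (x, y) z)"
    by (simp_all add: jac_transp_def 1 2 Lg_def fst_sum snd_sum)
qed

text \<open>Nonnegative multipliers make the Lagrangian convex in its lower-level variable. This is
  the source of the conditions on \<open>x\<close> and \<open>z\<close> in the later estimates of
  the gap.\<close>

lemma Lag_gradient_ineq:
  assumes "x \<in> Xset G" "0 \<le> z"
  shows "Lag f g x \<theta> z + snd (Lg (x, \<theta>) z) \<bullet> (\<theta>' - \<theta>) \<le> Lag f g x \<theta>' z"
proof -
  have "convex_on UNIV (\<lambda>y. f (x, y) + (\<Sum>i\<in>UNIV. z $ i * g (x, y) $ i))"
    using assms lower_convex
    by (intro convex_on_add convex_on_finite_sum convex_on_cmul) (auto simp: less_eq_vec_def)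
  then have "convex_on UNIV (\<lambda>y. Lag f g x y z)" by (simp add: Lag_def inner_vec_def)
  then show ?thesis using GDERIV_Lag_y[OF assms(1)] by (rule convex_on_gradient_ineq)
qed

section \<open>Strong convexity of the proximal objective\<close>

abbreviation prox_obj :: "real^'n \<Rightarrow> real^'m \<Rightarrow> real^'q \<Rightarrow> real^'m \<Rightarrow> real" where
  "prox_obj x y z \<theta> \<equiv> Lag f g x \<theta> z + (norm (\<theta> - y))\<^sup>2 / (2 * \<gamma>1)"

definition prox_grad :: "real^'n \<Rightarrow> real^'m \<Rightarrow> real^'q \<Rightarrow> real^'m \<Rightarrow> real^'m" where
  "prox_grad x y z \<theta> = snd (Lg (x, \<theta>) z) + (1 / \<gamma>1) *\<^sub>R (\<theta> - y)"

lemma resid_eq: "x \<in> Xset G \<Longrightarrow> resid f g \<gamma>1 \<theta> x y z = norm (prox_grad x y z \<theta>)"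
  by (simp add: resid_def prox_grad_def grad_Lag)

text \<open>The quadratic term expands exactly and contributes the modulus
  \<open>1 / \<gamma>1\<close>; the Lagrangian contributes its tangent inequality.\<close>

lemma prox_strong_convexity:
  assumes "x \<in> Xset G" "0 \<le> z"
  shows "prox_obj x y z \<theta> + prox_grad x y z \<theta> \<bullet> (\<theta>' - \<theta>) + (norm (\<theta>' - \<theta>))\<^sup>2 / (2 * \<gamma>1) \<le> prox_obj x y z \<theta>'"
proof -
  have "(norm (\<theta>' - y))\<^sup>2 = (norm (\<theta> - y))\<^sup>2 + 2 * ((\<theta> - y) \<bullet> (\<theta>' - \<theta>)) + (norm (\<theta>' - \<theta>))\<^sup>2"
    unfolding power2_norm_eq_inner by (simp add: algebra_simps inner_commute)
  then have "(norm (\<theta>' - y))\<^sup>2 / (2 * \<gamma>1)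
      = (norm (\<theta> - y))\<^sup>2 / (2 * \<gamma>1) + ((1 / \<gamma>1) *\<^sub>R (\<theta> - y)) \<bullet> (\<theta>' - \<theta>) + (norm (\<theta>' - \<theta>))\<^sup>2 / (2 * \<gamma>1)"
    using gamma_pos(1) by (simp only: inner_scaleR_left) (simp add: field_simps)
  then show ?thesis
    using Lag_gradient_ineq[OF assms, of \<theta> \<theta>'] by (simp add: prox_grad_def inner_add_left)
qed

text \<open>Minimizing the quadratic lower bound of \<open>prox_strong_convexity\<close> over
  \<open>\<theta>'\<close>, by completing the square, costs \<open>\<gamma>1 / 2\<close> times the
  squared gradient norm. This is the residual term in the acceptance tests of the algorithm.\<close>

lemma prox_obj_lower:
  assumes "x \<in> Xset G" "0 \<le> z"
  shows "prox_obj x y z \<theta> - (\<gamma>1 / 2) * (resid f g \<gamma>1 \<theta> x y z)\<^sup>2 \<le> prox_obj x y z \<theta>'"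
proof -
  let ?r = "prox_grad x y z \<theta>" and ?d = "\<theta>' - \<theta>"
  have "0 \<le> (norm (\<gamma>1 *\<^sub>R ?r + ?d))\<^sup>2 / (2 * \<gamma>1)" using gamma_pos by simp
  also have "(norm (\<gamma>1 *\<^sub>R ?r + ?d))\<^sup>2 = \<gamma>1\<^sup>2 * (norm ?r)\<^sup>2 + 2 * \<gamma>1 * (?r \<bullet> ?d) + (norm ?d)\<^sup>2"
    unfolding power2_norm_eq_inner by (simp add: algebra_simps inner_commute power2_eq_square)
  also have "\<dots> / (2 * \<gamma>1) = (\<gamma>1 / 2) * (norm ?r)\<^sup>2 + ?r \<bullet> ?d + (norm ?d)\<^sup>2 / (2 * \<gamma>1)"
    using gamma_pos(1) by (simp add: field_simps power2_eq_square)
  finally show ?thesis using prox_strong_convexity[OF assms, of \<theta> y \<theta>'] resid_eq[OF assms(1)] by simp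
qed

text \<open>Adding the strong convexity inequalities in both directions makes the gradient strongly
  monotone with modulus \<open>1 / \<gamma>1\<close>; Cauchy-Schwarz then gives the distance
  bound.\<close>

lemma prox_dist:
  assumes "x \<in> Xset G" "0 \<le> z"
  shows "norm (\<theta>' - \<theta>) \<le> \<gamma>1 * norm (prox_grad x y z \<theta>' - prox_grad x y z \<theta>)"
proof -
  let ?d = "\<theta>' - \<theta>" and ?D = "prox_grad x y z \<theta>' - prox_grad x y z \<theta>"
  have "(norm ?d)\<^sup>2 / (2 * \<gamma>1) + (norm ?d)\<^sup>2 / (2 * \<gamma>1) \<le> ?D \<bullet> ?d"
    using prox_strong_convexity[OF assms, of \<theta> y \<theta>'] prox_strong_convexity[OF assms, of \<theta>' y \<theta>]
    by (simp add: algebra_simps norm_minus_commute inner_diff_right inner_diff_left)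
  then have "(norm ?d)\<^sup>2 \<le> \<gamma>1 * (?D \<bullet> ?d)" using gamma_pos(1) by (simp add: field_simps)
  also have "\<dots> \<le> \<gamma>1 * (norm ?D * norm ?d)" using gamma_pos(1) by (intro mult_left_mono norm_cauchy_schwarz) auto
  finally have "norm ?d * norm ?d \<le> (\<gamma>1 * norm ?D) * norm ?d" by (simp add: power2_eq_square algebra_simps)
  then show ?thesis
    using gamma_pos(1) by (cases "norm ?d = 0") (simp_all add: mult_le_cancel_right)
qed

lemma prox_dist_resid:
  assumes "x \<in> Xset G" "0 \<le> z"
  shows "norm (\<theta>' - \<theta>) \<le> \<gamma>1 * (resid f g \<gamma>1 \<theta>' x y z + resid f g \<gamma>1 \<theta> x y z)"
  using prox_dist[OF assms, of \<theta>' \<theta> y] gamma_pos(1) resid_eq[OF assms(1)]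
    norm_triangle_ineq4[of "prox_grad x y z \<theta>'" "prox_grad x y z \<theta>"]
  by (smt (verit) mult_left_mono)

text \<open>\<open>theta_star\<close> is chosen by \<open>arg_min\<close>, so a minimizer must first
  be shown to exist. Strong convexity confines the search to a ball, compactness yields a minimizer
  there, and the gradient vanishes at a global minimizer.\<close>

lemma theta_star:
  assumes "x \<in> Xset G" "0 \<le> z"
  shows "resid f g \<gamma>1 (theta_star f g \<gamma>1 x y z) x y z = 0"
proof -
  let ?\<phi> = "prox_obj x y z" and ?b = "norm (prox_grad x y z y)"
  have GD: "GDERIV ?\<phi> \<theta> :> prox_grad x y z \<theta>" for \<theta>
  proof -
    have "GDERIV (\<lambda>\<theta>. (norm (\<theta> - y))\<^sup>2 / (2 * \<gamma>1)) \<theta> :> (1 / \<gamma>1) *\<^sub>R (\<theta> - y)"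
      unfolding gderiv_def power2_norm_eq_inner
      using gamma_pos(1) by (auto intro!: derivative_eq_intros simp: fun_eq_iff inner_commute simp del: scaleR_diff_right)
    then show ?thesis unfolding prox_grad_def by (intro GDERIV_add GDERIV_Lag_y assms)
  qed
  have cont: "continuous_on S ?\<phi>" for S
  proof (rule has_derivative_continuous_on)
    show "(?\<phi> has_derivative (\<lambda>k. k \<bullet> prox_grad x y z \<theta>)) (at \<theta> within S)" for \<theta>
      using GD[of \<theta>] unfolding gderiv_def by (rule has_derivative_at_withinI)
  qed
  \<comment> \<open>Beyond this radius the quadratic growth with factor
    \<open>1 / (2 * \<gamma>1)\<close> outweighs the linear term with factor \<open>?b\<close>, so
    the value at \<open>y\<close> is not undercut.\<close>
  define \<rho> where "\<rho> = 2 * \<gamma>1 * ?b"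
  have \<rho>: "0 \<le> \<rho>" using gamma_pos(1) by (simp add: \<rho>_def)
  obtain t where t: "t \<in> cball y \<rho>" "\<And>\<theta>. \<theta> \<in> cball y \<rho> \<Longrightarrow> ?\<phi> t \<le> ?\<phi> \<theta>"
    using continuous_attains_inf[OF compact_cball _ cont, of y \<rho>] \<rho> by auto
  have min: "?\<phi> t \<le> ?\<phi> \<theta>" for \<theta>
  proof (cases "\<theta> \<in> cball y \<rho>")
    case False
    let ?n = "norm (\<theta> - y)"
    have "\<rho> < ?n" using False by (simp add: dist_norm norm_minus_commute)
    have "?b * ?n \<le> ?n * ?n / (2 * \<gamma>1)"
    proof -
      have "2 * \<gamma>1 * (?b * ?n) \<le> ?n * ?n"
        using \<open>\<rho> < ?n\<close> unfolding \<rho>_def by (metis less_imp_le mult.assoc mult_right_mono norm_ge_zero)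
      then show ?thesis using gamma_pos(1) by (simp add: field_simps)
    qed
    moreover have "- (?b * ?n) \<le> prox_grad x y z y \<bullet> (\<theta> - y)"
      using Cauchy_Schwarz_ineq2[of "prox_grad x y z y" "\<theta> - y"] by linarith
    ultimately have "?\<phi> y \<le> ?\<phi> \<theta>"
      using prox_strong_convexity[OF assms, of y y \<theta>] by (simp add: power2_eq_square)
    moreover have "?\<phi> t \<le> ?\<phi> y" using \<rho> by (intro t(2)) simp
    ultimately show ?thesis by simp
  qed (use t in auto)
  have "is_arg_min ?\<phi> (\<lambda>_. True) (theta_star f g \<gamma>1 x y z)"
    unfolding theta_star_def arg_min_def
    by (rule someI[of _ t]) (use min in \<open>auto simp: is_arg_min_linorder\<close>)
  then have "\<forall>\<theta>. ?\<phi> (theta_star f g \<gamma>1 x y z) \<le> ?\<phi> \<theta>" by (simp add: is_arg_min_linorder)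
  then have "(\<lambda>k. k \<bullet> prox_grad x y z (theta_star f g \<gamma>1 x y z)) = (\<lambda>k. 0)"
    using differential_zero_maxmin[OF UNIV_I open_UNIV] GD unfolding gderiv_def by blast
  then have "prox_grad x y z (theta_star f g \<gamma>1 x y z) = 0" by (metis inner_eq_zero_iff)
  then show ?thesis using resid_eq[OF assms(1)] by simp
qed

section \<open>The gap function and its surrogate\<close>

lemma pen_component:
  fixes t z l :: real
  assumes "0 \<le> l"
  shows "l * t - (l - z)\<^sup>2 / (2 * \<gamma>2) \<le> ((max 0 (z + \<gamma>2 * t))\<^sup>2 - z\<^sup>2) / (2 * \<gamma>2)"
proof -
  \<comment> \<open>The left side is a concave quadratic in \<open>l\<close>, and the right side is
    its maximum over \<open>l \<ge> 0\<close>, attained at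
    \<open>max 0 (z + \<gamma>2 * t)\<close>.\<close>
  have "2 * l * (z + \<gamma>2 * t) - l\<^sup>2 \<le> (max 0 (z + \<gamma>2 * t))\<^sup>2"
  proof (cases "0 \<le> z + \<gamma>2 * t")
    case True
    have "0 \<le> (l - (z + \<gamma>2 * t))\<^sup>2" by simp
    then show ?thesis using True by (simp add: power2_diff)
  next
    case False
    then have "l * (z + \<gamma>2 * t) \<le> 0" using assms by (simp add: mult_nonneg_nonpos)
    moreover have "0 \<le> l\<^sup>2" "(max 0 (z + \<gamma>2 * t))\<^sup>2 = 0" using False by auto
    moreover have "2 * l * (z + \<gamma>2 * t) = 2 * (l * (z + \<gamma>2 * t))" by simp
    ultimately show ?thesis by linarith
  qed
  then have "(2 * \<gamma>2 * (l * t) - (l - z)\<^sup>2) / (2 * \<gamma>2) \<le> ((max 0 (z + \<gamma>2 * t))\<^sup>2 - z\<^sup>2) / (2 * \<gamma>2)"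
    using gamma_pos(2) by (intro divide_right_mono) (auto simp: power2_eq_square algebra_simps)
  then show ?thesis using gamma_pos(2) by (simp add: diff_divide_distrib)
qed

lemma penP_sum:
  "penP g \<gamma>2 x y z = (\<Sum>i\<in>UNIV. ((max 0 (z $ i + \<gamma>2 * g (x, y) $ i))\<^sup>2 - (z $ i)\<^sup>2) / (2 * \<gamma>2))"
  by (simp add: penP_def norm_vec_sq pos_part_def sum_divide_distrib[symmetric] sum_subtractf)

lemma gap_hat_eq: "gap_hat f g \<gamma>1 \<gamma>2 x y z \<theta> = f (x, y) + penP g \<gamma>2 x y z - prox_obj x y z \<theta>"
  by (simp add: gap_hat_def Lag_def)

text \<open>The maximization over \<open>\<lambda>\<close> splits over the constraints, and each
  part is bounded by its summand of \<open>penP\<close>: the surrogate is the gap with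
  \<open>\<lambda>\<close> maximized out and \<open>\<theta>\<close> left free.\<close>

lemma gap_integrand_le:
  assumes "0 \<le> lam"
  shows "Lag f g x y lam - (norm (lam - z))\<^sup>2 / (2 * \<gamma>2) - prox_obj x y z \<theta> \<le> gap_hat f g \<gamma>1 \<gamma>2 x y z \<theta>"
proof -
  have "lam \<bullet> g (x, y) - (norm (lam - z))\<^sup>2 / (2 * \<gamma>2)
      = (\<Sum>i\<in>UNIV. lam $ i * g (x, y) $ i - (lam $ i - z $ i)\<^sup>2 / (2 * \<gamma>2))"
    by (simp add: inner_vec_def norm_vec_sq sum_subtractf sum_divide_distrib)
  also have "\<dots> \<le> penP g \<gamma>2 x y z"
    unfolding penP_sum using assms by (intro sum_mono pen_component) (auto simp: less_eq_vec_def)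
  finally show ?thesis unfolding gap_hat_eq by (simp add: Lag_def)
qed

lemma gap_hat_le:
  assumes "x \<in> Xset G" "0 \<le> z"
  shows "gap_hat f g \<gamma>1 \<gamma>2 x y z \<theta>' \<le> gap_hat f g \<gamma>1 \<gamma>2 x y z \<theta> + (\<gamma>1 / 2) * (resid f g \<gamma>1 \<theta> x y z)\<^sup>2"
  using prox_obj_lower[OF assms, of \<theta> y \<theta>'] unfolding gap_hat_eq by linarith

text \<open>The candidate \<open>\<theta> = y\<close>, \<open>\<lambda> = z\<close> has value zero
  in the maximization.\<close>

lemma gap_hat_y_nonneg:
  assumes "0 \<le> z"
  shows "0 \<le> gap_hat f g \<gamma>1 \<gamma>2 x y z y"
  using gap_integrand_le[OF assms, of x y z y] by simp

lemma gap_hat_lower: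
  assumes "x \<in> Xset G" "0 \<le> z"
  shows "0 \<le> gap_hat f g \<gamma>1 \<gamma>2 x y z \<theta> + (\<gamma>1 / 2) * (resid f g \<gamma>1 \<theta> x y z)\<^sup>2"
  using gap_hat_le[OF assms, of y y \<theta>] gap_hat_y_nonneg[OF assms(2), of x y] by linarith

lemma gap_bounds:
  assumes "x \<in> Xset G" "0 \<le> z"
  shows "0 \<le> gap f g \<gamma>1 \<gamma>2 x y z"
    "gap f g \<gamma>1 \<gamma>2 x y z \<le> gap_hat f g \<gamma>1 \<gamma>2 x y z \<theta> + (\<gamma>1 / 2) * (resid f g \<gamma>1 \<theta> x y z)\<^sup>2"
proof -
  let ?h = "\<lambda>(\<theta>, lam). Lag f g x y lam - (norm (lam - z))\<^sup>2 / (2 * \<gamma>2) - Lag f g x \<theta> z - (norm (\<theta> - y))\<^sup>2 / (2 * \<gamma>1)"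
  let ?S = "UNIV \<times> {lam. 0 \<le> lam}"
  have up: "?h p \<le> gap_hat f g \<gamma>1 \<gamma>2 x y z \<theta> + (\<gamma>1 / 2) * (resid f g \<gamma>1 \<theta> x y z)\<^sup>2" if "p \<in> ?S" for p \<theta>
  proof -
    obtain \<theta>' lam where p: "p = (\<theta>', lam)" by (cases p)
    then have lam: "0 \<le> lam" using that by simp
    show ?thesis
      using gap_integrand_le[OF lam, of x y z \<theta>'] gap_hat_le[OF assms, of y \<theta>' \<theta>] p by simp
  qed
  \<comment> \<open>\<open>gap\<close> is a supremum of reals, which carries information only once
    boundedness above is known.\<close>
  have bdd: "bdd_above (?h ` ?S)" using up by (intro bdd_aboveI2) blast
  have "?h (y, z) \<le> gap f g \<gamma>1 \<gamma>2 x y z"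
    unfolding gap_def by (rule cSUP_upper[OF _ bdd]) (use assms in auto)
  then show "0 \<le> gap f g \<gamma>1 \<gamma>2 x y z" by simp
  show "gap f g \<gamma>1 \<gamma>2 x y z \<le> gap_hat f g \<gamma>1 \<gamma>2 x y z \<theta> + (\<gamma>1 / 2) * (resid f g \<gamma>1 \<theta> x y z)\<^sup>2"
    unfolding gap_def by (rule cSUP_least[OF _ up]) auto
qed

text \<open>
  The prox objective is strongly convex, and \<open>\<lambda> = z\<close> is a candidate in the maximization over \<open>\<lambda>\<close>.
\<close>

lemma gap_dist:
  assumes "x \<in> Xset G" "0 \<le> z"
  shows "(norm (theta_star f g \<gamma>1 x y z - y))\<^sup>2 / (2 * \<gamma>1) \<le> gap_hat f g \<gamma>1 \<gamma>2 x y z \<theta> + (\<gamma>1 / 2) * (resid f g \<gamma>1 \<theta> x y z)\<^sup>2"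
proof -
  let ?t = "theta_star f g \<gamma>1 x y z"
  have "prox_grad x y z ?t = 0" using theta_star[OF assms] resid_eq[OF assms(1)] by (metis norm_eq_zero)
  then have "prox_obj x y z ?t + (norm (y - ?t))\<^sup>2 / (2 * \<gamma>1) \<le> prox_obj x y z y"
    using prox_strong_convexity[OF assms, of ?t y y] by simp
  moreover have "prox_obj x y z y - prox_obj x y z ?t \<le> gap_hat f g \<gamma>1 \<gamma>2 x y z ?t"
    using gap_integrand_le[OF assms(2), of x y z ?t] by simp
  moreover have "gap_hat f g \<gamma>1 \<gamma>2 x y z ?t \<le> gap_hat f g \<gamma>1 \<gamma>2 x y z \<theta> + (\<gamma>1 / 2) * (resid f g \<gamma>1 \<theta> x y z)\<^sup>2"
    by (rule gap_hat_le[OF assms])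
  ultimately show ?thesis by (simp add: norm_minus_commute)
qed

end

section \<open>Uniform estimates for the penalized objective\<close>

text \<open>Meant for \<open>penP\<close>: the squared positive part has no second derivative at the
  kink, but a two-sided quadratic remainder estimate is enough for the gradient.\<close>

lemma GDERIV_of_quadratic_bound:
  fixes h :: "'a::real_inner \<Rightarrow> real"
  assumes "\<And>w'. \<bar>h w' - h w - D \<bullet> (w' - w)\<bar> \<le> C * (norm (w' - w))\<^sup>2"
  shows "GDERIV h w :> D"
  unfolding gderiv_def has_derivative_at_alt
proof (intro conjI allI impI)
  show "bounded_linear (\<lambda>k. k \<bullet> D)" by (rule bounded_linear_inner_left)
  fix e :: real assume "e > 0"
  define d where "d = e / (\<bar>C\<bar> + 1)"
  have "d > 0" using \<open>e > 0\<close> by (simp add: d_def)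
  moreover have "norm (h w' - h w - (w' - w) \<bullet> D) \<le> e * norm (w' - w)" if "norm (w' - w) < d" for w'
  proof -
    let ?n = "norm (w' - w)"
    have "C * ?n\<^sup>2 \<le> (\<bar>C\<bar> + 1) * ?n * ?n"
      unfolding power2_eq_square mult.assoc by (intro mult_right_mono) auto
    also have "\<dots> \<le> (\<bar>C\<bar> + 1) * d * ?n"
      using that by (intro mult_right_mono mult_left_mono) auto
    also have "\<dots> = e * ?n" by (simp add: d_def)
    finally show ?thesis using assms[of w'] by (simp add: inner_commute)
  qed
  ultimately show "\<exists>d>0. \<forall>y. norm (y - w) < d \<longrightarrow> norm (h y - h w - (y - w) \<bullet> D) \<le> e * norm (y - w)" by blast
qed

text \<open>The squared positive part has derivative \<open>2 * max 0 t\<close> with Lipschitz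
  constant \<open>2\<close>, and this is the resulting quadratic upper bound. The lower bound that
  follows is its convexity.\<close>

lemma max0_sq_upper: "(max 0 t')\<^sup>2 \<le> (max 0 t)\<^sup>2 + 2 * max 0 t * (t' - t) + (t' - t)\<^sup>2" for t t' :: real
proof -
  have "(max 0 t + (t' - t))\<^sup>2 = (max 0 t)\<^sup>2 + 2 * max 0 t * (t' - t) + (t' - t)\<^sup>2"
    by (simp add: power2_sum)
  moreover have "(max 0 t')\<^sup>2 \<le> (max 0 t + (t' - t))\<^sup>2" by (cases "t' \<ge> 0") (auto simp: max_def power_mono)
  ultimately show ?thesis by simp
qed

lemma max0_sq_lower: "(max 0 t)\<^sup>2 + 2 * max 0 t * (t' - t) \<le> (max 0 t')\<^sup>2" for t t' :: real
proof (cases "t \<ge> 0")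
  case True
  have "2 * t * t' \<le> t\<^sup>2 + (max 0 t')\<^sup>2"
  proof -
    have "2 * t * t' \<le> 2 * t * max 0 t'" using True by (intro mult_left_mono) auto
    also have "\<dots> \<le> t\<^sup>2 + (max 0 t')\<^sup>2" using sum_squares_bound[of t "max 0 t'"] by simp
    finally show ?thesis .
  qed
  then show ?thesis using True by (simp add: algebra_simps power2_eq_square)
qed simp

lemma max0_lipschitz: "\<bar>max 0 t - max 0 t'\<bar> \<le> \<bar>t - t'\<bar>" for t t' :: real
  by auto

text \<open>The increment of a product, split so that the scalar needs a bound only at the first
  point and the vector only at the second.\<close>

lemma scaleR_diff_bound:
  fixes q q' :: "'a::real_normed_vector"
  assumes "\<bar>a\<bar> \<le> A" "norm q' \<le> Q" "\<bar>a - a'\<bar> \<le> d" "norm (q - q') \<le> e" "0 \<le> A" "0 \<le> Q"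
  shows "norm (a *\<^sub>R q - a' *\<^sub>R q') \<le> A * e + d * Q"
proof -
  have "a *\<^sub>R q - a' *\<^sub>R q' = a *\<^sub>R (q - q') + (a - a') *\<^sub>R q'" by (simp add: algebra_simps)
  then have "norm (a *\<^sub>R q - a' *\<^sub>R q') \<le> \<bar>a\<bar> * norm (q - q') + \<bar>a - a'\<bar> * norm q'"
    using norm_triangle_ineq[of "a *\<^sub>R (q - q')" "(a - a') *\<^sub>R q'"] by simp
  also have "\<dots> \<le> A * e + d * Q"
    using assms by (intro add_mono mult_mono) auto
  finally show ?thesis .
qed

lemma norm_sum_le: "(\<And>i. i \<in> I \<Longrightarrow> norm (q i) \<le> c) \<Longrightarrow> norm (\<Sum>i\<in>I. q i) \<le> real (card I) * c"
  using sum_norm_bound by blast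

lemma quad_term_le:
  fixes a v v' :: real
  assumes "\<bar>v' - v - l\<bar> \<le> C * n\<^sup>2" "\<bar>a\<bar> \<le> A" "0 \<le> C"
  shows "a * v' \<le> a * v + a * l + A * C * n\<^sup>2"
proof -
  have "a * (v' - v - l) \<le> \<bar>a\<bar> * \<bar>v' - v - l\<bar>" by (metis abs_ge_self abs_mult)
  also have "\<dots> \<le> A * (C * n\<^sup>2)" using assms by (intro mult_mono) auto
  finally show ?thesis by (simp add: algebra_simps)
qed

section \<open>Descent inequality in \<open>(x, y)\<close>\<close>

context bilevel
begin

text \<open>The maximizer over \<open>\<lambda>\<close> in the gap, and the coefficient vector of
  the constraint gradients in the \<open>(x, y)\<close>-derivative of \<open>penP\<close>.\<close>

definition pen_mult :: "real^'n \<Rightarrow> real^'m \<Rightarrow> real^'q \<Rightarrow> real^'q" where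
  "pen_mult x y z = pos_part (z + \<gamma>2 *\<^sub>R g (x, y))"

lemma pen_mult_nth: "pen_mult x y z $ i = max 0 (z $ i + \<gamma>2 * g (x, y) $ i)"
  by (simp add: pen_mult_def pos_part_def)

text \<open>\<open>d_comp\<close> is the \<open>(x, y)\<close>-gradient of \<open>psi_comp\<close>.\<close>

definition psi_comp :: "real \<Rightarrow> real^'n \<Rightarrow> real^'m \<Rightarrow> real^'q \<Rightarrow> real^'q \<Rightarrow> real^'m \<Rightarrow> 'q \<Rightarrow> real" where
  "psi_comp \<sigma>2 x y z s \<theta> i = ((max 0 (z $ i + \<gamma>2 * g (x, y) $ i))\<^sup>2 - (z $ i)\<^sup>2) / (2 * \<gamma>2)
     - z $ i * g (x, \<theta>) $ i + (\<sigma>2 / 2) * (g (x, y) $ i + s $ i)\<^sup>2"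

definition d_comp :: "real \<Rightarrow> real^'n \<Rightarrow> real^'m \<Rightarrow> real^'q \<Rightarrow> real^'q \<Rightarrow> real^'m \<Rightarrow> 'q \<Rightarrow> (real^'n) \<times> (real^'m)" where
  "d_comp \<sigma>2 x y z s \<theta> i = (pen_mult x y z $ i) *\<^sub>R Gg i (x, y) - z $ i *\<^sub>R (fst (Gg i (x, \<theta>)), 0)
     + \<sigma>2 *\<^sub>R ((g (x, y) $ i + s $ i) *\<^sub>R Gg i (x, y))"

text \<open>Everything that depends on the constraints is collected in a sum over \<open>i\<close>,
  so that the estimates can be made for one constraint at a time.\<close>

lemma psi_hat_eq:
  "psi_hat F f g \<gamma>1 \<gamma>2 \<sigma> x y z s \<theta> = (1 / fst \<sigma>) * F (x, y) + f (x, y) - f (x, \<theta>)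
     - (norm (\<theta> - y))\<^sup>2 / (2 * \<gamma>1) + (\<Sum>i\<in>UNIV. psi_comp (snd \<sigma>) x y z s \<theta> i)"
  by (simp add: psi_hat_def gap_hat_def penP_sum psi_comp_def sum.distrib sum_subtractf inner_vec_def
      norm_vec_sq sum_distrib_left algebra_simps)

lemma d_xy_eq:
  assumes "x \<in> Xset G"
  shows "d_xy F f g \<gamma>1 \<gamma>2 \<sigma> x y z s \<theta> = (1 / fst \<sigma>) *\<^sub>R grad F (x, y) + grad f (x, y)
     - (fst (grad f (x, \<theta>)), (1 / \<gamma>1) *\<^sub>R (y - \<theta>)) + (\<Sum>i\<in>UNIV. d_comp (snd \<sigma>) x y z s \<theta> i)"
proof (rule prod_eqI)
  show "fst (d_xy F f g \<gamma>1 \<gamma>2 \<sigma> x y z s \<theta>) = fst ((1 / fst \<sigma>) *\<^sub>R grad F (x, y) + grad f (x, y)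
     - (fst (grad f (x, \<theta>)), (1 / \<gamma>1) *\<^sub>R (y - \<theta>)) + (\<Sum>i\<in>UNIV. d_comp (snd \<sigma>) x y z s \<theta> i))"
    using assms by (simp add: d_xy_def Let_def grad_Lag Lg_def jac_transp_def d_comp_def pen_mult_def fst_sum
        sum.distrib sum_subtractf scaleR_sum_right algebra_simps)
  show "snd (d_xy F f g \<gamma>1 \<gamma>2 \<sigma> x y z s \<theta>) = snd ((1 / fst \<sigma>) *\<^sub>R grad F (x, y) + grad f (x, y)
     - (fst (grad f (x, \<theta>)), (1 / \<gamma>1) *\<^sub>R (y - \<theta>)) + (\<Sum>i\<in>UNIV. d_comp (snd \<sigma>) x y z s \<theta> i))"
    using assms by (simp add: d_xy_def Let_def grad_Lag Lg_def jac_transp_def d_comp_def pen_mult_def snd_sum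
        sum.distrib sum_subtractf scaleR_sum_right algebra_simps)
qed

lemma pair_dist_bounds:
  fixes x x' :: "'a::real_normed_vector" and y y' :: "'b::real_normed_vector"
  shows "norm (x' - x) \<le> norm ((x', y') - (x, y))" "norm (y' - y) \<le> norm ((x', y') - (x, y))"
    "norm ((x', \<theta>) - (x, \<theta>)) \<le> norm ((x', y') - (x, y))"
  using norm_fst_le[of "x' - x" "y' - y"] norm_snd_le[of "y' - y" "x' - x"] by (simp_all add: norm_prod_def)

lemma comp_le: "norm (v :: real^'k) \<le> b \<Longrightarrow> \<bar>v $ i\<bar> \<le> b"
  using component_le_norm_cart[of v i] by linarith

text \<open>Origin of the constant: the multiplier is at most \<open>B + \<gamma>2 * C\<close>, so
  the squared positive part costs \<open>B * C + 2 * \<gamma>2 * C\<^sup>2\<close>; the term at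
  \<open>(x, \<theta>)\<close> costs \<open>B * C\<close>; the penalty costs
  \<open>\<sigma>2 * (2 * C\<^sup>2 + B * C)\<close>, from the coefficient bound
  \<open>C + B\<close> and the squared increment.\<close>

lemma xy_comp_descent:
  assumes C: "C \<ge> 1" "smooth_bound (Xset G \<times> cball 0 B) (\<lambda>w. g w $ i) C"
    and B: "0 \<le> B" and w: "x \<in> Xset G" "norm y \<le> B" "x' \<in> Xset G" "norm y' \<le> B"
    and b: "norm z \<le> B" "norm s \<le> B" "norm \<theta> \<le> B" and \<sigma>2: "0 < \<sigma>2"
  shows "psi_comp \<sigma>2 x' y' z s \<theta> i \<le> psi_comp \<sigma>2 x y z s \<theta> i + d_comp \<sigma>2 x y z s \<theta> i \<bullet> ((x', y') - (x, y))
     + ((2 * B * C + \<gamma>2 * C\<^sup>2 * 2) + \<sigma>2 * (2 * C\<^sup>2 + B * C)) * (norm ((x', y') - (x, y)))\<^sup>2"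
proof -
  let ?w = "(x, y)" and ?w' = "(x', y')"
  let ?\<Delta> = "?w' - ?w"
  let ?N = "norm ?\<Delta>"
  let ?gi = "\<lambda>w. g w $ i"
  have in_K: "?w \<in> Xset G \<times> cball 0 B" "?w' \<in> Xset G \<times> cball 0 B"
    "(x, \<theta>) \<in> Xset G \<times> cball 0 B" "(x', \<theta>) \<in> Xset G \<times> cball 0 B"
    using w b by auto
  have C0: "0 \<le> C" using C by simp
  have z: "\<bar>z $ i\<bar> \<le> B" and s: "\<bar>s $ i\<bar> \<le> B" using b comp_le by auto
  have gb: "\<bar>?gi ?w\<bar> \<le> C" and gl: "\<bar>?gi ?w' - ?gi ?w\<bar> \<le> C * ?N"
    and gq: "\<bar>?gi ?w' - ?gi ?w - Gg i ?w \<bullet> ?\<Delta>\<bar> \<le> C * ?N\<^sup>2"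
    using C(2) in_K(1,2) unfolding smooth_bound_def by blast+
  have gq\<theta>: "\<bar>?gi (x', \<theta>) - ?gi (x, \<theta>) - (fst (Gg i (x, \<theta>)), 0) \<bullet> ?\<Delta>\<bar> \<le> C * ?N\<^sup>2"
  proof -
    have "\<bar>?gi (x', \<theta>) - ?gi (x, \<theta>) - Gg i (x, \<theta>) \<bullet> ((x', \<theta>) - (x, \<theta>))\<bar> \<le> C * (norm ((x', \<theta>) - (x, \<theta>)))\<^sup>2"
      using C(2) in_K(3,4) unfolding smooth_bound_def by blast
    also have "\<dots> \<le> C * ?N\<^sup>2" using pair_dist_bounds(3) C0 by (intro mult_left_mono power_mono) auto
    finally show ?thesis by (simp add: inner_prod_def)
  qed
  have sq: "(?gi ?w' - ?gi ?w)\<^sup>2 \<le> C\<^sup>2 * ?N\<^sup>2"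
    using power_mono[OF gl, of 2] by (simp add: power_mult_distrib)
  let ?l = "pen_mult x y z $ i"
  have l: "\<bar>?l\<bar> \<le> B + \<gamma>2 * C"
  proof -
    have "\<bar>\<gamma>2 * ?gi ?w\<bar> \<le> \<gamma>2 * C" using gb gamma_pos(2) by (simp add: abs_mult)
    then show ?thesis using z unfolding pen_mult_nth by (auto simp: max_def)
  qed
  have P: "((max 0 (z $ i + \<gamma>2 * ?gi ?w'))\<^sup>2 - (z $ i)\<^sup>2) / (2 * \<gamma>2)
      \<le> ((max 0 (z $ i + \<gamma>2 * ?gi ?w))\<^sup>2 - (z $ i)\<^sup>2) / (2 * \<gamma>2) + ?l * (Gg i ?w \<bullet> ?\<Delta>)
        + ((B + \<gamma>2 * C) * C + \<gamma>2 * C\<^sup>2) * ?N\<^sup>2"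
  proof -
    have "(max 0 (z $ i + \<gamma>2 * ?gi ?w'))\<^sup>2
       \<le> (max 0 (z $ i + \<gamma>2 * ?gi ?w))\<^sup>2 + 2 * ?l * (\<gamma>2 * (?gi ?w' - ?gi ?w)) + \<gamma>2\<^sup>2 * (?gi ?w' - ?gi ?w)\<^sup>2"
      using max0_sq_upper[of "z $ i + \<gamma>2 * ?gi ?w'" "z $ i + \<gamma>2 * ?gi ?w"]
      unfolding pen_mult_nth by (simp add: right_diff_distrib[symmetric] power_mult_distrib)
    then have "((max 0 (z $ i + \<gamma>2 * ?gi ?w'))\<^sup>2 - (z $ i)\<^sup>2) / (2 * \<gamma>2)
      \<le> ((max 0 (z $ i + \<gamma>2 * ?gi ?w))\<^sup>2 + 2 * ?l * (\<gamma>2 * (?gi ?w' - ?gi ?w)) + \<gamma>2\<^sup>2 * (?gi ?w' - ?gi ?w)\<^sup>2 - (z $ i)\<^sup>2) / (2 * \<gamma>2)"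
      using gamma_pos(2) by (intro divide_right_mono) auto
    also have "\<dots> = ((max 0 (z $ i + \<gamma>2 * ?gi ?w))\<^sup>2 - (z $ i)\<^sup>2) / (2 * \<gamma>2) + ?l * (?gi ?w' - ?gi ?w) + \<gamma>2 / 2 * (?gi ?w' - ?gi ?w)\<^sup>2"
      using gamma_pos(2) by (simp add: field_simps power2_eq_square)
    also have "\<gamma>2 / 2 * (?gi ?w' - ?gi ?w)\<^sup>2 \<le> \<gamma>2 * (C\<^sup>2 * ?N\<^sup>2)"
      using sq gamma_pos(2) by (intro mult_mono) auto
    finally show ?thesis using quad_term_le[OF gq l C0] by (simp add: algebra_simps)
  qed
  have Z: "- (z $ i * ?gi (x', \<theta>)) \<le> - (z $ i * ?gi (x, \<theta>)) - z $ i * ((fst (Gg i (x, \<theta>)), 0) \<bullet> ?\<Delta>) + B * C * ?N\<^sup>2"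
    using quad_term_le[OF gq\<theta> _ C0, of "- z $ i" B] z by simp
  have S: "(\<sigma>2 / 2) * (?gi ?w' + s $ i)\<^sup>2 \<le> (\<sigma>2 / 2) * (?gi ?w + s $ i)\<^sup>2 + \<sigma>2 * ((?gi ?w + s $ i) * (Gg i ?w \<bullet> ?\<Delta>))
      + \<sigma>2 * (2 * C\<^sup>2 + B * C) * ?N\<^sup>2"
  proof -
    have "\<bar>?gi ?w + s $ i\<bar> \<le> C + B" using gb s by linarith
    from quad_term_le[OF gq this C0]
    have "2 * ((?gi ?w + s $ i) * (?gi ?w' - ?gi ?w)) \<le> 2 * ((?gi ?w + s $ i) * (Gg i ?w \<bullet> ?\<Delta>)) + 2 * ((C + B) * C * ?N\<^sup>2)"
      by (simp add: algebra_simps)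
    moreover have "(?gi ?w' + s $ i)\<^sup>2 = (?gi ?w + s $ i)\<^sup>2 + 2 * ((?gi ?w + s $ i) * (?gi ?w' - ?gi ?w)) + (?gi ?w' - ?gi ?w)\<^sup>2"
      by (simp add: power2_eq_square algebra_simps)
    moreover have "C\<^sup>2 * ?N\<^sup>2 \<le> 2 * (C\<^sup>2 * ?N\<^sup>2)" by simp
    ultimately have "(?gi ?w' + s $ i)\<^sup>2 \<le> (?gi ?w + s $ i)\<^sup>2 + 2 * ((?gi ?w + s $ i) * (Gg i ?w \<bullet> ?\<Delta>))
        + (2 * ((C + B) * C * ?N\<^sup>2) + 2 * (C\<^sup>2 * ?N\<^sup>2))"
      using sq by linarith
    from mult_left_mono[OF this, of "\<sigma>2 / 2"] show ?thesis
      using \<sigma>2 by (simp add: field_simps power2_eq_square)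
  qed
  have d: "d_comp \<sigma>2 x y z s \<theta> i \<bullet> ?\<Delta> = ?l * (Gg i ?w \<bullet> ?\<Delta>) - z $ i * ((fst (Gg i (x, \<theta>)), 0) \<bullet> ?\<Delta>)
     + \<sigma>2 * ((?gi ?w + s $ i) * (Gg i ?w \<bullet> ?\<Delta>))"
    unfolding d_comp_def by (simp only: inner_add_left inner_diff_left inner_scaleR_left)
  show ?thesis
    unfolding d unfolding psi_comp_def using P Z S
    by (simp add: distrib_right power2_eq_square algebra_simps)
qed

text \<open>Besides the constraint terms, \<open>F\<close> contributes
  \<open>C / fst \<sigma>\<close>, and \<open>f\<close> contributes \<open>C\<close> at
  \<open>(x, y)\<close> and again at \<open>(x, \<theta>)\<close>.\<close>

lemma xy_descent:
  assumes C: "C \<ge> 1" "smooth_bound (Omega G) F C" "smooth_bound (Xset G \<times> cball 0 B) f C"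
    "\<And>i. smooth_bound (Xset G \<times> cball 0 B) (\<lambda>w. g w $ i) C"
    and B: "0 \<le> B" and sub: "\<forall>x y. (x, y) \<in> Omega G \<longrightarrow> norm y \<le> B"
    and w: "(x, y) \<in> Omega G" "(x', y') \<in> Omega G"
    and b: "norm z \<le> B" "norm s \<le> B" "norm \<theta> \<le> B" and \<sigma>: "0 < fst \<sigma>" "0 < snd \<sigma>"
  shows "psi_hat F f g \<gamma>1 \<gamma>2 \<sigma> x' y' z s \<theta> \<le> psi_hat F f g \<gamma>1 \<gamma>2 \<sigma> x y z s \<theta>
     + d_xy F f g \<gamma>1 \<gamma>2 \<sigma> x y z s \<theta> \<bullet> ((x', y') - (x, y))
     + (C / fst \<sigma> + 2 * C + real CARD('q) * ((2 * B * C + \<gamma>2 * C\<^sup>2 * 2) + snd \<sigma> * (2 * C\<^sup>2 + B * C)))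
       * (norm ((x', y') - (x, y)))\<^sup>2"
proof -
  let ?w = "(x, y)" and ?w' = "(x', y')"
  let ?\<Delta> = "?w' - ?w"
  let ?N = "norm ?\<Delta>"
  let ?c = "(2 * B * C + \<gamma>2 * C\<^sup>2 * 2) + snd \<sigma> * (2 * C\<^sup>2 + B * C)"
  have x: "x \<in> Xset G" "x' \<in> Xset G" "norm y \<le> B" "norm y' \<le> B" using w Omega_X sub by auto
  have C0: "0 \<le> C" using C by simp
  have "F ?w' \<le> F ?w + grad F ?w \<bullet> ?\<Delta> + C * ?N\<^sup>2"
    using C(2) w unfolding smooth_bound_def by (smt (verit, best))
  then have "(1 / fst \<sigma>) * F ?w' \<le> (1 / fst \<sigma>) * (F ?w + grad F ?w \<bullet> ?\<Delta> + C * ?N\<^sup>2)"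
    using \<sigma> by (intro mult_left_mono) auto
  then have 1: "(1 / fst \<sigma>) * F ?w' \<le> (1 / fst \<sigma>) * F ?w + ((1 / fst \<sigma>) *\<^sub>R grad F ?w) \<bullet> ?\<Delta> + C / fst \<sigma> * ?N\<^sup>2"
    by (simp only: inner_scaleR_left) (simp add: distrib_left)
  have in_K: "?w \<in> Xset G \<times> cball 0 B" "?w' \<in> Xset G \<times> cball 0 B"
    "(x, \<theta>) \<in> Xset G \<times> cball 0 B" "(x', \<theta>) \<in> Xset G \<times> cball 0 B"
    using x b by auto
  have "\<bar>f ?w' - f ?w - grad f ?w \<bullet> ?\<Delta>\<bar> \<le> C * ?N\<^sup>2"
    using C(3) in_K(1,2) unfolding smooth_bound_def by blast
  then have 2: "f ?w' \<le> f ?w + grad f ?w \<bullet> ?\<Delta> + C * ?N\<^sup>2" by linarith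
  have "\<bar>f (x', \<theta>) - f (x, \<theta>) - grad f (x, \<theta>) \<bullet> ((x', \<theta>) - (x, \<theta>))\<bar> \<le> C * (norm ((x', \<theta>) - (x, \<theta>)))\<^sup>2"
    using C(3) in_K(3,4) unfolding smooth_bound_def by blast
  also have "\<dots> \<le> C * ?N\<^sup>2" using pair_dist_bounds(3) C0 by (intro mult_left_mono power_mono) auto
  finally have 3: "- f (x', \<theta>) \<le> - f (x, \<theta>) - fst (grad f (x, \<theta>)) \<bullet> (x' - x) + C * ?N\<^sup>2"
    by (simp add: inner_prod_def)
  have "(norm (\<theta> - y'))\<^sup>2 = (norm (\<theta> - y))\<^sup>2 - 2 * ((\<theta> - y) \<bullet> (y' - y)) + (norm (y' - y))\<^sup>2"
    unfolding power2_norm_eq_inner by (simp add: algebra_simps inner_commute)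
  then have "(norm (\<theta> - y'))\<^sup>2 \<ge> (norm (\<theta> - y))\<^sup>2 - 2 * ((\<theta> - y) \<bullet> (y' - y))" by simp
  then have "(norm (\<theta> - y'))\<^sup>2 / (2 * \<gamma>1) \<ge> ((norm (\<theta> - y))\<^sup>2 - 2 * ((\<theta> - y) \<bullet> (y' - y))) / (2 * \<gamma>1)"
    using gamma_pos by (intro divide_right_mono) auto
  moreover have "((1 / \<gamma>1) *\<^sub>R (y - \<theta>)) \<bullet> (y' - y) = - (((\<theta> - y) \<bullet> (y' - y)) / \<gamma>1)"
    by (simp only: inner_scaleR_left) (simp add: inner_diff_left diff_divide_distrib)
  ultimately have 4: "- ((norm (\<theta> - y'))\<^sup>2 / (2 * \<gamma>1)) \<le> - ((norm (\<theta> - y))\<^sup>2 / (2 * \<gamma>1)) - ((1 / \<gamma>1) *\<^sub>R (y - \<theta>)) \<bullet> (y' - y)"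
    by (simp add: diff_divide_distrib)
  have "(\<Sum>i\<in>UNIV. psi_comp (snd \<sigma>) x' y' z s \<theta> i)
     \<le> (\<Sum>i\<in>UNIV. psi_comp (snd \<sigma>) x y z s \<theta> i + d_comp (snd \<sigma>) x y z s \<theta> i \<bullet> ?\<Delta> + ?c * ?N\<^sup>2)"
    by (intro sum_mono xy_comp_descent C B x b \<sigma>)
  also have "\<dots> = (\<Sum>i\<in>UNIV. psi_comp (snd \<sigma>) x y z s \<theta> i) + (\<Sum>i\<in>UNIV. d_comp (snd \<sigma>) x y z s \<theta> i) \<bullet> ?\<Delta> + real CARD('q) * ?c * ?N\<^sup>2"
    by (simp only: sum.distrib inner_sum_left sum_constant mult.assoc)
  finally have 5: "(\<Sum>i\<in>UNIV. psi_comp (snd \<sigma>) x' y' z s \<theta> i)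
    \<le> (\<Sum>i\<in>UNIV. psi_comp (snd \<sigma>) x y z s \<theta> i) + (\<Sum>i\<in>UNIV. d_comp (snd \<sigma>) x y z s \<theta> i) \<bullet> ?\<Delta> + real CARD('q) * ?c * ?N\<^sup>2" .
  have d: "d_xy F f g \<gamma>1 \<gamma>2 \<sigma> x y z s \<theta> \<bullet> ?\<Delta> = ((1 / fst \<sigma>) *\<^sub>R grad F ?w) \<bullet> ?\<Delta> + grad f ?w \<bullet> ?\<Delta>
     - fst (grad f (x, \<theta>)) \<bullet> (x' - x) - ((1 / \<gamma>1) *\<^sub>R (y - \<theta>)) \<bullet> (y' - y) + (\<Sum>i\<in>UNIV. d_comp (snd \<sigma>) x y z s \<theta> i) \<bullet> ?\<Delta>"
    unfolding d_xy_eq[OF x(1)] inner_add_left inner_diff_left[of _ _ ?\<Delta>]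
    by (simp add: inner_prod_def[of "(_, _)"] del: inner_scaleR_left)
  have "(C / fst \<sigma> + 2 * C + real CARD('q) * ?c) * ?N\<^sup>2
    = C / fst \<sigma> * ?N\<^sup>2 + C * ?N\<^sup>2 + C * ?N\<^sup>2 + real CARD('q) * ?c * ?N\<^sup>2"
    by (simp only: distrib_right)
  then show ?thesis unfolding psi_hat_eq d using 1 2 3 4 5 by linarith
qed

end

section \<open>Lipschitz estimates for the \<open>(x, y)\<close>-direction and the residual\<close>

context bilevel
begin

lemma pen_mult_lipschitz:
  assumes C: "smooth_bound (Xset G \<times> cball 0 B) (\<lambda>w. g w $ i) C"
    and w: "x \<in> Xset G" "norm y \<le> B" "x' \<in> Xset G" "norm y' \<le> B" and D: "norm ((x', y') - (x, y)) \<le> D" "norm (z' - z) \<le> D"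
    and C1: "1 \<le> C"
  shows "\<bar>pen_mult x' y' z' $ i - pen_mult x y z $ i\<bar> \<le> (1 + \<gamma>2 * C) * D"
proof -
  have "\<bar>g (x', y') $ i - g (x, y) $ i\<bar> \<le> C * norm ((x', y') - (x, y))"
  proof -
    have "(x, y) \<in> Xset G \<times> cball 0 B" "(x', y') \<in> Xset G \<times> cball 0 B" using w by auto
    then show ?thesis using C unfolding smooth_bound_def by blast
  qed
  also have "\<dots> \<le> C * D" using D C1 by (intro mult_left_mono) auto
  finally have "\<bar>\<gamma>2 * g (x', y') $ i - \<gamma>2 * g (x, y) $ i\<bar> \<le> \<gamma>2 * (C * D)"
    using gamma_pos by (simp add: right_diff_distrib[symmetric] abs_mult)
  moreover have "\<bar>z' $ i - z $ i\<bar> \<le> D" using comp_le[OF D(2)] by simp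
  ultimately have "\<bar>(z' $ i + \<gamma>2 * g (x', y') $ i) - (z $ i + \<gamma>2 * g (x, y) $ i)\<bar> \<le> D + \<gamma>2 * (C * D)" by linarith
  then show ?thesis
    using max0_lipschitz[of "z' $ i + \<gamma>2 * g (x', y') $ i" "z $ i + \<gamma>2 * g (x, y) $ i"]
    unfolding pen_mult_nth by (simp add: algebra_simps)
qed

lemma pen_mult_bound:
  assumes C: "smooth_bound (Xset G \<times> cball 0 B) (\<lambda>w. g w $ i) C"
    and w: "x \<in> Xset G" "norm y \<le> B" and z: "norm z \<le> B"
  shows "\<bar>pen_mult x y z $ i\<bar> \<le> B + \<gamma>2 * C"
proof -
  have "\<bar>g (x, y) $ i\<bar> \<le> C" using C w unfolding smooth_bound_def by auto
  then have "\<bar>\<gamma>2 * g (x, y) $ i\<bar> \<le> \<gamma>2 * C" using gamma_pos(2) by (simp add: abs_mult)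
  then show ?thesis using comp_le[OF z, of i] unfolding pen_mult_nth by (auto simp: max_def)
qed

lemma norm_fst_snd_le:
  fixes p :: "'a::real_normed_vector \<times> 'b::real_normed_vector"
  shows "norm (fst p) \<le> norm p" "norm (snd p) \<le> norm p"
  by (metis norm_fst_le norm_snd_le prod.collapse)+

lemma norm_pair_zero: "norm ((a, 0) :: 'a::real_normed_vector \<times> 'b::real_normed_vector) = norm a"
  "norm ((0, b) :: 'a \<times> 'b) = norm b"
  by (simp_all add: norm_prod_def)

text \<open>The movement \<open>T\<close> of \<open>\<theta>\<close> is kept apart from the movement
  \<open>D\<close> of the other variables: \<open>\<theta>\<close> does not occur in the penalty
  term, so \<open>T\<close> carries no factor \<open>\<sigma>2\<close>. The stopping test controls
  the two movements at different scales.\<close>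

lemma d_comp_lipschitz:
  assumes C: "C \<ge> 1" "smooth_bound (Xset G \<times> cball 0 B) (\<lambda>w. g w $ i) C"
    and B: "0 \<le> B" and w: "x \<in> Xset G" "norm y \<le> B" "x' \<in> Xset G" "norm y' \<le> B"
    and b: "norm z \<le> B" "norm s \<le> B" "norm \<theta> \<le> B" "norm z' \<le> B" "norm s' \<le> B" "norm \<theta>' \<le> B" and \<sigma>2: "0 < \<sigma>2"
    and D: "norm ((x', y') - (x, y)) \<le> D" "norm (z' - z) \<le> D" "norm (s' - s) \<le> D" and T: "norm (\<theta>' - \<theta>) \<le> T"
  shows "norm (d_comp \<sigma>2 x' y' z' s' \<theta>' i - d_comp \<sigma>2 x y z s \<theta> i)
    \<le> ((B + \<gamma>2 * C) * C + (1 + \<gamma>2 * C) * C + B * C + C) * D + B * C * T + \<sigma>2 * (((C + B) * C + (C + 1) * C) * D)"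
proof -
  have C0: "0 \<le> C" using C by simp
  have D0: "0 \<le> D" using D(1) norm_ge_zero order_trans by blast
  have T0: "0 \<le> T" using T norm_ge_zero order_trans by blast
  have in_K: "(x, y) \<in> Xset G \<times> cball 0 B" "(x', y') \<in> Xset G \<times> cball 0 B"
    "(x, \<theta>) \<in> Xset G \<times> cball 0 B" "(x', \<theta>') \<in> Xset G \<times> cball 0 B"
    using w b by auto
  have sm: "\<bar>g w $ i\<bar> \<le> C \<and> norm (Gg i w) \<le> C \<and> \<bar>g w' $ i - g w $ i\<bar> \<le> C * norm (w' - w) \<and>
      norm (Gg i w' - Gg i w) \<le> C * norm (w' - w)"
    if "w \<in> Xset G \<times> cball 0 B" "w' \<in> Xset G \<times> cball 0 B" for w w'
    using C(2) that unfolding smooth_bound_def by blast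
  have CD: "C * norm ((x', y') - (x, y)) \<le> C * D" using D C0 by (intro mult_left_mono) auto
  have G1: "norm (Gg i (x', y') - Gg i (x, y)) \<le> C * D" and g1: "\<bar>g (x', y') $ i - g (x, y) $ i\<bar> \<le> C * D"
    using sm[OF in_K(1,2)] CD by linarith+
  have "norm ((x', \<theta>') - (x, \<theta>)) \<le> norm (x' - x) + norm (\<theta>' - \<theta>)"
    using norm_Pair_le[of "x' - x" "\<theta>' - \<theta>"] by simp
  also have "\<dots> \<le> D + T" using D(1) T pair_dist_bounds(1)[of x' x y' y] by linarith
  finally have "C * norm ((x', \<theta>') - (x, \<theta>)) \<le> C * (D + T)" using C0 by (intro mult_left_mono) auto
  then have G2: "norm (Gg i (x', \<theta>') - Gg i (x, \<theta>)) \<le> C * (D + T)"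
    using sm[OF in_K(3,4)] by linarith
  have z: "\<bar>z' $ i\<bar> \<le> B" "\<bar>s' $ i\<bar> \<le> B" and dz: "\<bar>z' $ i - z $ i\<bar> \<le> D" "\<bar>s' $ i - s $ i\<bar> \<le> D"
    using comp_le[OF b(4)] comp_le[OF b(5)] comp_le[OF D(2)] comp_le[OF D(3)] by auto
  have 1: "norm (pen_mult x' y' z' $ i *\<^sub>R Gg i (x', y') - pen_mult x y z $ i *\<^sub>R Gg i (x, y))
     \<le> (B + \<gamma>2 * C) * (C * D) + ((1 + \<gamma>2 * C) * D) * C"
  proof (rule scaleR_diff_bound)
    show "\<bar>pen_mult x' y' z' $ i\<bar> \<le> B + \<gamma>2 * C" by (rule pen_mult_bound[OF C(2) w(3,4) b(4)])
    show "\<bar>pen_mult x' y' z' $ i - pen_mult x y z $ i\<bar> \<le> (1 + \<gamma>2 * C) * D"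
      by (rule pen_mult_lipschitz[OF C(2) w D(1,2) C(1)])
  qed (use sm[OF in_K(1,2)] G1 B C0 gamma_pos in auto)
  have 2: "norm (z' $ i *\<^sub>R (fst (Gg i (x', \<theta>')), 0 :: real^'m) - z $ i *\<^sub>R (fst (Gg i (x, \<theta>)), 0))
     \<le> B * (C * (D + T)) + D * C"
  proof (rule scaleR_diff_bound)
    have "norm ((fst (Gg i (x', \<theta>')), 0 :: real^'m) - (fst (Gg i (x, \<theta>)), 0)) \<le> norm (Gg i (x', \<theta>') - Gg i (x, \<theta>))"
      using norm_fst_snd_le(1)[of "Gg i (x', \<theta>') - Gg i (x, \<theta>)"]
      by (simp add: norm_pair_zero)
    then show "norm ((fst (Gg i (x', \<theta>')), 0 :: real^'m) - (fst (Gg i (x, \<theta>)), 0)) \<le> C * (D + T)" using G2 by linarith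
    show "norm (fst (Gg i (x, \<theta>)), 0 :: real^'m) \<le> C"
      using norm_fst_snd_le(1)[of "Gg i (x, \<theta>)"] sm[OF in_K(3,3)] by (simp add: norm_pair_zero)
  qed (use z dz B C0 in auto)
  have 3: "norm ((g (x', y') $ i + s' $ i) *\<^sub>R Gg i (x', y') - (g (x, y) $ i + s $ i) *\<^sub>R Gg i (x, y))
     \<le> (C + B) * (C * D) + (C * D + D) * C"
  proof (rule scaleR_diff_bound)
    show "\<bar>g (x', y') $ i + s' $ i\<bar> \<le> C + B" using sm[OF in_K(2,2)] z by linarith
    show "\<bar>g (x', y') $ i + s' $ i - (g (x, y) $ i + s $ i)\<bar> \<le> C * D + D" using g1 dz by linarith
  qed (use sm[OF in_K(1,2)] G1 B C0 in auto)
  have eq: "d_comp \<sigma>2 x' y' z' s' \<theta>' i - d_comp \<sigma>2 x y z s \<theta> i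
    = (pen_mult x' y' z' $ i *\<^sub>R Gg i (x', y') - pen_mult x y z $ i *\<^sub>R Gg i (x, y))
      - (z' $ i *\<^sub>R (fst (Gg i (x', \<theta>')), 0) - z $ i *\<^sub>R (fst (Gg i (x, \<theta>)), 0))
      + \<sigma>2 *\<^sub>R ((g (x', y') $ i + s' $ i) *\<^sub>R Gg i (x', y') - (g (x, y) $ i + s $ i) *\<^sub>R Gg i (x, y))"
    (is "_ = ?a - ?b + \<sigma>2 *\<^sub>R ?c")
    unfolding d_comp_def scaleR_diff_right[of \<sigma>2] by simp
  have "norm (?a - ?b + \<sigma>2 *\<^sub>R ?c) \<le> norm ?a + norm ?b + \<sigma>2 * norm ?c"
    using norm_triangle_ineq[of "?a - ?b" "\<sigma>2 *\<^sub>R ?c"] norm_triangle_ineq4[of ?a ?b] \<sigma>2 by simp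
  moreover have "\<sigma>2 * norm ?c \<le> \<sigma>2 * ((C + B) * (C * D) + (C * D + D) * C)"
    using 3 \<sigma>2 by (intro mult_left_mono) auto
  ultimately have "norm (d_comp \<sigma>2 x' y' z' s' \<theta>' i - d_comp \<sigma>2 x y z s \<theta> i)
    \<le> ((B + \<gamma>2 * C) * (C * D) + ((1 + \<gamma>2 * C) * D) * C) + (B * (C * (D + T)) + D * C) + \<sigma>2 * ((C + B) * (C * D) + (C * D + D) * C)"
    unfolding eq using 1 2 by linarith
  then show ?thesis by (simp add: algebra_simps)
qed

lemma d_xy_lipschitz:
  assumes C: "C \<ge> 1" "smooth_bound (Omega G) F C" "smooth_bound (Xset G \<times> cball 0 B) f C"
    "\<And>i. smooth_bound (Xset G \<times> cball 0 B) (\<lambda>w. g w $ i) C"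
    and B: "0 \<le> B" and sub: "\<forall>x y. (x, y) \<in> Omega G \<longrightarrow> norm y \<le> B"
    and w: "(x, y) \<in> Omega G" "(x', y') \<in> Omega G"
    and b: "norm z \<le> B" "norm s \<le> B" "norm \<theta> \<le> B" "norm z' \<le> B" "norm s' \<le> B" "norm \<theta>' \<le> B"
    and \<sigma>: "0 < fst \<sigma>" "0 < snd \<sigma>"
    and D: "norm ((x', y') - (x, y)) \<le> D" "norm (z' - z) \<le> D" "norm (s' - s) \<le> D" and T: "norm (\<theta>' - \<theta>) \<le> T"
  shows "norm (d_xy F f g \<gamma>1 \<gamma>2 \<sigma> x' y' z' s' \<theta>' - d_xy F f g \<gamma>1 \<gamma>2 \<sigma> x y z s \<theta>)
    \<le> (C / fst \<sigma> + 2 * C + 1 / \<gamma>1) * D + (C + 1 / \<gamma>1) * T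
      + real CARD('q) * (((B + \<gamma>2 * C) * C + (1 + \<gamma>2 * C) * C + B * C + C) * D + B * C * T + snd \<sigma> * (((C + B) * C + (C + 1) * C) * D))"
proof -
  have x: "x \<in> Xset G" "x' \<in> Xset G" "norm y \<le> B" "norm y' \<le> B" using w Omega_X sub by auto
  have C0: "0 \<le> C" using C by simp
  have in_K: "(x, y) \<in> Xset G \<times> cball 0 B" "(x', y') \<in> Xset G \<times> cball 0 B"
    "(x, \<theta>) \<in> Xset G \<times> cball 0 B" "(x', \<theta>') \<in> Xset G \<times> cball 0 B"
    using x b by auto
  have CD: "C * norm ((x', y') - (x, y)) \<le> C * D" using D C0 by (intro mult_left_mono) auto
  have 1: "norm (grad F (x', y') - grad F (x, y)) \<le> C * D"
  proof -
    have "norm (grad F (x', y') - grad F (x, y)) \<le> C * norm ((x', y') - (x, y))"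
      using C(2) w unfolding smooth_bound_def by blast
    then show ?thesis using CD by linarith
  qed
  have f: "norm (grad f w' - grad f w) \<le> C * norm (w' - w)"
    if "w \<in> Xset G \<times> cball 0 B" "w' \<in> Xset G \<times> cball 0 B" for w w'
    using C(3) that unfolding smooth_bound_def by blast
  have 2: "norm (grad f (x', y') - grad f (x, y)) \<le> C * D" using f[OF in_K(1,2)] CD by linarith
  have "norm ((x', \<theta>') - (x, \<theta>)) \<le> norm (x' - x) + norm (\<theta>' - \<theta>)"
    using norm_Pair_le[of "x' - x" "\<theta>' - \<theta>"] by simp
  also have "\<dots> \<le> D + T" using D(1) T pair_dist_bounds(1)[of x' x y' y] by linarith
  finally have "C * norm ((x', \<theta>') - (x, \<theta>)) \<le> C * (D + T)" using C0 by (intro mult_left_mono) auto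
  then have G2: "norm (grad f (x', \<theta>') - grad f (x, \<theta>)) \<le> C * (D + T)"
    using f[OF in_K(3,4)] by linarith
  let ?h = "(fst (grad f (x', \<theta>')), (1 / \<gamma>1) *\<^sub>R (y' - \<theta>')) - (fst (grad f (x, \<theta>)), (1 / \<gamma>1) *\<^sub>R (y - \<theta>))"
  have 3: "norm ?h \<le> C * (D + T) + (1 / \<gamma>1) * (D + T)"
  proof -
    have "norm ?h \<le> norm (fst (grad f (x', \<theta>') - grad f (x, \<theta>))) + norm ((1 / \<gamma>1) *\<^sub>R ((y' - y) - (\<theta>' - \<theta>)))"
      using norm_Pair_le[of "fst ?h" "snd ?h"] by (simp add: algebra_simps)
    moreover have "norm (fst (grad f (x', \<theta>') - grad f (x, \<theta>))) \<le> C * (D + T)"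
      using norm_fst_snd_le(1)[of "grad f (x', \<theta>') - grad f (x, \<theta>)"] G2 by linarith
    moreover have "norm ((y' - y) - (\<theta>' - \<theta>)) \<le> D + T"
      using norm_triangle_ineq4[of "y' - y" "\<theta>' - \<theta>"] pair_dist_bounds(2)[of y' y x' x] D(1) T by linarith
    then have "norm ((1 / \<gamma>1) *\<^sub>R ((y' - y) - (\<theta>' - \<theta>))) \<le> (1 / \<gamma>1) * (D + T)"
      using gamma_pos unfolding norm_scaleR by (intro mult_mono) auto
    ultimately show ?thesis by linarith
  qed
  let ?c = "(((B + \<gamma>2 * C) * C + (1 + \<gamma>2 * C) * C + B * C + C) * D + B * C * T + snd \<sigma> * (((C + B) * C + (C + 1) * C) * D))"
  let ?e = "\<Sum>i\<in>UNIV. d_comp (snd \<sigma>) x' y' z' s' \<theta>' i - d_comp (snd \<sigma>) x y z s \<theta> i"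
  have 4: "norm ?e \<le> real CARD('q) * ?c"
    by (intro norm_sum_le d_comp_lipschitz C B x b \<sigma> D T)
  have eq: "d_xy F f g \<gamma>1 \<gamma>2 \<sigma> x' y' z' s' \<theta>' - d_xy F f g \<gamma>1 \<gamma>2 \<sigma> x y z s \<theta>
    = (1 / fst \<sigma>) *\<^sub>R (grad F (x', y') - grad F (x, y)) + (grad f (x', y') - grad f (x, y)) - ?h + ?e"
    unfolding d_xy_eq[OF x(1)] d_xy_eq[OF x(2)] sum_subtractf scaleR_diff_right[of "1 / fst \<sigma>"] by simp
  have "norm ((1 / fst \<sigma>) *\<^sub>R (grad F (x', y') - grad F (x, y)) + (grad f (x', y') - grad f (x, y)) - ?h + ?e)
     \<le> norm ((1 / fst \<sigma>) *\<^sub>R (grad F (x', y') - grad F (x, y))) + norm (grad f (x', y') - grad f (x, y)) + norm ?h + norm ?e"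
    using norm_triangle_ineq[of "(1 / fst \<sigma>) *\<^sub>R (grad F (x', y') - grad F (x, y)) + (grad f (x', y') - grad f (x, y)) - ?h" ?e]
      norm_triangle_ineq4[of "(1 / fst \<sigma>) *\<^sub>R (grad F (x', y') - grad F (x, y)) + (grad f (x', y') - grad f (x, y))" ?h]
      norm_triangle_ineq[of "(1 / fst \<sigma>) *\<^sub>R (grad F (x', y') - grad F (x, y))" "grad f (x', y') - grad f (x, y)"]
    by linarith
  moreover have "norm ((1 / fst \<sigma>) *\<^sub>R (grad F (x', y') - grad F (x, y))) \<le> (1 / fst \<sigma>) * (C * D)"
    using 1 \<sigma> unfolding norm_scaleR by (intro mult_mono) auto
  ultimately have "norm (d_xy F f g \<gamma>1 \<gamma>2 \<sigma> x' y' z' s' \<theta>' - d_xy F f g \<gamma>1 \<gamma>2 \<sigma> x y z s \<theta>)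
    \<le> (1 / fst \<sigma>) * (C * D) + C * D + (C * (D + T) + (1 / \<gamma>1) * (D + T)) + real CARD('q) * ?c"
    unfolding eq using 2 3 4 by linarith
  also have "(1 / fst \<sigma>) * (C * D) + C * D + (C * (D + T) + (1 / \<gamma>1) * (D + T))
     = (C / fst \<sigma> + 2 * C + 1 / \<gamma>1) * D + (C + 1 / \<gamma>1) * T"
    by (simp add: algebra_simps add_divide_distrib)
  finally show ?thesis .
qed

text \<open>The products are split such that only \<open>z\<close>, not \<open>z'\<close>, needs the
  bound \<open>B\<close>: trial points of the line search are bounded a priori only by the growing
  truncation bound.\<close>

lemma resid_lipschitz:
  assumes C: "C \<ge> 1" "smooth_bound (Xset G \<times> cball 0 B) f C"
    "\<And>i. smooth_bound (Xset G \<times> cball 0 B) (\<lambda>w. g w $ i) C"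
    and B: "0 \<le> B" and x: "x \<in> Xset G" "x' \<in> Xset G" and b: "norm z \<le> B" "norm \<theta> \<le> B"
  shows "\<bar>resid f g \<gamma>1 \<theta> x' y' z' - resid f g \<gamma>1 \<theta> x y z\<bar>
    \<le> (C + 1 / \<gamma>1 + real CARD('q) * (B * C + C)) * (norm ((x', y') - (x, y)) + norm (z' - z))"
proof -
  let ?D = "norm ((x', y') - (x, y)) + norm (z' - z)"
  have C0: "0 \<le> C" using C by simp
  have in_K: "(x, \<theta>) \<in> Xset G \<times> cball 0 B" "(x', \<theta>) \<in> Xset G \<times> cball 0 B" using x b by auto
  have N: "norm ((x', \<theta>) - (x, \<theta>)) \<le> ?D" using pair_dist_bounds(3)[of x' \<theta> x y' y] norm_ge_zero[of "z' - z"] by linarith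
  have f: "norm (grad f (x', \<theta>) - grad f (x, \<theta>)) \<le> C * ?D"
  proof -
    have "norm (grad f (x', \<theta>) - grad f (x, \<theta>)) \<le> C * norm ((x', \<theta>) - (x, \<theta>))"
      using C(2) in_K unfolding smooth_bound_def by blast
    also have "\<dots> \<le> C * ?D" by (rule mult_left_mono[OF N C0])
    finally show ?thesis .
  qed
  have g: "norm (z $ i *\<^sub>R Gg i (x, \<theta>) - z' $ i *\<^sub>R Gg i (x', \<theta>)) \<le> B * (C * ?D) + ?D * C" for i
  proof (rule scaleR_diff_bound)
    have "norm (Gg i (x, \<theta>) - Gg i (x', \<theta>)) \<le> C * norm ((x, \<theta>) - (x', \<theta>))"
      using C(3)[of i] in_K unfolding smooth_bound_def by blast
    also have "\<dots> \<le> C * ?D" by (metis N C0 mult_left_mono norm_minus_commute)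
    finally show "norm (Gg i (x, \<theta>) - Gg i (x', \<theta>)) \<le> C * ?D" .
    show "norm (Gg i (x', \<theta>)) \<le> C" using C(3)[of i] in_K unfolding smooth_bound_def by blast
    have "norm (z - z') \<le> ?D" by (simp add: norm_minus_commute)
    then show "\<bar>z $ i - z' $ i\<bar> \<le> ?D" using comp_le by fastforce
  qed (use B C0 comp_le[OF b(1)] in auto)
  have eq: "prox_grad x' y' z' \<theta> - prox_grad x y z \<theta>
    = snd ((grad f (x', \<theta>) - grad f (x, \<theta>)) - (\<Sum>i\<in>UNIV. z $ i *\<^sub>R Gg i (x, \<theta>) - z' $ i *\<^sub>R Gg i (x', \<theta>)))
      - (1 / \<gamma>1) *\<^sub>R (y' - y)"
    unfolding prox_grad_def Lg_def by (simp add: sum_subtractf algebra_simps)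
  have "norm (snd ((grad f (x', \<theta>) - grad f (x, \<theta>)) - (\<Sum>i\<in>UNIV. z $ i *\<^sub>R Gg i (x, \<theta>) - z' $ i *\<^sub>R Gg i (x', \<theta>))))
    \<le> C * ?D + real CARD('q) * (B * (C * ?D) + ?D * C)" (is "norm (snd ?v) \<le> _")
  proof -
    have "norm (snd ?v) \<le> norm ?v" by (rule norm_fst_snd_le)
    also have "\<dots> \<le> norm (grad f (x', \<theta>) - grad f (x, \<theta>)) + norm (\<Sum>i\<in>UNIV. z $ i *\<^sub>R Gg i (x, \<theta>) - z' $ i *\<^sub>R Gg i (x', \<theta>))"
      by (rule norm_triangle_ineq4)
    also have "\<dots> \<le> C * ?D + real CARD('q) * (B * (C * ?D) + ?D * C)"
      by (intro add_mono f norm_sum_le g)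
    finally show ?thesis .
  qed
  moreover have "norm ((1 / \<gamma>1) *\<^sub>R (y' - y)) \<le> (1 / \<gamma>1) * ?D"
    unfolding norm_scaleR using gamma_pos pair_dist_bounds(2)[of y' y x' x]
    by (intro mult_mono) (auto intro: add_increasing2)
  ultimately have "norm (prox_grad x' y' z' \<theta> - prox_grad x y z \<theta>)
    \<le> C * ?D + real CARD('q) * (B * (C * ?D) + ?D * C) + (1 / \<gamma>1) * ?D"
    using norm_triangle_ineq4[of "snd ((grad f (x', \<theta>) - grad f (x, \<theta>)) - (\<Sum>i\<in>UNIV. z $ i *\<^sub>R Gg i (x, \<theta>) - z' $ i *\<^sub>R Gg i (x', \<theta>)))" "(1 / \<gamma>1) *\<^sub>R (y' - y)"]
    unfolding eq by linarith
  also have "\<dots> = (C + 1 / \<gamma>1 + real CARD('q) * (B * C + C)) * ?D" by (simp add: algebra_simps)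
  finally show ?thesis
    unfolding resid_eq[OF x(1)] resid_eq[OF x(2)] using norm_triangle_ineq3 order_trans by blast
qed

section \<open>Derivative, descent and Lipschitz estimates in \<open>(z, s)\<close>\<close>

lemma GDERIV_penP:
  "GDERIV (\<lambda>z'. penP g \<gamma>2 x y z') z :> (1 / \<gamma>2) *\<^sub>R (pen_mult x y z - z)"
proof (rule GDERIV_of_quadratic_bound)
  fix z'
  let ?c = "\<lambda>i. \<gamma>2 * g (x, y) $ i"
  let ?q = "\<lambda>i. ((max 0 (z' $ i + ?c i))\<^sup>2 - (max 0 (z $ i + ?c i))\<^sup>2 - 2 * max 0 (z $ i + ?c i) * (z' $ i - z $ i) - (z' $ i - z $ i)\<^sup>2) / (2 * \<gamma>2)"
  have "penP g \<gamma>2 x y z' - penP g \<gamma>2 x y z - ((1 / \<gamma>2) *\<^sub>R (pen_mult x y z - z)) \<bullet> (z' - z) = (\<Sum>i\<in>UNIV. ?q i)"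
    unfolding penP_sum inner_vec_def sum_subtractf[symmetric]
  proof (rule sum.cong)
    fix i
    show "((max 0 (z' $ i + ?c i))\<^sup>2 - (z' $ i)\<^sup>2) / (2 * \<gamma>2) - ((max 0 (z $ i + ?c i))\<^sup>2 - (z $ i)\<^sup>2) / (2 * \<gamma>2)
      - ((1 / \<gamma>2) *\<^sub>R (pen_mult x y z - z)) $ i \<bullet> (z' - z) $ i = ?q i"
      using gamma_pos by (simp add: pen_mult_nth field_simps power2_eq_square)
  qed simp
  moreover have "norm (\<Sum>i\<in>UNIV. ?q i) \<le> real CARD('q) * (1 / (2 * \<gamma>2) * (norm (z' - z))\<^sup>2)"
  proof (rule norm_sum_le)
    fix i
    let ?p = "(max 0 (z' $ i + ?c i))\<^sup>2 - (max 0 (z $ i + ?c i))\<^sup>2 - 2 * max 0 (z $ i + ?c i) * (z' $ i - z $ i) - (z' $ i - z $ i)\<^sup>2"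
    have "(z' $ i - z $ i)\<^sup>2 \<le> (norm (z' - z))\<^sup>2"
      using component_le_norm_cart[of "z' - z" i] by (simp add: abs_le_square_iff[symmetric])
    moreover have "- ((z' $ i - z $ i)\<^sup>2) \<le> (max 0 (z' $ i + ?c i))\<^sup>2 - (max 0 (z $ i + ?c i))\<^sup>2 - 2 * max 0 (z $ i + ?c i) * (z' $ i - z $ i) - (z' $ i - z $ i)\<^sup>2"
      "(max 0 (z' $ i + ?c i))\<^sup>2 - (max 0 (z $ i + ?c i))\<^sup>2 - 2 * max 0 (z $ i + ?c i) * (z' $ i - z $ i) - (z' $ i - z $ i)\<^sup>2 \<le> 0"
      using max0_sq_upper[of "z' $ i + ?c i" "z $ i + ?c i"] max0_sq_lower[of "z $ i + ?c i" "z' $ i + ?c i"] by auto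
    ultimately have "\<bar>?p\<bar> \<le> (norm (z' - z))\<^sup>2" by linarith
    then have "\<bar>?p\<bar> / (2 * \<gamma>2) \<le> (norm (z' - z))\<^sup>2 / (2 * \<gamma>2)" using gamma_pos(2) by (intro divide_right_mono) auto
    then show "norm (?q i) \<le> 1 / (2 * \<gamma>2) * (norm (z' - z))\<^sup>2"
      using gamma_pos(2) unfolding real_norm_def abs_divide by simp
  qed
  ultimately show "\<bar>penP g \<gamma>2 x y z' - penP g \<gamma>2 x y z - ((1 / \<gamma>2) *\<^sub>R (pen_mult x y z - z)) \<bullet> (z' - z)\<bar>
      \<le> (real CARD('q) * (1 / (2 * \<gamma>2))) * (norm (z' - z))\<^sup>2" by simp
qed

lemma d_zs_eq:
  "d_zs g \<gamma>2 \<sigma> x y z s \<theta> = ((1 / \<gamma>2) *\<^sub>R (pen_mult x y z - z) - g (x, \<theta>), snd \<sigma> *\<^sub>R (g (x, y) + s))"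
  unfolding d_zs_def grad_eqI[OF GDERIV_penP] ..

text \<open>As a function of \<open>z\<close>, \<open>penP\<close> is concave: the squared positive
  part curves upward at most as much as the subtracted square of \<open>z\<close>. The tangent is
  therefore an upper bound without remainder.\<close>

lemma penP_upper:
  "penP g \<gamma>2 x y z' \<le> penP g \<gamma>2 x y z + ((1 / \<gamma>2) *\<^sub>R (pen_mult x y z - z)) \<bullet> (z' - z)"
proof -
  let ?c = "\<lambda>i. \<gamma>2 * g (x, y) $ i"
  have "penP g \<gamma>2 x y z' \<le> (\<Sum>i\<in>UNIV. ((max 0 (z $ i + ?c i))\<^sup>2 - (z $ i)\<^sup>2) / (2 * \<gamma>2)
     + ((1 / \<gamma>2) *\<^sub>R (pen_mult x y z - z)) $ i \<bullet> (z' - z) $ i)"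
    unfolding penP_sum
  proof (rule sum_mono)
    fix i
    have "(max 0 (z' $ i + ?c i))\<^sup>2 - (z' $ i)\<^sup>2 \<le> (max 0 (z $ i + ?c i))\<^sup>2 - (z $ i)\<^sup>2 + 2 * ((max 0 (z $ i + ?c i) - z $ i) * (z' $ i - z $ i))"
      using max0_sq_upper[of "z' $ i + ?c i" "z $ i + ?c i"] by (simp add: power2_eq_square algebra_simps)
    then have "((max 0 (z' $ i + ?c i))\<^sup>2 - (z' $ i)\<^sup>2) / (2 * \<gamma>2) \<le> ((max 0 (z $ i + ?c i))\<^sup>2 - (z $ i)\<^sup>2 + 2 * ((max 0 (z $ i + ?c i) - z $ i) * (z' $ i - z $ i))) / (2 * \<gamma>2)"
      using gamma_pos by (intro divide_right_mono) auto
    then show "((max 0 (z' $ i + ?c i))\<^sup>2 - (z' $ i)\<^sup>2) / (2 * \<gamma>2) \<le> ((max 0 (z $ i + ?c i))\<^sup>2 - (z $ i)\<^sup>2) / (2 * \<gamma>2)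
     + ((1 / \<gamma>2) *\<^sub>R (pen_mult x y z - z)) $ i \<bullet> (z' - z) $ i"
      by (simp add: pen_mult_nth add_divide_distrib)
  qed
  then show ?thesis by (simp add: sum.distrib penP_sum inner_vec_def)
qed

text \<open>\<open>penP\<close> is concave in \<open>z\<close> and the term with
  \<open>\<theta>\<close> is linear in \<open>z\<close>, so all curvature comes from the penalty,
  which is quadratic in \<open>s\<close>. No bound on the data is involved.\<close>

lemma zs_descent:
  assumes \<sigma>: "0 < snd \<sigma>"
  shows "psi_hat F f g \<gamma>1 \<gamma>2 \<sigma> x y z' s' \<theta> \<le> psi_hat F f g \<gamma>1 \<gamma>2 \<sigma> x y z s \<theta>
     + d_zs g \<gamma>2 \<sigma> x y z s \<theta> \<bullet> ((z', s') - (z, s)) + snd \<sigma> / 2 * (norm ((z', s') - (z, s)))\<^sup>2"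
proof -
  let ?h = "g (x, y) + s"
  have "(norm (g (x, y) + s'))\<^sup>2 = (norm ?h)\<^sup>2 + 2 * (?h \<bullet> (s' - s)) + (norm (s' - s))\<^sup>2"
    unfolding power2_norm_eq_inner by (simp add: algebra_simps inner_commute)
  moreover have "(norm (s' - s))\<^sup>2 \<le> (norm ((z', s') - (z, s)))\<^sup>2"
    by (intro power_mono pair_dist_bounds) auto
  ultimately have "(norm (g (x, y) + s'))\<^sup>2 \<le> (norm ?h)\<^sup>2 + 2 * (?h \<bullet> (s' - s)) + (norm ((z', s') - (z, s)))\<^sup>2" by simp
  then have "snd \<sigma> / 2 * (norm (g (x, y) + s'))\<^sup>2 \<le> snd \<sigma> / 2 * ((norm ?h)\<^sup>2 + 2 * (?h \<bullet> (s' - s)) + (norm ((z', s') - (z, s)))\<^sup>2)"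
    using \<sigma> by (intro mult_left_mono) auto
  moreover have "d_zs g \<gamma>2 \<sigma> x y z s \<theta> \<bullet> ((z', s') - (z, s))
      = ((1 / \<gamma>2) *\<^sub>R (pen_mult x y z - z)) \<bullet> (z' - z) - g (x, \<theta>) \<bullet> (z' - z) + snd \<sigma> * (?h \<bullet> (s' - s))"
    unfolding d_zs_eq by (simp add: inner_prod_def inner_diff_left)
  moreover have "z' \<bullet> g (x, \<theta>) = z \<bullet> g (x, \<theta>) + g (x, \<theta>) \<bullet> (z' - z)"
    by (simp add: inner_diff_right inner_commute[of "g (x, \<theta>)"])
  ultimately show ?thesis
    using penP_upper[of x y z' z] unfolding psi_hat_def gap_hat_def by (simp add: distrib_left)
qed

text \<open>Again \<open>\<theta>\<close>, which enters only through \<open>g (x, \<theta>)\<close>,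
  contributes without the penalty factor.\<close>

lemma d_zs_lipschitz:
  assumes C: "C \<ge> 1" "\<And>i. smooth_bound (Xset G \<times> cball 0 B) (\<lambda>w. g w $ i) C"
    and B: "0 \<le> B" and x: "x \<in> Xset G" "norm y \<le> B" and \<theta>: "norm \<theta> \<le> B" "norm \<theta>' \<le> B" and \<sigma>: "0 < snd \<sigma>"
    and D: "norm (z' - z) \<le> D" "norm (s' - s) \<le> D" and T: "norm (\<theta>' - \<theta>) \<le> T"
  shows "norm (d_zs g \<gamma>2 \<sigma> x y z' s' \<theta>' - d_zs g \<gamma>2 \<sigma> x y z s \<theta>)
    \<le> (1 / \<gamma>2) * (real CARD('q) * ((1 + \<gamma>2 * C) * D) + D) + real CARD('q) * (C * T) + snd \<sigma> * D"
proof -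
  have D0: "0 \<le> D" using D(1) norm_ge_zero order_trans by blast
  have 1: "norm (pen_mult x y z' - pen_mult x y z) \<le> real CARD('q) * ((1 + \<gamma>2 * C) * D)"
  proof -
    have "norm (pen_mult x y z' - pen_mult x y z) \<le> (\<Sum>i\<in>UNIV. \<bar>(pen_mult x y z' - pen_mult x y z) $ i\<bar>)"
      by (rule norm_le_l1_cart)
    also have "\<dots> \<le> real CARD('q) * ((1 + \<gamma>2 * C) * D)"
      by (rule sum_bounded_above) (use pen_mult_lipschitz[OF C(2) x x, of D] D D0 C(1) in simp)
    finally show ?thesis .
  qed
  have 2: "norm (g (x, \<theta>') - g (x, \<theta>)) \<le> real CARD('q) * (C * T)"
  proof -
    have c: "\<bar>g (x, \<theta>') $ i - g (x, \<theta>) $ i\<bar> \<le> C * T" for i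
    proof -
      have "\<bar>g (x, \<theta>') $ i - g (x, \<theta>) $ i\<bar> \<le> C * norm ((x, \<theta>') - (x, \<theta>))"
      proof -
        have "(x, \<theta>) \<in> Xset G \<times> cball 0 B" "(x, \<theta>') \<in> Xset G \<times> cball 0 B" using x \<theta> by auto
        then show ?thesis using C(2)[of i] unfolding smooth_bound_def by blast
      qed
      also have "norm ((x, \<theta>') - (x, \<theta>)) = norm (\<theta>' - \<theta>)" by (simp add: norm_pair_zero)
      also have "C * norm (\<theta>' - \<theta>) \<le> C * T" using T C by (intro mult_left_mono) auto
      finally show ?thesis .
    qed
    have "norm (g (x, \<theta>') - g (x, \<theta>)) \<le> (\<Sum>i\<in>UNIV. \<bar>(g (x, \<theta>') - g (x, \<theta>)) $ i\<bar>)"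
      by (rule norm_le_l1_cart)
    also have "\<dots> \<le> real CARD('q) * (C * T)" by (rule sum_bounded_above) (use c in simp)
    finally show ?thesis .
  qed
  let ?a = "(1 / \<gamma>2) *\<^sub>R ((pen_mult x y z' - pen_mult x y z) - (z' - z))" and ?b = "g (x, \<theta>') - g (x, \<theta>)"
  have "d_zs g \<gamma>2 \<sigma> x y z' s' \<theta>' - d_zs g \<gamma>2 \<sigma> x y z s \<theta> = (?a - ?b, snd \<sigma> *\<^sub>R (s' - s))"
    unfolding d_zs_eq by (simp add: algebra_simps)
  then have "norm (d_zs g \<gamma>2 \<sigma> x y z' s' \<theta>' - d_zs g \<gamma>2 \<sigma> x y z s \<theta>) \<le> norm (?a - ?b) + norm (snd \<sigma> *\<^sub>R (s' - s))"
    by (simp only: norm_Pair_le)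
  also have "\<dots> \<le> norm ?a + norm ?b + snd \<sigma> * D"
  proof -
    have "norm (snd \<sigma> *\<^sub>R (s' - s)) \<le> snd \<sigma> * D" using D(2) \<sigma> by simp
    then show ?thesis using norm_triangle_ineq4[of ?a ?b] by linarith
  qed
  also have "norm ?a \<le> (1 / \<gamma>2) * (real CARD('q) * ((1 + \<gamma>2 * C) * D) + D)"
    unfolding norm_scaleR using gamma_pos 1 D(1) norm_triangle_ineq4[of "pen_mult x y z' - pen_mult x y z" "z' - z"]
    by (intro mult_mono) auto
  finally show ?thesis using 2 by simp
qed

end

section \<open>Line searches\<close>

text \<open>Either the first trial is accepted, or the trial before the accepted one was rejected
  and hence below the threshold \<open>T\<close>; backtracking adds one factor
  \<open>\<kappa>\<close>.\<close>

lemma line_search_bound: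
  fixes L \<kappa> Lmax T :: real
  assumes "first_accepted A j" "0 < L" "L \<le> Lmax" "1 < \<kappa>" "0 \<le> T"
    and acc: "\<And>i. T \<le> L * \<kappa> ^ i \<Longrightarrow> A i"
  shows "L * \<kappa> ^ j \<le> Lmax + \<kappa> * T"
proof (cases j)
  case 0
  have "0 \<le> \<kappa> * T" using assms by simp
  moreover have "L * \<kappa> ^ j = L" using 0 by simp
  ultimately show ?thesis using assms(3) by linarith
next
  case (Suc i)
  then have "\<not> A i" using assms(1) by (simp add: first_accepted_def)
  then have "L * \<kappa> ^ i < T" using acc by force
  then have "\<kappa> * (L * \<kappa> ^ i) \<le> \<kappa> * T" using assms(4) by (intro mult_left_mono) auto
  moreover have "\<kappa> * (L * \<kappa> ^ i) = L * \<kappa> ^ j" using Suc by simp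
  ultimately show ?thesis using assms(2,3) by linarith
qed

lemma projection_step_dot:
  fixes w w' d :: "'a::real_inner"
  assumes "(w - a *\<^sub>R d - w') \<bullet> (w - w') \<le> 0"
  shows "(w' - w) \<bullet> (w' - w) + a * (d \<bullet> (w' - w)) \<le> 0"
  using assms by (simp add: inner_diff_left inner_diff_right inner_commute algebra_simps)

lemma sum_sq_le: "(a + b)\<^sup>2 \<le> 2 * a\<^sup>2 + 2 * b\<^sup>2" for a b :: real
  using zero_le_power2[of "a - b"] unfolding power2_sum power2_diff by linarith

context bilevel
begin

text \<open>
  A constant for data bounded by \<open>B\<close> and penalty parameters bounded below by \<open>l\<close>, uniform in the
  penalty parameters: the curvature grows at most like the second one.
\<close>

definition step_const :: "real \<Rightarrow> real \<Rightarrow> real \<Rightarrow> bool" where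
  "step_const B l K \<longleftrightarrow> 0 < K \<and>
    (\<forall>x y x' y' z s \<theta> \<sigma>. (x, y) \<in> Omega G \<longrightarrow> (x', y') \<in> Omega G \<longrightarrow> norm z \<le> B \<longrightarrow> norm s \<le> B \<longrightarrow> norm \<theta> \<le> B \<longrightarrow>
      l \<le> fst \<sigma> \<longrightarrow> l \<le> snd \<sigma> \<longrightarrow>
      psi_hat F f g \<gamma>1 \<gamma>2 \<sigma> x' y' z s \<theta> \<le> psi_hat F f g \<gamma>1 \<gamma>2 \<sigma> x y z s \<theta>
        + d_xy F f g \<gamma>1 \<gamma>2 \<sigma> x y z s \<theta> \<bullet> ((x', y') - (x, y)) + K * snd \<sigma> * (norm ((x', y') - (x, y)))\<^sup>2) \<and>
    (\<forall>x y x' y' z z' \<theta>. x \<in> Xset G \<longrightarrow> x' \<in> Xset G \<longrightarrow> norm z \<le> B \<longrightarrow> norm \<theta> \<le> B \<longrightarrow>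
      resid f g \<gamma>1 \<theta> x' y' z' \<le> resid f g \<gamma>1 \<theta> x y z + K * (norm ((x', y') - (x, y)) + norm (z' - z))) \<and>
    (\<forall>x y x' y' z z' s s' \<theta> \<theta>' \<sigma> D T. (x, y) \<in> Omega G \<longrightarrow> (x', y') \<in> Omega G \<longrightarrow>
      norm z \<le> B \<longrightarrow> norm s \<le> B \<longrightarrow> norm \<theta> \<le> B \<longrightarrow> norm z' \<le> B \<longrightarrow> norm s' \<le> B \<longrightarrow> norm \<theta>' \<le> B \<longrightarrow>
      l \<le> fst \<sigma> \<longrightarrow> l \<le> snd \<sigma> \<longrightarrow>
      norm ((x', y') - (x, y)) \<le> D \<longrightarrow> norm (z' - z) \<le> D \<longrightarrow> norm (s' - s) \<le> D \<longrightarrow> norm (\<theta>' - \<theta>) \<le> T \<longrightarrow>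
      norm (d_xy F f g \<gamma>1 \<gamma>2 \<sigma> x' y' z' s' \<theta>' - d_xy F f g \<gamma>1 \<gamma>2 \<sigma> x y z s \<theta>) \<le> K * snd \<sigma> * D + K * T) \<and>
    (\<forall>x y z z' s s' \<theta> \<theta>' \<sigma> D T. (x, y) \<in> Omega G \<longrightarrow> norm \<theta> \<le> B \<longrightarrow> norm \<theta>' \<le> B \<longrightarrow> l \<le> snd \<sigma> \<longrightarrow>
      norm (z' - z) \<le> D \<longrightarrow> norm (s' - s) \<le> D \<longrightarrow> norm (\<theta>' - \<theta>) \<le> T \<longrightarrow>
      norm (d_zs g \<gamma>2 \<sigma> x y z' s' \<theta>' - d_zs g \<gamma>2 \<sigma> x y z s \<theta>) \<le> K * snd \<sigma> * D + K * T)"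

lemmas step_const_pos = step_const_def[THEN iffD1, THEN conjunct1]
lemmas step_const_xy = step_const_def[THEN iffD1, THEN conjunct2, THEN conjunct1, rule_format]
lemmas step_const_resid = step_const_def[THEN iffD1, THEN conjunct2, THEN conjunct2, THEN conjunct1, rule_format]
lemmas step_const_d_xy =
  step_const_def[THEN iffD1, THEN conjunct2, THEN conjunct2, THEN conjunct2, THEN conjunct1, rule_format]
lemmas step_const_d_zs =
  step_const_def[THEN iffD1, THEN conjunct2, THEN conjunct2, THEN conjunct2, THEN conjunct2, rule_format]

lemma step_const_exists:
  assumes "0 < l"
  shows "\<exists>K. step_const B l K"
proof -
  obtain By where By: "\<And>x y. (x, y) \<in> Omega G \<Longrightarrow> norm y \<le> By" using Omega_bounded_y by blast
  \<comment> \<open>\<open>y\<close> and \<open>\<theta>\<close> share one radius with the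
    multipliers, since \<open>(x, y)\<close> and \<open>(x, \<theta>)\<close> have to lie in the
    same compact set.\<close>
  define B' where "B' = max (max B By) 0"
  have B': "0 \<le> B'" "B \<le> B'" and sub: "\<forall>x y. (x, y) \<in> Omega G \<longrightarrow> norm y \<le> B'"
    using By by (auto simp: B'_def le_max_iff_disj)
  obtain C where C: "C \<ge> 1" "smooth_bound (Omega G) F C" "smooth_bound (Xset G \<times> cball 0 B') f C"
    "\<And>i. smooth_bound (Xset G \<times> cball 0 B') (\<lambda>w. g w $ i) C"
    using data_bound[of B'] by blast
  have C0: "0 \<le> C" using C by simp
  let ?n = "real CARD('q)"
  \<comment> \<open>\<open>a1\<close>, \<open>a2\<close> belong to the descent inequality,
    \<open>b1\<close>, \<open>b2\<close>, \<open>b3\<close> to the \<open>(x, y)\<close>-direction,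
    \<open>c1\<close>, \<open>c2\<close> to the \<open>(z, s)\<close>-direction and \<open>e\<close>
    to the residual.\<close>
  define a1 a2 b1 b2 b3 c1 c2 e where
    "a1 = 2 * C + ?n * (2 * B' * C + \<gamma>2 * C\<^sup>2 * 2)" and "a2 = ?n * (2 * C\<^sup>2 + B' * C)"
    and "b1 = 2 * C + 1 / \<gamma>1 + ?n * ((B' + \<gamma>2 * C) * C + (1 + \<gamma>2 * C) * C + B' * C + C)"
    and "b2 = C + 1 / \<gamma>1 + ?n * (B' * C)" and "b3 = ?n * ((C + B') * C + (C + 1) * C)"
    and "c1 = (1 / \<gamma>2) * (?n * (1 + \<gamma>2 * C) + 1)" and "c2 = ?n * C"
    and "e = C + 1 / \<gamma>1 + ?n * (B' * C + C)"
  have nn: "0 \<le> a1" "0 \<le> a2" "0 \<le> b1" "0 \<le> b2" "0 \<le> b3" "0 \<le> c1" "0 \<le> c2" "0 \<le> e"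
    using C0 B' gamma_pos by (simp_all add: a1_def a2_def b1_def b2_def b3_def c1_def c2_def e_def)
  define K where "K = 1 + (C / l + a1) / l + a2 + (C / l + b1) / l + b2 + b3 + c1 / l + 1 + c2 + e"
  have dl: "0 \<le> (C / l + a1) / l" "0 \<le> (C / l + b1) / l" "0 \<le> c1 / l" using nn C0 assms by auto
  have K: "(C / l + a1) / l + a2 \<le> K" "(C / l + b1) / l + b3 \<le> K" "b2 \<le> K" "c1 / l + 1 \<le> K" "c2 \<le> K" "e \<le> K" "0 < K"
    using nn dl unfolding K_def by linarith+
  \<comment> \<open>The lower bound \<open>l\<close> on the penalty parameters allows terms without
    \<open>snd \<sigma>\<close> to be absorbed into a multiple of it, so that the single factor
    \<open>K * snd \<sigma>\<close> remains.\<close>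
  have big: "c \<le> c / l * t" if "l \<le> t" "0 \<le> c" for c t
  proof -
    have "c / l * l \<le> c / l * t" using that assms by (intro mult_left_mono) auto
    then show ?thesis using assms by simp
  qed
  have inv: "C / t \<le> C / l" if "l \<le> t" for t
    using that assms C0 by (intro divide_left_mono) auto
  show ?thesis
  proof (intro exI[of _ K], unfold step_const_def, intro conjI allI impI K(7))
    fix x x' :: "real^'n" and y y' \<theta> :: "real^'m" and z s :: "real^'q" and \<sigma> :: "real \<times> real"
    assume w: "(x, y) \<in> Omega G" "(x', y') \<in> Omega G" and b: "norm z \<le> B" "norm s \<le> B" "norm \<theta> \<le> B"
      and \<sigma>: "l \<le> fst \<sigma>" "l \<le> snd \<sigma>"
    let ?N = "(norm ((x', y') - (x, y)))\<^sup>2"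
    have "C / fst \<sigma> + 2 * C + ?n * ((2 * B' * C + \<gamma>2 * C\<^sup>2 * 2) + snd \<sigma> * (2 * C\<^sup>2 + B' * C)) = C / fst \<sigma> + a1 + a2 * snd \<sigma>"
      by (simp add: a1_def a2_def algebra_simps)
    also have "\<dots> \<le> (C / l + a1) + a2 * snd \<sigma>" using inv[OF \<sigma>(1)] by simp
    also have "\<dots> \<le> (C / l + a1) / l * snd \<sigma> + a2 * snd \<sigma>"
      using big[OF \<sigma>(2), of "C / l + a1"] nn C0 assms by simp
    also have "\<dots> = ((C / l + a1) / l + a2) * snd \<sigma>" by (simp add: distrib_right)
    also have "\<dots> \<le> K * snd \<sigma>" using K(1) \<sigma> assms by (intro mult_right_mono) auto
    finally have "(C / fst \<sigma> + 2 * C + ?n * ((2 * B' * C + \<gamma>2 * C\<^sup>2 * 2) + snd \<sigma> * (2 * C\<^sup>2 + B' * C))) * ?N \<le> K * snd \<sigma> * ?N"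
      by (rule mult_right_mono) simp
    moreover have "norm z \<le> B'" "norm s \<le> B'" "norm \<theta> \<le> B'" "0 < fst \<sigma>" "0 < snd \<sigma>"
      using b B' \<sigma> assms by linarith+
    note xy_descent[OF C B'(1) sub w this]
    ultimately show "psi_hat F f g \<gamma>1 \<gamma>2 \<sigma> x' y' z s \<theta> \<le> psi_hat F f g \<gamma>1 \<gamma>2 \<sigma> x y z s \<theta>
        + d_xy F f g \<gamma>1 \<gamma>2 \<sigma> x y z s \<theta> \<bullet> ((x', y') - (x, y)) + K * snd \<sigma> * ?N" by linarith
  next
    fix x x' :: "real^'n" and y y' \<theta> :: "real^'m" and z z' :: "real^'q"
    assume x: "x \<in> Xset G" "x' \<in> Xset G" and b: "norm z \<le> B" "norm \<theta> \<le> B"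
    let ?D = "norm ((x', y') - (x, y)) + norm (z' - z)"
    have "norm z \<le> B'" "norm \<theta> \<le> B'" using b B' by linarith+
    from resid_lipschitz[OF C(1,3,4) B'(1) x this, of y' z' y]
    have "\<bar>resid f g \<gamma>1 \<theta> x' y' z' - resid f g \<gamma>1 \<theta> x y z\<bar> \<le> e * ?D" by (simp add: e_def)
    also have "\<dots> \<le> K * ?D" using K(6) by (intro mult_right_mono) auto
    finally show "resid f g \<gamma>1 \<theta> x' y' z' \<le> resid f g \<gamma>1 \<theta> x y z + K * ?D" by linarith
  next
    fix x x' :: "real^'n" and y y' \<theta> \<theta>' :: "real^'m" and z z' s s' :: "real^'q" and \<sigma> :: "real \<times> real" and D T :: real
    assume w: "(x, y) \<in> Omega G" "(x', y') \<in> Omega G"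
      and b: "norm z \<le> B" "norm s \<le> B" "norm \<theta> \<le> B" "norm z' \<le> B" "norm s' \<le> B" "norm \<theta>' \<le> B"
      and \<sigma>: "l \<le> fst \<sigma>" "l \<le> snd \<sigma>"
      and D: "norm ((x', y') - (x, y)) \<le> D" "norm (z' - z) \<le> D" "norm (s' - s) \<le> D" "norm (\<theta>' - \<theta>) \<le> T"
    have D0: "0 \<le> D" "0 \<le> T" using D(1,4) norm_ge_zero order_trans by blast+
    have b': "norm z \<le> B'" "norm s \<le> B'" "norm \<theta> \<le> B'" "norm z' \<le> B'" "norm s' \<le> B'" "norm \<theta>' \<le> B'"
      "0 < fst \<sigma>" "0 < snd \<sigma>"
      using b B' \<sigma> assms by linarith+
    have "norm (d_xy F f g \<gamma>1 \<gamma>2 \<sigma> x' y' z' s' \<theta>' - d_xy F f g \<gamma>1 \<gamma>2 \<sigma> x y z s \<theta>)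
       \<le> (C / fst \<sigma> + 2 * C + 1 / \<gamma>1) * D + (C + 1 / \<gamma>1) * T
      + ?n * (((B' + \<gamma>2 * C) * C + (1 + \<gamma>2 * C) * C + B' * C + C) * D + B' * C * T + snd \<sigma> * (((C + B') * C + (C + 1) * C) * D))"
      by (rule d_xy_lipschitz[OF C B'(1) sub w b' D])
    also have "\<dots> = (C / fst \<sigma> + b1 + b3 * snd \<sigma>) * D + b2 * T"
      unfolding b1_def b2_def b3_def by (simp add: algebra_simps)
    also have "\<dots> \<le> K * snd \<sigma> * D + K * T"
    proof (intro add_mono mult_right_mono D0 K)
      have "C / fst \<sigma> + b1 + b3 * snd \<sigma> \<le> (C / l + b1) + b3 * snd \<sigma>" using inv[OF \<sigma>(1)] by simp
      also have "\<dots> \<le> (C / l + b1) / l * snd \<sigma> + b3 * snd \<sigma>"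
        using big[OF \<sigma>(2), of "C / l + b1"] nn C0 assms by simp
      also have "\<dots> = ((C / l + b1) / l + b3) * snd \<sigma>" by (simp add: distrib_right)
      also have "\<dots> \<le> K * snd \<sigma>" using K(2) \<sigma> assms by (intro mult_right_mono) auto
      finally show "C / fst \<sigma> + b1 + b3 * snd \<sigma> \<le> K * snd \<sigma>" .
    qed
    finally show "norm (d_xy F f g \<gamma>1 \<gamma>2 \<sigma> x' y' z' s' \<theta>' - d_xy F f g \<gamma>1 \<gamma>2 \<sigma> x y z s \<theta>) \<le> K * snd \<sigma> * D + K * T" .
  next
    fix x :: "real^'n" and y \<theta> \<theta>' :: "real^'m" and z z' s s' :: "real^'q" and \<sigma> :: "real \<times> real" and D T :: real
    assume w: "(x, y) \<in> Omega G" and b: "norm \<theta> \<le> B" "norm \<theta>' \<le> B" and \<sigma>: "l \<le> snd \<sigma>"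
      and D: "norm (z' - z) \<le> D" "norm (s' - s) \<le> D" "norm (\<theta>' - \<theta>) \<le> T"
    have D0: "0 \<le> D" "0 \<le> T" using D(1,3) norm_ge_zero order_trans by blast+
    have b': "norm \<theta> \<le> B'" "norm \<theta>' \<le> B'" "0 < snd \<sigma>" using b B' \<sigma> assms by linarith+
    have "norm (d_zs g \<gamma>2 \<sigma> x y z' s' \<theta>' - d_zs g \<gamma>2 \<sigma> x y z s \<theta>)
       \<le> (1 / \<gamma>2) * (?n * ((1 + \<gamma>2 * C) * D) + D) + ?n * (C * T) + snd \<sigma> * D"
      by (rule d_zs_lipschitz[OF C(1,4) B'(1) Omega_X[OF w] sub[rule_format, OF w] b' D])
    also have "\<dots> = (c1 + snd \<sigma>) * D + c2 * T" unfolding c1_def c2_def by (simp add: algebra_simps)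
    also have "\<dots> \<le> K * snd \<sigma> * D + K * T"
    proof (intro add_mono mult_right_mono D0 K)
      have "c1 + snd \<sigma> \<le> (c1 / l + 1) * snd \<sigma>" using big[OF \<sigma>, of c1] nn by (simp add: distrib_right)
      also have "\<dots> \<le> K * snd \<sigma>" using K(4) \<sigma> assms by (intro mult_right_mono) auto
      finally show "c1 + snd \<sigma> \<le> K * snd \<sigma>" .
    qed
    finally show "norm (d_zs g \<gamma>2 \<sigma> x y z' s' \<theta>' - d_zs g \<gamma>2 \<sigma> x y z s \<theta>) \<le> K * snd \<sigma> * D + K * T" .
  qed
qed

text \<open>Compare \<open>\<theta>\<close> with \<open>y\<close>: the residual at \<open>y\<close>
  is the lower-level gradient of the Lagrangian, bounded for bounded \<open>z\<close>, and residuals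
  control distances by strong monotonicity.\<close>

lemma theta_bound:
  assumes "0 \<le> B"
  shows "\<exists>C. \<forall>x y z \<theta>. (x, y) \<in> Omega G \<longrightarrow> 0 \<le> z \<longrightarrow> norm z \<le> B \<longrightarrow> norm \<theta> \<le> C + \<gamma>1 * resid f g \<gamma>1 \<theta> x y z"
proof -
  obtain By where By: "\<And>x y. (x, y) \<in> Omega G \<Longrightarrow> norm y \<le> By" using Omega_bounded_y by blast
  obtain C where C: "C \<ge> 1" "smooth_bound (Xset G \<times> cball 0 By) f C"
    "\<And>i. smooth_bound (Xset G \<times> cball 0 By) (\<lambda>w. g w $ i) C"
    using data_bound[of By] by blast
  have "norm \<theta> \<le> (By + \<gamma>1 * (C + real CARD('q) * (B * C))) + \<gamma>1 * resid f g \<gamma>1 \<theta> x y z"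
    if w: "(x, y) \<in> Omega G" and z: "0 \<le> z" "norm z \<le> B" for x y z \<theta>
  proof -
    have x: "x \<in> Xset G" using w by (rule Omega_X)
    have in_K: "(x, y) \<in> Xset G \<times> cball 0 By" using x By[OF w] by simp
    have "resid f g \<gamma>1 y x y z \<le> norm (Lg (x, y) z)"
      unfolding resid_eq[OF x] prox_grad_def by (simp add: norm_fst_snd_le)
    also have "\<dots> \<le> norm (grad f (x, y)) + norm (\<Sum>i\<in>UNIV. z $ i *\<^sub>R Gg i (x, y))"
      unfolding Lg_def by (rule norm_triangle_ineq)
    also have "\<dots> \<le> C + real CARD('q) * (B * C)"
    proof (intro add_mono norm_sum_le)
      show "norm (grad f (x, y)) \<le> C" using C(2) in_K unfolding smooth_bound_def by blast
      fix i
      have "norm (Gg i (x, y)) \<le> C" using C(3)[of i] in_K unfolding smooth_bound_def by blast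
      then show "norm (z $ i *\<^sub>R Gg i (x, y)) \<le> B * C"
        unfolding norm_scaleR using comp_le[OF z(2), of i] assms by (intro mult_mono) auto
    qed
    finally have "\<gamma>1 * resid f g \<gamma>1 y x y z \<le> \<gamma>1 * (C + real CARD('q) * (B * C))"
      using gamma_pos by (intro mult_left_mono) auto
    moreover have "norm (\<theta> - y) \<le> \<gamma>1 * resid f g \<gamma>1 \<theta> x y z + \<gamma>1 * resid f g \<gamma>1 y x y z"
      using prox_dist_resid[OF x z(1), of \<theta> y y] by (simp add: distrib_left)
    moreover have "norm \<theta> \<le> norm (\<theta> - y) + norm y" using norm_triangle_ineq[of "\<theta> - y" y] by simp
    ultimately show ?thesis using By[OF w] by linarith
  qed
  then show ?thesis by blast
qed

lemma resid_nonneg: "0 \<le> resid f g \<gamma>1 \<theta> x y z"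
  by (simp add: resid_def)

text \<open>The projection gives \<open>d \<bullet> \<Delta> \<le> - (L + c_alpha) N\<^sup>2\<close>
  for the displacement \<open>\<Delta>\<close> of norm \<open>N\<close>, against a curvature
  \<open>K * \<sigma>\<^sub>2\<close>. The residual at the trial point is at most
  \<open>\<zeta> + K * N\<close>; its square splits into the slack
  \<open>\<gamma>1 * \<zeta>\<^sup>2\<close> granted by the acceptance test and the part
  \<open>\<gamma>1 * K\<^sup>2\<close> of the threshold.\<close>

lemma step_xy_bound:
  assumes K: "step_const B l K" and step: "step_xy F f G g \<gamma>1 \<gamma>2 P r k j" and P: "valid_params P"
    and l: "0 < l" "l \<le> fst (sigma_out r k)" "l \<le> snd (sigma_out r k)"
    and w: "(x_in r k j, y_in r k j) \<in> Omega G"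
    and b: "norm (z_in r k j) \<le> B" "norm (s_in r k j) \<le> B" "norm (th_in r k j) \<le> B"
    and R: "resid f g \<gamma>1 (th_in r k j) (x_in r k j) (y_in r k j) (z_in r k j) \<le> zeta P k j"
  shows "\<exists>A. 0 < A \<and> A \<le> L_hat P + kappa_L P * (K * snd (sigma_out r k) + \<gamma>1 * K\<^sup>2) + c_alpha P \<and>
     (x_in r k (Suc j), y_in r k (Suc j)) = closest_point (Omega G) ((x_in r k j, y_in r k j)
        - (1 / A) *\<^sub>R d_xy F f g \<gamma>1 \<gamma>2 (sigma_out r k) (x_in r k j) (y_in r k j) (z_in r k j) (s_in r k j) (th_in r k j))"
proof -
  let ?\<sigma> = "sigma_out r k" and ?x = "x_in r k j" and ?y = "y_in r k j" and ?z = "z_in r k j" and ?s = "s_in r k j"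
    and ?\<theta> = "th_in r k j" and ?\<zeta> = "zeta P k j"
  let ?d = "d_xy F f g \<gamma>1 \<gamma>2 ?\<sigma> ?x ?y ?z ?s ?\<theta>"
  let ?L = "\<lambda>i. L0_xy P k j * kappa_L P ^ i"
  let ?trial = "\<lambda>i. closest_point (Omega G) ((?x, ?y) - (1 / (?L i + c_alpha P)) *\<^sub>R ?d)"
  define accept where "accept = (\<lambda>i. let (x', y') = ?trial i in
            psi_hat F f g \<gamma>1 \<gamma>2 ?\<sigma> x' y' ?z ?s ?\<theta> + (\<gamma>1 / 2) * (resid f g \<gamma>1 ?\<theta> x' y' ?z)\<^sup>2
              \<le> psi_hat F f g \<gamma>1 \<gamma>2 ?\<sigma> ?x ?y ?z ?s ?\<theta>
                - c_alpha P * (norm ((x', y') - (?x, ?y)))\<^sup>2 + \<gamma>1 * ?\<zeta>\<^sup>2)"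
  obtain i where i: "first_accepted accept i" "(x_in r k (Suc j), y_in r k (Suc j)) = ?trial i"
    using step unfolding step_xy_def Let_def accept_def by blast
  have p: "0 < c_alpha P" "0 < L0_xy P k j" "L0_xy P k j \<le> L_hat P" "1 < kappa_L P"
    using P by (auto simp: valid_params_def)
  have L: "0 < ?L i" for i using p by simp
  have K0: "0 < K" using K by (simp add: step_const_def)
  let ?T = "K * snd ?\<sigma> + \<gamma>1 * K\<^sup>2"
  have "?L i \<le> L_hat P + kappa_L P * ?T"
  proof (rule line_search_bound[OF i(1) p(2-4)])
    show "0 \<le> ?T" using K0 l gamma_pos by simp
    fix i assume T: "?T \<le> ?L i"
    obtain x' y' where tr: "?trial i = (x', y')" by fastforce
    have w': "(x', y') \<in> Omega G" using closest_point_in_set[OF Omega_set(2,1)] tr by metis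
    let ?\<Delta> = "(x', y') - (?x, ?y)"
    let ?N = "norm ?\<Delta>"
    let ?a = "1 / (?L i + c_alpha P)"
    have "0 < ?L i + c_alpha P" using L[of i] p(1) by linarith
    have "((?x, ?y) - ?a *\<^sub>R ?d - (x', y')) \<bullet> ((?x, ?y) - (x', y')) \<le> 0"
      using closest_point_dot[OF Omega_set(3,2) w, of "(?x, ?y) - ?a *\<^sub>R ?d"] unfolding tr .
    then have "?\<Delta> \<bullet> ?\<Delta> + ?a * (?d \<bullet> ?\<Delta>) \<le> 0" by (rule projection_step_dot)
    then have "(?L i + c_alpha P) * (?\<Delta> \<bullet> ?\<Delta> + ?a * (?d \<bullet> ?\<Delta>)) \<le> 0"
      using L[of i] p by (intro mult_nonneg_nonpos) auto
    then have dot: "?d \<bullet> ?\<Delta> \<le> - ((?L i + c_alpha P) * ?N\<^sup>2)"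
      using L[of i] p by (simp only: distrib_left[of "?L i + c_alpha P"] power2_norm_eq_inner) simp
    have desc: "psi_hat F f g \<gamma>1 \<gamma>2 ?\<sigma> x' y' ?z ?s ?\<theta> \<le> psi_hat F f g \<gamma>1 \<gamma>2 ?\<sigma> ?x ?y ?z ?s ?\<theta> + ?d \<bullet> ?\<Delta> + K * snd ?\<sigma> * ?N\<^sup>2"
      by (rule step_const_xy[OF K w w' b l(2,3)])
    have "resid f g \<gamma>1 ?\<theta> x' y' ?z \<le> resid f g \<gamma>1 ?\<theta> ?x ?y ?z + K * (?N + norm (?z - ?z))"
      by (rule step_const_resid[OF K Omega_X[OF w] Omega_X[OF w'] b(1,3)])
    then have "resid f g \<gamma>1 ?\<theta> x' y' ?z \<le> ?\<zeta> + K * ?N" using R by simp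
    then have "(resid f g \<gamma>1 ?\<theta> x' y' ?z)\<^sup>2 \<le> (?\<zeta> + K * ?N)\<^sup>2" using resid_nonneg by (rule power_mono)
    also have "\<dots> \<le> 2 * ?\<zeta>\<^sup>2 + 2 * (K * ?N)\<^sup>2" by (rule sum_sq_le)
    finally have "(\<gamma>1 / 2) * (resid f g \<gamma>1 ?\<theta> x' y' ?z)\<^sup>2 \<le> (\<gamma>1 / 2) * (2 * ?\<zeta>\<^sup>2 + 2 * (K * ?N)\<^sup>2)"
      using gamma_pos by (intro mult_left_mono) auto
    then have res: "(\<gamma>1 / 2) * (resid f g \<gamma>1 ?\<theta> x' y' ?z)\<^sup>2 \<le> \<gamma>1 * ?\<zeta>\<^sup>2 + \<gamma>1 * K\<^sup>2 * ?N\<^sup>2"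
      by (simp add: power_mult_distrib algebra_simps)
    have "?T * ?N\<^sup>2 \<le> ?L i * ?N\<^sup>2" using T by (rule mult_right_mono) simp
    then have "psi_hat F f g \<gamma>1 \<gamma>2 ?\<sigma> x' y' ?z ?s ?\<theta> + (\<gamma>1 / 2) * (resid f g \<gamma>1 ?\<theta> x' y' ?z)\<^sup>2
              \<le> psi_hat F f g \<gamma>1 \<gamma>2 ?\<sigma> ?x ?y ?z ?s ?\<theta> - c_alpha P * ?N\<^sup>2 + \<gamma>1 * ?\<zeta>\<^sup>2"
      using dot desc res unfolding distrib_right by linarith
    then show "accept i" unfolding accept_def tr Let_def by simp
  qed
  moreover have "0 < ?L i + c_alpha P" using L[of i] p(1) by linarith
  ultimately show ?thesis using i(2) by (intro exI[of _ "?L i + c_alpha P"]) auto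
qed

text \<open>The truncated complementarity set is not convex, so there is no variational inequality;
  the projection is only known to be no farther away than the current point. This yields half the
  decrease, \<open>2 (d \<bullet> \<Delta>) \<le> - (L + c_beta) N\<^sup>2\<close>, and explains
  \<open>c_beta\<close> and the factor \<open>2\<close> in the threshold.\<close>

lemma step_zs_bound:
  assumes K: "step_const B l K" and step: "step_zs F f g \<gamma>1 \<gamma>2 P r k j" and P: "valid_params P"
    and l: "0 < l" "l \<le> snd (sigma_out r k)"
    and x: "x_in r k (Suc j) \<in> Xset G" and zs: "(z_in r k j, s_in r k j) \<in> compl_trunc (Mz r k)"
    and b: "norm (z_in r k j) \<le> B" "norm (th_half r k j) \<le> B"
    and R: "resid f g \<gamma>1 (th_half r k j) (x_in r k (Suc j)) (y_in r k (Suc j)) (z_in r k j) \<le> zeta P k j"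
  shows "\<exists>A. 0 < A \<and> A \<le> L_hat P + kappa_L P * (c_beta P + snd (sigma_out r k) + 2 * (\<gamma>1 * K\<^sup>2)) + c_beta P \<and>
     (z_in r k (Suc j), s_in r k (Suc j)) = proj_compl (Mz r k) ((z_in r k j, s_in r k j)
        - (1 / A) *\<^sub>R d_zs g \<gamma>2 (sigma_out r k) (x_in r k (Suc j)) (y_in r k (Suc j)) (z_in r k j) (s_in r k j) (th_half r k j))"
proof -
  let ?\<sigma> = "sigma_out r k" and ?x = "x_in r k (Suc j)" and ?y = "y_in r k (Suc j)" and ?z = "z_in r k j" and ?s = "s_in r k j"
    and ?\<theta> = "th_half r k j" and ?\<zeta> = "zeta P k j"
  let ?d = "d_zs g \<gamma>2 ?\<sigma> ?x ?y ?z ?s ?\<theta>"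
  let ?L = "\<lambda>i. L0_zs P k j * kappa_L P ^ i"
  let ?trial = "\<lambda>i. proj_compl (Mz r k) ((?z, ?s) - (1 / (?L i + c_beta P)) *\<^sub>R ?d)"
  define accept where "accept = (\<lambda>i. let (z', s') = ?trial i in
            psi_hat F f g \<gamma>1 \<gamma>2 ?\<sigma> ?x ?y z' s' ?\<theta> + (\<gamma>1 / 2) * (resid f g \<gamma>1 ?\<theta> ?x ?y z')\<^sup>2
              \<le> psi_hat F f g \<gamma>1 \<gamma>2 ?\<sigma> ?x ?y ?z ?s ?\<theta>
                - c_beta P * (norm ((z', s') - (?z, ?s)))\<^sup>2 + \<gamma>1 * ?\<zeta>\<^sup>2)"
  obtain i where i: "first_accepted accept i" "(z_in r k (Suc j), s_in r k (Suc j)) = ?trial i"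
    using step unfolding step_zs_def Let_def accept_def by blast
  have p: "0 < c_beta P" "0 < L0_zs P k j" "L0_zs P k j \<le> L_hat P" "1 < kappa_L P"
    using P by (auto simp: valid_params_def)
  have L: "0 < ?L i" for i using p by simp
  have \<sigma>: "0 < snd ?\<sigma>" using l by simp
  let ?T = "c_beta P + snd ?\<sigma> + 2 * (\<gamma>1 * K\<^sup>2)"
  have "?L i \<le> L_hat P + kappa_L P * ?T"
  proof (rule line_search_bound[OF i(1) p(2-4)])
    show "0 \<le> ?T" using \<sigma> p gamma_pos by simp
    fix i assume T: "?T \<le> ?L i"
    obtain z' s' where tr: "?trial i = (z', s')" by fastforce
    let ?\<Delta> = "(z', s') - (?z, ?s)"
    let ?N = "norm ?\<Delta>"
    let ?a = "1 / (?L i + c_beta P)"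
    have "norm ((?z, ?s) - ?a *\<^sub>R ?d - (z', s')) \<le> norm ((?z, ?s) - ?a *\<^sub>R ?d - (?z, ?s))"
      using proj_compl_nearest[OF zs, of "(?z, ?s) - ?a *\<^sub>R ?d"] unfolding tr .
    moreover have "(?z, ?s) - ?a *\<^sub>R ?d - (z', s') = - (?\<Delta> + ?a *\<^sub>R ?d)" "(?z, ?s) - ?a *\<^sub>R ?d - (?z, ?s) = - (?a *\<^sub>R ?d)"
      by (simp_all add: algebra_simps)
    ultimately have "norm (?\<Delta> + ?a *\<^sub>R ?d) \<le> norm (?a *\<^sub>R ?d)" by (metis norm_minus_cancel)
    then have "(norm (?\<Delta> + ?a *\<^sub>R ?d))\<^sup>2 \<le> (norm (?a *\<^sub>R ?d))\<^sup>2" by (intro power_mono) auto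
    moreover have "(norm (?\<Delta> + ?a *\<^sub>R ?d))\<^sup>2 = ?\<Delta> \<bullet> ?\<Delta> + 2 * (?a * (?d \<bullet> ?\<Delta>)) + (norm (?a *\<^sub>R ?d))\<^sup>2"
      unfolding power2_norm_eq_inner inner_add_left inner_add_right
      by (simp only: inner_scaleR_left inner_scaleR_right inner_commute[of ?\<Delta> ?d])
    ultimately have "?\<Delta> \<bullet> ?\<Delta> + 2 * (?a * (?d \<bullet> ?\<Delta>)) \<le> 0" by linarith
    then have "(?L i + c_beta P) * (?\<Delta> \<bullet> ?\<Delta> + 2 * (?a * (?d \<bullet> ?\<Delta>))) \<le> 0"
      using L[of i] p by (intro mult_nonneg_nonpos) auto
    then have dot: "2 * (?d \<bullet> ?\<Delta>) \<le> - ((?L i + c_beta P) * ?N\<^sup>2)"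
      using L[of i] p by (simp only: distrib_left[of "?L i + c_beta P"] power2_norm_eq_inner) simp
    have desc: "psi_hat F f g \<gamma>1 \<gamma>2 ?\<sigma> ?x ?y z' s' ?\<theta> \<le> psi_hat F f g \<gamma>1 \<gamma>2 ?\<sigma> ?x ?y ?z ?s ?\<theta> + ?d \<bullet> ?\<Delta> + snd ?\<sigma> / 2 * ?N\<^sup>2"
      by (rule zs_descent[OF \<sigma>])
    have "resid f g \<gamma>1 ?\<theta> ?x ?y z' \<le> resid f g \<gamma>1 ?\<theta> ?x ?y ?z + K * (norm ((?x, ?y) - (?x, ?y)) + norm (z' - ?z))"
      by (rule step_const_resid[OF K x x b])
    also have "K * (norm ((?x, ?y) - (?x, ?y)) + norm (z' - ?z)) \<le> K * ?N"
      using pair_dist_bounds(1)[of z' ?z s' ?s] K by (intro mult_left_mono) (auto simp: step_const_def)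
    finally have "resid f g \<gamma>1 ?\<theta> ?x ?y z' \<le> ?\<zeta> + K * ?N" using R by simp
    then have "(resid f g \<gamma>1 ?\<theta> ?x ?y z')\<^sup>2 \<le> (?\<zeta> + K * ?N)\<^sup>2" using resid_nonneg by (rule power_mono)
    also have "\<dots> \<le> 2 * ?\<zeta>\<^sup>2 + 2 * (K * ?N)\<^sup>2" by (rule sum_sq_le)
    finally have "(\<gamma>1 / 2) * (resid f g \<gamma>1 ?\<theta> ?x ?y z')\<^sup>2 \<le> (\<gamma>1 / 2) * (2 * ?\<zeta>\<^sup>2 + 2 * (K * ?N)\<^sup>2)"
      using gamma_pos by (intro mult_left_mono) auto
    then have res: "(\<gamma>1 / 2) * (resid f g \<gamma>1 ?\<theta> ?x ?y z')\<^sup>2 \<le> \<gamma>1 * ?\<zeta>\<^sup>2 + (\<gamma>1 * K\<^sup>2) * ?N\<^sup>2"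
      by (simp add: power_mult_distrib algebra_simps)
    have "?T * ?N\<^sup>2 \<le> ?L i * ?N\<^sup>2" using T by (rule mult_right_mono) simp
    then have "c_beta P * ?N\<^sup>2 + snd ?\<sigma> * ?N\<^sup>2 + 2 * ((\<gamma>1 * K\<^sup>2) * ?N\<^sup>2) \<le> ?L i * ?N\<^sup>2"
      by (simp only: distrib_right mult.assoc)
    moreover have "2 * (?d \<bullet> ?\<Delta>) \<le> - (?L i * ?N\<^sup>2) - c_beta P * ?N\<^sup>2" using dot unfolding distrib_right by linarith
    moreover have "snd ?\<sigma> / 2 * ?N\<^sup>2 = (snd ?\<sigma> * ?N\<^sup>2) / 2" by simp
    ultimately have "psi_hat F f g \<gamma>1 \<gamma>2 ?\<sigma> ?x ?y z' s' ?\<theta> + (\<gamma>1 / 2) * (resid f g \<gamma>1 ?\<theta> ?x ?y z')\<^sup>2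
              \<le> psi_hat F f g \<gamma>1 \<gamma>2 ?\<sigma> ?x ?y ?z ?s ?\<theta> - c_beta P * ?N\<^sup>2 + \<gamma>1 * ?\<zeta>\<^sup>2"
      using desc res by linarith
    then show "accept i" unfolding accept_def tr Let_def by simp
  qed
  moreover have "0 < ?L i + c_beta P" using L[of i] p(1) by linarith
  ultimately show ?thesis using i(2) by (intro exI[of _ "?L i + c_beta P"]) auto
qed

end

section \<open>Invariants and energy of a run\<close>

lemma compl_trunc_mono: "M \<le> M' \<Longrightarrow> compl_trunc M \<subseteq> compl_trunc M'"
  unfolding compl_trunc_def by (auto intro: order_trans)

locale bspm_run = bilevel F f G g LF \<gamma>1 \<gamma>2
  for F f :: "(real^'n) \<times> (real^'m) \<Rightarrow> real"
    and G :: "(real^'n) \<times> (real^'m) \<Rightarrow> real^'p"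
    and g :: "(real^'n) \<times> (real^'m) \<Rightarrow> real^'q"
    and LF \<gamma>1 \<gamma>2 :: real +
  fixes P :: ig_params and r :: "('n, 'm, 'q) ig_run"
  assumes run: "iG_BSPM F f G g \<gamma>1 \<gamma>2 P r"
    and tau_lim: "tau P \<longlonglongrightarrow> 0"
    and zeta_summable: "\<And>k. summable (\<lambda>l. (zeta P k l)\<^sup>2)"
    and zeta_lim: "(\<lambda>k. \<Sum>l. (zeta P k l)\<^sup>2) \<longlonglongrightarrow> 0"
begin

lemma valid: "valid_params P"
  and loop: "inner_loop F f G g \<gamma>1 \<gamma>2 P r k"
  and upd: "outer_update f G g \<gamma>1 \<gamma>2 P r k"
  using run by (auto simp: iG_BSPM_def)

lemma pos: "0 < varrho_rho P" "0 < c_rho P" "0 < c_tilde P" "0 < M_init P" "0 < Delta_z P"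
  "0 < c_alpha P" "0 < c_beta P" "0 < L_hat P" "1 < kappa_L P" "0 < tau P k" "0 \<le> zeta P k l"
  "0 < fst (sigma_init P)" "0 < snd (sigma_init P)"
  using valid by (auto simp: valid_params_def)

definition t_val :: "nat \<Rightarrow> real" where
  "t_val k = gap_hat f g \<gamma>1 \<gamma>2 (x_out r (Suc k)) (y_out r (Suc k)) (z_out r (Suc k)) (th_out r (Suc k))
     + (snd (sigma_out r k) / 2) * (norm (g (x_out r (Suc k), y_out r (Suc k)) + s_out r (Suc k)))\<^sup>2"

lemma update_cases:
  obtains (1) "t_val k \<le> c_rho P * tau P k" "sigma_out r (Suc k) = sigma_out r k" "keep_iterates r k"
  | (2) "\<not> t_val k \<le> c_rho P * tau P k" "t_val k \<le> c_tilde P / fst (sigma_out r k)" "increase_sigma P r k" "keep_iterates r k"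
  | (3) "\<not> t_val k \<le> c_rho P * tau P k" "increase_sigma P r k" "restart_iterates f G g \<gamma>1 \<gamma>2 P r k"
  using upd[of k] unfolding outer_update_def Let_def t_val_def[symmetric] by (auto split: if_splits)

section \<open>Growth of the penalty parameters and of the truncation bound\<close>

definition l0 :: real where "l0 = min (fst (sigma_init P)) (snd (sigma_init P))"

lemma l0_pos: "0 < l0"
  using pos by (simp add: l0_def)

lemma sigma_Suc:
  "sigma_out r (Suc k) = (if t_val k \<le> c_rho P * tau P k then sigma_out r k
     else (fst (sigma_out r k) + varrho_rho P, snd (sigma_out r k) + varrho_rho P))"
  by (cases k rule: update_cases) (auto simp: increase_sigma_def)

lemma sigma_lower: "l0 \<le> fst (sigma_out r k)" "l0 \<le> snd (sigma_out r k)"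
proof -
  have "l0 \<le> fst (sigma_out r k) \<and> l0 \<le> snd (sigma_out r k)"
  proof (induction k)
    case 0
    then show ?case using run by (simp add: iG_BSPM_def l0_def)
  next
    case (Suc k)
    then show ?case using pos(1) by (auto simp: sigma_Suc)
  qed
  then show "l0 \<le> fst (sigma_out r k)" "l0 \<le> snd (sigma_out r k)" by auto
qed

lemma sigma_pos: "0 < fst (sigma_out r k)" "0 < snd (sigma_out r k)"
  using sigma_lower[of k] l0_pos by linarith+

lemma Mz_Suc: "Mz r (Suc k) = max (Mz r k + Delta_z P) (max (norm (z_start r (Suc k))) (norm (s_start r (Suc k))))"
  using upd[of k] by (simp add: outer_update_def)

lemma Mz_lower: "M_init P + real k * Delta_z P \<le> Mz r k"
proof (induction k)
  case 0
  then show ?case using run by (simp add: iG_BSPM_def)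
next
  case (Suc k)
  then show ?case unfolding Mz_Suc by (simp add: algebra_simps le_max_iff_disj)
qed

lemma Mz_pos: "M_init P \<le> Mz r k" "0 < Mz r k"
proof -
  have "0 \<le> real k * Delta_z P" using pos by simp
  then show "M_init P \<le> Mz r k" using Mz_lower[of k] by linarith
  then show "0 < Mz r k" using pos by linarith
qed

lemma Mz_at_top: "filterlim (Mz r) at_top sequentially"
proof (rule filterlim_at_top_mono)
  show "filterlim (\<lambda>k. M_init P + real k * Delta_z P) at_top sequentially"
    by (intro filterlim_tendsto_add_at_top[OF tendsto_const] filterlim_at_top_mult_tendsto_pos[OF tendsto_const]
        filterlim_real_sequentially pos)
  show "\<forall>\<^sub>F k in sequentially. M_init P + real k * Delta_z P \<le> Mz r k" using Mz_lower by simp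
qed

section \<open>Invariants of the iterates\<close>

definition inv_at :: "nat \<Rightarrow> real^'n \<Rightarrow> real^'m \<Rightarrow> real^'q \<Rightarrow> real^'q \<Rightarrow> real^'m \<Rightarrow> real \<Rightarrow> bool" where
  "inv_at k x y z s \<theta> \<zeta> \<longleftrightarrow> (x, y) \<in> Omega G \<and> (z, s) \<in> compl_trunc (Mz r k) \<and> resid f g \<gamma>1 \<theta> x y z \<le> \<zeta>"

lemma inner_stepD: "l \<le> stop r k \<Longrightarrow> inner_step F f G g \<gamma>1 \<gamma>2 P r k l"
  using loop[of k] by (simp add: inner_loop_def)

lemma x_step_in_Omega:
  assumes "l \<le> stop r k"
  shows "(x_in r k (Suc l), y_in r k (Suc l)) \<in> Omega G"
proof -
  have "step_xy F f G g \<gamma>1 \<gamma>2 P r k l" using inner_stepD[OF assms] by (simp add: inner_step_def)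
  then have "\<exists>p. (x_in r k (Suc l), y_in r k (Suc l)) = closest_point (Omega G) p"
    unfolding step_xy_def Let_def by (elim exE conjE) (rule exI)
  then show ?thesis using closest_point_in_set[OF Omega_set(2,1)] by auto
qed

lemma z_step_in_trunc:
  assumes "l \<le> stop r k"
  shows "(z_in r k (Suc l), s_in r k (Suc l)) \<in> compl_trunc (Mz r k)"
proof -
  have "step_zs F f g \<gamma>1 \<gamma>2 P r k l" using inner_stepD[OF assms] by (simp add: inner_step_def)
  then have "\<exists>p. (z_in r k (Suc l), s_in r k (Suc l)) = proj_compl (Mz r k) p"
    unfolding step_zs_def Let_def by (elim exE conjE) (rule exI)
  then show ?thesis using proj_compl_in[of "Mz r k"] Mz_pos(2)[of k] by auto
qed

text \<open>No induction over \<open>l\<close>: the projections and the residual test restore the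
  invariant in every step, whatever the preceding iterate.\<close>

lemma inv_in:
  assumes "inv_at k (x_out r k) (y_start r k) (z_start r k) (s_start r k) (th_start r k) (zeta P k 0)" "l \<le> Suc (stop r k)"
  shows "inv_at k (x_in r k l) (y_in r k l) (z_in r k l) (s_in r k l) (th_in r k l) (zeta P k l)"
proof (cases l)
  case 0
  then show ?thesis using assms(1) loop[of k] by (simp add: inner_loop_def)
next
  case (Suc j)
  then have "j \<le> stop r k" using assms(2) by simp
  then show ?thesis
    using x_step_in_Omega z_step_in_trunc inner_stepD unfolding Suc inv_at_def inner_step_def by blast
qed

lemma out_eq:
  "x_out r (Suc k) = x_in r k (Suc (stop r k))" "y_out r (Suc k) = y_in r k (Suc (stop r k))"
  "z_out r (Suc k) = z_in r k (Suc (stop r k))" "s_out r (Suc k) = s_in r k (Suc (stop r k))"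
  "th_out r (Suc k) = th_in r k (Suc (stop r k))" "zeta P (Suc k) 0 = zeta P k (Suc (stop r k))"
  using loop[of k] by (simp_all add: inner_loop_def)

lemma inv_start: "inv_at k (x_out r k) (y_start r k) (z_start r k) (s_start r k) (th_start r k) (zeta P k 0)"
proof (induction k)
  case 0
  show ?case using run unfolding iG_BSPM_def inv_at_def by blast
next
  case (Suc k)
  have out: "inv_at k (x_out r (Suc k)) (y_out r (Suc k)) (z_out r (Suc k)) (s_out r (Suc k)) (th_out r (Suc k)) (zeta P (Suc k) 0)"
    using inv_in[OF Suc, of "Suc (stop r k)"] by (simp add: out_eq)
  have M: "Mz r k \<le> Mz r (Suc k)" using pos(5) unfolding Mz_Suc by (simp add: le_max_iff_disj)
  have keep: ?case if "keep_iterates r k"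
    using out that compl_trunc_mono[OF M] unfolding inv_at_def keep_iterates_def by auto
  show ?case
  proof (cases k rule: update_cases)
    case 3
    let ?z = "z_start r (Suc k)" and ?s = "s_start r (Suc k)"
    have R: "(x_out r (Suc k), y_start r (Suc k)) \<in> Omega G" "0 \<le> ?z"
      "resid f g \<gamma>1 (th_start r (Suc k)) (x_out r (Suc k)) (y_start r (Suc k)) ?z \<le> zeta P (Suc k) 0"
      and s: "?s = (\<chi> i. if ?z $ i > 0 then 0 else max 0 (- (g (x_out r (Suc k), y_start r (Suc k)) $ i)))"
      using 3(3) unfolding restart_iterates_def Let_def by auto
    \<comment> \<open>The update of \<open>Mz\<close> takes the maximum with the norms of the
      restarted pair, so that this pair fits into the new truncated set.\<close>
    have "norm ?z \<le> Mz r (Suc k)" "norm ?s \<le> Mz r (Suc k)" unfolding Mz_Suc by auto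
    then have le: "?z $ i \<le> Mz r (Suc k)" "?s $ i \<le> Mz r (Suc k)" for i
      using component_le_norm_cart[of ?z i] component_le_norm_cart[of ?s i] by linarith+
    have z0: "0 \<le> ?z $ i" for i using R(2) by (simp add: less_eq_vec_def)
    have s0: "0 \<le> ?s $ i" for i by (simp add: s)
    have zs: "?z $ i * ?s $ i = 0" for i using z0[of i] by (simp add: s)
    have "(?z, ?s) \<in> compl_trunc (Mz r (Suc k))"
      using le z0 s0 zs by (simp add: compl_trunc_def compl_set_def less_eq_vec_def)
    then show ?thesis using R by (simp add: inv_at_def)
  qed (use keep in auto)
qed

lemmas inv_inner = inv_in[OF inv_start]

lemma inv_out: "inv_at k (x_out r (Suc k)) (y_out r (Suc k)) (z_out r (Suc k)) (s_out r (Suc k)) (th_out r (Suc k)) (zeta P (Suc k) 0)"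
  using inv_inner[of "Suc (stop r k)" k] by (simp add: out_eq)

lemma trunc_nonneg: "(z, s) \<in> compl_trunc M \<Longrightarrow> 0 \<le> z"
  by (simp add: compl_trunc_def compl_set_def)

section \<open>Energy estimates for the loops\<close>

lemma psi_hat_le:
  assumes "x \<in> Xset G" "0 \<le> z"
  shows "psi_hat F f g \<gamma>1 \<gamma>2 \<sigma> x y z s \<theta>' \<le> psi_hat F f g \<gamma>1 \<gamma>2 \<sigma> x y z s \<theta> + (\<gamma>1 / 2) * (resid f g \<gamma>1 \<theta> x y z)\<^sup>2"
  using gap_hat_le[OF assms, of y \<theta>' \<theta>] unfolding psi_hat_def by linarith

abbreviation psi_in :: "nat \<Rightarrow> nat \<Rightarrow> real" where
  "psi_in k l \<equiv> psi_hat F f g \<gamma>1 \<gamma>2 (sigma_out r k) (x_in r k l) (y_in r k l) (z_in r k l) (s_in r k l) (th_in r k l)"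

text \<open>
  The line search decreases the surrogate for the old approximate proximal point; replacing that point costs
  at most the squared residual, which the acceptance tests include.
\<close>

lemma psi_in_Suc:
  assumes l: "l \<le> stop r k"
  shows "psi_in k (Suc l) \<le> psi_in k l + 2 * \<gamma>1 * (zeta P k l)\<^sup>2"
proof -
  let ?\<sigma> = "sigma_out r k" and ?x = "x_in r k (Suc l)" and ?y = "y_in r k (Suc l)" and ?z = "z_in r k l" and ?s = "s_in r k l"
    and ?z' = "z_in r k (Suc l)" and ?s' = "s_in r k (Suc l)" and ?\<theta> = "th_in r k l" and ?\<theta>h = "th_half r k l" and ?\<zeta> = "zeta P k l"
  have x: "?x \<in> Xset G" using x_step_in_Omega[OF l] by (rule Omega_X)
  have z: "0 \<le> ?z" using inv_inner[of l k] l trunc_nonneg unfolding inv_at_def by auto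
  have z': "0 \<le> ?z'" using z_step_in_trunc[OF l] by (rule trunc_nonneg)
  have st: "step_xy F f G g \<gamma>1 \<gamma>2 P r k l" "step_zs F f g \<gamma>1 \<gamma>2 P r k l"
    using inner_stepD[OF l] by (auto simp: inner_step_def)
  let ?tx = "\<lambda>j. closest_point (Omega G) ((x_in r k l, y_in r k l)
     - (1 / (L0_xy P k l * kappa_L P ^ j + c_alpha P)) *\<^sub>R d_xy F f g \<gamma>1 \<gamma>2 ?\<sigma> (x_in r k l) (y_in r k l) ?z ?s ?\<theta>)"
  \<comment> \<open>The acceptance test as a predicate on pairs; it is then evaluated at the
    accepted point without reference to the trial index.\<close>
  define ax where "ax = (\<lambda>(x', y'). psi_hat F f g \<gamma>1 \<gamma>2 ?\<sigma> x' y' ?z ?s ?\<theta> + (\<gamma>1 / 2) * (resid f g \<gamma>1 ?\<theta> x' y' ?z)\<^sup>2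
     \<le> psi_in k l - c_alpha P * (norm ((x', y') - (x_in r k l, y_in r k l)))\<^sup>2 + \<gamma>1 * ?\<zeta>\<^sup>2)"
  have "\<exists>j. first_accepted (\<lambda>j. ax (?tx j)) j \<and> (?x, ?y) = ?tx j"
    using st(1) unfolding step_xy_def Let_def ax_def .
  then have "ax (?x, ?y)" unfolding first_accepted_def by (elim exE conjE) simp
  then have "psi_hat F f g \<gamma>1 \<gamma>2 ?\<sigma> ?x ?y ?z ?s ?\<theta> + (\<gamma>1 / 2) * (resid f g \<gamma>1 ?\<theta> ?x ?y ?z)\<^sup>2
     \<le> psi_in k l - c_alpha P * (norm ((?x, ?y) - (x_in r k l, y_in r k l)))\<^sup>2 + \<gamma>1 * ?\<zeta>\<^sup>2"
    unfolding ax_def by simp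
  moreover have "0 \<le> c_alpha P * (norm ((?x, ?y) - (x_in r k l, y_in r k l)))\<^sup>2" using pos by simp
  moreover
  let ?tz = "\<lambda>j. proj_compl (Mz r k) ((?z, ?s)
     - (1 / (L0_zs P k l * kappa_L P ^ j + c_beta P)) *\<^sub>R d_zs g \<gamma>2 ?\<sigma> ?x ?y ?z ?s ?\<theta>h)"
  define az where "az = (\<lambda>(z', s'). psi_hat F f g \<gamma>1 \<gamma>2 ?\<sigma> ?x ?y z' s' ?\<theta>h + (\<gamma>1 / 2) * (resid f g \<gamma>1 ?\<theta>h ?x ?y z')\<^sup>2
     \<le> psi_hat F f g \<gamma>1 \<gamma>2 ?\<sigma> ?x ?y ?z ?s ?\<theta>h - c_beta P * (norm ((z', s') - (?z, ?s)))\<^sup>2 + \<gamma>1 * ?\<zeta>\<^sup>2)"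
  have "\<exists>j. first_accepted (\<lambda>j. az (?tz j)) j \<and> (?z', ?s') = ?tz j"
    using st(2) unfolding step_zs_def Let_def az_def .
  then have "az (?z', ?s')" unfolding first_accepted_def by (elim exE conjE) simp
  then have "psi_hat F f g \<gamma>1 \<gamma>2 ?\<sigma> ?x ?y ?z' ?s' ?\<theta>h + (\<gamma>1 / 2) * (resid f g \<gamma>1 ?\<theta>h ?x ?y ?z')\<^sup>2
     \<le> psi_hat F f g \<gamma>1 \<gamma>2 ?\<sigma> ?x ?y ?z ?s ?\<theta>h - c_beta P * (norm ((?z', ?s') - (?z, ?s)))\<^sup>2 + \<gamma>1 * ?\<zeta>\<^sup>2"
    unfolding az_def by simp
  moreover have "0 \<le> c_beta P * (norm ((?z', ?s') - (?z, ?s)))\<^sup>2" using pos by simp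
  \<comment> \<open>\<open>\<theta>\<close> is exchanged twice, for the half-step point and then for
    the new one. Each exchange is paid by the residual term of one acceptance test, and each test
    leaves the slack \<open>\<gamma>1 * \<zeta>\<^sup>2\<close>.\<close>
  ultimately show ?thesis
    using psi_hat_le[OF x z, of ?\<sigma> ?y ?s ?\<theta>h ?\<theta>] psi_hat_le[OF x z', of ?\<sigma> ?y ?s' "th_in r k (Suc l)" ?\<theta>h]
    by linarith
qed

abbreviation zsum :: "nat \<Rightarrow> real" where "zsum k \<equiv> \<Sum>l. (zeta P k l)\<^sup>2"

lemma zeta_sq_le: "(zeta P k l)\<^sup>2 \<le> zsum k"
  using sum_le_suminf[OF zeta_summable, of "{l}" k] by simp

lemma zsum_nonneg: "0 \<le> zsum k"
  by (rule suminf_nonneg[OF zeta_summable]) simp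

lemma psi_out: "psi_in k (Suc (stop r k)) \<le> psi_in k 0 + 2 * \<gamma>1 * zsum k"
proof -
  have "psi_in k l \<le> psi_in k 0 + 2 * \<gamma>1 * (\<Sum>j<l. (zeta P k j)\<^sup>2)" if "l \<le> Suc (stop r k)" for l
    using that
  proof (induction l)
    case (Suc l)
    then show ?case using psi_in_Suc[of l k] by (simp add: algebra_simps)
  qed simp
  from this[of "Suc (stop r k)"]
  have "psi_in k (Suc (stop r k)) \<le> psi_in k 0 + 2 * \<gamma>1 * (\<Sum>j<Suc (stop r k). (zeta P k j)\<^sup>2)" by simp
  moreover have "(\<Sum>j<Suc (stop r k). (zeta P k j)\<^sup>2) \<le> zsum k" by (rule sum_le_suminf[OF zeta_summable]) auto
  then have "2 * \<gamma>1 * (\<Sum>j<Suc (stop r k). (zeta P k j)\<^sup>2) \<le> 2 * \<gamma>1 * zsum k"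
    using gamma_pos by (intro mult_left_mono) auto
  ultimately show ?thesis by linarith
qed

text \<open>The counterpart of \<open>t_val\<close> at the beginning of a loop. It uses the penalty
  parameter of the loop about to start, which may exceed the one with which the point was
  tested.\<close>

definition start_val :: "nat \<Rightarrow> real" where
  "start_val k = gap_hat f g \<gamma>1 \<gamma>2 (x_out r k) (y_start r k) (z_start r k) (th_start r k)
     + (snd (sigma_out r k) / 2) * (norm (g (x_out r k, y_start r k) + s_start r k))\<^sup>2"

lemma t_val_le:
  "t_val k \<le> start_val k + (F (x_out r k, y_start r k) - F (x_out r (Suc k), y_out r (Suc k))) / fst (sigma_out r k) + 2 * \<gamma>1 * zsum k"
proof -
  have "psi_in k 0 = (1 / fst (sigma_out r k)) * F (x_out r k, y_start r k) + start_val k"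
    using loop[of k] by (simp add: psi_hat_def start_val_def inner_loop_def)
  moreover have "psi_in k (Suc (stop r k)) = (1 / fst (sigma_out r k)) * F (x_out r (Suc k), y_out r (Suc k)) + t_val k"
    by (simp add: psi_hat_def t_val_def out_eq)
  ultimately show ?thesis using psi_out[of k] by (simp add: diff_divide_distrib)
qed

text \<open>In Cases 2 and 3 the penalty value with the old parameter is at most of order
  \<open>1 / \<sigma>\<^sub>1\<close>. The surrogate gap may be slightly negative, but only by the
  squared residual, so the infeasibility term alone is bounded as well; this pays for the increase
  of \<open>\<sigma>\<^sub>2\<close>.\<close>

lemma start_val_Suc:
  "start_val (Suc k) \<le> c_rho P * tau P k + (1 + varrho_rho P / l0) * (c_tilde P / fst (sigma_out r k) + (\<gamma>1 / 2) * zsum (Suc k))"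
proof -
  let ?q = "(norm (g (x_out r (Suc k), y_start r (Suc k)) + s_start r (Suc k)))\<^sup>2"
  let ?gh = "gap_hat f g \<gamma>1 \<gamma>2 (x_out r (Suc k)) (y_start r (Suc k)) (z_start r (Suc k)) (th_start r (Suc k))"
  let ?c = "c_tilde P / fst (sigma_out r k)" and ?S = "(\<gamma>1 / 2) * zsum (Suc k)"
  let ?R = "resid f g \<gamma>1 (th_start r (Suc k)) (x_out r (Suc k)) (y_start r (Suc k)) (z_start r (Suc k))"
  have nn: "0 \<le> c_rho P * tau P k" "0 \<le> ?c" "0 \<le> ?S" "0 \<le> varrho_rho P / l0" "0 \<le> ?q"
    using pos(1-3) pos(10)[of k] sigma_pos[of k] gamma_pos zsum_nonneg[of "Suc k"] l0_pos by (auto simp: less_imp_le)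
  have inv: "(x_out r (Suc k), y_start r (Suc k)) \<in> Omega G" "0 \<le> z_start r (Suc k)" "?R \<le> zeta P (Suc k) 0"
    using inv_start[of "Suc k"] trunc_nonneg unfolding inv_at_def by auto
  have low: "0 \<le> ?gh + (\<gamma>1 / 2) * ?R\<^sup>2" by (rule gap_hat_lower[OF Omega_X[OF inv(1)] inv(2)])
  have "?R\<^sup>2 \<le> (zeta P (Suc k) 0)\<^sup>2" using inv(3) resid_nonneg by (rule power_mono)
  then have "?R\<^sup>2 \<le> zsum (Suc k)" using zeta_sq_le[of "Suc k" 0] by linarith
  then have RS: "(\<gamma>1 / 2) * ?R\<^sup>2 \<le> ?S" using gamma_pos by (intro mult_left_mono) auto
  show ?thesis
  proof (cases k rule: update_cases)
    case 1
    then have "start_val (Suc k) = t_val k" by (simp add: start_val_def t_val_def keep_iterates_def)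
    moreover have "0 \<le> (1 + varrho_rho P / l0) * (?c + ?S)" using nn by simp
    ultimately show ?thesis using 1 by linarith
  next
    assume neg: "\<not> t_val k \<le> c_rho P * tau P k" and "increase_sigma P r k"
    then have sv: "start_val (Suc k) = ?gh + snd (sigma_out r k) / 2 * ?q + varrho_rho P / 2 * ?q"
      by (simp add: start_val_def increase_sigma_def algebra_simps add_divide_distrib)
    \<comment> \<open>Since the old \<open>\<sigma>\<^sub>2\<close> is at least \<open>l0\<close>,
      its increment \<open>varrho_rho\<close> is at most \<open>varrho_rho / l0\<close> times the
      old value.\<close>
    have vr: "varrho_rho P / 2 * ?q \<le> varrho_rho P / l0 * (snd (sigma_out r k) / 2 * ?q)"
    proof -
      have "1 \<le> snd (sigma_out r k) / l0" using sigma_lower(2)[of k] l0_pos by simp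
      then have "varrho_rho P / 2 * ?q * 1 \<le> varrho_rho P / 2 * ?q * (snd (sigma_out r k) / l0)"
        using nn pos(1) by (intro mult_left_mono) auto
      then show ?thesis by (simp add: algebra_simps)
    qed
    have fin: ?thesis if a: "snd (sigma_out r k) / 2 * ?q \<le> ?c + ?S" "?gh + snd (sigma_out r k) / 2 * ?q \<le> ?c"
    proof -
      have "varrho_rho P / l0 * (snd (sigma_out r k) / 2 * ?q) \<le> varrho_rho P / l0 * (?c + ?S)"
        using a(1) nn(4) by (rule mult_left_mono)
      moreover have "(1 + varrho_rho P / l0) * (?c + ?S) = ?c + ?S + varrho_rho P / l0 * (?c + ?S)"
        by (simp add: distrib_right)
      ultimately show ?thesis using sv vr a nn by linarith
    qed
    {
      assume t: "t_val k \<le> ?c" and "keep_iterates r k"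
      then have "t_val k = ?gh + snd (sigma_out r k) / 2 * ?q" by (simp add: t_val_def keep_iterates_def)
      then show ?thesis using t low RS by (intro fin) linarith+
    next
      assume rs: "restart_iterates f G g \<gamma>1 \<gamma>2 P r k"
      let ?gi = "\<lambda>i. g (x_out r (Suc k), y_start r (Suc k)) $ i" and ?z = "z_start r (Suc k)"
      have z: "0 \<le> ?z $ i" for i using inv(2) by (simp add: less_eq_vec_def)
      have s: "s_start r (Suc k) = (\<chi> i. if ?z $ i > 0 then 0 else max 0 (- ?gi i))"
        and le: "?gh + (\<gamma>1 / 2) * ?R\<^sup>2 + (snd (sigma_out r k) / 2) *
               ((\<Sum>i\<in>{i. ?z $ i > 0}. (?gi i)\<^sup>2) + (\<Sum>i\<in>{i. ?z $ i = 0}. (max 0 (?gi i))\<^sup>2)) \<le> ?c"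
        using rs unfolding restart_iterates_def Let_def by auto
      have U: "UNIV = {i. ?z $ i > 0} \<union> {i. ?z $ i = 0}" using z by (auto simp: less_le)
      \<comment> \<open>With the restarted slack, \<open>g + s\<close> equals \<open>g\<close> where
        \<open>z > 0\<close> and the positive part of \<open>g\<close> where \<open>z = 0\<close>,
        so the restart test bounds exactly this penalty.\<close>
      have "?q = (\<Sum>i\<in>{i. ?z $ i > 0} \<union> {i. ?z $ i = 0}. (?gi i + s_start r (Suc k) $ i)\<^sup>2)"
        unfolding norm_vec_sq U[symmetric] by simp
      also have "\<dots> = (\<Sum>i\<in>{i. ?z $ i > 0}. (?gi i + s_start r (Suc k) $ i)\<^sup>2) + (\<Sum>i\<in>{i. ?z $ i = 0}. (?gi i + s_start r (Suc k) $ i)\<^sup>2)"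
        by (rule sum.union_disjoint) auto
      also have "(\<Sum>i\<in>{i. ?z $ i > 0}. (?gi i + s_start r (Suc k) $ i)\<^sup>2) = (\<Sum>i\<in>{i. ?z $ i > 0}. (?gi i)\<^sup>2)"
        by (rule sum.cong) (auto simp: s)
      also have "(\<Sum>i\<in>{i. ?z $ i = 0}. (?gi i + s_start r (Suc k) $ i)\<^sup>2) = (\<Sum>i\<in>{i. ?z $ i = 0}. (max 0 (?gi i))\<^sup>2)"
        by (rule sum.cong) (auto simp: s max_def)
      finally have "?gh + (\<gamma>1 / 2) * ?R\<^sup>2 + snd (sigma_out r k) / 2 * ?q \<le> ?c" using le by simp
      moreover have "0 \<le> (\<gamma>1 / 2) * ?R\<^sup>2" using gamma_pos by simp
      ultimately show ?thesis using low nn by (intro fin) linarith+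
    }
  qed
qed

section \<open>Vanishing of the gap and of the infeasibility\<close>

lemma sigma_mono: "k \<le> k' \<Longrightarrow> fst (sigma_out r k) \<le> fst (sigma_out r k') \<and> snd (sigma_out r k) \<le> snd (sigma_out r k')"
proof (induction k' rule: dec_induct)
  case (step n)
  then show ?case using pos(1) by (auto simp: sigma_Suc)
qed simp

text \<open>Outside Case 1 both parameters grow by the fixed amount \<open>varrho_rho\<close>. If
  this happens infinitely often, they pass every bound and, being monotone, stay above it.\<close>

lemma dichotomy:
  "(\<exists>K. \<forall>k\<ge>K. t_val k \<le> c_rho P * tau P k) \<or>
   (filterlim (\<lambda>k. fst (sigma_out r k)) at_top sequentially \<and> filterlim (\<lambda>k. snd (sigma_out r k)) at_top sequentially)"
proof (cases "\<exists>K. \<forall>k\<ge>K. t_val k \<le> c_rho P * tau P k")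
  case False
  then have inf: "\<exists>k\<ge>K. \<not> t_val k \<le> c_rho P * tau P k" for K by blast
  have "filterlim (\<lambda>k. fst (sigma_out r k)) at_top sequentially \<and> filterlim (\<lambda>k. snd (sigma_out r k)) at_top sequentially"
  proof -
    have ex: "\<exists>k. l0 + real n * varrho_rho P \<le> fst (sigma_out r k) \<and> l0 + real n * varrho_rho P \<le> snd (sigma_out r k)" for n
    proof (induction n)
      case 0
      then show ?case using sigma_lower[of 0] by auto
    next
      case (Suc n)
      then obtain k where k: "l0 + real n * varrho_rho P \<le> fst (sigma_out r k)" "l0 + real n * varrho_rho P \<le> snd (sigma_out r k)" by auto
      obtain k' where k': "k' \<ge> k" "\<not> t_val k' \<le> c_rho P * tau P k'" using inf by blast
      then show ?case
        using k sigma_mono[OF k'(1)] by (intro exI[of _ "Suc k'"]) (simp add: sigma_Suc algebra_simps)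
    qed
    have ev: "\<forall>\<^sub>F k in sequentially. Z \<le> fst (sigma_out r k) \<and> Z \<le> snd (sigma_out r k)" for Z
    proof -
      obtain n where "(Z - l0) / varrho_rho P \<le> real n" using real_arch_simple by blast
      then have "Z \<le> l0 + real n * varrho_rho P" using pos(1) by (simp add: field_simps)
      moreover obtain k where "l0 + real n * varrho_rho P \<le> fst (sigma_out r k)" "l0 + real n * varrho_rho P \<le> snd (sigma_out r k)"
        using ex by blast
      ultimately have "Z \<le> fst (sigma_out r k') \<and> Z \<le> snd (sigma_out r k')" if "k' \<ge> k" for k'
        using sigma_mono[OF that] by linarith
      then show ?thesis unfolding eventually_sequentially by blast
    qed
    have "\<forall>\<^sub>F k in sequentially. Z \<le> fst (sigma_out r k)" "\<forall>\<^sub>F k in sequentially. Z \<le> snd (sigma_out r k)" for Z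
      using ev[of Z] by (rule eventually_mono, simp)+
    then show ?thesis unfolding filterlim_at_top by blast
  qed
  then show ?thesis ..
qed blast

text \<open>If only Case 1 occurs from some index on, the tolerance bounds \<open>t_val\<close>
  directly. Otherwise the inner loop adds to the start value only the oscillation of
  \<open>F\<close> divided by the diverging first parameter and a tail of the inexactness.\<close>

lemma t_val_small:
  assumes "e > 0"
  shows "\<forall>\<^sub>F k in sequentially. t_val k < e"
  using dichotomy
proof
  assume "\<exists>K. \<forall>k\<ge>K. t_val k \<le> c_rho P * tau P k"
  then have 1: "\<forall>\<^sub>F k in sequentially. t_val k \<le> c_rho P * tau P k" unfolding eventually_sequentially .
  have "(\<lambda>k. c_rho P * tau P k) \<longlonglongrightarrow> c_rho P * 0" by (intro tendsto_intros tau_lim)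
  then have "\<forall>\<^sub>F k in sequentially. c_rho P * tau P k < e" using assms by (intro order_tendstoD) auto
  with 1 show ?thesis by eventually_elim simp
next
  assume top: "filterlim (\<lambda>k. fst (sigma_out r k)) at_top sequentially \<and> filterlim (\<lambda>k. snd (sigma_out r k)) at_top sequentially"
  obtain C where C: "smooth_bound (Omega G) F C" using smooth_bound_F by blast
  let ?u = "\<lambda>k. c_rho P * tau P k + (1 + varrho_rho P / l0) * (c_tilde P / fst (sigma_out r k) + (\<gamma>1 / 2) * zsum (Suc k))
     + 2 * C / fst (sigma_out r (Suc k)) + 2 * \<gamma>1 * zsum (Suc k)"
  have Sl: "(\<lambda>k. zsum (Suc k)) \<longlonglongrightarrow> 0" using zeta_lim LIMSEQ_Suc by blast
  have inv: "(\<lambda>k. c / fst (sigma_out r k)) \<longlonglongrightarrow> 0" for c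
    using top by (intro tendsto_divide_0[OF tendsto_const] filterlim_at_top_imp_at_infinity) auto
  have "?u \<longlonglongrightarrow> c_rho P * 0 + (1 + varrho_rho P / l0) * (0 + (\<gamma>1 / 2) * 0) + 0 + 2 * \<gamma>1 * 0"
    by (intro tendsto_intros tau_lim Sl inv LIMSEQ_Suc[OF inv])
  then have u: "\<forall>\<^sub>F k in sequentially. ?u k < e" using assms by (intro order_tendstoD) auto
  \<comment> \<open>The index is shifted because \<open>start_val_Suc\<close> says nothing about the
    start of the loop with index \<open>0\<close>.\<close>
  have le: "t_val (Suc k) \<le> ?u k" for k
  proof -
    have "(x_out r (Suc k), y_start r (Suc k)) \<in> Omega G" "(x_out r (Suc (Suc k)), y_out r (Suc (Suc k))) \<in> Omega G"
      using inv_start[of "Suc k"] inv_out[of "Suc k"] by (auto simp: inv_at_def)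
    then have "\<bar>F (x_out r (Suc k), y_start r (Suc k))\<bar> \<le> C" "\<bar>F (x_out r (Suc (Suc k)), y_out r (Suc (Suc k)))\<bar> \<le> C"
      using C unfolding smooth_bound_def by blast+
    then have "(F (x_out r (Suc k), y_start r (Suc k)) - F (x_out r (Suc (Suc k)), y_out r (Suc (Suc k)))) / fst (sigma_out r (Suc k))
       \<le> 2 * C / fst (sigma_out r (Suc k))"
      using sigma_pos(1)[of "Suc k"] by (intro divide_right_mono) linarith+
    then show ?thesis using t_val_le[of "Suc k"] start_val_Suc[of k] by linarith
  qed
  have "\<forall>\<^sub>F k in sequentially. t_val (Suc k) < e"
    using u by (rule eventually_mono) (rule order_le_less_trans[OF le])
  then show ?thesis using eventually_sequentially_Suc[of "\<lambda>k. t_val k < e"] by simp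
qed

abbreviation th_star :: "nat \<Rightarrow> real^'m" where
  "th_star k \<equiv> theta_star f g \<gamma>1 (x_out r (Suc k)) (y_out r (Suc k)) (z_out r (Suc k))"

lemma out_in: "(x_out r (Suc k), y_out r (Suc k)) \<in> Omega G" "x_out r (Suc k) \<in> Xset G" "0 \<le> z_out r (Suc k)"
  "(z_out r (Suc k), s_out r (Suc k)) \<in> compl_trunc (Mz r k)"
  using inv_out[of k] Omega_X trunc_nonneg unfolding inv_at_def by auto

text \<open>The last tolerance used in loop \<open>k\<close> reappears as entry \<open>0\<close> of
  row \<open>Suc k\<close>; hence the residual is measured by \<open>zsum (Suc k)\<close>.\<close>

lemma out_gap_bound:
  "gap_hat f g \<gamma>1 \<gamma>2 (x_out r (Suc k)) (y_out r (Suc k)) (z_out r (Suc k)) (th_out r (Suc k))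
     + (\<gamma>1 / 2) * (resid f g \<gamma>1 (th_out r (Suc k)) (x_out r (Suc k)) (y_out r (Suc k)) (z_out r (Suc k)))\<^sup>2
     + (snd (sigma_out r k) / 2) * (norm (g (x_out r (Suc k), y_out r (Suc k)) + s_out r (Suc k)))\<^sup>2
   \<le> t_val k + (\<gamma>1 / 2) * zsum (Suc k)"
proof -
  let ?R = "resid f g \<gamma>1 (th_out r (Suc k)) (x_out r (Suc k)) (y_out r (Suc k)) (z_out r (Suc k))"
  have "?R \<le> zeta P (Suc k) 0" using inv_out[of k] by (simp add: inv_at_def)
  then have "?R\<^sup>2 \<le> (zeta P (Suc k) 0)\<^sup>2" using resid_nonneg by (rule power_mono)
  then have "?R\<^sup>2 \<le> zsum (Suc k)" using zeta_sq_le[of "Suc k" 0] by linarith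
  then have "(\<gamma>1 / 2) * ?R\<^sup>2 \<le> (\<gamma>1 / 2) * zsum (Suc k)" using gamma_pos by (intro mult_left_mono) auto
  then show ?thesis by (simp add: t_val_def)
qed

lemma bound_small:
  assumes "e > 0"
  shows "\<forall>\<^sub>F k in sequentially. t_val k + (\<gamma>1 / 2) * zsum (Suc k) < e"
proof -
  have "(\<lambda>k. zsum (Suc k)) \<longlonglongrightarrow> 0" using zeta_lim LIMSEQ_Suc by blast
  then have "(\<lambda>k. (\<gamma>1 / 2) * zsum (Suc k)) \<longlonglongrightarrow> (\<gamma>1 / 2) * 0" by (intro tendsto_intros)
  from order_tendstoD(2)[OF this, of "e / 2"]
  have "\<forall>\<^sub>F k in sequentially. (\<gamma>1 / 2) * zsum (Suc k) < e / 2" using assms by simp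
  moreover have "\<forall>\<^sub>F k in sequentially. t_val k < e / 2" using assms by (intro t_val_small) simp
  ultimately show ?thesis by eventually_elim simp
qed

text \<open>The left side of \<open>out_gap_bound\<close> is a nonnegative gap part plus a
  nonnegative penalty. Dropping one of them dominates the gap, the distance to the proximal point,
  or the infeasibility by the same vanishing quantity.\<close>

lemma squeeze:
  assumes "\<And>k. 0 \<le> q k" "\<And>k. q k \<le> c * (t_val k + (\<gamma>1 / 2) * zsum (Suc k))" "0 < c"
  shows "q \<longlonglongrightarrow> 0"
proof (rule order_tendstoI)
  fix a :: real assume "a < 0"
  then show "\<forall>\<^sub>F k in sequentially. a < q k" using assms(1) by (simp add: less_le_trans)
next
  fix a :: real assume "0 < a"
  have "\<forall>\<^sub>F k in sequentially. t_val k + (\<gamma>1 / 2) * zsum (Suc k) < a / c" using \<open>0 < a\<close> assms(3) by (intro bound_small) simp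
  then show "\<forall>\<^sub>F k in sequentially. q k < a"
  proof (rule eventually_mono)
    fix k assume "t_val k + (\<gamma>1 / 2) * zsum (Suc k) < a / c"
    then have "c * (t_val k + (\<gamma>1 / 2) * zsum (Suc k)) < a" using assms(3) by (simp add: field_simps)
    then show "q k < a" using assms(2)[of k] by linarith
  qed
qed

lemma gap_lim: "(\<lambda>k. gap f g \<gamma>1 \<gamma>2 (x_out r (Suc k)) (y_out r (Suc k)) (z_out r (Suc k))) \<longlonglongrightarrow> 0"
proof (rule squeeze[where c=1])
  fix k
  note o = out_in(2,3)[of k]
  show "0 \<le> gap f g \<gamma>1 \<gamma>2 (x_out r (Suc k)) (y_out r (Suc k)) (z_out r (Suc k))" by (rule gap_bounds(1)[OF o])
  have "0 \<le> (snd (sigma_out r k) / 2) * (norm (g (x_out r (Suc k), y_out r (Suc k)) + s_out r (Suc k)))\<^sup>2"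
    using sigma_pos[of k] by simp
  then show "gap f g \<gamma>1 \<gamma>2 (x_out r (Suc k)) (y_out r (Suc k)) (z_out r (Suc k)) \<le> 1 * (t_val k + (\<gamma>1 / 2) * zsum (Suc k))"
    using gap_bounds(2)[OF o, of "y_out r (Suc k)" "th_out r (Suc k)"] out_gap_bound[of k] by simp
qed simp

lemma theta_lim: "(\<lambda>k. th_star k - y_out r (Suc k)) \<longlonglongrightarrow> 0"
proof -
  have "(\<lambda>k. (norm (th_star k - y_out r (Suc k)))\<^sup>2) \<longlonglongrightarrow> 0"
  proof (rule squeeze[where c="2 * \<gamma>1"])
    fix k
    note o = out_in(2,3)[of k]
    have "0 \<le> (snd (sigma_out r k) / 2) * (norm (g (x_out r (Suc k), y_out r (Suc k)) + s_out r (Suc k)))\<^sup>2"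
      using sigma_pos[of k] by simp
    then have "(norm (th_star k - y_out r (Suc k)))\<^sup>2 / (2 * \<gamma>1) \<le> t_val k + (\<gamma>1 / 2) * zsum (Suc k)"
      using gap_dist[OF o, of "y_out r (Suc k)" "th_out r (Suc k)"] out_gap_bound[of k] by linarith
    then show "(norm (th_star k - y_out r (Suc k)))\<^sup>2 \<le> 2 * \<gamma>1 * (t_val k + (\<gamma>1 / 2) * zsum (Suc k))"
      using gamma_pos by (simp add: field_simps)
  qed (use gamma_pos in auto)
  then have "(\<lambda>k. sqrt ((norm (th_star k - y_out r (Suc k)))\<^sup>2)) \<longlonglongrightarrow> sqrt 0" by (rule tendsto_real_sqrt)
  then show ?thesis by (simp add: tendsto_norm_zero_iff)
qed

text \<open>The second penalty parameter never falls below \<open>l0\<close>, so a vanishing penalty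
  forces feasibility even if the parameters stay bounded.\<close>

lemma feas_lim: "(\<lambda>k. g (x_out r (Suc k), y_out r (Suc k)) + s_out r (Suc k)) \<longlonglongrightarrow> 0"
proof -
  have "(\<lambda>k. (norm (g (x_out r (Suc k), y_out r (Suc k)) + s_out r (Suc k)))\<^sup>2) \<longlonglongrightarrow> 0"
  proof (rule squeeze[where c="2 / l0"])
    fix k
    let ?q = "(norm (g (x_out r (Suc k), y_out r (Suc k)) + s_out r (Suc k)))\<^sup>2"
    note o = out_in(2,3)[of k]
    have "l0 / 2 * ?q \<le> snd (sigma_out r k) / 2 * ?q" using sigma_lower[of k] by (intro mult_right_mono) auto
    then have "l0 / 2 * ?q \<le> t_val k + (\<gamma>1 / 2) * zsum (Suc k)"
      using gap_hat_lower[OF o, of "y_out r (Suc k)" "th_out r (Suc k)"] out_gap_bound[of k] by linarith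
    then show "?q \<le> 2 / l0 * (t_val k + (\<gamma>1 / 2) * zsum (Suc k))"
      using l0_pos by (simp add: field_simps)
  qed (use l0_pos in auto)
  then have "(\<lambda>k. sqrt ((norm (g (x_out r (Suc k), y_out r (Suc k)) + s_out r (Suc k)))\<^sup>2)) \<longlonglongrightarrow> sqrt 0" by (rule tendsto_real_sqrt)
  then show ?thesis by (simp add: tendsto_norm_zero_iff)
qed

end

section \<open>The approximate KKT condition\<close>

lemma GDERIV_component_s:
  fixes p :: "'a::euclidean_space \<times> ((real^'q) \<times> (real^'q))"
  shows "GDERIV (\<lambda>p. snd (snd p) $ i) p :> (0 :: 'a, (0 :: real^'q, axis i 1))"
  unfolding gderiv_def
  by (rule has_derivative_eq_rhs)
     (auto intro!: bounded_linear.has_derivative[OF bounded_linear_vec_nth] derivative_eq_intros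
       simp: fun_eq_iff inner_prod_def inner_axis)

context bilevel
begin

lemma grad_infeasibility:
  assumes "x \<in> Xset G"
  shows "grad (\<lambda>((x', y'), (z' :: real^'q, s')). (norm (g (x', y') + s'))\<^sup>2) ((x, y), (z, s))
    = (2 *\<^sub>R jac_transp g (x, y) (g (x, y) + s), (0, 2 *\<^sub>R (g (x, y) + s)))"
proof (rule grad_eqI)
  let ?p = "((x, y), (z, s))"
  let ?c = "\<lambda>i (p :: ((real^'n) \<times> (real^'m)) \<times> ((real^'q) \<times> (real^'q))). g (fst p) $ i + snd (snd p) $ i"
  let ?D = "\<lambda>i. (Gg i (x, y), (0 :: real^'q, axis i 1 :: real^'q))"
  have gi: "GDERIV (?c i) ?p :> ?D i" for i
  proof -
    have "((\<lambda>p. g (fst p) $ i) has_derivative (\<lambda>k. fst k \<bullet> Gg i (x, y))) (at ?p)"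
      by (rule has_derivative_compose[where g="\<lambda>w. g w $ i" and f=fst])
         (use GDERIV_g[OF assms, of i y] in \<open>auto simp: gderiv_def intro!: derivative_eq_intros\<close>)
    then have "GDERIV (\<lambda>p. g (fst p) $ i) ?p :> (Gg i (x, y), (0 :: real^'q, 0 :: real^'q))"
      by (simp add: gderiv_def inner_prod_def)
    from GDERIV_add[OF this GDERIV_component_s] show ?thesis by simp
  qed
  have "GDERIV (\<lambda>p. \<Sum>i\<in>UNIV. ?c i p * ?c i p) ?p :> (\<Sum>i\<in>UNIV. ?c i ?p *\<^sub>R ?D i + ?c i ?p *\<^sub>R ?D i)"
    by (intro GDERIV_sum GDERIV_mult gi)
  moreover have "(\<Sum>i\<in>UNIV. ?c i ?p *\<^sub>R ?D i + ?c i ?p *\<^sub>R ?D i)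
    = (2 *\<^sub>R jac_transp g (x, y) (g (x, y) + s), (0, 2 *\<^sub>R (g (x, y) + s)))"
  proof -
    have "(\<Sum>i\<in>UNIV. ?c i ?p *\<^sub>R ?D i + ?c i ?p *\<^sub>R ?D i) = 2 *\<^sub>R (\<Sum>i\<in>UNIV. ?c i ?p *\<^sub>R ?D i)"
      unfolding scaleR_2 sum.distrib ..
    moreover have "(\<Sum>i\<in>UNIV. ?c i ?p *\<^sub>R axis i 1) = g (x, y) + s"
      using basis_expansion[of "g (x, y) + s"] by (simp add: scalar_mult_eq_scaleR)
    ultimately show ?thesis
      by (simp add: prod_eq_iff fst_sum snd_sum jac_transp_def)
  qed
  moreover have "(\<lambda>p. \<Sum>i\<in>UNIV. ?c i p * ?c i p) = (\<lambda>((x', y'), (z' :: real^'q, s')). (norm (g (x', y') + s'))\<^sup>2)"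
    by (simp add: fun_eq_iff split_beta norm_vec_sq) (simp add: power2_eq_square)
  ultimately show "GDERIV (\<lambda>((x', y'), (z' :: real^'q, s')). (norm (g (x', y') + s'))\<^sup>2) ?p
      :> (2 *\<^sub>R jac_transp g (x, y) (g (x, y) + s), (0, 2 *\<^sub>R (g (x, y) + s)))" by simp
qed

text \<open>At the exact proximal point, the search direction scaled by \<open>fst \<sigma>\<close>
  is the \<open>(x, y)\<close>-gradient in the approximate KKT condition. For this reason the
  directions are re-evaluated at that point.\<close>

lemma d_xy_gap_grad:
  assumes "x \<in> Xset G"
  shows "d_xy F f g \<gamma>1 \<gamma>2 \<sigma> x y z s (theta_star f g \<gamma>1 x y z) = (1 / fst \<sigma>) *\<^sub>R grad F (x, y)
    + snd \<sigma> *\<^sub>R jac_transp g (x, y) (g (x, y) + s) + (gap_grad_x f g \<gamma>1 \<gamma>2 x y z, gap_grad_y f g \<gamma>1 \<gamma>2 x y z)"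
  using grad_partials(1,2)[OF assms]
  by (simp add: d_xy_def gap_grad_x_def gap_grad_y_def Let_def grad_Lag[OF assms] lambda_star_def diff_diff_eq)

lemma d_zs_gap_grad:
  "d_zs g \<gamma>2 \<sigma> x y z s (theta_star f g \<gamma>1 x y z) = (gap_grad_z f g \<gamma>1 \<gamma>2 x y z, snd \<sigma> *\<^sub>R (g (x, y) + s))"
  by (simp add: d_zs_eq gap_grad_z_def Let_def lambda_star_def pen_mult_def algebra_simps)

end

section \<open>Optimality of the last projections\<close>

context bspm_run
begin

abbreviation d_xy_out :: "nat \<Rightarrow> (real^'n) \<times> (real^'m)" where
  "d_xy_out k \<equiv> d_xy F f g \<gamma>1 \<gamma>2 (sigma_out r k) (x_out r (Suc k)) (y_out r (Suc k)) (z_out r (Suc k)) (s_out r (Suc k)) (th_star k)"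

abbreviation d_zs_out :: "nat \<Rightarrow> (real^'q) \<times> (real^'q)" where
  "d_zs_out k \<equiv> d_zs g \<gamma>2 (sigma_out r k) (x_out r (Suc k)) (y_out r (Suc k)) (z_out r (Suc k)) (s_out r (Suc k)) (th_star k)"

lemma tau_bounded: "\<exists>c>0. \<forall>k. tau P k \<le> c"
proof -
  have "Bseq (tau P)" using tau_lim by (rule convergentI[THEN convergent_imp_Bseq])
  then obtain c where "c > 0" "\<And>k. norm (tau P k) \<le> c" unfolding Bseq_def by blast
  then show ?thesis by (intro exI[of _ c]) (auto simp: abs_le_iff)
qed

text \<open>
  Optimality of the last projections, with the direction re-evaluated at the new iterate. The stopping test
  is scaled such that the resulting error is of the order of the tolerance, uniformly in the penalty parameters,
  as long as the multipliers stay bounded.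
\<close>

lemma last_step:
  assumes "0 \<le> B"
  shows "\<exists>K. \<forall>k. norm (z_out r (Suc k)) \<le> B \<longrightarrow> norm (s_out r (Suc k)) \<le> B \<longrightarrow> B < Mz r k \<longrightarrow>
     (\<exists>\<nu>1\<in>regular_normal_cone (Omega G) (x_out r (Suc k), y_out r (Suc k)).
      \<exists>\<nu>2\<in>regular_normal_cone compl_set (z_out r (Suc k), s_out r (Suc k)).
        norm (fst (sigma_out r k) *\<^sub>R d_xy_out k + \<nu>1) \<le> K * tau P k \<and>
        norm (fst (sigma_out r k) *\<^sub>R d_zs_out k + \<nu>2) \<le> K * tau P k)"
proof -
  obtain tm where tm: "tm > 0" "\<And>k. tau P k \<le> tm" using tau_bounded by blast
  define M0 where "M0 = M_init P"
  have M0: "0 < M0" "\<And>k. M0 \<le> Mz r k" using pos(4) Mz_pos by (auto simp: M0_def)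
  \<comment> \<open>\<open>\<delta>m\<close> and \<open>\<zeta>m\<close> bound the last step and the
    last tolerance of all loops at once, from the bound \<open>tm\<close> on the tolerances and the
    lower bounds \<open>l0\<close> and \<open>M0\<close>.\<close>
  define \<delta>m where "\<delta>m = tm / (l0 * l0 * M0)"
  define \<zeta>m where "\<zeta>m = tm / (l0 * M0)"
  have mpos: "0 \<le> \<delta>m" "0 \<le> \<zeta>m" using tm(1) l0_pos M0 by (auto simp: \<delta>m_def \<zeta>m_def)
  \<comment> \<open>The bound \<open>B\<close> is given for the final iterate only; its predecessor
    is at most \<open>\<delta>m\<close> away.\<close>
  define B1 where "B1 = B + \<delta>m"
  have B1: "0 \<le> B1" "B \<le> B1" using assms mpos by (auto simp: B1_def)
  obtain Ct where Ct: "\<And>x y z \<theta>. (x, y) \<in> Omega G \<Longrightarrow> 0 \<le> z \<Longrightarrow> norm z \<le> B1 \<Longrightarrow> norm \<theta> \<le> Ct + \<gamma>1 * resid f g \<gamma>1 \<theta> x y z"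
    using theta_bound[OF B1(1)] by blast
  \<comment> \<open>By \<open>theta_bound\<close> this radius also contains the proximal points,
    approximate and exact.\<close>
  define B2 where "B2 = max B1 (Ct + \<gamma>1 * \<zeta>m)"
  obtain K1 where K1: "step_const B2 l0 K1" using step_const_exists[OF l0_pos] by blast
  have K1p: "0 < K1" by (rule step_const_pos[OF K1])
  \<comment> \<open>\<open>KA\<close> and \<open>KB\<close> turn the line search bounds into
    multiples of the second penalty parameter; terms without it are divided by its lower bound
    \<open>l0\<close>.\<close>
  define KA where "KA = (L_hat P + kappa_L P * (\<gamma>1 * K1\<^sup>2) + c_alpha P) / l0 + kappa_L P * K1"
  define KB where "KB = (L_hat P + kappa_L P * (c_beta P + 2 * (\<gamma>1 * K1\<^sup>2)) + c_beta P) / l0 + kappa_L P"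
  have KAB: "0 \<le> KA" "0 \<le> KB" using pos(6-9) gamma_pos K1p l0_pos by (auto simp: KA_def KB_def)
  define K where "K = (K1 + KA + KB) / M0 + K1 * \<gamma>1 * (1 / M0 + 2 * K1 / (M0 * l0))"
  show ?thesis
  proof (intro exI[of _ K] allI impI)
    fix k assume zB: "norm (z_out r (Suc k)) \<le> B" and sB: "norm (s_out r (Suc k)) \<le> B" and MB: "B < Mz r k"
    let ?l = "stop r k" and ?\<sigma> = "sigma_out r k" and ?M = "Mz r k" and ?\<tau> = "tau P k"
    let ?s1 = "fst ?\<sigma>" and ?s2 = "snd ?\<sigma>"
    let ?x = "x_in r k ?l" and ?y = "y_in r k ?l" and ?z = "z_in r k ?l" and ?s = "s_in r k ?l" and ?\<theta> = "th_in r k ?l" and ?h = "th_half r k ?l"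
    let ?x' = "x_out r (Suc k)" and ?y' = "y_out r (Suc k)" and ?z' = "z_out r (Suc k)" and ?s' = "s_out r (Suc k)" and ?t = "th_star k"
    let ?\<zeta> = "zeta P k ?l"
    define \<delta> where "\<delta> = ?\<tau> / (?s1 * ?s2 * ?M)"
    note sp = sigma_pos[of k] and sl = sigma_lower[of k] and Mp = Mz_pos(2)[of k]
    have \<tau>0: "0 < ?\<tau>" by (rule pos(10))
    have \<delta>0: "0 \<le> \<delta>" using \<tau>0 sp Mp by (simp add: \<delta>_def)
    have f1: "?s1 * (?s2 * \<delta>) \<le> ?\<tau> / M0"
    proof -
      have "?s1 * (?s2 * \<delta>) = ?\<tau> / ?M" using sp Mp by (simp add: \<delta>_def)
      also have "\<dots> \<le> ?\<tau> / M0" using M0 \<tau>0 by (intro divide_left_mono) (auto intro: mult_pos_pos Mp)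
      finally show ?thesis .
    qed
    have f3: "?s1 * \<delta> \<le> ?\<tau> / (M0 * l0)"
    proof -
      have "l0 * (?s1 * \<delta>) \<le> ?s2 * (?s1 * \<delta>)" using sl sp \<delta>0 by (intro mult_right_mono) auto
      then have "l0 * (?s1 * \<delta>) \<le> ?\<tau> / M0" using f1 by (simp add: algebra_simps)
      then show ?thesis using l0_pos M0 by (simp add: field_simps)
    qed
    have \<delta>le: "\<delta> \<le> \<delta>m"
    proof -
      have "l0 * l0 * M0 \<le> ?s1 * ?s2 * ?M" using sl sp M0 l0_pos by (intro mult_mono) auto
      then show ?thesis unfolding \<delta>_def \<delta>m_def using tm \<tau>0 l0_pos M0 by (intro frac_le) auto
    qed
    have st: "inner_stop P r k ?l" using loop[of k] by (simp add: inner_loop_def)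
    have D: "norm (((?x', ?y'), (?z', ?s')) - ((?x, ?y), (?z, ?s))) \<le> \<delta>"
      using st unfolding inner_stop_def \<delta>_def out_eq by simp
    have Dxy: "norm ((?x', ?y') - (?x, ?y)) \<le> \<delta>" and Dzs: "norm ((?z', ?s') - (?z, ?s)) \<le> \<delta>"
      using pair_dist_bounds(1,2)[where x'="(?x', ?y')" and x="(?x, ?y)" and y'="(?z', ?s')" and y="(?z, ?s)"] D by linarith+
    have Dz: "norm (?z' - ?z) \<le> \<delta>" and Ds: "norm (?s' - ?s) \<le> \<delta>"
      using pair_dist_bounds(1)[of ?z' ?z ?s' ?s] pair_dist_bounds(2)[of ?s' ?s ?z' ?z] Dzs by linarith+
    have s\<zeta>: "?s1 * ?M * ?\<zeta> \<le> ?\<tau>"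
    proof -
      have "?s1 * ?M * ?\<zeta> \<le> ?s1 * ?M * max ?\<zeta> (zeta P k (Suc ?l))" using sp Mp by (intro mult_left_mono) auto
      then show ?thesis using st unfolding inner_stop_def by linarith
    qed
    have f2: "?s1 * ?\<zeta> \<le> ?\<tau> / M0"
    proof -
      have "M0 * (?s1 * ?\<zeta>) \<le> ?M * (?s1 * ?\<zeta>)" using M0(2)[of k] sp pos(11) by (intro mult_right_mono) auto
      then have "M0 * (?s1 * ?\<zeta>) \<le> ?\<tau>" using s\<zeta> by (simp add: algebra_simps)
      then show ?thesis using M0 by (simp add: field_simps)
    qed
    have \<zeta>le: "?\<zeta> \<le> \<zeta>m"
    proof -
      have "l0 * ?\<zeta> \<le> ?s1 * ?\<zeta>" using sl pos(11) by (intro mult_right_mono) auto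
      then have "l0 * ?\<zeta> \<le> ?\<tau> / M0" using f2 by linarith
      also have "\<dots> \<le> tm / M0" using tm M0 by (intro divide_right_mono) auto
      finally show ?thesis unfolding \<zeta>m_def using l0_pos M0 by (simp add: field_simps)
    qed
    have zb: "norm ?z \<le> B1" "norm ?s \<le> B1"
      using norm_triangle_sub[of ?z ?z'] norm_triangle_sub[of ?s ?s'] Dz Ds zB sB \<delta>le
      unfolding B1_def norm_minus_commute[of ?z ?z'] norm_minus_commute[of ?s ?s'] by linarith+
    have zb': "norm ?z' \<le> B1" "norm ?s' \<le> B1" using zB sB B1 by linarith+
    have inv: "(?x, ?y) \<in> Omega G" "(?z, ?s) \<in> compl_trunc ?M" "resid f g \<gamma>1 ?\<theta> ?x ?y ?z \<le> ?\<zeta>"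
      using inv_inner[of ?l k] unfolding inv_at_def by auto
    have ist: "step_xy F f G g \<gamma>1 \<gamma>2 P r k ?l" "step_zs F f g \<gamma>1 \<gamma>2 P r k ?l"
      "resid f g \<gamma>1 ?h ?x' ?y' ?z \<le> ?\<zeta>"
      using inner_stepD[of ?l k] unfolding inner_step_def out_eq by auto
    note o = out_in[of k]
    note x = Omega_X[OF inv(1)]
    have z0: "0 \<le> ?z" using inv(2) by (rule trunc_nonneg)
    have tr: "resid f g \<gamma>1 ?t ?x' ?y' ?z' = 0" by (rule theta_star[OF o(2,3)])
    have g\<zeta>: "\<gamma>1 * u \<le> \<gamma>1 * \<zeta>m" if "u \<le> ?\<zeta>" for u
      using that \<zeta>le gamma_pos by (intro mult_left_mono) auto
    have tb: "norm ?\<theta> \<le> B2" "norm ?h \<le> B2" "norm ?t \<le> B2"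
    proof -
      show "norm ?\<theta> \<le> B2" using Ct[OF inv(1) z0 zb(1), of ?\<theta>] g\<zeta>[OF inv(3)] unfolding B2_def by linarith
      show "norm ?h \<le> B2" using Ct[OF o(1) z0 zb(1), of ?h] g\<zeta>[OF ist(3)] unfolding B2_def by linarith
      have "0 \<le> \<gamma>1 * \<zeta>m" using mpos gamma_pos by simp
      then show "norm ?t \<le> B2" using Ct[OF o(1) o(3) zb'(1), of ?t] unfolding tr B2_def by simp
    qed
    have b2: "norm ?z \<le> B2" "norm ?s \<le> B2" "norm ?z' \<le> B2" "norm ?s' \<le> B2"
      using zb zb' by (auto simp: B2_def)
    \<comment> \<open>Bounds the distance of the exact proximal point at the new iterate from both
      approximate ones: the tolerance plus the change of the residual, to which
      \<open>(x, y)\<close> and \<open>z\<close> contribute at most \<open>\<delta>\<close>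
      each.\<close>
    define T where "T = \<gamma>1 * (?\<zeta> + K1 * (2 * \<delta>))"
    have sT: "?s1 * T \<le> ?\<tau> * (\<gamma>1 * (1 / M0 + 2 * K1 / (M0 * l0)))"
    proof -
      have "?s1 * T = \<gamma>1 * (?s1 * ?\<zeta> + 2 * K1 * (?s1 * \<delta>))" by (simp add: T_def algebra_simps)
      also have "\<dots> \<le> \<gamma>1 * (?\<tau> / M0 + 2 * K1 * (?\<tau> / (M0 * l0)))"
        using f2 f3 gamma_pos K1p by (intro mult_left_mono add_mono) auto
      finally show ?thesis by (simp add: algebra_simps)
    qed
    have Tx: "norm (?t - ?\<theta>) \<le> T"
    proof -
      have "resid f g \<gamma>1 ?\<theta> ?x' ?y' ?z' \<le> resid f g \<gamma>1 ?\<theta> ?x ?y ?z + K1 * (norm ((?x', ?y') - (?x, ?y)) + norm (?z' - ?z))"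
        by (rule step_const_resid[OF K1 x o(2) b2(1) tb(1)])
      also have "\<dots> \<le> ?\<zeta> + K1 * (2 * \<delta>)" using inv(3) Dxy Dz K1p by (intro add_mono mult_left_mono) auto
      finally have "\<gamma>1 * resid f g \<gamma>1 ?\<theta> ?x' ?y' ?z' \<le> T" unfolding T_def using gamma_pos by (intro mult_left_mono) auto
      then show ?thesis using prox_dist_resid[OF o(2,3), of ?t ?\<theta> ?y'] tr by simp
    qed
    have Th: "norm (?t - ?h) \<le> T"
    proof -
      have "resid f g \<gamma>1 ?h ?x' ?y' ?z' \<le> resid f g \<gamma>1 ?h ?x' ?y' ?z + K1 * (norm ((?x', ?y') - (?x', ?y')) + norm (?z' - ?z))"
        by (rule step_const_resid[OF K1 o(2) o(2) b2(1) tb(2)])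
      also have "\<dots> \<le> ?\<zeta> + K1 * (2 * \<delta>)" using ist(3) Dz \<delta>0 K1p by (intro add_mono mult_left_mono) auto
      finally have "\<gamma>1 * resid f g \<gamma>1 ?h ?x' ?y' ?z' \<le> T" unfolding T_def using gamma_pos by (intro mult_left_mono) auto
      then show ?thesis using prox_dist_resid[OF o(2,3), of ?t ?h ?y'] tr by simp
    qed
    \<comment> \<open>The factor \<open>?s1\<close> is harmless, because
      \<open>?s1 * (?s2 * \<delta>)\<close>, \<open>?s1 * \<delta>\<close> and
      \<open>?s1 * ?\<zeta>\<close> are all at most a constant times the tolerance.\<close>
    have scale: "?s1 * ((K1 * ?s2 * \<delta> + K1 * T) + KC * ?s2 * \<delta>) \<le> K * ?\<tau>" if "0 \<le> KC" "KC \<le> KA + KB" for KC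
    proof -
      have "?s1 * ((K1 * ?s2 * \<delta> + K1 * T) + KC * ?s2 * \<delta>) = (K1 + KC) * (?s1 * (?s2 * \<delta>)) + K1 * (?s1 * T)"
        by (simp add: algebra_simps)
      also have "\<dots> \<le> (K1 + (KA + KB)) * (?\<tau> / M0) + K1 * (?\<tau> * (\<gamma>1 * (1 / M0 + 2 * K1 / (M0 * l0))))"
      proof (rule add_mono)
        show "(K1 + KC) * (?s1 * (?s2 * \<delta>)) \<le> (K1 + (KA + KB)) * (?\<tau> / M0)"
          by (rule mult_mono) (use f1 K1p that sp \<delta>0 in auto)
        show "K1 * (?s1 * T) \<le> K1 * (?\<tau> * (\<gamma>1 * (1 / M0 + 2 * K1 / (M0 * l0))))"
          by (rule mult_left_mono[OF sT]) (use K1p in simp)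
      qed
      also have "\<dots> = K * ?\<tau>" by (simp add: K_def algebra_simps add_divide_distrib)
      finally show ?thesis .
    qed
    let ?d = "d_xy F f g \<gamma>1 \<gamma>2 ?\<sigma> ?x ?y ?z ?s ?\<theta>"
    obtain A where A: "0 < A" "A \<le> L_hat P + kappa_L P * (K1 * ?s2 + \<gamma>1 * K1\<^sup>2) + c_alpha P"
      and proj: "(?x', ?y') = closest_point (Omega G) ((?x, ?y) - (1 / A) *\<^sub>R ?d)"
      using step_xy_bound[OF K1 ist(1) valid l0_pos sl inv(1) b2(1,2) tb(1) inv(3)] unfolding out_eq by blast
    have big: "c \<le> c / l0 * ?s2" if "0 \<le> c" for c
    proof -
      have "c / l0 * l0 \<le> c / l0 * ?s2" using that sl l0_pos by (intro mult_left_mono) auto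
      then show ?thesis using l0_pos by simp
    qed
    have AK: "A \<le> KA * ?s2"
    proof -
      have "0 \<le> L_hat P + kappa_L P * (\<gamma>1 * K1\<^sup>2) + c_alpha P" using pos(6-9) gamma_pos by simp
      from big[OF this] show ?thesis using A(2) by (simp add: KA_def algebra_simps)
    qed
    \<comment> \<open>The displacement from the projected point is normal to
      \<open>\<Omega>\<close>; the factor \<open>A\<close> undoes the step size \<open>1 / A\<close>
      and \<open>?s1\<close> matches the scaling of the KKT system.\<close>
    define \<nu>1 where "\<nu>1 = (?s1 * A) *\<^sub>R (((?x, ?y) - (1 / A) *\<^sub>R ?d) - (?x', ?y'))"
    have n1: "\<nu>1 \<in> regular_normal_cone (Omega G) (?x', ?y')"
      unfolding \<nu>1_def
    proof (intro regular_normal_cone_scale nearest_point_regular_normal o(1))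
      show "0 < ?s1 * A" using A sp by simp
      show "norm (((?x, ?y) - (1 / A) *\<^sub>R ?d) - (?x', ?y')) \<le> norm (((?x, ?y) - (1 / A) *\<^sub>R ?d) - u)" if "u \<in> Omega G" for u
        using closest_point_le[OF Omega_set(2) that, of "(?x, ?y) - (1 / A) *\<^sub>R ?d"] unfolding proj[symmetric] dist_norm .
    qed
    have e1: "norm (?s1 *\<^sub>R d_xy_out k + \<nu>1) \<le> K * ?\<tau>"
    proof -
      have "\<nu>1 = (?s1 * A) *\<^sub>R ((?x, ?y) - (?x', ?y')) - ?s1 *\<^sub>R ?d"
        unfolding \<nu>1_def using A(1) by (simp only: scaleR_diff_right scaleR_scaleR) simp
      then have "?s1 *\<^sub>R d_xy_out k + \<nu>1 = ?s1 *\<^sub>R (d_xy_out k - ?d) - (?s1 * A) *\<^sub>R ((?x', ?y') - (?x, ?y))"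
        by (simp only: scaleR_diff_right) simp
      then have "norm (?s1 *\<^sub>R d_xy_out k + \<nu>1) \<le> ?s1 * norm (d_xy_out k - ?d) + ?s1 * A * norm ((?x', ?y') - (?x, ?y))"
        using norm_triangle_ineq4[of "?s1 *\<^sub>R (d_xy_out k - ?d)" "(?s1 * A) *\<^sub>R ((?x', ?y') - (?x, ?y))"] sp A(1)
        unfolding norm_scaleR by simp
      also have "\<dots> \<le> ?s1 * (K1 * ?s2 * \<delta> + K1 * T) + ?s1 * (KA * ?s2) * \<delta>"
      proof (intro add_mono mult_left_mono mult_mono Dxy AK)
        show "norm (d_xy_out k - ?d) \<le> K1 * ?s2 * \<delta> + K1 * T"
          by (rule step_const_d_xy[OF K1 inv(1) o(1) b2(1,2) tb(1) b2(3,4) tb(3) sl Dxy Dz Ds Tx])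
      qed (use sp KAB in auto)
      also have "\<dots> = ?s1 * ((K1 * ?s2 * \<delta> + K1 * T) + KA * ?s2 * \<delta>)" by (simp add: algebra_simps)
      also have "\<dots> \<le> K * ?\<tau>" using KAB by (intro scale) auto
      finally show ?thesis .
    qed
    let ?e = "d_zs g \<gamma>2 ?\<sigma> ?x' ?y' ?z ?s ?h"
    obtain A' where A': "0 < A'" "A' \<le> L_hat P + kappa_L P * (c_beta P + ?s2 + 2 * (\<gamma>1 * K1\<^sup>2)) + c_beta P"
      and proj': "(?z', ?s') = proj_compl ?M ((?z, ?s) - (1 / A') *\<^sub>R ?e)"
      using step_zs_bound[OF K1 ist(2) valid l0_pos sl(2) _ inv(2) b2(1) tb(2)] o(2) ist(3) unfolding out_eq by blast
    have AK': "A' \<le> KB * ?s2"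
    proof -
      have "0 \<le> L_hat P + kappa_L P * (c_beta P + 2 * (\<gamma>1 * K1\<^sup>2)) + c_beta P" using pos(6-9) gamma_pos by simp
      from big[OF this] show ?thesis using A'(2) by (simp add: KB_def algebra_simps)
    qed
    define \<nu>2 where "\<nu>2 = (?s1 * A') *\<^sub>R (((?z, ?s) - (1 / A') *\<^sub>R ?e) - (?z', ?s'))"
    have "\<nu>2 \<in> regular_normal_cone (compl_trunc ?M) (?z', ?s')"
      unfolding \<nu>2_def
    proof (intro regular_normal_cone_scale nearest_point_regular_normal o(4))
      show "0 < ?s1 * A'" using A' sp by simp
      show "norm (((?z, ?s) - (1 / A') *\<^sub>R ?e) - (?z', ?s')) \<le> norm (((?z, ?s) - (1 / A') *\<^sub>R ?e) - u)" if "u \<in> compl_trunc ?M" for u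
        using proj_compl_nearest[OF that, of "(?z, ?s) - (1 / A') *\<^sub>R ?e"] unfolding proj'[symmetric] .
    qed
    \<comment> \<open>\<open>B < ?M\<close> puts all entries strictly below the bound, so the
      truncation can be removed from the normal cone.\<close>
    moreover have "?z' $ i < ?M" "?s' $ i < ?M" for i
      using component_le_norm_cart[of ?z' i] component_le_norm_cart[of ?s' i] zB sB MB by linarith+
    ultimately have n2: "\<nu>2 \<in> regular_normal_cone compl_set (?z', ?s')"
      using compl_trunc_normal[OF o(4)] by simp
    have e2: "norm (?s1 *\<^sub>R d_zs_out k + \<nu>2) \<le> K * ?\<tau>"
    proof -
      have "\<nu>2 = (?s1 * A') *\<^sub>R ((?z, ?s) - (?z', ?s')) - ?s1 *\<^sub>R ?e"
        unfolding \<nu>2_def using A'(1) by (simp only: scaleR_diff_right scaleR_scaleR) simp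
      then have "?s1 *\<^sub>R d_zs_out k + \<nu>2 = ?s1 *\<^sub>R (d_zs_out k - ?e) - (?s1 * A') *\<^sub>R ((?z', ?s') - (?z, ?s))"
        by (simp only: scaleR_diff_right) simp
      then have "norm (?s1 *\<^sub>R d_zs_out k + \<nu>2) \<le> ?s1 * norm (d_zs_out k - ?e) + ?s1 * A' * norm ((?z', ?s') - (?z, ?s))"
        using norm_triangle_ineq4[of "?s1 *\<^sub>R (d_zs_out k - ?e)" "(?s1 * A') *\<^sub>R ((?z', ?s') - (?z, ?s))"] sp A'(1)
        unfolding norm_scaleR by simp
      also have "\<dots> \<le> ?s1 * (K1 * ?s2 * \<delta> + K1 * T) + ?s1 * (KB * ?s2) * \<delta>"
      proof (intro add_mono mult_left_mono mult_mono Dzs AK')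
        show "norm (d_zs_out k - ?e) \<le> K1 * ?s2 * \<delta> + K1 * T"
          by (rule step_const_d_zs[OF K1 o(1) tb(2,3) sl(2) Dz Ds Th])
      qed (use sp KAB in auto)
      also have "\<dots> = ?s1 * ((K1 * ?s2 * \<delta> + K1 * T) + KB * ?s2 * \<delta>)" by (simp add: algebra_simps)
      also have "\<dots> \<le> K * ?\<tau>" using KAB by (intro scale) auto
      finally show ?thesis .
    qed
    show "\<exists>\<nu>1\<in>regular_normal_cone (Omega G) (?x', ?y'). \<exists>\<nu>2\<in>regular_normal_cone compl_set (?z', ?s').
        norm (?s1 *\<^sub>R d_xy_out k + \<nu>1) \<le> K * ?\<tau> \<and> norm (?s1 *\<^sub>R d_zs_out k + \<nu>2) \<le> K * ?\<tau>"
      using n1 n2 e1 e2 by blast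
  qed
qed

text \<open>Convergence bounds the multipliers along the subsequence, so \<open>last_step\<close>
  applies with one constant. The index \<open>kk j\<close> is the loop that produced the iterate;
  its parameters, not those of the next loop, occur in the optimality conditions.\<close>

lemma key_sequence:
  assumes sub: "strict_mono sub"
    and lim: "(\<lambda>j. ((x_out r (sub j), y_out r (sub j)), (z_out r (sub j), s_out r (sub j)))) \<longlonglongrightarrow> ((xb, yb), (zb, sb))"
  shows "\<exists>kk \<nu>1 \<nu>2. filterlim kk at_top sequentially \<and>
     (\<lambda>j. x_out r (Suc (kk j))) \<longlonglongrightarrow> xb \<and> (\<lambda>j. y_out r (Suc (kk j))) \<longlonglongrightarrow> yb \<and>
     (\<lambda>j. z_out r (Suc (kk j))) \<longlonglongrightarrow> zb \<and> (\<lambda>j. s_out r (Suc (kk j))) \<longlonglongrightarrow> sb \<and>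
     (\<forall>j. \<nu>1 j \<in> regular_normal_cone (Omega G) (x_out r (Suc (kk j)), y_out r (Suc (kk j)))) \<and>
     (\<forall>j. \<nu>2 j \<in> regular_normal_cone compl_set (z_out r (Suc (kk j)), s_out r (Suc (kk j)))) \<and>
     (\<lambda>j. fst (sigma_out r (kk j)) *\<^sub>R d_xy_out (kk j) + \<nu>1 j) \<longlonglongrightarrow> 0 \<and>
     (\<lambda>j. fst (sigma_out r (kk j)) *\<^sub>R d_zs_out (kk j) + \<nu>2 j) \<longlonglongrightarrow> 0"
proof -
  have l: "(\<lambda>j. x_out r (sub j)) \<longlonglongrightarrow> xb" "(\<lambda>j. y_out r (sub j)) \<longlonglongrightarrow> yb"
    "(\<lambda>j. z_out r (sub j)) \<longlonglongrightarrow> zb" "(\<lambda>j. s_out r (sub j)) \<longlonglongrightarrow> sb"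
    using tendsto_fst[OF tendsto_fst[OF lim]] tendsto_snd[OF tendsto_fst[OF lim]]
      tendsto_fst[OF tendsto_snd[OF lim]] tendsto_snd[OF tendsto_snd[OF lim]] by simp_all
  obtain Bz Bs where Bz: "\<And>j. norm (z_out r (sub j)) \<le> Bz" and Bs: "\<And>j. norm (s_out r (sub j)) \<le> Bs"
    using convergent_imp_Bseq[OF convergentI[OF l(3)]] convergent_imp_Bseq[OF convergentI[OF l(4)]]
    unfolding Bseq_def by blast
  define B where "B = max Bz Bs"
  have B: "norm (z_out r (sub j)) \<le> B" "norm (s_out r (sub j)) \<le> B" for j
    using Bz[of j] Bs[of j] by (auto simp: B_def)
  have B0: "0 \<le> B" using B(1)[of 0] norm_ge_zero order_trans by blast
  have "\<forall>\<^sub>F k in sequentially. B < Mz r k" using Mz_at_top unfolding filterlim_at_top_dense by blast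
  then obtain J where J: "\<And>k. k \<ge> J \<Longrightarrow> B < Mz r k" unfolding eventually_sequentially by blast
  obtain K where K: "\<And>k. norm (z_out r (Suc k)) \<le> B \<Longrightarrow> norm (s_out r (Suc k)) \<le> B \<Longrightarrow> B < Mz r k \<Longrightarrow>
     \<exists>\<nu>1\<in>regular_normal_cone (Omega G) (x_out r (Suc k), y_out r (Suc k)).
      \<exists>\<nu>2\<in>regular_normal_cone compl_set (z_out r (Suc k), s_out r (Suc k)).
        norm (fst (sigma_out r k) *\<^sub>R d_xy_out k + \<nu>1) \<le> K * tau P k \<and>
        norm (fst (sigma_out r k) *\<^sub>R d_zs_out k + \<nu>2) \<le> K * tau P k"
    using last_step[OF B0] by blast
  \<comment> \<open>Since \<open>sub i \<ge> i\<close>, the offset \<open>Suc J\<close> makes every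
    iterate the result of a loop and puts the index of that loop beyond \<open>J\<close>, where the
    truncation bound exceeds \<open>B\<close>.\<close>
  define kk where "kk j = sub (j + Suc J) - 1" for j
  have ge: "j + Suc J \<le> sub (j + Suc J)" for j by (rule seq_suble[OF sub])
  then have S: "Suc (kk j) = sub (j + Suc J)" and kJ: "j + J \<le> kk j" for j
    unfolding kk_def using ge[of j] by linarith+
  have top: "filterlim kk at_top sequentially"
    by (rule filterlim_at_top_mono[OF filterlim_ident[of sequentially]])
       (use kJ in \<open>auto intro!: always_eventually intro: le_trans[OF le_add1]\<close>)
  have "\<forall>j. \<exists>\<nu>1 \<nu>2. \<nu>1 \<in> regular_normal_cone (Omega G) (x_out r (Suc (kk j)), y_out r (Suc (kk j))) \<and>
      \<nu>2 \<in> regular_normal_cone compl_set (z_out r (Suc (kk j)), s_out r (Suc (kk j))) \<and>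
        norm (fst (sigma_out r (kk j)) *\<^sub>R d_xy_out (kk j) + \<nu>1) \<le> K * tau P (kk j) \<and>
        norm (fst (sigma_out r (kk j)) *\<^sub>R d_zs_out (kk j) + \<nu>2) \<le> K * tau P (kk j)"
  proof
    fix j
    have "B < Mz r (kk j)" using kJ[of j] by (intro J) simp
    then show "\<exists>\<nu>1 \<nu>2. \<nu>1 \<in> regular_normal_cone (Omega G) (x_out r (Suc (kk j)), y_out r (Suc (kk j))) \<and>
      \<nu>2 \<in> regular_normal_cone compl_set (z_out r (Suc (kk j)), s_out r (Suc (kk j))) \<and>
        norm (fst (sigma_out r (kk j)) *\<^sub>R d_xy_out (kk j) + \<nu>1) \<le> K * tau P (kk j) \<and>
        norm (fst (sigma_out r (kk j)) *\<^sub>R d_zs_out (kk j) + \<nu>2) \<le> K * tau P (kk j)"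
      using K[of "kk j"] B[of "j + Suc J"] unfolding S by blast
  qed
  then obtain \<nu>1 \<nu>2 where \<nu>: "\<And>j. \<nu>1 j \<in> regular_normal_cone (Omega G) (x_out r (Suc (kk j)), y_out r (Suc (kk j)))"
      "\<And>j. \<nu>2 j \<in> regular_normal_cone compl_set (z_out r (Suc (kk j)), s_out r (Suc (kk j)))"
      and e: "\<And>j. norm (fst (sigma_out r (kk j)) *\<^sub>R d_xy_out (kk j) + \<nu>1 j) \<le> K * tau P (kk j)"
      "\<And>j. norm (fst (sigma_out r (kk j)) *\<^sub>R d_zs_out (kk j) + \<nu>2 j) \<le> K * tau P (kk j)"
    by metis
  have "(\<lambda>j. tau P (kk j)) \<longlonglongrightarrow> 0" by (rule filterlim_compose[OF tau_lim top])
  then have t0: "(\<lambda>j. K * tau P (kk j)) \<longlonglongrightarrow> 0" by (rule tendsto_mult_right_zero)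
  have el: "(\<lambda>j. fst (sigma_out r (kk j)) *\<^sub>R d_xy_out (kk j) + \<nu>1 j) \<longlonglongrightarrow> 0"
    "(\<lambda>j. fst (sigma_out r (kk j)) *\<^sub>R d_zs_out (kk j) + \<nu>2 j) \<longlonglongrightarrow> 0"
    using e by (auto intro!: Lim_null_comparison[OF _ t0] always_eventually)
  have ls: "(\<lambda>j. x_out r (Suc (kk j))) \<longlonglongrightarrow> xb" "(\<lambda>j. y_out r (Suc (kk j))) \<longlonglongrightarrow> yb"
    "(\<lambda>j. z_out r (Suc (kk j))) \<longlonglongrightarrow> zb" "(\<lambda>j. s_out r (Suc (kk j))) \<longlonglongrightarrow> sb"
    unfolding S using l[THEN LIMSEQ_ignore_initial_segment, of "Suc J"] by simp_all
  show ?thesis using top ls \<nu> el by blast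
qed

text \<open>The first multiplier of the condition is \<open>fst \<sigma>\<close> and the second is
  \<open>fst \<sigma> * snd \<sigma> / 2\<close>; the half is due to the squared norm, which occurs
  there without a factor \<open>1 / 2\<close>. The residuals of the last projections serve as error
  sequence.\<close>

lemma approx_KKT_accumulation:
  assumes sub: "strict_mono sub"
    and lim: "(\<lambda>j. ((x_out r (sub j), y_out r (sub j)), (z_out r (sub j), s_out r (sub j)))) \<longlonglongrightarrow> ((xb, yb), (zb, sb))"
  shows "approx_KKT F f G g \<gamma>1 \<gamma>2 xb yb"
proof -
  obtain kk \<nu>1 \<nu>2 where top: "filterlim kk at_top sequentially"
    and ls: "(\<lambda>j. x_out r (Suc (kk j))) \<longlonglongrightarrow> xb" "(\<lambda>j. y_out r (Suc (kk j))) \<longlonglongrightarrow> yb"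
    and n1: "\<And>j. \<nu>1 j \<in> regular_normal_cone (Omega G) (x_out r (Suc (kk j)), y_out r (Suc (kk j)))"
    and n2: "\<And>j. \<nu>2 j \<in> regular_normal_cone compl_set (z_out r (Suc (kk j)), s_out r (Suc (kk j)))"
    and e1: "(\<lambda>j. fst (sigma_out r (kk j)) *\<^sub>R d_xy_out (kk j) + \<nu>1 j) \<longlonglongrightarrow> 0"
    and e2: "(\<lambda>j. fst (sigma_out r (kk j)) *\<^sub>R d_zs_out (kk j) + \<nu>2 j) \<longlonglongrightarrow> 0"
    using key_sequence[OF sub lim] by blast
  let ?x = "\<lambda>j. x_out r (Suc (kk j))" and ?y = "\<lambda>j. y_out r (Suc (kk j))"
    and ?z = "\<lambda>j. z_out r (Suc (kk j))" and ?s = "\<lambda>j. s_out r (Suc (kk j))"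
    and ?s1 = "\<lambda>j. fst (sigma_out r (kk j))" and ?s2 = "\<lambda>j. snd (sigma_out r (kk j))"
  let ?\<epsilon> = "\<lambda>j. (?s1 j *\<^sub>R d_xy_out (kk j) + \<nu>1 j, ?s1 j *\<^sub>R d_zs_out (kk j) + \<nu>2 j)"
  show ?thesis
    unfolding approx_KKT_def
  proof (rule exI[of _ ?x], rule exI[of _ ?y], rule exI[of _ ?z], rule exI[of _ ?s], rule exI[of _ ?\<epsilon>],
      rule exI[of _ ?s1], rule exI[of _ "\<lambda>j. ?s1 j * ?s2 j / 2"], intro conjI allI)
    fix j
    show "0 < ?s1 j" "0 < ?s1 j * ?s2 j / 2" using sigma_pos by simp_all
    show "(?x j, ?y j) \<in> Omega G" using out_in by blast
    show "(?z j, ?s j) \<in> compl_set" using n2[of j] by (simp add: regular_normal_cone_def)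
    have s1: "?s1 j \<noteq> 0" using sigma_pos[of "kk j"] by simp
    show "\<exists>\<nu>\<in>limiting_normal_cone (Omega G) (?x j, ?y j) \<times> limiting_normal_cone compl_set (?z j, ?s j).
           ?\<epsilon> j = (grad F (?x j, ?y j), 0, 0) +
             ?s1 j *\<^sub>R ((gap_grad_x f g \<gamma>1 \<gamma>2 (?x j) (?y j) (?z j), gap_grad_y f g \<gamma>1 \<gamma>2 (?x j) (?y j) (?z j)), gap_grad_z f g \<gamma>1 \<gamma>2 (?x j) (?y j) (?z j), 0) +
             (?s1 j * ?s2 j / 2) *\<^sub>R grad (\<lambda>((x', y'), (z' :: real^'q, s')). (norm (g (x', y') + s'))\<^sup>2) ((?x j, ?y j), (?z j, ?s j)) + \<nu>"
    proof (intro bexI[of _ "(\<nu>1 j, \<nu>2 j)"])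
      show "(\<nu>1 j, \<nu>2 j) \<in> limiting_normal_cone (Omega G) (?x j, ?y j) \<times> limiting_normal_cone compl_set (?z j, ?s j)"
        by (intro SigmaI subsetD[OF regular_subset_limiting] n1 n2)
      show "?\<epsilon> j = (grad F (?x j, ?y j), 0, 0) +
             ?s1 j *\<^sub>R ((gap_grad_x f g \<gamma>1 \<gamma>2 (?x j) (?y j) (?z j), gap_grad_y f g \<gamma>1 \<gamma>2 (?x j) (?y j) (?z j)), gap_grad_z f g \<gamma>1 \<gamma>2 (?x j) (?y j) (?z j), 0) +
             (?s1 j * ?s2 j / 2) *\<^sub>R grad (\<lambda>((x', y'), (z' :: real^'q, s')). (norm (g (x', y') + s'))\<^sup>2) ((?x j, ?y j), (?z j, ?s j)) + (\<nu>1 j, \<nu>2 j)"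
        unfolding grad_infeasibility[OF out_in(2)] d_xy_gap_grad[OF out_in(2)] d_zs_gap_grad
        using s1 by (simp add: scaleR_add_right)
    qed
  next
    show "(\<lambda>j. (?x j, ?y j)) \<longlonglongrightarrow> (xb, yb)" by (rule tendsto_Pair[OF ls])
    show "?\<epsilon> \<longlonglongrightarrow> 0" using tendsto_Pair[OF e1 e2] by (simp add: zero_prod_def)
    show "(\<lambda>j. gap f g \<gamma>1 \<gamma>2 (?x j) (?y j) (?z j)) \<longlonglongrightarrow> 0" by (rule filterlim_compose[OF gap_lim top])
    show "(\<lambda>j. g (?x j, ?y j) + ?s j) \<longlonglongrightarrow> 0" by (rule filterlim_compose[OF feas_lim top])
  qed
qed

end

section \<open>Multipliers of the MPCC\<close>

text \<open>Bundles the facts needed at the limit point. The last one, strict differentiability of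
  the gradient, allows increments between two moving points to be linearized there.\<close>

definition hess_at :: "('a::euclidean_space \<Rightarrow> real) \<Rightarrow> 'a \<Rightarrow> ('a \<Rightarrow> 'a) \<Rightarrow> bool" where
  "hess_at h w H \<longleftrightarrow> (grad h has_derivative H) (at w) \<and> (\<forall>u v. H u \<bullet> v = H v \<bullet> u) \<and>
     (\<forall>e>0. \<exists>d>0. \<forall>a\<in>ball w d. \<forall>b\<in>ball w d. norm (grad h b - grad h a - H (b - a)) \<le> e * norm (b - a))"

lemma hess_at_exists:
  assumes "twice_cont_diff_on U h" "open U" "w \<in> U"
  shows "\<exists>H. hess_at h w H"
proof -
  obtain H where H: "\<And>w. w \<in> U \<Longrightarrow> (grad h has_derivative blinfun_apply (H w)) (at w)" "continuous_on U H"
    using assms(1) unfolding twice_cont_diff_on_def by auto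
  have GD: "\<And>w. w \<in> U \<Longrightarrow> GDERIV h w :> grad h w"
    using assms(1) unfolding twice_cont_diff_on_def cont_diff_on_def by auto
  have "hess_at h w (blinfun_apply (H w))"
    unfolding hess_at_def
    using H(1)[OF assms(3)] hessian_symmetric[OF assms(2,3) GD H(1)[OF assms(3)]]
      grad_strict_differentiable[OF assms(2,3) H] by blast
  then show ?thesis by blast
qed

lemma hess_at_linear: "hess_at h w H \<Longrightarrow> bounded_linear H"
  unfolding hess_at_def using has_derivative_bounded_linear by blast

text \<open>The factors \<open>t j\<close> may be unbounded. The linearization error is at most
  \<open>e\<close> times the length of the increment, hence after scaling at most \<open>e\<close>
  times a bound for the convergent sequence \<open>t j *\<^sub>R (b j - a j)\<close>.\<close>

lemma grad_increment_limit:
  fixes h :: "'a::euclidean_space \<Rightarrow> real"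
  assumes H: "hess_at h w H" and a: "a \<longlonglongrightarrow> w" and b: "b \<longlonglongrightarrow> w"
    and t: "(\<lambda>j. t j *\<^sub>R (b j - a j)) \<longlonglongrightarrow> v"
  shows "(\<lambda>j. t j *\<^sub>R (grad h (b j) - grad h (a j))) \<longlonglongrightarrow> H v"
proof -
  interpret H: bounded_linear H by (rule hess_at_linear[OF H])
  let ?r = "\<lambda>j. t j *\<^sub>R (grad h (b j) - grad h (a j)) - H (t j *\<^sub>R (b j - a j))"
  obtain M where M: "M > 0" "\<And>j. norm (t j *\<^sub>R (b j - a j)) \<le> M"
    using convergent_imp_Bseq[OF convergentI[OF t]] unfolding Bseq_def by blast
  have "?r \<longlonglongrightarrow> 0"
  proof (rule LIMSEQ_I)
    fix e :: real assume "e > 0"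
    then have "e / (2 * M) > 0" using M by simp
    then obtain d where d: "d > 0"
      "\<And>p q. p \<in> ball w d \<Longrightarrow> q \<in> ball w d \<Longrightarrow> norm (grad h q - grad h p - H (q - p)) \<le> e / (2 * M) * norm (q - p)"
      using H unfolding hess_at_def by blast
    have "\<forall>\<^sub>F j in sequentially. dist (a j) w < d" "\<forall>\<^sub>F j in sequentially. dist (b j) w < d"
      using a b d(1) by (auto simp: tendsto_iff)
    then have "\<forall>\<^sub>F j in sequentially. norm (?r j - 0) < e"
    proof eventually_elim
      fix j assume "dist (a j) w < d" "dist (b j) w < d"
      then have "norm (grad h (b j) - grad h (a j) - H (b j - a j)) \<le> e / (2 * M) * norm (b j - a j)"
        by (intro d(2)) (auto simp: dist_commute)
      then have "\<bar>t j\<bar> * norm (grad h (b j) - grad h (a j) - H (b j - a j)) \<le> \<bar>t j\<bar> * (e / (2 * M) * norm (b j - a j))"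
        by (rule mult_left_mono) simp
      also have "\<dots> = e / (2 * M) * norm (t j *\<^sub>R (b j - a j))" by simp
      also have "\<dots> \<le> e / (2 * M) * M" using M \<open>e > 0\<close> by (intro mult_left_mono) auto
      also have "\<dots> < e" using M \<open>e > 0\<close> by simp
      also have "\<bar>t j\<bar> * norm (grad h (b j) - grad h (a j) - H (b j - a j)) = norm (?r j)"
        unfolding norm_scaleR[symmetric] H.scaleR by (simp add: scaleR_diff_right)
      finally show "norm (?r j - 0) < e" by simp
    qed
    then show "\<exists>no. \<forall>n\<ge>no. norm (?r n - 0) < e" unfolding eventually_sequentially .
  qed
  moreover have "(\<lambda>j. H (t j *\<^sub>R (b j - a j))) \<longlonglongrightarrow> H v" by (rule H.tendsto[OF t])
  ultimately have "(\<lambda>j. ?r j + H (t j *\<^sub>R (b j - a j))) \<longlonglongrightarrow> 0 + H v" by (rule tendsto_add)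
  then show ?thesis by simp
qed

text \<open>The scaled quadratic remainder is at most \<open>C\<close> times the bounded scaled
  increment times the unscaled one, which tends to zero.\<close>

lemma function_increment_limit:
  fixes h :: "'a::euclidean_space \<Rightarrow> real"
  assumes C: "smooth_bound K h C" and in_K: "\<And>j. a j \<in> K" "\<And>j. b j \<in> K"
    and a: "(\<lambda>j. grad h (a j)) \<longlonglongrightarrow> D" and ba: "(\<lambda>j. b j - a j) \<longlonglongrightarrow> 0"
    and t: "(\<lambda>j. t j *\<^sub>R (b j - a j)) \<longlonglongrightarrow> v"
  shows "(\<lambda>j. t j * (h (b j) - h (a j))) \<longlonglongrightarrow> D \<bullet> v"
proof -
  let ?r = "\<lambda>j. t j * (h (b j) - h (a j)) - grad h (a j) \<bullet> (t j *\<^sub>R (b j - a j))"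
  have "?r \<longlonglongrightarrow> 0"
  proof (rule Lim_null_comparison)
    show "(\<lambda>j. C * (norm (t j *\<^sub>R (b j - a j)) * norm (b j - a j))) \<longlonglongrightarrow> 0"
      using tendsto_mult[OF tendsto_const[of C] tendsto_mult[OF tendsto_norm[OF t] tendsto_norm[OF ba]]] by simp
    show "\<forall>\<^sub>F j in sequentially. norm (?r j) \<le> C * (norm (t j *\<^sub>R (b j - a j)) * norm (b j - a j))"
    proof (rule always_eventually, rule allI)
      fix j
      have "\<bar>h (b j) - h (a j) - grad h (a j) \<bullet> (b j - a j)\<bar> \<le> C * (norm (b j - a j))\<^sup>2"
        using C in_K unfolding smooth_bound_def by blast
      then have "\<bar>t j\<bar> * \<bar>h (b j) - h (a j) - grad h (a j) \<bullet> (b j - a j)\<bar> \<le> \<bar>t j\<bar> * (C * (norm (b j - a j))\<^sup>2)"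
        by (rule mult_left_mono) simp
      moreover have "?r j = t j * (h (b j) - h (a j) - grad h (a j) \<bullet> (b j - a j))"
        unfolding inner_scaleR_right by (simp add: right_diff_distrib)
      ultimately show "norm (?r j) \<le> C * (norm (t j *\<^sub>R (b j - a j)) * norm (b j - a j))"
        unfolding norm_scaleR real_norm_def by (simp only: abs_mult) (simp add: power2_eq_square mult_ac)
    qed
  qed
  moreover have "(\<lambda>j. grad h (a j) \<bullet> (t j *\<^sub>R (b j - a j))) \<longlonglongrightarrow> D \<bullet> v" by (rule tendsto_inner[OF a t])
  ultimately have "(\<lambda>j. ?r j + grad h (a j) \<bullet> (t j *\<^sub>R (b j - a j))) \<longlonglongrightarrow> 0 + D \<bullet> v" by (rule tendsto_add)
  then show ?thesis by simp
qed

text \<open>For a convex set, normality is a family of inequalities indexed by fixed points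
  \<open>u\<close> of the set, and each of them passes to the limit.\<close>

lemma normal_cone_limit:
  fixes D :: "'a::euclidean_space set"
  assumes "convex D" "closed D" and n: "\<And>j. v j \<in> regular_normal_cone D (w j)"
    and lim: "w \<longlonglongrightarrow> wb" "v \<longlonglongrightarrow> vb"
  shows "vb \<in> regular_normal_cone D wb"
proof -
  have wD: "w j \<in> D" for j using n[of j] by (simp add: regular_normal_cone_def)
  then have "wb \<in> D" using closed_sequentially[OF assms(2) _ lim(1)] by blast
  moreover have "vb \<bullet> (u - wb) \<le> 0" if "u \<in> D" for u
  proof (rule LIMSEQ_le_const2)
    show "(\<lambda>j. v j \<bullet> (u - w j)) \<longlonglongrightarrow> vb \<bullet> (u - wb)" by (intro tendsto_intros lim)
    show "\<exists>N. \<forall>j\<ge>N. v j \<bullet> (u - w j) \<le> 0"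
      using n regular_normal_cone_convex_iff[OF assms(1) wD] that by blast
  qed
  ultimately show ?thesis using regular_normal_cone_convex_iff[OF assms(1)] by blast
qed

section \<open>Second derivatives of the Lagrangian and the MPCC constraint qualification\<close>

context bilevel
begin

definition Lag_hess :: "((real^'n) \<times> (real^'m) \<Rightarrow> (real^'n) \<times> (real^'m)) \<Rightarrow> ('q \<Rightarrow> (real^'n) \<times> (real^'m) \<Rightarrow> (real^'n) \<times> (real^'m))
    \<Rightarrow> real^'q \<Rightarrow> (real^'n) \<times> (real^'m) \<Rightarrow> (real^'n) \<times> (real^'m)" where
  "Lag_hess Hf Hg z u = Hf u + (\<Sum>i\<in>UNIV. z $ i *\<^sub>R Hg i u)"

lemma hessians:
  assumes "x \<in> Xset G"
  shows "\<exists>Hf Hg. hess_at f (x, y) Hf \<and> (\<forall>i. hess_at (\<lambda>w. g w $ i) (x, y) (Hg i))"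
proof -
  obtain U where U: "open U" "Xset G \<times> UNIV \<subseteq> U" "twice_cont_diff_on U f"
    "\<And>i. twice_cont_diff_on U (\<lambda>w. g w $ i)" using common_domain by auto
  have w: "(x, y) \<in> U" using assms U(2) by blast
  show ?thesis using hess_at_exists[OF U(3,1) w] hess_at_exists[OF U(4,1) w] by metis
qed

lemma Lag_hess_linear:
  assumes "hess_at f w Hf" "\<And>i. hess_at (\<lambda>w. g w $ i) w (Hg i)"
  shows "bounded_linear (Lag_hess Hf Hg z)"
proof -
  have "bounded_linear (\<lambda>u. Hf u + (\<Sum>i\<in>UNIV. z $ i *\<^sub>R Hg i u))"
    by (intro bounded_linear_add bounded_linear_sum bounded_linear_const_scaleR
        hess_at_linear[OF assms(1)] hess_at_linear[OF assms(2)])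
  then show ?thesis by (simp add: Lag_hess_def[abs_def])
qed

lemma Lag_hess_symmetric:
  assumes "hess_at f w Hf" "\<And>i. hess_at (\<lambda>w. g w $ i) w (Hg i)"
  shows "Lag_hess Hf Hg z u \<bullet> v = Lag_hess Hf Hg z v \<bullet> u"
proof -
  have "Hf u \<bullet> v = Hf v \<bullet> u" "Hg i u \<bullet> v = Hg i v \<bullet> u" for i
    using assms unfolding hess_at_def by blast+
  then show ?thesis by (simp add: Lag_hess_def inner_add_left inner_sum_left)
qed

lemma Lg_has_derivative:
  assumes "hess_at f w Hf" "\<And>i. hess_at (\<lambda>w. g w $ i) w (Hg i)"
  shows "((\<lambda>w. Lg w z) has_derivative Lag_hess Hf Hg z) (at w)"
  unfolding Lg_def Lag_hess_def[abs_def]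
  using assms unfolding hess_at_def by (auto intro!: has_derivative_add has_derivative_sum has_derivative_scaleR_right)

text \<open>Identifies the matrix-vector product in the stationarity conditions with the full
  Hessian of the Lagrangian applied to \<open>(0, \<omega>)\<close>, the form in which the limit of
  the scaled increments appears.\<close>

lemma frechet_Lag:
  assumes x: "x \<in> Xset G" and H: "hess_at f (x, y) Hf" "\<And>i. hess_at (\<lambda>w. g w $ i) (x, y) (Hg i)"
  shows "frechet_derivative (\<lambda>y'. grad (\<lambda>(a, b). Lag f g a b z) (x, y')) (at y) \<omega> = Lag_hess Hf Hg z (0, \<omega>)"
proof -
  have "grad (\<lambda>(a, b). Lag f g a b z) (x, y') = Lg (x, y') z" for y'
  proof (rule grad_eqI)
    have "(\<lambda>(a, b). Lag f g a b z) = (\<lambda>w. f w + z \<bullet> g w)" by (auto simp: Lag_def)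
    then show "GDERIV (\<lambda>(a, b). Lag f g a b z) (x, y') :> Lg (x, y') z"
      using GDERIV_Lag_X[OF x, of z y'] by simp
  qed
  moreover have "((\<lambda>y'. Lg (x, y') z) has_derivative (\<lambda>k. Lag_hess Hf Hg z (0, k))) (at y)"
    by (rule has_derivative_compose[where g="\<lambda>w. Lg w z" and f="\<lambda>y'. (x, y')", OF _ Lg_has_derivative[OF H]])
       (auto intro!: derivative_eq_intros)
  ultimately show ?thesis using frechet_derivative_at[of "\<lambda>y'. Lg (x, y') z"] by simp
qed

lemma grad_stationarity_residual:
  assumes x: "x \<in> Xset G" and H: "hess_at f (x, y) Hf" "\<And>i. hess_at (\<lambda>w. g w $ i) (x, y) (Hg i)"
  shows "grad (\<lambda>(x, y, z). grad_y_Lag f g x y z $ l) (x, y, z)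
    = (fst (Lag_hess Hf Hg z (0, axis l 1)), snd (Lag_hess Hf Hg z (0, axis l 1)), \<chi> i. snd (Gg i (x, y)) $ l)"
proof (rule grad_eqI)
  obtain U where U: "open U" "Xset G \<times> UNIV \<subseteq> U" "twice_cont_diff_on U f"
    "\<And>i. twice_cont_diff_on U (\<lambda>w. g w $ i)" using common_domain by auto
  let ?w = "\<lambda>p :: (real^'n) \<times> (real^'m) \<times> (real^'q). (fst p, fst (snd p))"
  let ?z = "\<lambda>p :: (real^'n) \<times> (real^'m) \<times> (real^'q). snd (snd p)"
  let ?S = "{p. ?w p \<in> U}"
  have "continuous_on UNIV ?w" by (intro continuous_intros)
  then have "open ?S" using open_vimage[OF U(1), of ?w] by (simp add: vimage_def)
  \<comment> \<open>\<open>grad_y_Lag\<close> is known to equal this expression only where the data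
    are differentiable; an open set of such points suffices to transfer the derivative.\<close>
  have eq: "snd (Lg (?w p) (?z p)) $ l = (\<lambda>(x, y, z). grad_y_Lag f g x y z $ l) p" if "p \<in> ?S" for p
  proof -
    obtain a b c where p: "p = (a, b, c)" by (metis prod.collapse)
    have "(a, b) \<in> U" using that p by simp
    then have "GDERIV f (a, b) :> grad f (a, b)" "\<And>i. GDERIV (\<lambda>w. g w $ i) (a, b) :> Gg i (a, b)"
      using U(3,4) unfolding twice_cont_diff_on_def cont_diff_on_def by blast+
    from GDERIV_partial_snd[OF GDERIV_Lag[OF this]]
    have "grad_y_Lag f g a b c = snd (Lg (a, b) c)" by (simp add: Lag_def grad_eqI)
    then show ?thesis by (simp add: p)
  qed
  have w: "(?w has_derivative ?w) (at (x, y, z))" "(?z has_derivative ?z) (at (x, y, z))"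
    by (auto intro!: derivative_eq_intros)
  have f': "((\<lambda>p. grad f (?w p)) has_derivative (\<lambda>k. Hf (?w k))) (at (x, y, z))"
    using has_derivative_compose[OF w(1), of "grad f" Hf] H(1) unfolding hess_at_def by simp
  have g': "((\<lambda>p. Gg i (?w p)) has_derivative (\<lambda>k. Hg i (?w k))) (at (x, y, z))" for i
    using has_derivative_compose[OF w(1), of "Gg i" "Hg i"] H(2)[of i] unfolding hess_at_def by simp
  have z': "((\<lambda>p. ?z p $ i) has_derivative (\<lambda>k. ?z k $ i)) (at (x, y, z))" for i
    by (rule bounded_linear.has_derivative[OF bounded_linear_vec_nth w(2)])
  have "((\<lambda>p. grad f (?w p) + (\<Sum>i\<in>UNIV. ?z p $ i *\<^sub>R Gg i (?w p))) has_derivative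
     (\<lambda>k. Hf (?w k) + (\<Sum>i\<in>UNIV. z $ i *\<^sub>R Hg i (?w k) + ?z k $ i *\<^sub>R Gg i (x, y)))) (at (x, y, z))"
    using has_derivative_scaleR[OF z' g']
    by (intro has_derivative_add has_derivative_sum f') simp
  then have "((\<lambda>p. Lg (?w p) (?z p)) has_derivative
     (\<lambda>k. Lag_hess Hf Hg z (?w k) + (\<Sum>i\<in>UNIV. ?z k $ i *\<^sub>R Gg i (x, y)))) (at (x, y, z))"
    by (simp add: Lg_def Lag_hess_def sum.distrib add.assoc)
  from bounded_linear.has_derivative[OF bounded_linear_compose[OF bounded_linear_vec_nth bounded_linear_snd] this]
  have der: "((\<lambda>p. snd (Lg (?w p) (?z p)) $ l) has_derivative
     (\<lambda>k. snd (Lag_hess Hf Hg z (?w k) + (\<Sum>i\<in>UNIV. ?z k $ i *\<^sub>R Gg i (x, y))) $ l)) (at (x, y, z))" .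
  have "snd (Lag_hess Hf Hg z (?w k) + (\<Sum>i\<in>UNIV. ?z k $ i *\<^sub>R Gg i (x, y))) $ l
     = k \<bullet> (fst (Lag_hess Hf Hg z (0, axis l 1)), snd (Lag_hess Hf Hg z (0, axis l 1)), \<chi> i. snd (Gg i (x, y)) $ l)" for k
  proof -
    \<comment> \<open>The component is an inner product with \<open>(0, axis l 1)\<close>, and
      symmetry moves the Hessian onto this fixed vector, which produces a gradient.\<close>
    have "snd (Lag_hess Hf Hg z (?w k)) $ l = Lag_hess Hf Hg z (?w k) \<bullet> (0, axis l 1)"
      by (simp add: inner_prod_def inner_axis)
    also have "\<dots> = Lag_hess Hf Hg z (0, axis l 1) \<bullet> ?w k" by (rule Lag_hess_symmetric[OF H])
    finally have "snd (Lag_hess Hf Hg z (?w k)) $ l = fst k \<bullet> fst (Lag_hess Hf Hg z (0, axis l 1))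
       + fst (snd k) \<bullet> snd (Lag_hess Hf Hg z (0, axis l 1))"
      by (simp add: inner_prod_def inner_commute)
    moreover have "snd (\<Sum>i\<in>UNIV. ?z k $ i *\<^sub>R Gg i (x, y)) $ l = ?z k \<bullet> (\<chi> i. snd (Gg i (x, y)) $ l)"
      by (simp add: snd_sum inner_vec_def)
    ultimately show ?thesis by (simp add: inner_prod_def)
  qed
  then have "GDERIV (\<lambda>p. snd (Lg (?w p) (?z p)) $ l) (x, y, z)
     :> (fst (Lag_hess Hf Hg z (0, axis l 1)), snd (Lag_hess Hf Hg z (0, axis l 1)), \<chi> i. snd (Gg i (x, y)) $ l)"
    using der unfolding gderiv_def by simp
  moreover have "(x, y, z) \<in> ?S" using U(2) x by auto
  ultimately show "GDERIV (\<lambda>(x, y, z). grad_y_Lag f g x y z $ l) (x, y, z)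
     :> (fst (Lag_hess Hf Hg z (0, axis l 1)), snd (Lag_hess Hf Hg z (0, axis l 1)), \<chi> i. snd (Gg i (x, y)) $ l)"
    unfolding gderiv_def by (rule has_derivative_transform_within_open[OF _ \<open>open ?S\<close> _ eq])
qed

lemma grad_lift:
  fixes h :: "(real^'n) \<times> (real^'m) \<Rightarrow> real"
  assumes "GDERIV h (x, y) :> D"
  shows "grad (\<lambda>(x, y, z :: real^'q). h (x, y)) (x, y, z) = (fst D, snd D, 0)"
proof (rule grad_eqI)
  let ?w = "\<lambda>p :: (real^'n) \<times> (real^'m) \<times> (real^'q). (fst p, fst (snd p))"
  have "(?w has_derivative ?w) (at (x, y, z))" by (auto intro!: derivative_eq_intros)
  from has_derivative_compose[OF this, of h "\<lambda>k. k \<bullet> D"] assms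
  have "((\<lambda>p. h (?w p)) has_derivative (\<lambda>k. ?w k \<bullet> D)) (at (x, y, z))" by (simp add: gderiv_def)
  then show "GDERIV (\<lambda>(x, y, z :: real^'q). h (x, y)) (x, y, z) :> (fst D, snd D, 0)"
    by (simp add: gderiv_def split_beta' inner_prod_def)
qed

lemma grad_z_component:
  "grad (\<lambda>(x :: real^'n, y :: real^'m, z :: real^'q). z $ i) (x, y, z) = (0, 0, axis i 1)"
proof (rule grad_eqI)
  have "((\<lambda>p. snd (snd p) $ i) has_derivative (\<lambda>k. snd (snd k) $ i)) (at (x, y, z))"
    by (intro bounded_linear.has_derivative[OF bounded_linear_vec_nth] has_derivative_snd has_derivative_ident)
  then show "GDERIV (\<lambda>(x :: real^'n, y :: real^'m, z :: real^'q). z $ i) (x, y, z) :> (0, 0, axis i 1)"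
    by (simp add: gderiv_def split_beta' inner_prod_def inner_axis)
qed

lemma MPCC_MFCQ_multipliers_zero:
  assumes mf: "MPCC_MFCQ f G g (x, y, z)" and feas: "MPCC_feasible f G g (x, y, z)" and w: "(x, y) \<in> Omega G"
    and H: "hess_at f (x, y) Hf" "\<And>i. hess_at (\<lambda>w. g w $ i) (x, y) (Hg i)"
    and \<mu>: "\<And>j. 0 \<le> \<mu> j" "\<And>j. \<mu> j * G (x, y) $ j = 0"
    and eq: "Lag_hess Hf Hg z (0, \<omega>) + (\<Sum>i\<in>UNIV. \<eta> $ i *\<^sub>R Gg i (x, y)) + (\<Sum>j\<in>UNIV. \<mu> j *\<^sub>R grad (\<lambda>w. G w $ j) (x, y)) = 0"
    and \<eta>0: "\<And>i. i \<in> I_0p g (x, y, z) \<Longrightarrow> \<eta> $ i = 0"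
    and J0: "\<And>i. i \<in> I_p0 g (x, y, z) \<Longrightarrow> snd (Gg i (x, y)) \<bullet> \<omega> = 0"
  shows "\<omega> = 0 \<and> \<eta> = 0 \<and> (\<forall>j. \<mu> j = 0)"
proof -
  let ?p = "(x, y, z)"
  have x: "x \<in> Xset G" using w by (rule Omega_X)
  have fz: "0 \<le> z $ i" "g (x, y) $ i \<le> 0" "z $ i * g (x, y) $ i = 0" for i
  proof -
    have z: "0 \<le> z $ i" and g: "g (x, y) $ i \<le> 0" for i using feas by (auto simp: MPCC_feasible_def less_eq_vec_def)
    have "(\<Sum>i\<in>UNIV. z $ i * (- (g (x, y) $ i))) = 0" using feas by (simp add: MPCC_feasible_def inner_vec_def)
    then have "z $ i * (- (g (x, y) $ i)) = 0"
      by (rule sum_nonneg_0[rotated 2]) (use z g in \<open>auto simp: mult_nonneg_nonpos\<close>)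
    then show "0 \<le> z $ i" "g (x, y) $ i \<le> 0" "z $ i * g (x, y) $ i = 0" using z g by auto
  qed
  let ?A = "I_p0 g ?p" and ?B = "I_0p g ?p" and ?Z = "I_00 g ?p"
  have cover: "i \<in> ?A \<or> i \<in> ?B \<or> i \<in> ?Z" for i
    using fz[of i] by (auto simp: I_p0_def I_0p_def I_00_def less_le)
  have disj: "?A \<inter> ?B = {}" "?A \<inter> ?Z = {}" "?B \<inter> ?Z = {}" by (auto simp: I_p0_def I_0p_def I_00_def)
  let ?E = "(UNIV :: 'm set) <+> ((?A \<union> ?Z) <+> (?B \<union> ?Z))"
  let ?h = "case_sum (\<lambda>j (x, y, z). grad_y_Lag f g x y z $ j)
         (case_sum (\<lambda>i (x, y, z). - (g (x, y) $ i)) (\<lambda>i (x, y, z). z $ i))"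
  let ?I = "(UNIV :: 'p set) <+> (?B <+> ?A)"
  let ?c = "case_sum (\<lambda>j (x, y, z). G (x, y) $ j)
         (case_sum (\<lambda>i (x, y, z). g (x, y) $ i) (\<lambda>i (x, y, z). - (z $ i)))"
  let ?J = "\<lambda>i. snd (Gg i (x, y)) \<bullet> \<omega>"
  \<comment> \<open>\<open>\<omega>\<close> is attached to the stationarity equation,
    \<open>-\<eta>\<close> to \<open>-g_i = 0\<close> and \<open>-?J\<close> to
    \<open>z_i = 0\<close>, where it cancels the \<open>z\<close>-component left by
    \<open>\<omega>\<close>. The inequalities on \<open>I_0p\<close> and \<open>I_p0\<close> are
    inactive at the point, so they receive the multiplier \<open>0\<close>.\<close>
  let ?mh = "case_sum (\<lambda>l. \<omega> $ l) (case_sum (\<lambda>i. - (\<eta> $ i)) (\<lambda>i. - ?J i))"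
  let ?mc = "case_sum \<mu> (\<lambda>_. 0)"
  have act: "{i \<in> ?I. ?c i ?p = 0} = Inl ` {j. G (x, y) $ j = 0}"
  proof -
    have "g (x, y) $ i \<noteq> 0" if "i \<in> ?B" for i using that by (auto simp: I_0p_def)
    moreover have "z $ i \<noteq> 0" if "i \<in> ?A" for i using that by (auto simp: I_p0_def)
    ultimately show ?thesis by auto
  qed
  have gy: "grad (\<lambda>(x, y, z). grad_y_Lag f g x y z $ l) ?p
    = (fst (Lag_hess Hf Hg z (0, axis l 1)), snd (Lag_hess Hf Hg z (0, axis l 1)), \<chi> i. snd (Gg i (x, y)) $ l)" for l
    by (rule grad_stationarity_residual[OF x H])
  have gg: "grad (\<lambda>(x, y, z :: real^'q). - (g (x, y) $ i)) ?p = (- fst (Gg i (x, y)), - snd (Gg i (x, y)), 0)" for i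
    using grad_lift[OF GDERIV_minus[OF GDERIV_g[OF x]], of i y z] by simp
  have gG: "grad (\<lambda>(x, y, z :: real^'q). G (x, y) $ j) ?p = (fst (grad (\<lambda>w. G w $ j) (x, y)), snd (grad (\<lambda>w. G w $ j) (x, y)), 0)" for j
    by (rule grad_lift[OF GDERIV_G[OF w]])
  let ?L = "Lag_hess Hf Hg z"
  interpret L: bounded_linear ?L by (rule Lag_hess_linear[OF H])
  have \<omega>e: "(0, \<omega>) = (\<Sum>l\<in>UNIV. \<omega> $ l *\<^sub>R (0 :: real^'n, axis l 1 :: real^'m))"
    using basis_expansion[of \<omega>] by (simp add: prod_eq_iff fst_sum snd_sum scalar_mult_eq_scaleR)
  have L\<omega>: "?L (0, \<omega>) = (\<Sum>l\<in>UNIV. \<omega> $ l *\<^sub>R ?L (0, axis l 1))"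
    unfolding \<omega>e L.sum L.scaleR ..
  have S\<eta>: "(\<Sum>i\<in>?A \<union> ?Z. \<eta> $ i *\<^sub>R q i) = (\<Sum>i\<in>UNIV. \<eta> $ i *\<^sub>R q i)" for q :: "'q \<Rightarrow> 'b::real_vector"
    using \<eta>0 cover by (intro sum.mono_neutral_left) auto
  have S\<mu>: "(\<Sum>j\<in>{j. G (x, y) $ j = 0}. \<mu> j *\<^sub>R q j) = (\<Sum>j\<in>UNIV. \<mu> j *\<^sub>R q j)" for q :: "'p \<Rightarrow> 'b::real_vector"
    using \<mu>(2) by (intro sum.mono_neutral_left) auto
  have SJ: "(\<Sum>i\<in>?B \<union> ?Z. ?J i *\<^sub>R axis i 1) = (\<chi> i. ?J i)"
  proof -
    have "(\<Sum>i\<in>?B \<union> ?Z. ?J i *\<^sub>R axis i (1::real)) = (\<Sum>i\<in>UNIV. ?J i *\<^sub>R axis i 1)"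
      using J0 cover by (intro sum.mono_neutral_left) auto
    then show ?thesis using basis_expansion[of "\<chi> i. ?J i"] by (simp add: scalar_mult_eq_scaleR)
  qed
  have "(\<Sum>e\<in>?E. ?mh e *\<^sub>R grad (?h e) ?p)
     = (\<Sum>l\<in>UNIV. \<omega> $ l *\<^sub>R (fst (?L (0, axis l 1)), snd (?L (0, axis l 1)), \<chi> i. snd (Gg i (x, y)) $ l))
       + ((\<Sum>i\<in>?A \<union> ?Z. (- (\<eta> $ i)) *\<^sub>R (- fst (Gg i (x, y)), - snd (Gg i (x, y)), 0))
          + (\<Sum>i\<in>?B \<union> ?Z. (- ?J i) *\<^sub>R (0, 0, axis i 1)))"
    by (simp only: sum.Plus finite finite_Plus o_def sum.case gy gg grad_z_component)
  also have "\<dots> = (fst (?L (0, \<omega>)) + (\<Sum>i\<in>?A \<union> ?Z. \<eta> $ i *\<^sub>R fst (Gg i (x, y))),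
      snd (?L (0, \<omega>)) + (\<Sum>i\<in>?A \<union> ?Z. \<eta> $ i *\<^sub>R snd (Gg i (x, y))),
      (\<Sum>l\<in>UNIV. \<omega> $ l *\<^sub>R (\<chi> i. snd (Gg i (x, y)) $ l)) - (\<Sum>i\<in>?B \<union> ?Z. ?J i *\<^sub>R axis i 1))"
    unfolding L\<omega> by (simp add: prod_eq_iff fst_sum snd_sum sum_negf)
  also have "(\<Sum>l\<in>UNIV. \<omega> $ l *\<^sub>R (\<chi> i. snd (Gg i (x, y)) $ l)) = (\<chi> i. ?J i)"
    by (simp add: vec_eq_iff inner_vec_def mult.commute)
  finally have Eq: "(\<Sum>e\<in>?E. ?mh e *\<^sub>R grad (?h e) ?p)
     = (fst (?L (0, \<omega>)) + (\<Sum>i\<in>UNIV. \<eta> $ i *\<^sub>R fst (Gg i (x, y))),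
      snd (?L (0, \<omega>)) + (\<Sum>i\<in>UNIV. \<eta> $ i *\<^sub>R snd (Gg i (x, y))), 0)"
    unfolding S\<eta> SJ by simp
  have "(\<Sum>i\<in>{i \<in> ?I. ?c i ?p = 0}. ?mc i *\<^sub>R grad (?c i) ?p)
     = (\<Sum>j\<in>{j. G (x, y) $ j = 0}. \<mu> j *\<^sub>R (fst (grad (\<lambda>w. G w $ j) (x, y)), snd (grad (\<lambda>w. G w $ j) (x, y)), 0))"
    unfolding act by (simp add: sum.reindex gG)
  then have Ineq: "(\<Sum>i\<in>{i \<in> ?I. ?c i ?p = 0}. ?mc i *\<^sub>R grad (?c i) ?p)
     = ((\<Sum>j\<in>UNIV. \<mu> j *\<^sub>R fst (grad (\<lambda>w. G w $ j) (x, y))), (\<Sum>j\<in>UNIV. \<mu> j *\<^sub>R snd (grad (\<lambda>w. G w $ j) (x, y))), 0)"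
    unfolding S\<mu> by (simp add: prod_eq_iff fst_sum snd_sum)
  have "fst (?L (0, \<omega>)) + (\<Sum>i\<in>UNIV. \<eta> $ i *\<^sub>R fst (Gg i (x, y))) + (\<Sum>j\<in>UNIV. \<mu> j *\<^sub>R fst (grad (\<lambda>w. G w $ j) (x, y))) = 0"
    "snd (?L (0, \<omega>)) + (\<Sum>i\<in>UNIV. \<eta> $ i *\<^sub>R snd (Gg i (x, y))) + (\<Sum>j\<in>UNIV. \<mu> j *\<^sub>R snd (grad (\<lambda>w. G w $ j) (x, y))) = 0"
    using eq by (simp_all add: prod_eq_iff fst_sum snd_sum)
  then have zero: "(\<Sum>e\<in>?E. ?mh e *\<^sub>R grad (?h e) ?p) + (\<Sum>i\<in>{i \<in> ?I. ?c i ?p = 0}. ?mc i *\<^sub>R grad (?c i) ?p) = 0"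
    unfolding Eq Ineq by (simp add: zero_prod_def)
  have nn: "\<forall>i\<in>?I. 0 \<le> ?mc i" using \<mu>(1) by auto
  have res: "(\<forall>e\<in>?E. ?mh e = 0) \<and> (\<forall>i\<in>{i \<in> ?I. ?c i ?p = 0}. ?mc i = 0)"
    using mf[unfolded MPCC_MFCQ_def MFCQ_def, THEN spec, THEN spec, THEN mp, THEN mp, OF nn zero] .
  have "\<omega> $ l = 0" for l using res by (auto dest!: bspec[of _ _ "Inl l"])
  then have "\<omega> = 0" by (simp add: vec_eq_iff)
  moreover have "\<eta> $ i = 0" for i
  proof (cases "i \<in> ?B")
    case False
    then have "Inr (Inl i) \<in> ?E" using cover by auto
    then have "?mh (Inr (Inl i)) = 0" using res by blast
    then show ?thesis by simp
  qed (rule \<eta>0)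
  then have "\<eta> = 0" by (simp add: vec_eq_iff)
  moreover have "\<mu> j = 0" for j
  proof (cases "G (x, y) $ j = 0")
    case True
    then show ?thesis using res unfolding act by auto
  next
    case False
    then show ?thesis using \<mu>(2)[of j] by simp
  qed
  ultimately show ?thesis by blast
qed

end

section \<open>Limits of the iterates\<close>

text \<open>Nonpositive exactly at the pairs admitted by M-stationarity on the biactive set.\<close>

definition m_excess :: "real \<Rightarrow> real \<Rightarrow> real" where
  "m_excess a b = min (max (- a) (- b)) (min \<bar>a\<bar> \<bar>b\<bar>)"

lemma m_excess_nonpos:
  assumes "m_excess a b \<le> 0"
  shows "(0 < a \<and> 0 < b) \<or> a * b = 0"
  using assms by (auto simp: m_excess_def min_def max_def split: if_splits)

context bilevel
begin

lemma tendsto_grad_data: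
  assumes w: "w \<longlonglongrightarrow> (x, y)" and x: "x \<in> Xset G"
  shows "(\<lambda>j. grad f (w j)) \<longlonglongrightarrow> grad f (x, y)" "(\<lambda>j. Gg i (w j)) \<longlonglongrightarrow> Gg i (x, y)"
    "(\<lambda>j. g (w j)) \<longlonglongrightarrow> g (x, y)"
proof -
  obtain Hf Hg where H: "hess_at f (x, y) Hf" "\<And>i. hess_at (\<lambda>w. g w $ i) (x, y) (Hg i)" using hessians[OF x] by blast
  have "isCont (grad f) (x, y)" "isCont (Gg i) (x, y)"
    using H(1) H(2)[of i] has_derivative_continuous unfolding hess_at_def by blast+
  then show "(\<lambda>j. grad f (w j)) \<longlonglongrightarrow> grad f (x, y)" "(\<lambda>j. Gg i (w j)) \<longlonglongrightarrow> Gg i (x, y)"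
    using isCont_tendsto_compose w by blast+
  have "isCont (\<lambda>w. g w $ i) (x, y)" for i
    using GDERIV_g[OF x, of i y] has_derivative_continuous unfolding gderiv_def by blast
  then show "(\<lambda>j. g (w j)) \<longlonglongrightarrow> g (x, y)"
    by (intro vec_tendstoI isCont_tendsto_compose[OF _ w])
qed

lemma tendsto_Lg:
  assumes "w \<longlonglongrightarrow> (x, y)" "x \<in> Xset G" "z \<longlonglongrightarrow> zb"
  shows "(\<lambda>j. Lg (w j) (z j)) \<longlonglongrightarrow> Lg (x, y) zb"
  unfolding Lg_def by (intro tendsto_intros tendsto_vec_nth tendsto_grad_data assms)

lemma tendsto_pen_mult:
  assumes "(\<lambda>j. g (x j, y j)) \<longlonglongrightarrow> gb" "z \<longlonglongrightarrow> zb"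
  shows "(\<lambda>j. pen_mult (x j) (y j) (z j)) \<longlonglongrightarrow> pos_part (zb + \<gamma>2 *\<^sub>R gb)"
proof (rule vec_tendstoI)
  fix i
  have "(\<lambda>j. max 0 (z j $ i + \<gamma>2 * g (x j, y j) $ i)) \<longlonglongrightarrow> max 0 (zb $ i + \<gamma>2 * gb $ i)"
    by (intro tendsto_intros tendsto_vec_nth assms)
  then show "(\<lambda>j. pen_mult (x j) (y j) (z j) $ i) \<longlonglongrightarrow> pos_part (zb + \<gamma>2 *\<^sub>R gb) $ i"
    by (simp add: pen_mult_nth pos_part_def)
qed

lemma Lg_diff: "Lg w z' - Lg w z = (\<Sum>i\<in>UNIV. (z' $ i - z $ i) *\<^sub>R Gg i w)"
  by (simp add: Lg_def sum_subtractf scaleR_diff_left)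

text \<open>Both components of the \<open>(x, y)\<close>-gradient of the gap have the same form by optimality of the proximal point.\<close>

lemma gap_grad_xy:
  assumes "x \<in> Xset G" "0 \<le> z"
  shows "(gap_grad_x f g \<gamma>1 \<gamma>2 x y z, gap_grad_y f g \<gamma>1 \<gamma>2 x y z)
     = Lg (x, y) (pen_mult x y z) - Lg (x, theta_star f g \<gamma>1 x y z) z"
proof -
  have "prox_grad x y z (theta_star f g \<gamma>1 x y z) = 0" using theta_star[OF assms] resid_eq[OF assms(1)] by (metis norm_eq_zero)
  then have "snd (Lg (x, theta_star f g \<gamma>1 x y z) z) = (1 / \<gamma>1) *\<^sub>R (y - theta_star f g \<gamma>1 x y z)"
    unfolding prox_grad_def by (simp add: eq_neg_iff_add_eq_0 algebra_simps)
  then show ?thesis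
    using grad_partials(1,2)[OF assms(1)]
    by (simp add: prod_eq_iff gap_grad_x_def gap_grad_y_def Let_def lambda_star_def pen_mult_def diff_diff_eq)
qed

text \<open>Inserting \<open>Lg (x, y) z\<close> splits the gap gradient. The change of the
  multiplier joins the penalty in the coefficients that become \<open>\<eta>\<close>; the increment
  between the proximal point and \<open>y\<close> becomes the Hessian applied to
  \<open>\<omega>\<close>.\<close>

lemma scaled_d_xy:
  assumes "x \<in> Xset G" "0 \<le> z" "fst \<sigma> \<noteq> 0"
  shows "fst \<sigma> *\<^sub>R d_xy F f g \<gamma>1 \<gamma>2 \<sigma> x y z s (theta_star f g \<gamma>1 x y z) = grad F (x, y)
    + (\<Sum>i\<in>UNIV. (fst \<sigma> * (pen_mult x y z $ i - z $ i) + fst \<sigma> * snd \<sigma> * (g (x, y) $ i + s $ i)) *\<^sub>R Gg i (x, y))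
    + fst \<sigma> *\<^sub>R (Lg (x, y) z - Lg (x, theta_star f g \<gamma>1 x y z) z)"
proof -
  let ?a = "\<Sum>i\<in>UNIV. (fst \<sigma> * (pen_mult x y z $ i - z $ i)) *\<^sub>R Gg i (x, y)"
  let ?b = "\<Sum>i\<in>UNIV. (fst \<sigma> * snd \<sigma> * (g (x, y) $ i + s $ i)) *\<^sub>R Gg i (x, y)"
  have "Lg (x, y) (pen_mult x y z) - Lg (x, theta_star f g \<gamma>1 x y z) z
     = (Lg (x, y) (pen_mult x y z) - Lg (x, y) z) + (Lg (x, y) z - Lg (x, theta_star f g \<gamma>1 x y z) z)" by simp
  then have gg: "fst \<sigma> *\<^sub>R (gap_grad_x f g \<gamma>1 \<gamma>2 x y z, gap_grad_y f g \<gamma>1 \<gamma>2 x y z)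
     = ?a + fst \<sigma> *\<^sub>R (Lg (x, y) z - Lg (x, theta_star f g \<gamma>1 x y z) z)"
    unfolding gap_grad_xy[OF assms(1,2)] Lg_diff by (simp only: scaleR_add_right scaleR_sum_right scaleR_scaleR)
  have j: "fst \<sigma> *\<^sub>R (snd \<sigma> *\<^sub>R jac_transp g (x, y) (g (x, y) + s)) = ?b"
    unfolding jac_transp_def by (simp add: scaleR_sum_right mult.assoc)
  have "fst \<sigma> *\<^sub>R d_xy F f g \<gamma>1 \<gamma>2 \<sigma> x y z s (theta_star f g \<gamma>1 x y z) = grad F (x, y) + ?b
     + (?a + fst \<sigma> *\<^sub>R (Lg (x, y) z - Lg (x, theta_star f g \<gamma>1 x y z) z))"
    unfolding d_xy_gap_grad[OF assms(1)] scaleR_add_right gg j using assms(3) by simp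
  then show ?thesis
    unfolding scaleR_add_left sum.distrib by (simp only: add.assoc add.commute add.left_commute)
qed

end

text \<open>The conclusions of \<open>key_sequence\<close> as a locale, since the proof of
  M-stationarity passes to a further subsequence and needs all consequences a second time along
  it.\<close>

locale bspm_limit = bspm_run F f G g LF \<gamma>1 \<gamma>2 P r
  for F f :: "(real^'n) \<times> (real^'m) \<Rightarrow> real"
    and G :: "(real^'n) \<times> (real^'m) \<Rightarrow> real^'p"
    and g :: "(real^'n) \<times> (real^'m) \<Rightarrow> real^'q"
    and LF \<gamma>1 \<gamma>2 :: real
    and P :: ig_params and r :: "('n, 'm, 'q) ig_run" +
  fixes kk :: "nat \<Rightarrow> nat" and \<nu>1 :: "nat \<Rightarrow> (real^'n) \<times> (real^'m)" and \<nu>2 :: "nat \<Rightarrow> (real^'q) \<times> (real^'q)"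
    and xb :: "real^'n" and yb :: "real^'m" and zb sb :: "real^'q"
  assumes top: "filterlim kk at_top sequentially"
    and x_lim: "(\<lambda>j. x_out r (Suc (kk j))) \<longlonglongrightarrow> xb" and y_lim: "(\<lambda>j. y_out r (Suc (kk j))) \<longlonglongrightarrow> yb"
    and z_lim: "(\<lambda>j. z_out r (Suc (kk j))) \<longlonglongrightarrow> zb" and s_lim: "(\<lambda>j. s_out r (Suc (kk j))) \<longlonglongrightarrow> sb"
    and n1: "\<And>j. \<nu>1 j \<in> regular_normal_cone (Omega G) (x_out r (Suc (kk j)), y_out r (Suc (kk j)))"
    and n2: "\<And>j. \<nu>2 j \<in> regular_normal_cone compl_set (z_out r (Suc (kk j)), s_out r (Suc (kk j)))"
    and e1: "(\<lambda>j. fst (sigma_out r (kk j)) *\<^sub>R d_xy_out (kk j) + \<nu>1 j) \<longlonglongrightarrow> 0"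
    and e2: "(\<lambda>j. fst (sigma_out r (kk j)) *\<^sub>R d_zs_out (kk j) + \<nu>2 j) \<longlonglongrightarrow> 0"
begin

section \<open>Feasibility of the limit, and the case of bounded penalty parameters\<close>

abbreviation "X j \<equiv> x_out r (Suc (kk j))"
abbreviation "Y j \<equiv> y_out r (Suc (kk j))"
abbreviation "Z j \<equiv> z_out r (Suc (kk j))"
abbreviation "S j \<equiv> s_out r (Suc (kk j))"
abbreviation "TH j \<equiv> th_star (kk j)"
abbreviation "s1 j \<equiv> fst (sigma_out r (kk j))"
abbreviation "s2 j \<equiv> snd (sigma_out r (kk j))"

lemma w_lim: "(\<lambda>j. (X j, Y j)) \<longlonglongrightarrow> (xb, yb)"
  by (rule tendsto_Pair[OF x_lim y_lim])

lemma limit_in_Omega: "(xb, yb) \<in> Omega G" "xb \<in> Xset G"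
proof -
  show "(xb, yb) \<in> Omega G"
    by (rule closed_sequentially[OF Omega_set(2) _ w_lim]) (use out_in(1) in blast)
  then show "xb \<in> Xset G" by (rule Omega_X)
qed

lemma g_lim: "(\<lambda>j. g (X j, Y j)) \<longlonglongrightarrow> g (xb, yb)"
  by (rule tendsto_grad_data(3)[OF w_lim limit_in_Omega(2)])

lemma TH_diff_lim: "(\<lambda>j. TH j - Y j) \<longlonglongrightarrow> 0"
  by (rule filterlim_compose[OF theta_lim top])

lemma TH_lim: "TH \<longlonglongrightarrow> yb"
  using tendsto_add[OF TH_diff_lim y_lim] by simp

lemma gs_zero: "g (xb, yb) + sb = 0"
proof -
  have "(\<lambda>j. g (X j, Y j) + S j) \<longlonglongrightarrow> 0" by (rule filterlim_compose[OF feas_lim top])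
  moreover have "(\<lambda>j. g (X j, Y j) + S j) \<longlonglongrightarrow> g (xb, yb) + sb" by (intro tendsto_intros g_lim s_lim)
  ultimately show ?thesis using LIMSEQ_unique by blast
qed

lemma zs_in: "0 \<le> Z j $ i" "0 \<le> S j $ i" "Z j $ i * S j $ i = 0"
  using n2[of j] by (auto simp: regular_normal_cone_def compl_set_def less_eq_vec_def)

lemma zs_limit: "0 \<le> zb $ i" "0 \<le> sb $ i" "zb $ i * sb $ i = 0"
proof -
  have z: "(\<lambda>j. Z j $ i) \<longlonglongrightarrow> zb $ i" and s: "(\<lambda>j. S j $ i) \<longlonglongrightarrow> sb $ i"
    by (intro tendsto_vec_nth z_lim s_lim)+
  show "0 \<le> zb $ i" by (rule LIMSEQ_le_const[OF z]) (use zs_in in auto)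
  show "0 \<le> sb $ i" by (rule LIMSEQ_le_const[OF s]) (use zs_in in auto)
  have "(\<lambda>j. Z j $ i * S j $ i) \<longlonglongrightarrow> zb $ i * sb $ i" by (rule tendsto_mult[OF z s])
  then have "(\<lambda>j. 0) \<longlonglongrightarrow> zb $ i * sb $ i" by (simp add: zs_in)
  then show "zb $ i * sb $ i = 0" by (simp add: LIMSEQ_const_iff)
qed

lemma g_limit: "g (xb, yb) $ i = - (sb $ i)"
proof -
  have "(g (xb, yb) + sb) $ i = 0" unfolding gs_zero by simp
  then show ?thesis by simp
qed

text \<open>At the limit \<open>g = -sb\<close>, and by complementarity \<open>zb\<close> is left
  unchanged by the multiplier update.\<close>

lemma pen_mult_limit: "(\<lambda>j. pen_mult (X j) (Y j) (Z j)) \<longlonglongrightarrow> zb"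
proof -
  have "max 0 (zb $ i + \<gamma>2 * g (xb, yb) $ i) = zb $ i" for i
  proof (cases "sb $ i = 0")
    case True
    then show ?thesis using zs_limit(1)[of i] g_limit[of i] by simp
  next
    case False
    then have "zb $ i = 0" using zs_limit(3)[of i] by simp
    then show ?thesis using zs_limit(2)[of i] g_limit[of i] gamma_pos by simp
  qed
  then have "pos_part (zb + \<gamma>2 *\<^sub>R g (xb, yb)) = zb" by (simp add: vec_eq_iff pos_part_def)
  then show ?thesis using tendsto_pen_mult[OF g_lim z_lim] by simp
qed

text \<open>Optimality of the proximal point expresses the lower-level gradient at that point as a
  multiple of its distance vector to \<open>y\<close>, which tends to zero; the other conditions are
  limits of those satisfied by the iterates.\<close>

lemma feasible_limit: "MPCC_feasible f G g (xb, yb, zb)"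
proof -
  have "snd (Lg (X j, TH j) (Z j)) = - ((1 / \<gamma>1) *\<^sub>R (TH j - Y j))" for j
  proof -
    have "prox_grad (X j) (Y j) (Z j) (TH j) = 0"
      using theta_star[OF out_in(2,3)] resid_eq[OF out_in(2)] by (metis norm_eq_zero)
    then show ?thesis unfolding prox_grad_def by (simp only: add_eq_0_iff2)
  qed
  moreover have "(\<lambda>j. snd (Lg (X j, TH j) (Z j))) \<longlonglongrightarrow> snd (Lg (xb, yb) zb)"
    by (intro tendsto_snd tendsto_Lg tendsto_Pair x_lim TH_lim z_lim limit_in_Omega)
  moreover have "(\<lambda>j. - ((1 / \<gamma>1) *\<^sub>R (TH j - Y j))) \<longlonglongrightarrow> - ((1 / \<gamma>1) *\<^sub>R 0)"
    by (intro tendsto_intros TH_diff_lim)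
  ultimately have "snd (Lg (xb, yb) zb) = 0" using LIMSEQ_unique by fastforce
  then have "grad_y_Lag f g xb yb zb = 0" using grad_Lag(2)[OF limit_in_Omega(2)] by simp
  moreover have "G (xb, yb) \<le> 0" using limit_in_Omega(1) by (simp add: Omega_def)
  moreover have "0 \<le> zb" "0 \<le> - g (xb, yb)" using zs_limit g_limit by (auto simp: less_eq_vec_def)
  moreover have "zb \<bullet> (- g (xb, yb)) = 0"
    unfolding inner_vec_def by (rule sum.neutral) (use zs_limit(3) g_limit in simp)
  ultimately show ?thesis by (simp add: MPCC_feasible_def)
qed

lemma GF_lim: "(\<lambda>j. grad F (X j, Y j)) \<longlonglongrightarrow> grad F (xb, yb)"
proof -
  have "continuous_on (Omega G) (grad F)"
    using F_smooth continuous_on_subset unfolding cont_diff_on_def by blast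
  from continuous_on_sequentially[THEN iffD1, rule_format, OF this, of "(xb, yb)" "\<lambda>j. (X j, Y j)"]
  show ?thesis using w_lim limit_in_Omega(1) out_in(1) by (simp add: comp_def)
qed

lemma normal_multipliers:
  assumes "MFCQ_ineq (\<lambda>j w. G w $ j) (xb, yb)" and v: "v \<in> regular_normal_cone (Omega G) (xb, yb)"
  shows "\<exists>\<mu> :: real^'p. 0 \<le> \<mu> \<and> (\<forall>j. \<mu> $ j * G (xb, yb) $ j = 0) \<and> v = jac_transp G (xb, yb) \<mu>"
proof -
  have O: "Omega G = {w. \<forall>j. G w $ j \<le> 0}" by (auto simp: Omega_def less_eq_vec_def)
  have "\<exists>\<mu>. (\<forall>j. 0 \<le> \<mu> j) \<and> (\<forall>j. \<mu> j * G (xb, yb) $ j = 0) \<and> v = (\<Sum>j\<in>UNIV. \<mu> j *\<^sub>R grad (\<lambda>w. G w $ j) (xb, yb))"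
  proof (rule normal_cone_multipliers)
    show "G (xb, yb) $ j \<le> 0" for j using limit_in_Omega(1) O by blast
    show "GDERIV (\<lambda>w. G w $ j) (xb, yb) :> grad (\<lambda>w. G w $ j) (xb, yb)" for j by (rule GDERIV_G[OF limit_in_Omega(1)])
    show "v \<in> regular_normal_cone {w. \<forall>j. G w $ j \<le> 0} (xb, yb)" using v unfolding O .
  qed (fact assms(1))
  then obtain \<mu> where "\<And>j. 0 \<le> \<mu> j" "\<And>j. \<mu> j * G (xb, yb) $ j = 0" "v = (\<Sum>j\<in>UNIV. \<mu> j *\<^sub>R grad (\<lambda>w. G w $ j) (xb, yb))" by blast
  then show ?thesis by (intro exI[of _ "\<chi> j. \<mu> j"]) (auto simp: less_eq_vec_def jac_transp_def)
qed

text \<open>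
  With bounded penalty parameters the penalty gradients vanish in the limit, so the limit is stationary
  for \<open>F\<close> over \<open>\<Omega>\<close> and the remaining multipliers are zero.
\<close>

lemma S_stationary_bounded:
  assumes bd: "bounded (range (sigma_out r))" and mfcq: "MFCQ_ineq (\<lambda>j w. G w $ j) (xb, yb)"
  shows "S_stationary F f G g (xb, yb, zb)"
proof -
  obtain M where M: "\<And>k. norm (sigma_out r k) \<le> M" using bd unfolding bounded_iff by blast
  have s1M: "\<bar>s1 j\<bar> \<le> M" and s2M: "\<bar>s2 j\<bar> \<le> M" for j
    using norm_fst_snd_le[of "sigma_out r (kk j)"] M[of "kk j"] by auto
  have M0: "0 \<le> M" using s1M[of 0] by linarith
  have bnd0: "(\<lambda>j. c j *\<^sub>R v j) \<longlonglongrightarrow> 0" if "\<And>j. \<bar>c j\<bar> \<le> M'" "v \<longlonglongrightarrow> 0" for c M' and v :: "nat \<Rightarrow> 'c::real_normed_vector"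
  proof (rule Lim_null_comparison)
    show "(\<lambda>j. M' * norm (v j)) \<longlonglongrightarrow> 0" using tendsto_mult_right_zero[OF tendsto_norm_zero[OF that(2)]] .
    show "\<forall>\<^sub>F j in sequentially. norm (c j *\<^sub>R v j) \<le> M' * norm (v j)"
      using that(1) by (intro always_eventually) (simp add: mult_right_mono)
  qed
  have eta: "(\<lambda>j. s1 j * (pen_mult (X j) (Y j) (Z j) $ i - Z j $ i) + s1 j * s2 j * (g (X j, Y j) $ i + S j $ i)) \<longlonglongrightarrow> 0" for i
  proof -
    have "(\<lambda>j. pen_mult (X j) (Y j) (Z j) $ i - Z j $ i) \<longlonglongrightarrow> zb $ i - zb $ i"
      by (intro tendsto_intros tendsto_vec_nth pen_mult_limit z_lim)
    then have 1: "(\<lambda>j. s1 j *\<^sub>R (pen_mult (X j) (Y j) (Z j) $ i - Z j $ i)) \<longlonglongrightarrow> 0"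
      by (intro bnd0[of s1 M, OF s1M]) simp
    have "(\<lambda>j. g (X j, Y j) $ i + S j $ i) \<longlonglongrightarrow> g (xb, yb) $ i + sb $ i"
      by (intro tendsto_intros tendsto_vec_nth g_lim s_lim)
    moreover have "\<bar>s1 j * s2 j\<bar> \<le> M * M" for j
      unfolding abs_mult using s1M s2M M0 by (intro mult_mono) auto
    ultimately have 2: "(\<lambda>j. (s1 j * s2 j) *\<^sub>R (g (X j, Y j) $ i + S j $ i)) \<longlonglongrightarrow> 0"
      by (intro bnd0[of _ "M * M"]) (auto simp: g_limit)
    show ?thesis using tendsto_add[OF 1 2] by simp
  qed
  have "(\<lambda>j. Lg (X j, Y j) (Z j) - Lg (X j, TH j) (Z j)) \<longlonglongrightarrow> Lg (xb, yb) zb - Lg (xb, yb) zb"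
    by (intro tendsto_diff tendsto_Lg tendsto_Pair x_lim y_lim TH_lim z_lim limit_in_Omega)
  then have L: "(\<lambda>j. s1 j *\<^sub>R (Lg (X j, Y j) (Z j) - Lg (X j, TH j) (Z j))) \<longlonglongrightarrow> 0"
    by (intro bnd0[of s1 M, OF s1M]) simp
  have sd: "s1 j *\<^sub>R d_xy_out (kk j) = grad F (X j, Y j)
      + (\<Sum>i\<in>UNIV. (s1 j * (pen_mult (X j) (Y j) (Z j) $ i - Z j $ i) + s1 j * s2 j * (g (X j, Y j) $ i + S j $ i)) *\<^sub>R Gg i (X j, Y j))
      + s1 j *\<^sub>R (Lg (X j, Y j) (Z j) - Lg (X j, TH j) (Z j))" for j
    using sigma_pos[of "kk j"] by (intro scaled_d_xy out_in) simp
  have "(\<lambda>j. s1 j *\<^sub>R d_xy_out (kk j)) \<longlonglongrightarrow> grad F (xb, yb) + (\<Sum>i\<in>UNIV. 0 *\<^sub>R Gg i (xb, yb)) + 0"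
    unfolding sd
    by (intro tendsto_add GF_lim tendsto_sum tendsto_scaleR eta L tendsto_grad_data(2)[OF w_lim limit_in_Omega(2)])
  from tendsto_diff[OF e1 this] have "\<nu>1 \<longlonglongrightarrow> - grad F (xb, yb)" by simp
  from normal_cone_limit[OF Omega_set(3,2) n1 w_lim this]
  have "- grad F (xb, yb) \<in> regular_normal_cone (Omega G) (xb, yb)" .
  then obtain \<mu> where \<mu>: "0 \<le> \<mu>" "\<And>j. \<mu> $ j * G (xb, yb) $ j = 0" "- grad F (xb, yb) = jac_transp G (xb, yb) \<mu>"
    using normal_multipliers[OF mfcq] by blast
  obtain Hf Hg where H: "hess_at f (xb, yb) Hf" "\<And>i. hess_at (\<lambda>w. g w $ i) (xb, yb) (Hg i)"
    using hessians[OF limit_in_Omega(2)] by blast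
  interpret L: bounded_linear "Lag_hess Hf Hg zb" by (rule Lag_hess_linear[OF H])
  have z0: "Lag_hess Hf Hg zb (0, 0) = 0" using L.zero by (simp add: zero_prod_def)
  have "grad F (xb, yb) + jac_transp G (xb, yb) \<mu> = 0" unfolding \<mu>(3)[symmetric] by simp
  then have "MPCC_multipliers F f G g (xb, yb, zb) \<mu> 0 0"
    using \<mu>(1,2) unfolding MPCC_multipliers_def split_conv frechet_Lag[OF limit_in_Omega(2) H] z0
    by (simp add: jac_transp_def)
  then show ?thesis
    unfolding S_stationary_def split_conv using feasible_limit by (intro conjI exI[of _ \<mu>] exI[of _ 0]) auto
qed

section \<open>Approximate multipliers and their signs\<close>

definition om :: "nat \<Rightarrow> real^'m" where
  "om j = s1 j *\<^sub>R (Y j - TH j)"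

definition et :: "nat \<Rightarrow> real^'q" where
  "et j = s1 j *\<^sub>R (pen_mult (X j) (Y j) (Z j) - Z j) + (s1 j * s2 j) *\<^sub>R (g (X j, Y j) + S j)"

lemma et_nth: "et j $ i = s1 j * (pen_mult (X j) (Y j) (Z j) $ i - Z j $ i) + s1 j * s2 j * (g (X j, Y j) $ i + S j $ i)"
  by (simp add: et_def)

text \<open>The residuals of the \<open>z\<close>- and \<open>s\<close>-components of the asymptotic optimality condition.\<close>

definition r1 :: "nat \<Rightarrow> 'q \<Rightarrow> real" where
  "r1 j i = s1 j * ((pen_mult (X j) (Y j) (Z j) $ i - Z j $ i) / \<gamma>2 - g (X j, TH j) $ i) + fst (\<nu>2 j) $ i"

definition r2 :: "nat \<Rightarrow> 'q \<Rightarrow> real" where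
  "r2 j i = s1 j * s2 j * (g (X j, Y j) $ i + S j $ i) + snd (\<nu>2 j) $ i"

lemma r_lim: "(\<lambda>j. r1 j i) \<longlonglongrightarrow> 0" "(\<lambda>j. r2 j i) \<longlonglongrightarrow> 0"
proof -
  have "r1 j i = fst (s1 j *\<^sub>R d_zs_out (kk j) + \<nu>2 j) $ i" "r2 j i = snd (s1 j *\<^sub>R d_zs_out (kk j) + \<nu>2 j) $ i" for j
    by (simp_all add: r1_def r2_def d_zs_eq mult.assoc)
  moreover have "(\<lambda>j. fst (s1 j *\<^sub>R d_zs_out (kk j) + \<nu>2 j) $ i) \<longlonglongrightarrow> fst (0 :: (real^'q) \<times> (real^'q)) $ i"
    "(\<lambda>j. snd (s1 j *\<^sub>R d_zs_out (kk j) + \<nu>2 j) $ i) \<longlonglongrightarrow> snd (0 :: (real^'q) \<times> (real^'q)) $ i"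
    by (intro tendsto_vec_nth tendsto_fst tendsto_snd e2)+
  ultimately show "(\<lambda>j. r1 j i) \<longlonglongrightarrow> 0" "(\<lambda>j. r2 j i) \<longlonglongrightarrow> 0" by simp_all
qed

text \<open>\<open>(\<lambda> - z) / \<gamma>2 - g\<close> is the negative part of
  \<open>z / \<gamma>2 + g\<close>. Up to the residual \<open>r1\<close>, the scaled increment is
  thus minus a nonnegative term and minus a normal component of known sign or value.\<close>

lemma increment_eq:
  "s1 j * (g (X j, Y j) $ i - g (X j, TH j) $ i)
     = r1 j i - s1 j * max 0 (- (Z j $ i / \<gamma>2 + g (X j, Y j) $ i)) - fst (\<nu>2 j) $ i"
proof -
  have "(pen_mult (X j) (Y j) (Z j) $ i - Z j $ i) / \<gamma>2 - g (X j, Y j) $ i = max 0 (- (Z j $ i / \<gamma>2 + g (X j, Y j) $ i))"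
  proof (cases "0 \<le> Z j $ i + \<gamma>2 * g (X j, Y j) $ i")
    case True
    then have "0 \<le> Z j $ i / \<gamma>2 + g (X j, Y j) $ i" using gamma_pos by (simp add: field_simps)
    then show ?thesis using True gamma_pos by (simp add: pen_mult_nth)
  next
    case False
    then have "Z j $ i / \<gamma>2 + g (X j, Y j) $ i \<le> 0" using gamma_pos by (simp add: field_simps)
    then show ?thesis using False gamma_pos by (simp add: pen_mult_nth)
  qed
  then have "s1 j * max 0 (- (Z j $ i / \<gamma>2 + g (X j, Y j) $ i))
     = s1 j * ((pen_mult (X j) (Y j) (Z j) $ i - Z j $ i) / \<gamma>2 - g (X j, Y j) $ i)" by simp
  then show ?thesis unfolding r1_def by (simp add: algebra_simps)
qed

text \<open>Each position of the iterate on the complementarity set gives one way to make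
  \<open>m_excess\<close> small: for \<open>z > 0\<close> the second argument is small, for
  \<open>s > 0\<close> the first, and if both entries vanish, both arguments are almost nonnegative.
  The factor \<open>c\<close> is the normalization used later.\<close>

lemma biactive_excess:
  assumes c: "0 \<le> c" "c \<le> 1"
  shows "m_excess (c * et j $ i) (c * (s1 j * (g (X j, Y j) $ i - g (X j, TH j) $ i)))
     \<le> \<bar>r1 j i\<bar> + \<bar>r2 j i\<bar> + (1 + \<gamma>2) * \<bar>r2 j i\<bar> / s2 j + \<bar>c * et j $ i\<bar> / s2 j"
proof -
  let ?z = "Z j $ i" and ?s = "S j $ i" and ?g = "g (X j, Y j) $ i" and ?a = "fst (\<nu>2 j) $ i" and ?b = "snd (\<nu>2 j) $ i"
  let ?J = "s1 j * (?g - g (X j, TH j) $ i)" and ?u = "max 0 (- (?z / \<gamma>2 + ?g))" and ?l = "max 0 (?z + \<gamma>2 * ?g)"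
  let ?\<delta> = "\<bar>r1 j i\<bar> + \<bar>r2 j i\<bar> + (1 + \<gamma>2) * \<bar>r2 j i\<bar> / s2 j + \<bar>c * et j $ i\<bar> / s2 j"
  note sp = sigma_pos[of "kk j"]
  have n: "(fst (\<nu>2 j), snd (\<nu>2 j)) \<in> regular_normal_cone compl_set (Z j, S j)" using n2[of j] by simp
  have J: "?J = r1 j i - s1 j * ?u - ?a" by (rule increment_eq)
  have et: "et j $ i = s1 j * (?l - ?z) + s1 j * s2 j * (?g + ?s)" by (simp add: et_nth pen_mult_nth)
  have r2: "r2 j i = s1 j * s2 j * (?g + ?s) + ?b" by (simp add: r2_def)
  have nn: "0 \<le> (1 + \<gamma>2) * \<bar>r2 j i\<bar> / s2 j" "0 \<le> \<bar>c * et j $ i\<bar> / s2 j" "0 \<le> \<gamma>2 * \<bar>r2 j i\<bar> / s2 j" "0 \<le> \<bar>r2 j i\<bar> / s2 j"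
    using sp gamma_pos by simp_all
  have split: "(1 + \<gamma>2) * \<bar>r2 j i\<bar> / s2 j = \<bar>r2 j i\<bar> / s2 j + \<gamma>2 * \<bar>r2 j i\<bar> / s2 j" by (simp add: distrib_right add_divide_distrib)
  have cabs: "\<bar>c * v\<bar> \<le> \<bar>v\<bar>" for v using c by (simp add: abs_mult mult_left_le_one_le)
  have lower: "- b \<le> c * v" if "- b \<le> v" "0 \<le> b" for b v
  proof -
    have "c * (- b) \<le> c * v" using that c by (intro mult_left_mono) auto
    moreover have "c * b \<le> 1 * b" using that c by (intro mult_right_mono) auto
    ultimately show ?thesis by simp
  qed
  have ex1: "m_excess p q \<le> ?\<delta>" if "\<bar>p\<bar> \<le> ?\<delta> \<or> \<bar>q\<bar> \<le> ?\<delta> \<or> (- p \<le> ?\<delta> \<and> - q \<le> ?\<delta>)" for p q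
    using that unfolding m_excess_def min_le_iff_disj max.bounded_iff by blast
  consider "0 < ?z" | "0 < ?s" | "?z = 0" "?s = 0" using zs_in(1,2)[of j i] by fastforce
  then show ?thesis
  proof cases
    case 1
    then have a: "?a = 0" and s: "?s = 0" using compl_set_normal(1)[OF n] zs_in(3)[of j i] by auto
    have "\<bar>c * ?J\<bar> \<le> ?\<delta>"
    proof (cases "0 \<le> ?z + \<gamma>2 * ?g")
      case True
      then have "?u = 0" using gamma_pos by (simp add: field_simps)
      then have "\<bar>c * ?J\<bar> \<le> \<bar>r1 j i\<bar>" using cabs[of "r1 j i"] unfolding J a by simp
      then show ?thesis using nn by linarith
    next
      \<comment> \<open>Here \<open>g < 0\<close>, and because \<open>s = 0\<close> both summands of
        \<open>et\<close> are nonpositive. So \<open>s1 j * s2 j * ?u\<close> is at most the modulus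
        of \<open>et\<close>, and one division by \<open>s2 j\<close> makes the extra term
        small.\<close>
      case False
      have zg: "0 < ?z / \<gamma>2" using 1 gamma_pos by simp
      have u: "?u = - (?z / \<gamma>2 + ?g)" and g0: "?g \<le> - (?z / \<gamma>2)" using False gamma_pos by (auto simp: field_simps max_def)
      then have uz: "?u \<le> - ?g" "?g \<le> 0" "0 \<le> ?u" using zg by linarith+
      have "et j $ i = - (s1 j * ?z) + s1 j * s2 j * ?g" using False unfolding et s by simp
      moreover have "0 \<le> s1 j * ?z" using sp 1 by simp
      ultimately have "s1 j * s2 j * (- ?g) \<le> \<bar>et j $ i\<bar>" by simp
      moreover have "s1 j * s2 j * ?u \<le> s1 j * s2 j * (- ?g)" using uz sp by (intro mult_left_mono) auto
      ultimately have "s1 j * s2 j * ?u \<le> \<bar>et j $ i\<bar>" by linarith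
      then have "c * (s1 j * s2 j * ?u) \<le> c * \<bar>et j $ i\<bar>" using c by (intro mult_left_mono) auto
      then have "c * (s1 j * ?u) \<le> \<bar>c * et j $ i\<bar> / s2 j"
        using sp c by (simp add: abs_mult field_simps)
      moreover have "\<bar>c * (s1 j * ?u)\<bar> = c * (s1 j * ?u)" using c sp uz by simp
      moreover have "\<bar>c * ?J\<bar> \<le> \<bar>c * r1 j i\<bar> + \<bar>c * (s1 j * ?u)\<bar>"
        unfolding J a by (simp add: right_diff_distrib abs_triangle_ineq4)
      ultimately have "\<bar>c * ?J\<bar> \<le> \<bar>r1 j i\<bar> + \<bar>c * et j $ i\<bar> / s2 j"
        using cabs[of "r1 j i"] by linarith
      then show ?thesis using nn abs_ge_zero[of "r2 j i"] by linarith
    qed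
    then show ?thesis by (intro ex1) simp
  next
    case 2
    then have b: "?b = 0" and z: "?z = 0" using compl_set_normal(2)[OF n] zs_in(3)[of j i] by auto
    \<comment> \<open>On this branch the normal component vanishes and the scaled infeasibility is
      the residual itself. As \<open>s > 0\<close>, it also bounds the positive part of
      \<open>g\<close>, and with it the remaining term of \<open>et\<close>.\<close>
    have e: "s1 j * s2 j * (?g + ?s) = r2 j i" using r2 b by simp
    have "s1 j * s2 j * ?g \<le> s1 j * s2 j * (?g + ?s)" using 2 sp by (intro mult_left_mono) auto
    then have "s2 j * (s1 j * ?g) \<le> \<bar>r2 j i\<bar>" using e by (simp add: mult_ac)
    then have "s1 j * ?g \<le> \<bar>r2 j i\<bar> / s2 j" using sp by (simp add: field_simps)
    then have "\<gamma>2 * (s1 j * ?g) \<le> \<gamma>2 * (\<bar>r2 j i\<bar> / s2 j)" using gamma_pos by (intro mult_left_mono) auto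
    moreover have "s1 j * ?l = max 0 (\<gamma>2 * (s1 j * ?g))"
      using sp unfolding z by (simp add: max_mult_distrib_left mult_ac)
    ultimately have "0 \<le> s1 j * ?l \<and> s1 j * ?l \<le> \<gamma>2 * \<bar>r2 j i\<bar> / s2 j" using nn by auto
    moreover have "et j $ i = s1 j * ?l + r2 j i" unfolding et z e[symmetric] by simp
    ultimately have "\<bar>et j $ i\<bar> \<le> \<gamma>2 * \<bar>r2 j i\<bar> / s2 j + \<bar>r2 j i\<bar>" by linarith
    then have "\<bar>c * et j $ i\<bar> \<le> ?\<delta>" using cabs[of "et j $ i"] nn split by linarith
    then show ?thesis by (intro ex1) simp
  next
    case 3
    \<comment> \<open>At a pair of zeros both normal components are nonpositive, which pushes both
      quantities up to small errors into the nonnegative range.\<close>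
    then have a: "?a \<le> 0" and b: "?b \<le> 0" using compl_set_normal(3,4)[OF n] by auto
    have "s1 j * s2 j * ?g = r2 j i - ?b" using r2 3 by simp
    then have ge: "- \<bar>r2 j i\<bar> \<le> s1 j * s2 j * ?g" using b by linarith
    have "0 \<le> s1 j * ?l" using sp by simp
    then have "- \<bar>r2 j i\<bar> \<le> et j $ i" using ge unfolding et 3 by simp
    then have "- \<bar>r2 j i\<bar> \<le> c * et j $ i" by (rule lower) simp
    then have p: "- (c * et j $ i) \<le> ?\<delta>" using nn by linarith
    have "s2 j * (s1 j * (- ?g)) \<le> \<bar>r2 j i\<bar>" using ge by (simp add: mult_ac)
    then have "s1 j * (- ?g) \<le> \<bar>r2 j i\<bar> / s2 j" using sp by (simp add: field_simps)
    moreover have "s1 j * ?u = max 0 (s1 j * (- ?g))" using sp 3 by (simp add: max_mult_distrib_left)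
    ultimately have "s1 j * ?u \<le> \<bar>r2 j i\<bar> / s2 j" using nn by simp
    then have "- (\<bar>r1 j i\<bar> + \<bar>r2 j i\<bar> / s2 j) \<le> ?J" using a unfolding J by linarith
    then have "- (\<bar>r1 j i\<bar> + \<bar>r2 j i\<bar> / s2 j) \<le> c * ?J" by (rule lower) (use nn in linarith)
    then have "- (c * ?J) \<le> ?\<delta>" using nn split by linarith
    then show ?thesis using p by (intro ex1) simp
  qed
qed

end

section \<open>Passage to the limit for diverging penalty parameters\<close>

context bspm_limit
begin

text \<open>The scaling \<open>c\<close> serves two purposes: with \<open>cb > 0\<close> division by
  \<open>cb\<close> gives the stationarity system, and with \<open>cb = 0\<close> the term of
  \<open>F\<close> drops out and the homogeneous system excluded by \<open>MPCC_MFCQ\<close>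
  remains.\<close>

lemma limit_system:
  assumes c: "\<And>j. 0 < c j" "\<And>j. c j \<le> 1" "c \<longlonglongrightarrow> cb"
    and lim: "(\<lambda>j. c j *\<^sub>R om j) \<longlonglongrightarrow> ob" "(\<lambda>j. c j *\<^sub>R et j) \<longlonglongrightarrow> eb" "(\<lambda>j. c j *\<^sub>R \<nu>1 j) \<longlonglongrightarrow> nb"
    and s2_top: "filterlim (\<lambda>k. snd (sigma_out r k)) at_top sequentially"
    and H: "hess_at f (xb, yb) Hf" "\<And>i. hess_at (\<lambda>w. g w $ i) (xb, yb) (Hg i)"
  shows "cb *\<^sub>R grad F (xb, yb) + Lag_hess Hf Hg zb (0, ob) + (\<Sum>i\<in>UNIV. eb $ i *\<^sub>R Gg i (xb, yb)) + nb = 0"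
    and "nb \<in> regular_normal_cone (Omega G) (xb, yb)"
    and "i \<in> I_0p g (xb, yb, zb) \<Longrightarrow> eb $ i = 0"
    and "i \<in> I_p0 g (xb, yb, zb) \<Longrightarrow> snd (Gg i (xb, yb)) \<bullet> ob = 0"
    and "m_excess (eb $ i) (snd (Gg i (xb, yb)) \<bullet> ob) \<le> 0"
proof -
  let ?a = "\<lambda>j. (X j, TH j)" and ?b = "\<lambda>j. (X j, Y j)" and ?t = "\<lambda>j. c j * s1 j"
  have a: "?a \<longlonglongrightarrow> (xb, yb)" by (rule tendsto_Pair[OF x_lim TH_lim])
  \<comment> \<open>The two points share their first component and differ in the second by what
    \<open>om\<close> scales, so the limit of the scaled increments is
    \<open>(0, ob)\<close>.\<close>
  have tba: "?t j *\<^sub>R (?b j - ?a j) = (0, c j *\<^sub>R om j)" for j by (simp add: om_def)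
  have t: "(\<lambda>j. ?t j *\<^sub>R (?b j - ?a j)) \<longlonglongrightarrow> (0, ob)"
    unfolding tba by (intro tendsto_Pair tendsto_const lim)
  have ba: "(\<lambda>j. ?b j - ?a j) \<longlonglongrightarrow> 0" using tendsto_diff[OF w_lim a] by simp
  have et_lim: "(\<lambda>j. c j * et j $ i) \<longlonglongrightarrow> eb $ i" for i
    using tendsto_vec_nth[OF lim(2), of i] by simp
  have q: "(\<lambda>j. ?t j *\<^sub>R (Lg (?b j) (Z j) - Lg (?a j) (Z j))) \<longlonglongrightarrow> Lag_hess Hf Hg zb (0, ob)"
  proof -
    have "?t j *\<^sub>R (Lg (?b j) (Z j) - Lg (?a j) (Z j)) = ?t j *\<^sub>R (grad f (?b j) - grad f (?a j))
        + (\<Sum>i\<in>UNIV. Z j $ i *\<^sub>R (?t j *\<^sub>R (Gg i (?b j) - Gg i (?a j))))" for j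
    proof -
      have "Lg (?b j) (Z j) - Lg (?a j) (Z j) = (grad f (?b j) - grad f (?a j))
          + (\<Sum>i\<in>UNIV. Z j $ i *\<^sub>R (Gg i (?b j) - Gg i (?a j)))"
        by (simp add: Lg_def sum_subtractf scaleR_diff_right)
      then show ?thesis by (simp only: scaleR_add_right scaleR_sum_right scaleR_scaleR mult.commute)
    qed
    moreover have "(\<lambda>j. ?t j *\<^sub>R (grad f (?b j) - grad f (?a j))
        + (\<Sum>i\<in>UNIV. Z j $ i *\<^sub>R (?t j *\<^sub>R (Gg i (?b j) - Gg i (?a j))))) \<longlonglongrightarrow> Lag_hess Hf Hg zb (0, ob)"
      unfolding Lag_hess_def
      by (intro tendsto_add tendsto_sum tendsto_scaleR[OF tendsto_vec_nth[OF z_lim]]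
          grad_increment_limit[OF H(1) a w_lim t] grad_increment_limit[OF H(2) a w_lim t])
    ultimately show ?thesis by simp
  qed
  have sd: "c j *\<^sub>R (s1 j *\<^sub>R d_xy_out (kk j)) = c j *\<^sub>R grad F (X j, Y j)
      + (\<Sum>i\<in>UNIV. (c j * et j $ i) *\<^sub>R Gg i (X j, Y j)) + ?t j *\<^sub>R (Lg (?b j) (Z j) - Lg (?a j) (Z j))" for j
  proof -
    have "s1 j *\<^sub>R d_xy_out (kk j) = grad F (X j, Y j) + (\<Sum>i\<in>UNIV. et j $ i *\<^sub>R Gg i (X j, Y j))
      + s1 j *\<^sub>R (Lg (?b j) (Z j) - Lg (?a j) (Z j))"
      unfolding et_nth using sigma_pos[of "kk j"] by (intro scaled_d_xy out_in) simp
    then show ?thesis by (simp only: scaleR_add_right scaleR_sum_right scaleR_scaleR)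
  qed
  have "(\<lambda>j. c j *\<^sub>R (s1 j *\<^sub>R d_xy_out (kk j))) \<longlonglongrightarrow>
     cb *\<^sub>R grad F (xb, yb) + (\<Sum>i\<in>UNIV. eb $ i *\<^sub>R Gg i (xb, yb)) + Lag_hess Hf Hg zb (0, ob)"
    unfolding sd by (intro tendsto_add tendsto_scaleR c GF_lim tendsto_sum et_lim q tendsto_grad_data(2)[OF w_lim limit_in_Omega(2)])
  from tendsto_add[OF this lim(3)]
  have "(\<lambda>j. c j *\<^sub>R (s1 j *\<^sub>R d_xy_out (kk j) + \<nu>1 j)) \<longlonglongrightarrow>
     cb *\<^sub>R grad F (xb, yb) + (\<Sum>i\<in>UNIV. eb $ i *\<^sub>R Gg i (xb, yb)) + Lag_hess Hf Hg zb (0, ob) + nb"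
    by (simp add: scaleR_add_right)
  moreover have "(\<lambda>j. c j *\<^sub>R (s1 j *\<^sub>R d_xy_out (kk j) + \<nu>1 j)) \<longlonglongrightarrow> cb *\<^sub>R 0"
    by (intro tendsto_scaleR c e1)
  ultimately have "cb *\<^sub>R grad F (xb, yb) + (\<Sum>i\<in>UNIV. eb $ i *\<^sub>R Gg i (xb, yb)) + Lag_hess Hf Hg zb (0, ob) + nb = cb *\<^sub>R 0"
    using LIMSEQ_unique by blast
  then show "cb *\<^sub>R grad F (xb, yb) + Lag_hess Hf Hg zb (0, ob) + (\<Sum>i\<in>UNIV. eb $ i *\<^sub>R Gg i (xb, yb)) + nb = 0"
    by (simp add: algebra_simps)
  show "nb \<in> regular_normal_cone (Omega G) (xb, yb)"
    by (rule normal_cone_limit[OF Omega_set(3,2) regular_normal_cone_scale[OF n1 c(1)] w_lim lim(3)])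
  \<comment> \<open>The quadratic remainders of \<open>g\<close> hold on
    \<open>X \<times> cball 0 B\<close>, hence both second components must be bounded.\<close>
  obtain By where By: "\<And>j. norm (Y j) \<le> By" using convergent_imp_Bseq[OF convergentI[OF y_lim]] unfolding Bseq_def by blast
  obtain Bt where Bt: "\<And>j. norm (TH j) \<le> Bt" using convergent_imp_Bseq[OF convergentI[OF TH_lim]] unfolding Bseq_def by blast
  define B where "B = max By Bt"
  have in_K: "?a j \<in> Xset G \<times> cball 0 B" "?b j \<in> Xset G \<times> cball 0 B" for j
    using By[of j] Bt[of j] out_in(2)[of "kk j"] by (auto simp: B_def le_max_iff_disj)
  obtain C where C: "\<And>i. smooth_bound (Xset G \<times> cball 0 B) (\<lambda>w. g w $ i) C" using data_bound[of B] by blast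
  have incr: "(\<lambda>j. c j * (s1 j * (g (X j, Y j) $ i - g (X j, TH j) $ i))) \<longlonglongrightarrow> snd (Gg i (xb, yb)) \<bullet> ob" for i
    using function_increment_limit[OF C in_K tendsto_grad_data(2)[OF a limit_in_Omega(2)] ba t, of i]
    by (simp add: inner_prod_def mult.assoc)
  have n: "(fst (\<nu>2 j), snd (\<nu>2 j)) \<in> regular_normal_cone compl_set (Z j, S j)" for j using n2[of j] by simp
  have Zl: "(\<lambda>j. Z j $ i) \<longlonglongrightarrow> zb $ i" and Sl: "(\<lambda>j. S j $ i) \<longlonglongrightarrow> sb $ i"
    and gl: "(\<lambda>j. g (X j, Y j) $ i) \<longlonglongrightarrow> g (xb, yb) $ i" for i
    by (intro tendsto_vec_nth z_lim s_lim g_lim)+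
  show "eb $ i = 0" if i: "i \<in> I_0p g (xb, yb, zb)"
  proof -
    have gi: "g (xb, yb) $ i < 0" using i by (simp add: I_0p_def)
    then have "0 < sb $ i" using g_limit[of i] by simp
    from order_tendstoD(1)[OF Sl this] order_tendstoD(2)[OF gl gi]
    \<comment> \<open>Eventually \<open>s > 0\<close> and \<open>g < 0\<close>, so \<open>z\<close>,
      the updated multiplier and the normal component are zero, and \<open>et\<close> coincides with
      a vanishing residual.\<close>
    have "\<forall>\<^sub>F j in sequentially. c j * r2 j i = c j * et j $ i"
    proof eventually_elim
      case (elim j)
      then have "Z j $ i = 0" "snd (\<nu>2 j) $ i = 0" using zs_in(3)[of j i] compl_set_normal(2)[OF n] by auto
      moreover have "\<gamma>2 * g (X j, Y j) $ i \<le> 0" using elim(2) gamma_pos by (simp add: mult_nonneg_nonpos)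
      ultimately show ?case by (simp add: r2_def et_nth pen_mult_nth)
    qed
    moreover have "(\<lambda>j. c j * r2 j i) \<longlonglongrightarrow> cb * 0" by (intro tendsto_mult c r_lim)
    ultimately have "(\<lambda>j. c j * et j $ i) \<longlonglongrightarrow> cb * 0" by (rule Lim_transform_eventually[rotated])
    then show ?thesis using et_lim[of i] LIMSEQ_unique by fastforce
  qed
  show "snd (Gg i (xb, yb)) \<bullet> ob = 0" if i: "i \<in> I_p0 g (xb, yb, zb)"
  proof -
    have zi: "0 < zb $ i" and gi: "g (xb, yb) $ i = 0" using i by (auto simp: I_p0_def)
    have "(\<lambda>j. Z j $ i / \<gamma>2 + g (X j, Y j) $ i) \<longlonglongrightarrow> zb $ i / \<gamma>2 + g (xb, yb) $ i"
      using gamma_pos by (intro tendsto_intros Zl gl) simp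
    moreover have "0 < zb $ i / \<gamma>2 + g (xb, yb) $ i" using zi gi gamma_pos by simp
    ultimately have "\<forall>\<^sub>F j in sequentially. 0 < Z j $ i / \<gamma>2 + g (X j, Y j) $ i" by (rule order_tendstoD)
    with order_tendstoD(1)[OF Zl zi]
    \<comment> \<open>Eventually \<open>z > 0\<close> and \<open>z / \<gamma>2 + g > 0\<close>: both
      correction terms of \<open>increment_eq\<close> vanish.\<close>
    have "\<forall>\<^sub>F j in sequentially. c j * r1 j i = c j * (s1 j * (g (X j, Y j) $ i - g (X j, TH j) $ i))"
    proof eventually_elim
      case (elim j)
      then have "fst (\<nu>2 j) $ i = 0" using compl_set_normal(1)[OF n] by auto
      then show ?case unfolding increment_eq using elim by simp
    qed
    moreover have "(\<lambda>j. c j * r1 j i) \<longlonglongrightarrow> cb * 0" by (intro tendsto_mult c r_lim)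
    ultimately have "(\<lambda>j. c j * (s1 j * (g (X j, Y j) $ i - g (X j, TH j) $ i))) \<longlonglongrightarrow> cb * 0"
      by (rule Lim_transform_eventually[rotated])
    then show ?thesis using incr[of i] LIMSEQ_unique by fastforce
  qed
  show "m_excess (eb $ i) (snd (Gg i (xb, yb)) \<bullet> ob) \<le> 0"
  proof (rule LIMSEQ_le)
    show "(\<lambda>j. m_excess (c j * et j $ i) (c j * (s1 j * (g (X j, Y j) $ i - g (X j, TH j) $ i))))
       \<longlonglongrightarrow> m_excess (eb $ i) (snd (Gg i (xb, yb)) \<bullet> ob)"
      unfolding m_excess_def by (intro tendsto_min tendsto_max tendsto_minus tendsto_rabs et_lim incr)
    \<comment> \<open>The scaled multipliers merely converge, so the last error term of
      \<open>biactive_excess\<close> disappears only because the second penalty parameter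
      diverges.\<close>
    have inf: "filterlim s2 at_infinity sequentially"
      by (rule filterlim_at_top_imp_at_infinity[OF filterlim_compose[OF s2_top top]])
    have "(\<lambda>j. \<bar>r1 j i\<bar> + \<bar>r2 j i\<bar> + (1 + \<gamma>2) * \<bar>r2 j i\<bar> / s2 j + \<bar>c j * et j $ i\<bar> / s2 j) \<longlonglongrightarrow> \<bar>0\<bar> + \<bar>0\<bar> + 0 + 0"
      by (intro tendsto_add tendsto_rabs r_lim tendsto_divide_0[OF tendsto_rabs[OF et_lim] inf]
          tendsto_divide_0[OF tendsto_mult_left[OF tendsto_rabs[OF r_lim(2)]] inf])
    then show "(\<lambda>j. \<bar>r1 j i\<bar> + \<bar>r2 j i\<bar> + (1 + \<gamma>2) * \<bar>r2 j i\<bar> / s2 j + \<bar>c j * et j $ i\<bar> / s2 j) \<longlonglongrightarrow> 0" by simp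
    show "\<exists>N. \<forall>j\<ge>N. m_excess (c j * et j $ i) (c j * (s1 j * (g (X j, Y j) $ i - g (X j, TH j) $ i)))
       \<le> \<bar>r1 j i\<bar> + \<bar>r2 j i\<bar> + (1 + \<gamma>2) * \<bar>r2 j i\<bar> / s2 j + \<bar>c j * et j $ i\<bar> / s2 j"
      using biactive_excess[OF less_imp_le[OF c(1)] c(2)] by blast
  qed
qed

text \<open>
  The multipliers are normalized by \<open>1 / (1 + norm)\<close>. If the limit of this factor were zero, a nontrivial multiplier
  of the system in \<open>MPCC_MFCQ\<close> would remain.
\<close>

lemma M_stationary_unbounded:
  assumes s2_top: "filterlim (\<lambda>k. snd (sigma_out r k)) at_top sequentially"
    and mfcq: "MFCQ_ineq (\<lambda>j w. G w $ j) (xb, yb)" and mpcc: "MPCC_MFCQ f G g (xb, yb, zb)"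
  shows "M_stationary F f G g (xb, yb, zb)"
proof -
  define N where "N j = (om j, et j, \<nu>1 j)" for j
  define c where "c j = 1 / (1 + norm (N j))" for j
  \<comment> \<open>\<open>c\<close> and the norm of the scaled triple add up to \<open>1\<close>.
    This persists in the limit, so not everything can vanish there.\<close>
  have c: "0 < c j" "c j \<le> 1" "c j + norm (c j *\<^sub>R N j) = 1" for j
  proof -
    have "0 < 1 + norm (N j)" by (rule add_pos_nonneg) auto
    then show "0 < c j" "c j \<le> 1" "c j + norm (c j *\<^sub>R N j) = 1" unfolding c_def by (auto simp: field_simps)
  qed
  have "bounded (range (\<lambda>j. (c j, c j *\<^sub>R N j)))"
  proof (rule boundedI)
    fix p assume "p \<in> range (\<lambda>j. (c j, c j *\<^sub>R N j))"
    then obtain j where p: "p = (c j, c j *\<^sub>R N j)" by auto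
    show "norm p \<le> 1" using norm_Pair_le[of "c j" "c j *\<^sub>R N j"] c[of j] unfolding p by simp
  qed
  then obtain l rr where rr: "strict_mono (rr :: nat \<Rightarrow> nat)" and l: "((\<lambda>j. (c j, c j *\<^sub>R N j)) \<circ> rr) \<longlonglongrightarrow> l"
    using bounded_imp_convergent_subsequence by blast
  obtain cb ob eb nb where l_eq: "l = (cb, ob, eb, nb)" by (metis prod.collapse)
  have lims: "(c \<circ> rr) \<longlonglongrightarrow> cb" "(\<lambda>j. c (rr j) *\<^sub>R N (rr j)) \<longlonglongrightarrow> (ob, eb, nb)"
    using tendsto_fst[OF l] tendsto_snd[OF l] unfolding l_eq by (simp_all add: comp_def)
  have lims': "(\<lambda>j. c (rr j) *\<^sub>R om (rr j)) \<longlonglongrightarrow> ob" "(\<lambda>j. c (rr j) *\<^sub>R et (rr j)) \<longlonglongrightarrow> eb"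
    "(\<lambda>j. c (rr j) *\<^sub>R \<nu>1 (rr j)) \<longlonglongrightarrow> nb"
    using tendsto_fst[OF lims(2)] tendsto_fst[OF tendsto_snd[OF lims(2)]] tendsto_snd[OF tendsto_snd[OF lims(2)]]
    by (simp_all add: N_def)
  have rtop: "filterlim rr at_top sequentially" using rr by (rule filterlim_subseq)
  interpret sub: bspm_limit F f G g LF \<gamma>1 \<gamma>2 P r "kk \<circ> rr" "\<nu>1 \<circ> rr" "\<nu>2 \<circ> rr" xb yb zb sb
  proof unfold_locales
    show "filterlim (kk \<circ> rr) at_top sequentially" unfolding comp_def by (rule filterlim_compose[OF top rtop])
    show "(\<nu>1 \<circ> rr) j \<in> regular_normal_cone (Omega G) (x_out r (Suc ((kk \<circ> rr) j)), y_out r (Suc ((kk \<circ> rr) j)))" for j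
      using n1[of "rr j"] by simp
    show "(\<nu>2 \<circ> rr) j \<in> regular_normal_cone compl_set (z_out r (Suc ((kk \<circ> rr) j)), s_out r (Suc ((kk \<circ> rr) j)))" for j
      using n2[of "rr j"] by simp
  qed (simp_all add: filterlim_compose[OF x_lim rtop] filterlim_compose[OF y_lim rtop] filterlim_compose[OF z_lim rtop]
      filterlim_compose[OF s_lim rtop] filterlim_compose[OF e1 rtop] filterlim_compose[OF e2 rtop])
  obtain Hf Hg where H: "hess_at f (xb, yb) Hf" "\<And>i. hess_at (\<lambda>w. g w $ i) (xb, yb) (Hg i)"
    using hessians[OF limit_in_Omega(2)] by blast
  have cs: "0 < (c \<circ> rr) j" "(c \<circ> rr) j \<le> 1" for j using c by simp_all
  have so: "(\<lambda>j. (c \<circ> rr) j *\<^sub>R sub.om j) \<longlonglongrightarrow> ob" "(\<lambda>j. (c \<circ> rr) j *\<^sub>R sub.et j) \<longlonglongrightarrow> eb"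
     "(\<lambda>j. (c \<circ> rr) j *\<^sub>R (\<nu>1 \<circ> rr) j) \<longlonglongrightarrow> nb"
    using lims' by (simp_all add: om_def sub.om_def et_def sub.et_def)
  note sys = sub.limit_system[OF cs lims(1) so s2_top H]
  have "(\<lambda>j. c (rr j) + norm (c (rr j) *\<^sub>R N (rr j))) \<longlonglongrightarrow> cb + norm (ob, eb, nb)"
    using tendsto_add[OF lims(1) tendsto_norm[OF lims(2)]] by (simp add: comp_def)
  then have one: "cb + norm (ob, eb, nb) = 1" unfolding c(3) by (simp add: LIMSEQ_const_iff)
  have "0 \<le> cb" by (rule LIMSEQ_le_const[OF lims(1)]) (use c(1) in \<open>auto intro: less_imp_le\<close>)
  interpret L: bounded_linear "Lag_hess Hf Hg zb" by (rule Lag_hess_linear[OF H])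
  have "cb \<noteq> 0"
  proof
    assume cb: "cb = 0"
    obtain \<mu> where \<mu>: "0 \<le> \<mu>" "\<And>j. \<mu> $ j * G (xb, yb) $ j = 0" "nb = jac_transp G (xb, yb) \<mu>"
      using normal_multipliers[OF mfcq sys(2)] by blast
    have "ob = 0 \<and> eb = 0 \<and> (\<forall>j. \<mu> $ j = 0)"
    proof (rule MPCC_MFCQ_multipliers_zero[OF mpcc feasible_limit limit_in_Omega(1) H])
      show "Lag_hess Hf Hg zb (0, ob) + (\<Sum>i\<in>UNIV. eb $ i *\<^sub>R Gg i (xb, yb)) + (\<Sum>j\<in>UNIV. \<mu> $ j *\<^sub>R grad (\<lambda>w. G w $ j) (xb, yb)) = 0"
        using sys(1) unfolding cb \<mu>(3) jac_transp_def by simp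
    qed (use \<mu> sys(3,4) in \<open>auto simp: less_eq_vec_def\<close>)
    moreover from this have "nb = 0" unfolding \<mu>(3) by (simp add: jac_transp_def)
    ultimately have "(ob, eb, nb) = 0" by (simp add: zero_prod_def)
    then show False using one cb by simp
  qed
  then have cpos: "0 < 1 / cb" using \<open>0 \<le> cb\<close> by simp
  let ?k = "1 / cb"
  obtain \<mu> where \<mu>: "0 \<le> \<mu>" "\<And>j. \<mu> $ j * G (xb, yb) $ j = 0" "?k *\<^sub>R nb = jac_transp G (xb, yb) \<mu>"
    using normal_multipliers[OF mfcq regular_normal_cone_scale[OF sys(2) cpos]] by blast
  have Ls: "Lag_hess Hf Hg zb (0, ?k *\<^sub>R ob) = ?k *\<^sub>R Lag_hess Hf Hg zb (0, ob)"
    using L.scaleR[of ?k "(0, ob)"] by simp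
  have js: "jac_transp g (xb, yb) (?k *\<^sub>R eb) = ?k *\<^sub>R (\<Sum>i\<in>UNIV. eb $ i *\<^sub>R Gg i (xb, yb))"
    by (simp add: jac_transp_def scaleR_sum_right)
  have "?k *\<^sub>R (cb *\<^sub>R grad F (xb, yb) + Lag_hess Hf Hg zb (0, ob) + (\<Sum>i\<in>UNIV. eb $ i *\<^sub>R Gg i (xb, yb)) + nb) = 0"
    unfolding sys(1) by simp
  then have eq: "grad F (xb, yb) + ?k *\<^sub>R Lag_hess Hf Hg zb (0, ob) + ?k *\<^sub>R (\<Sum>i\<in>UNIV. eb $ i *\<^sub>R Gg i (xb, yb)) + ?k *\<^sub>R nb = 0"
    using \<open>cb \<noteq> 0\<close> by (simp only: scaleR_add_right scaleR_scaleR) simp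
  have "0 = grad F (xb, yb) + jac_transp G (xb, yb) \<mu> + Lag_hess Hf Hg zb (0, ?k *\<^sub>R ob) + jac_transp g (xb, yb) (?k *\<^sub>R eb)"
    unfolding Ls js \<mu>(3)[symmetric] using eq by (simp only: add.assoc add.commute add.left_commute)
  then have mult: "MPCC_multipliers F f G g (xb, yb, zb) \<mu> (?k *\<^sub>R ob) (?k *\<^sub>R eb)"
    unfolding MPCC_multipliers_def split_conv frechet_Lag[OF limit_in_Omega(2) H] grad_partials(3)[OF limit_in_Omega(2)]
    using \<mu>(1,2) sys(3,4) by simp
  have "(0 < (?k *\<^sub>R eb) $ i \<and> 0 < snd (Gg i (xb, yb)) \<bullet> (?k *\<^sub>R ob)) \<or> (?k *\<^sub>R eb) $ i * (snd (Gg i (xb, yb)) \<bullet> (?k *\<^sub>R ob)) = 0" for i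
  proof -
    have "(0 < eb $ i \<and> 0 < snd (Gg i (xb, yb)) \<bullet> ob) \<or> eb $ i * (snd (Gg i (xb, yb)) \<bullet> ob) = 0"
      by (rule m_excess_nonpos[OF sys(5)])
    then show ?thesis using cpos by auto
  qed
  then show ?thesis
    unfolding M_stationary_def split_conv grad_partials(3)[OF limit_in_Omega(2)]
    using feasible_limit mult by (intro conjI exI[of _ \<mu>] exI[of _ "?k *\<^sub>R ob"] exI[of _ "?k *\<^sub>R eb"]) auto
qed

end

theorem theorem5p12:
  fixes F f :: "(real^'n) \<times> (real^'m) \<Rightarrow> real"
    and G :: "(real^'n) \<times> (real^'m) \<Rightarrow> real^'p"
    and g :: "(real^'n) \<times> (real^'m) \<Rightarrow> real^'q"
    and LF \<gamma>1 \<gamma>2 :: real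
    and P :: ig_params
    and r :: "('n, 'm, 'q) ig_run"
    and xbar :: "real^'n" and ybar :: "real^'m" and zbar sbar :: "real^'q"
    and sub :: "nat \<Rightarrow> nat"
  assumes F_smooth: "\<exists>U. open U \<and> Omega G \<subseteq> U \<and> cont_diff_on U F"
    and F_lipschitz: "0 < LF" "LF-lipschitz_on (Omega G) (grad F)"
    and G_smooth_convex: "\<And>i. \<exists>U. open U \<and> Omega G \<subseteq> U \<and>
          cont_diff_on U (\<lambda>w. G w $ i) \<and> convex_on U (\<lambda>w. G w $ i)"
    and lower_convex: "\<And>x. x \<in> Xset G \<Longrightarrow> convex_on UNIV (\<lambda>y. f (x, y))"
          "\<And>x i. x \<in> Xset G \<Longrightarrow> convex_on UNIV (\<lambda>y. g (x, y) $ i)"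
    and f_smooth: "\<exists>U. open U \<and> Xset G \<times> UNIV \<subseteq> U \<and> twice_cont_diff_on U f"
    and g_smooth: "\<And>i. \<exists>U. open U \<and> Xset G \<times> UNIV \<subseteq> U \<and> twice_cont_diff_on U (\<lambda>w. g w $ i)"
    and Omega_set: "Omega G \<noteq> {}" "closed (Omega G)" "convex (Omega G)" "bounded (Omega G)"
    and lower_KKT: "\<And>x. x \<in> Xset G \<Longrightarrow>
          \<exists>y\<in>lower_solutions f g x. (x, y) \<in> Omega G \<and> lower_multipliers f g x y \<noteq> {}"
    and gamma_pos: "0 < \<gamma>1" "0 < \<gamma>2"
    and run: "iG_BSPM F f G g \<gamma>1 \<gamma>2 P r"
    and tau_lim: "tau P \<longlonglongrightarrow> 0"
    and zeta_summable: "\<And>k. summable (\<lambda>l. (zeta P k l)\<^sup>2)"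
    and zeta_lim: "(\<lambda>k. \<Sum>l. (zeta P k l)\<^sup>2) \<longlonglongrightarrow> 0"
    and accumulation: "strict_mono sub"
          "(\<lambda>j. ((x_out r (sub j), y_out r (sub j)), (z_out r (sub j), s_out r (sub j))))
             \<longlonglongrightarrow> ((xbar, ybar), (zbar, sbar))"
  shows "approx_KKT F f G g \<gamma>1 \<gamma>2 xbar ybar \<and>
    (MFCQ_ineq (\<lambda>i y. g (xbar, y) $ i) ybar \<and> MFCQ_ineq (\<lambda>j w. G w $ j) (xbar, ybar) \<longrightarrow>
       (bounded (range (sigma_out r)) \<longrightarrow> S_stationary F f G g (xbar, ybar, zbar)) \<and>
       (filterlim (\<lambda>k. fst (sigma_out r k)) at_top sequentially \<and>
        filterlim (\<lambda>k. snd (sigma_out r k)) at_top sequentially \<and>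
        MPCC_MFCQ f G g (xbar, ybar, zbar) \<longrightarrow> M_stationary F f G g (xbar, ybar, zbar)))"
proof -
  interpret bspm_run F f G g LF \<gamma>1 \<gamma>2 P r
    using assms by unfold_locales
  obtain kk \<nu>1 \<nu>2 where "filterlim kk at_top sequentially"
     "(\<lambda>j. x_out r (Suc (kk j))) \<longlonglongrightarrow> xbar" "(\<lambda>j. y_out r (Suc (kk j))) \<longlonglongrightarrow> ybar"
     "(\<lambda>j. z_out r (Suc (kk j))) \<longlonglongrightarrow> zbar" "(\<lambda>j. s_out r (Suc (kk j))) \<longlonglongrightarrow> sbar"
     "\<And>j. \<nu>1 j \<in> regular_normal_cone (Omega G) (x_out r (Suc (kk j)), y_out r (Suc (kk j)))"
     "\<And>j. \<nu>2 j \<in> regular_normal_cone compl_set (z_out r (Suc (kk j)), s_out r (Suc (kk j)))"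
     "(\<lambda>j. fst (sigma_out r (kk j)) *\<^sub>R d_xy_out (kk j) + \<nu>1 j) \<longlonglongrightarrow> 0"
     "(\<lambda>j. fst (sigma_out r (kk j)) *\<^sub>R d_zs_out (kk j) + \<nu>2 j) \<longlonglongrightarrow> 0"
    using key_sequence[OF accumulation] by blast
  then interpret bspm_limit F f G g LF \<gamma>1 \<gamma>2 P r kk \<nu>1 \<nu>2 xbar ybar zbar sbar
    by unfold_locales
  show ?thesis
    using approx_KKT_accumulation[OF accumulation] S_stationary_bounded M_stationary_unbounded by blast
qed

end
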